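(* Let $r=r_1+r_2\ge1$ and $s=s_1+s_2\in\{1,2\}$ with non-negative integers $r_1,r_2,s_1,s_2$, and let $\mu$ be a Borel probability measure on $\mathbb{R}^{r+s}$ with one-dimensional marginals $\mu_1,\dots,\mu_{r+s}$. Suppose that $\operatorname{supp}(\mu_i)\subset\mathbb{Z}$ and $\gcd\operatorname{supp}(\mu_i)=1$ for $i\in\{1,\dots,r_1\}\cup\{r+1,\dots,r+s_1\}$, and that $\mu_i$ is non-lattice for all other $i$. Let $\mu_{\lfloor r\rfloor}$ and $\mu_{\lceil s\rceil}$ denote the marginals of $\mu$ on the first $r$ and the last $s$ coordinates, respectively. Suppose that for each $i\in\{1,\dots,r\}$ one has $\mu_i((0,\infty))>0$ and the one-dimensional reflected random walk induced by $\mu_i$ is positive recurrent on the set $\mathcal{L}_i$ defined in the context (so that the reflected random walk $(X_n^x)$ on $\mathbb{N}_0^{r_1}\times\mathbb{R}_+^{r_2}$ induced by $\mu_{\lfloor r\rfloor}$ is positive recurrent on each of its essential classes $\mathcal{L}^{(j)}$). If $\mu_{\lceil s\rceil}$ has finite moment of order $s$, then the process $(X_n^x,Z_n)$ (reflected in the first $r$ coordinates, non-reflected in the last $s$; see context) is topologically recurrent if and only if $\mu_{\lceil s\rceil}$ is centred. Here topological recurrence means: for each essential class $\mathcal{L}^{(j)}$, each $x\in\mathcal{L}^{(j)}$ and each $v\in\mathbb{R}^s$, the process $(X_n^x,v+Z_n)$ returns to every neighbourhood of $(x,v)$ infinitely often with probability $1$.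
   Context: The process. Let $(Y_n,V_n)_{n\ge1}$ be i.i.d. $\mu$-distributed random vectors with $Y_n\in\mathbb{R}^r$, $V_n\in\mathbb{R}^s$. For $x\in\mathbb{R}^r$ write $|x|=(|x_1|,\dots,|x_r|)$. For $x\in\mathcal{X}=\mathbb{N}_0^{r_1}\times\mathbb{R}_+^{r_2}$ put $X_0^x=x$, $X_n^x=|X_{n-1}^x-Y_n|$ (reflected random walk induced by $\mu_{\lfloor r\rfloor}$), and $Z_0=0$, $Z_n=V_1+\dots+V_n$. Here $\mathbb{N}_0=\{0,1,2,\dots\}$ and $\mathbb{R}_+=[0,\infty)$. The measure $\mu_{\lceil s\rceil}$ has finite moment of order $s$ if $\mathsf{E}(\|V_1\|^s)<\infty$, and is centred if $\mathsf{E}(V_1)=0$. A probability measure on $\mathbb{R}$ is non-lattice if there is no $\kappa>0$ such that its support is contained in $\kappa\mathbb{Z}$. The sets $\mathcal{L}_i$ ($i\le r$). The $i$-th coordinate of $(X_n^x)$ is the one-dimensional reflected random walk induced by $\mu_i$, on $\mathcal{X}_i=\mathbb{N}_0$ if $i\le r_1$ and on $\mathcal{X}_i=\mathbb{R}_+$ if $r_1<i\le r$. Put $N_i=\sup\operatorname{supp}(\mu_i)$ if $\operatorname{supp}(\mu_i)\subset\mathbb{R}_+$ and $N_i=\infty$ otherwise. Then $\mathcal{L}_i=[0,N_i]\cap\mathcal{X}_i$ if $N_i<\infty$, and $\mathcal{L}_i=\mathcal{X}_i$ if $N_i=\infty$. "Positive recurrent on a closed set $\mathcal{L}$" means: for every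 open set $U$ with $U\cap\mathcal{L}\ne\emptyset$, the return time to $U$ has finite expectation for every starting point in $U\cap\mathcal{L}$. The essential classes $\mathcal{L}^{(j)}$ of $(X_n^x)$. If $r_1=0$ put $\mathcal{X}^{(1)}=\mathcal{X}$. If $r_1\ge1$, let $\boldsymbol{\pi}:\mathbb{Z}^{r_1}\times\mathbb{R}^{r_2}\to(\mathbb{Z}/2\mathbb{Z})^{r_1}$ reduce each of the first $r_1$ coordinates mod 2, let $\Gamma$ be the subgroup of $(\mathbb{Z}/2\mathbb{Z})^{r_1}$ generated by the support of the image of $\mu_{\lfloor r\rfloor}$ under $\boldsymbol{\pi}$, let $\Gamma^{(j)}$ be the cosets of $\Gamma$, and put $\mathcal{X}^{(j)}=\{x\in\mathcal{X}:\boldsymbol{\pi}(x)\in\Gamma^{(j)}\}$. Under the stated assumptions each $\mathcal{X}^{(j)}$ carries a unique invariant probability measure $\nu^{(j)}$ for $(X_n^x)$ (i.e. $\int\Pr[X_1^x\in B]\,d\nu^{(j)}(x)=\nu^{(j)}(B)$ for all Borel $B$), and $\mathcal{L}^{(j)}=\operatorname{supp}(\nu^{(j)})$. *)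

theory Defs
  imports
    "HOL-Probability.Probability"
    "HOL-Computational_Algebra.Group_Closure"
    "HOL-Library.Z2"
begin

text \<open>
  Conventions. Vectors in \<open>\<real>\<^sup>r\<close> and \<open>\<real>\<^sup>s\<close> are elements of \<open>real ^ 'r\<close> and \<open>real ^ 's\<close>, and a
  measure on \<open>\<real>\<^sup>r\<^sup>+\<^sup>s\<close> is a Borel measure on \<open>(real ^ 'r) \<times> (real ^ 's)\<close>. The index types carry no
  order, so the split \<open>r = r\<^sub>1 + r\<^sub>2\<close> is given by the set \<open>I\<close> of integer coordinates (\<open>card I = r\<^sub>1\<close>)
  and the split \<open>s = s\<^sub>1 + s\<^sub>2\<close> by a set \<open>J\<close> (\<open>card J = s\<^sub>1\<close>); each of them may be empty or everything.
\<close>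

definition measure_support :: "'a::topological_space measure \<Rightarrow> 'a set"
  where "measure_support \<rho> = {x. \<forall>U. open U \<longrightarrow> x \<in> U \<longrightarrow> emeasure \<rho> U > 0}"

definition first_marginal :: "('a::topological_space \<times> 'b::topological_space) measure \<Rightarrow> 'a measure"
  where "first_marginal \<mu> = distr \<mu> borel fst"

definition last_marginal :: "('a::topological_space \<times> 'b::topological_space) measure \<Rightarrow> 'b measure"
  where "last_marginal \<mu> = distr \<mu> borel snd"

definition coord_marginal :: "(real ^ 'n) measure \<Rightarrow> 'n \<Rightarrow> real measure"
  where "coord_marginal \<rho> i = distr \<rho> borel (\<lambda>x. x $ i)"

text \<open>\<open>supp \<rho> \<subseteq> \<int>\<close> and \<open>gcd (supp \<rho>) = 1\<close>.\<close>

definition integer_aperiodic :: "real measure \<Rightarrow> bool"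
  where "integer_aperiodic \<rho> \<longleftrightarrow>
    measure_support \<rho> \<subseteq> \<int> \<and> Gcd {k::int. real_of_int k \<in> measure_support \<rho>} = 1"

definition non_lattice :: "real measure \<Rightarrow> bool"
  where "non_lattice \<rho> \<longleftrightarrow>
    \<not> (\<exists>\<kappa>>0. measure_support \<rho> \<subseteq> {\<kappa> * real_of_int k | k. True})"

definition finite_moment :: "'a::real_normed_vector measure \<Rightarrow> nat \<Rightarrow> bool"
  where "finite_moment \<rho> p \<longleftrightarrow> integrable \<rho> (\<lambda>v. norm v ^ p)"

definition centred :: "'a::euclidean_space measure \<Rightarrow> bool"
  where "centred \<rho> \<longleftrightarrow> integral\<^sup>L \<rho> (\<lambda>v. v) = 0"

text \<open>
  The increments are indexed from 1; the value at index 0 is irrelevant. On \<open>real ^ 'r\<close> the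
  library's absolute value is componentwise, so one definition serves for the vector-valued walk and
  for its coordinates; see \<open>refl_walk_nth\<close>.
\<close>

primrec refl_walk :: "(nat \<Rightarrow> 'w \<Rightarrow> 'a::{minus,abs}) \<Rightarrow> 'a \<Rightarrow> nat \<Rightarrow> 'w \<Rightarrow> 'a" where
  "refl_walk Y x 0 \<omega> = x"
| "refl_walk Y x (Suc n) \<omega> = \<bar>refl_walk Y x n \<omega> - Y (Suc n) \<omega>\<bar>"

definition partial_sum :: "(nat \<Rightarrow> 'w \<Rightarrow> 'a::comm_monoid_add) \<Rightarrow> nat \<Rightarrow> 'w \<Rightarrow> 'a"
  where "partial_sum V n \<omega> = (\<Sum>k=1..n. V k \<omega>)"

lemma refl_walk_nth:
  "refl_walk Y x n \<omega> $ i = refl_walk (\<lambda>k \<omega>. Y k \<omega> $ i) (x $ i) n \<omega>"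
  for Y :: "nat \<Rightarrow> 'w \<Rightarrow> real ^ 'r"
  by (induction n) (simp_all add: abs_vec_def)

text \<open>The infimum of the empty set is \<open>\<infinity>\<close>, so a path that never returns has infinite return time.\<close>

definition return_time :: "(nat \<Rightarrow> 'a) \<Rightarrow> 'a set \<Rightarrow> ennreal"
  where "return_time X U = Inf {of_nat n | n. n \<ge> 1 \<and> X n \<in> U}"

text \<open>\<open>X x n\<close> is the position at time \<open>n\<close> of the process started at \<open>x\<close>.\<close>

definition positive_recurrent_on ::
    "'w measure \<Rightarrow> ('a::topological_space \<Rightarrow> nat \<Rightarrow> 'w \<Rightarrow> 'a) \<Rightarrow> 'a set \<Rightarrow> bool"
  where "positive_recurrent_on M X L \<longleftrightarrow>
    (\<forall>U. open U \<longrightarrow> U \<inter> L \<noteq> {} \<longrightarrow>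
      (\<forall>x \<in> U \<inter> L. (\<integral>\<^sup>+ \<omega>. return_time (\<lambda>n. X x n \<omega>) U \<partial>M) < \<infinity>))"

definition coord_space :: "'r set \<Rightarrow> 'r \<Rightarrow> real set"
  where "coord_space I i = (if i \<in> I then \<nat> else {0..})"

definition state_space :: "'r set \<Rightarrow> (real ^ 'r) set"
  where "state_space I = {x. \<forall>i. x $ i \<in> coord_space I i}"

definition coord_bound :: "real measure \<Rightarrow> ereal"
  where "coord_bound \<rho> =
    (if measure_support \<rho> \<subseteq> {0..} then Sup (ereal ` measure_support \<rho>) else \<infinity>)"

text \<open>The set \<open>\<L>\<^sub>i\<close>, where \<open>S\<close> is the state space of the \<open>i\<close>-th coordinate.\<close>

definition coord_class :: "real measure \<Rightarrow> real set \<Rightarrow> real set"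
  where "coord_class \<rho> S =
    (if coord_bound \<rho> < \<infinity> then {x \<in> S. 0 \<le> x \<and> ereal x \<le> coord_bound \<rho>} else S)"

text \<open>
  \<open>(\<int>/2\<int>)\<^bsup>r\<^sub>1\<^esup>\<close> is realised as the subgroup of \<open>bit ^ 'r\<close> of vectors that vanish outside \<open>I\<close>. The
  floor makes the reduction total; it only matters where the coordinates in \<open>I\<close> are not integers,
  which is a null set under the hypotheses of interest. For \<open>I = {}\<close> there is a single coset and
  its \<open>coset_space\<close> is all of \<open>state_space I\<close>.
\<close>

definition parity_group :: "'r set \<Rightarrow> (bit ^ 'r) set"
  where "parity_group I = {g. \<forall>i. i \<notin> I \<longrightarrow> g $ i = 0}"

definition parity :: "'r set \<Rightarrow> real ^ 'r \<Rightarrow> bit ^ 'r"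
  where "parity I x = (\<chi> i. if i \<in> I then of_int \<lfloor>x $ i\<rfloor> else 0)"

text \<open>The support of the image measure on the finite discrete group is its set of atoms.\<close>

definition parity_subgroup :: "(real ^ 'r) measure \<Rightarrow> 'r set \<Rightarrow> (bit ^ 'r) set"
  where "parity_subgroup \<rho> I =
    group_closure {g. emeasure (distr \<rho> (count_space UNIV) (parity I)) {g} > 0}"

definition parity_cosets :: "(real ^ 'r) measure \<Rightarrow> 'r set \<Rightarrow> (bit ^ 'r) set set"
  where "parity_cosets \<rho> I = {(\<lambda>h. g + h) ` parity_subgroup \<rho> I | g. g \<in> parity_group I}"

definition coset_space :: "'r set \<Rightarrow> (bit ^ 'r) set \<Rightarrow> (real ^ 'r) set"
  where "coset_space I C = {x \<in> state_space I. parity I x \<in> C}"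

text \<open>
  \<open>\<nu>\<close> is an invariant probability measure, carried by \<open>S\<close>, of the reflected random walk induced
  by \<open>\<rho>\<close>: the integrand is the probability that the walk started at \<open>x\<close> is in \<open>B\<close> at time 1.
\<close>

definition invariant_prob_on ::
    "(real ^ 'r) measure \<Rightarrow> (real ^ 'r) set \<Rightarrow> (real ^ 'r) measure \<Rightarrow> bool"
  where "invariant_prob_on \<rho> S \<nu> \<longleftrightarrow>
    prob_space \<nu> \<and> sets \<nu> = sets borel \<and> emeasure \<nu> S = 1 \<and>
    (\<forall>B \<in> sets borel. (\<integral>\<^sup>+ x. emeasure \<rho> {y. \<bar>x - y\<bar> \<in> B} \<partial>\<nu>) = emeasure \<nu> B)"

text \<open>
  The description operator is justified only where each \<open>coset_space I C\<close> carries exactly one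
  invariant probability measure; this is so under the hypotheses of the theorem.
\<close>

definition essential_classes :: "(real ^ 'r) measure \<Rightarrow> 'r set \<Rightarrow> (real ^ 'r) set set"
  where "essential_classes \<rho> I =
    {measure_support (THE \<nu>. invariant_prob_on \<rho> (coset_space I C) \<nu>) | C. C \<in> parity_cosets \<rho> I}"

text \<open>\<open>\<C>\<close> is the collection of essential classes of \<open>X\<close>.\<close>

definition topologically_recurrent ::
    "'w measure \<Rightarrow> ('a::topological_space \<Rightarrow> nat \<Rightarrow> 'w \<Rightarrow> 'a) \<Rightarrow>
     (nat \<Rightarrow> 'w \<Rightarrow> 'b::{topological_space,plus}) \<Rightarrow> 'a set set \<Rightarrow> bool"
  where "topologically_recurrent M X Z \<C> \<longleftrightarrow>
    (\<forall>L \<in> \<C>. \<forall>x \<in> L. \<forall>v. \<forall>U. open U \<longrightarrow> (x, v) \<in> U \<longrightarrow>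
      (AE \<omega> in M. infinite {n. (X x n \<omega>, v + Z n \<omega>) \<in> U}))"

end

theory Submission
  imports Defs
begin

text \<open>
  Two copies of the walk driven by the same increments never move apart, and positive recurrence makes
  every coordinate tight. A minimality argument on the closure of the orbit of a pair shows that two
  copies started in the same parity class can be brought arbitrarily close, so by tightness their
  distance tends to 0 in probability, uniformly on bounded sets. Hence the backward iteration converges
  (existence of the invariant measures), any two invariant measures on a coset agree, and every point of
  the support of the invariant measure can be approached from anywhere in the coset.

  If a return of \<open>(X, Z)\<close> to a neighbourhood of \<open>(x, 0)\<close> failed with positive probability, then the
  values \<open>Z\<^sub>k\<close> at the times of final departure would be separated, and the expected number of visits of
  \<open>X\<close> near \<open>x\<close> with \<open>\<bar>Z\<^sub>k\<bar> \<le> r\<close> would be \<open>O(r\<^sup>s)\<close>. For centred \<open>Z\<close> this number is not \<open>O(r\<^sup>s)\<close>: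
  \<open>Pr[\<bar>Z\<^sub>k\<bar> \<le> k\<^sup>1\<^sup>/\<^sup>s/a]\<close> is at least a constant if \<open>s = 1\<close>, by the law of large numbers, and at least
  \<open>c/a\<^sup>2\<close> for large \<open>k\<close> if \<open>s = 2\<close>, by the central limit theorem, and then summation over dyadic scales
  gives a logarithmic factor. Conversely, a walk with a drift cannot return infinitely often, by the
  maximal ergodic inequality.
\<close>

section \<open>Supports, subgroups of the reals and orbits of pairs\<close>

text \<open>The recurrence hypotheses constrain only one-dimensional marginals, while the
  coordinates, and \<open>X\<close> and \<open>Z\<close>, may depend on each other in any way. The
  coordinates are therefore handled one at a time: in each of them the distance of two copies never
  grows, so their estimates combine by union bounds. Parity is the only obstruction to contraction:
  two integer copies of different parity keep an odd distance forever, hence the classes and cosets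
  in \<open>bit ^ 'r\<close>. The dependence on the past is met by restarting a copy at the fixed
  point \<open>x\<close> instead of at the current position: whether this copy returns is
  independent of the past, and nonexpansiveness transfers the answer to the walk itself. In
  dimension 2 the order r^2 of the occupation bound is critical, so the probability that
  \<open>Z\<close> is small must be bounded below with the sharp order 1/a^2 on every scale,
  whatever the covariance; averaging one-dimensional characteristic functions against a Gaussian
  achieves this direction by direction.\<close>

text \<open>Second countability turns the union of all null open sets into a countable one: a point
  outside the support lies in a null member of a countable basis.\<close>

lemma emeasure_measure_support_compl:
  fixes \<rho> :: "'a::second_countable_topology measure"
  assumes "sets \<rho> = sets borel"
  shows "emeasure \<rho> (- measure_support \<rho>) = 0"
proof -
  obtain B :: "'a set set" where B: "countable B" "topological_basis B"
    using ex_countable_basis by blast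
  have "- measure_support \<rho> = \<Union>{U \<in> B. emeasure \<rho> U = 0}" (is "_ = \<Union>?N")
  proof (intro set_eqI iffI)
    fix x assume "x \<in> - measure_support \<rho>"
    then obtain U where U: "open U" "x \<in> U" "emeasure \<rho> U = 0"
      by (auto simp: measure_support_def)
    from topological_basisE[OF B(2) U(1,2)] obtain W where W: "W \<in> B" "x \<in> W" "W \<subseteq> U"
      by blast
    have "emeasure \<rho> W \<le> emeasure \<rho> U"
      using U(1) assms by (intro emeasure_mono W) auto
    with U W show "x \<in> \<Union>?N" by auto
  next
    fix x assume "x \<in> \<Union>?N"
    then obtain U where "U \<in> B" "emeasure \<rho> U = 0" "x \<in> U" by auto
    with topological_basis_open[OF B(2)] show "x \<in> - measure_support \<rho>"
      by (force simp: measure_support_def)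
  qed
  moreover have "\<Union>?N \<in> null_sets \<rho>"
  proof (rule null_sets_UN'[of ?N "\<lambda>x. x", simplified])
    show "countable ?N" using B(1) by (rule countable_subset[rotated]) auto
    show "\<And>U. U \<in> B \<and> emeasure \<rho> U = 0 \<Longrightarrow> U \<in> null_sets \<rho>"
      using topological_basis_open[OF B(2)] assms by (auto intro!: null_setsI)
  qed
  ultimately show ?thesis by auto
qed

lemma closed_measure_support: "closed (measure_support \<rho>)"
proof -
  have "- measure_support \<rho> = \<Union>{U. open U \<and> emeasure \<rho> U = 0}"
    by (force simp: measure_support_def)
  then show ?thesis unfolding closed_def by auto
qed

lemma measure_support_subset_closed:
  fixes \<rho> :: "'a::second_countable_topology measure"
  assumes "prob_space \<rho>" "sets \<rho> = sets borel" "closed K" "emeasure \<rho> K = 1"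
  shows "measure_support \<rho> \<subseteq> K"
proof
  fix x assume x: "x \<in> measure_support \<rho>"
  show "x \<in> K"
  proof (rule ccontr)
    assume "x \<notin> K"
    then have "emeasure \<rho> (- K) > 0"
      using x assms(3) by (auto simp: measure_support_def)
    moreover have "emeasure \<rho> (space \<rho> - K) = 0"
      using assms prob_space.emeasure_space_1[OF assms(1)]
      by (subst emeasure_compl) auto
    moreover have "space \<rho> = UNIV" using assms(2) by (simp add: sets_eq_imp_space_eq)
    ultimately show False by (simp add: Compl_eq_Diff_UNIV)
  qed
qed

lemma measure_support_nonempty:
  fixes \<rho> :: "'a::second_countable_topology measure"
  assumes "prob_space \<rho>" "sets \<rho> = sets borel"
  shows "measure_support \<rho> \<noteq> {}"
proof
  assume "measure_support \<rho> = {}"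
  then have "emeasure \<rho> (space \<rho>) = 0"
    using emeasure_measure_support_compl[OF assms(2)] assms(2)
    by (simp add: sets_eq_imp_space_eq)
  with prob_space.emeasure_space_1[OF assms(1)] show False by simp
qed

section \<open>Discrete and dense subgroups of the real line\<close>

lemma group_closure_int_multiple:
  fixes g :: real
  assumes "g \<in> group_closure T"
  shows "of_int k * g \<in> group_closure T"
proof (cases "k \<ge> 0")
  case True
  then show ?thesis using group_closure_scalar_mult_left[OF assms, of "nat k"] by simp
next
  case False
  then have "- (of_nat (nat (- k)) * g) \<in> group_closure T"
    using group_closure_scalar_mult_left[OF assms, of "nat (- k)"] by simp
  with False show ?thesis by simp
qed

text \<open>The dichotomy for subgroups of the reals; \<open>y0\<close> excludes the trivial group.
  If the positive elements stay away from 0, division with remainder by the smallest one gives the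
  cyclic case; otherwise the multiples of a tiny positive element come within its size of every
  real.\<close>

lemma group_closure_real_cases:
  fixes T :: "real set"
  assumes y0: "y0 \<in> T" "y0 > 0"
  obtains (cyclic) \<kappa> where "\<kappa> > 0" "\<kappa> \<in> group_closure T" "\<forall>g\<in>group_closure T. \<exists>k::int. g = \<kappa> * k"
    | (dense) "\<forall>t. \<forall>\<delta>>0. \<exists>g\<in>group_closure T. \<bar>t + g\<bar> < \<delta>"
proof (cases "\<exists>\<delta>>0. \<forall>g\<in>group_closure T. \<not> (0 < g \<and> g < \<delta>)")
  case True
  then obtain \<delta> where \<delta>: "\<delta> > 0" "\<And>g. g \<in> group_closure T \<Longrightarrow> 0 < g \<Longrightarrow> \<delta> \<le> g"
    by (metis not_less)
  define A where "A = {g \<in> group_closure T. g > 0}"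
  define \<kappa> where "\<kappa> = Inf A"
  have A: "A \<noteq> {}" "bdd_below A"
    using y0 \<delta>(2) by (auto simp: A_def intro: group_closure.base intro!: bdd_belowI[of _ \<delta>])
  have "\<kappa> \<ge> \<delta>" unfolding \<kappa>_def using A(1) \<delta> by (intro cInf_greatest) (auto simp: A_def)
  then have pos: "\<kappa> > 0" using \<delta> by simp
  have low: "\<kappa> \<le> g" if "g \<in> A" for g unfolding \<kappa>_def using that A by (intro cInf_lower)
  have "\<exists>g\<in>A. g < \<kappa> + \<delta>"
    using cInf_lessD[of A "\<kappa> + \<delta>"] A \<delta>(1) by (auto simp: \<kappa>_def)
  then obtain g where g: "g \<in> A" "g < \<kappa> + \<delta>" by blast
  \<comment> \<open>The infimum is attained: a positive element \<open>g'\<close> below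
    \<open>g\<close> would be smaller by at least \<delta>, and so would lie below \<kappa>.\<close>
  have "g = \<kappa>"
  proof (rule ccontr)
    assume "g \<noteq> \<kappa>"
    with low[OF g(1)] have "\<kappa> < g" by simp
    then obtain g' where g': "g' \<in> A" "g' < g"
      using cInf_lessD[of A g] A by (auto simp: \<kappa>_def)
    have "g - g' \<in> group_closure T" using g(1) g'(1) by (auto simp: A_def intro: group_closure.diff)
    then have "\<delta> \<le> g - g'" using g' by (intro \<delta>(2)) auto
    with low[OF g'(1)] g(2) show False by simp
  qed
  with g have \<kappa>G: "\<kappa> \<in> group_closure T" by (simp add: A_def)
  have "\<exists>k::int. h = \<kappa> * k" if h: "h \<in> group_closure T" for h
  proof -
    define d where "d = h - \<lfloor>h / \<kappa>\<rfloor> * \<kappa>"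
    have dG: "d \<in> group_closure T"
      unfolding d_def by (intro group_closure.diff h group_closure_int_multiple \<kappa>G)
    have "\<lfloor>h / \<kappa>\<rfloor> * \<kappa> \<le> h" "h < (\<lfloor>h / \<kappa>\<rfloor> + 1) * \<kappa>"
      using floor_divide_lower[OF pos] floor_divide_upper[OF pos] by simp_all
    then have "d \<ge> 0" "d < \<kappa>" by (auto simp: d_def algebra_simps)
    moreover have "\<not> d > 0" using low[of d] dG \<open>d < \<kappa>\<close> by (auto simp: A_def)
    ultimately have "d = 0" by simp
    then show ?thesis by (intro exI[of _ "\<lfloor>h / \<kappa>\<rfloor>"]) (simp add: d_def mult.commute)
  qed
  with pos \<kappa>G show thesis by (intro cyclic) auto
next
  case False
  show thesis
  proof (rule dense, intro allI impI)
    fix t \<delta> :: real assume "\<delta> > 0"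
    with False obtain g where g: "g \<in> group_closure T" "0 < g" "g < \<delta>" by blast
    have "\<lfloor>t / g\<rfloor> * g \<le> t" "t < (\<lfloor>t / g\<rfloor> + 1) * g"
      using floor_divide_lower[OF g(2)] floor_divide_upper[OF g(2)] by simp_all
    then have "\<bar>t + of_int (- \<lfloor>t / g\<rfloor>) * g\<bar> < \<delta>" using g by (auto simp: algebra_simps)
    then show "\<exists>g\<in>group_closure T. \<bar>t + g\<bar> < \<delta>"
      using group_closure_int_multiple[OF g(1)] by blast
  qed
qed

lemma non_lattice_group_closure_dense:
  fixes T :: "real set" and t \<delta> :: real
  assumes y0: "y0 \<in> T" "y0 > 0" and "\<not> (\<exists>\<kappa>>0. T \<subseteq> {\<kappa> * real_of_int k | k. True})" and "\<delta> > 0"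
  shows "\<exists>g\<in>group_closure T. \<bar>t + g\<bar> < \<delta>"
proof (rule group_closure_real_cases[OF y0])
  fix \<kappa> :: real assume *: "\<kappa> > 0" "\<forall>g\<in>group_closure T. \<exists>k::int. g = \<kappa> * k"
  then have "T \<subseteq> {\<kappa> * real_of_int k | k. True}" by (auto intro: group_closure.base)
  with * assms(3) show ?thesis by blast
qed (use \<open>\<delta> > 0\<close> in blast)

lemma group_closure_Ints:
  fixes T :: "real set"
  assumes "T \<subseteq> \<int>" "g \<in> group_closure T"
  shows "g \<in> \<int>"
  using assms(2) by induction (use assms(1) in auto)

text \<open>In the cyclic case the generator is a positive integer dividing all of \<open>T\<close>,
  hence 1 by the gcd hypothesis, and -t itself lies in the group. The dense alternative yields the
  claim at once.\<close>

lemma Gcd_1_group_closure_dense: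
  fixes T :: "real set" and t \<delta> :: real
  assumes y0: "y0 \<in> T" "y0 > 0" and T: "T \<subseteq> \<int>" "Gcd {k::int. real_of_int k \<in> T} = 1"
    and "t \<in> \<int>" "\<delta> > 0"
  shows "\<exists>g\<in>group_closure T. \<bar>t + g\<bar> < \<delta>"
proof (rule group_closure_real_cases[OF y0])
  fix \<kappa> :: real assume \<kappa>: "\<kappa> > 0" "\<kappa> \<in> group_closure T" "\<forall>g\<in>group_closure T. \<exists>k::int. g = \<kappa> * k"
  obtain m :: int where m: "\<kappa> = m" using group_closure_Ints[OF T(1) \<kappa>(2)] by (auto elim: Ints_cases)
  have "m dvd k" if k: "real_of_int k \<in> T" for k
  proof -
    obtain j :: int where "real_of_int k = \<kappa> * j" using \<kappa>(3) k by (auto intro: group_closure.base)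
    then have "k = m * j" unfolding m by (metis of_int_eq_iff of_int_mult)
    then show ?thesis by simp
  qed
  then have "m dvd Gcd {k::int. real_of_int k \<in> T}" by (intro Gcd_greatest) auto
  then have "m = 1" using T(2) \<kappa>(1) m by simp
  then have 1: "1 \<in> group_closure T" using \<kappa>(2) m by simp
  obtain j :: int where j: "t = j" using \<open>t \<in> \<int>\<close> by (auto elim: Ints_cases)
  show ?thesis using group_closure_int_multiple[OF 1, of "- j"] j \<open>\<delta> > 0\<close> by (intro bexI[of _ "- t"]) auto
qed (use \<open>\<delta> > 0\<close> in blast)

text \<open>The deterministic skeleton of two coupled walks: \<open>T\<close> will be the support of
  a marginal, so that each finite path in the orbit is followed up to any given error with positive
  probability.\<close>

inductive_set pair_orbit :: "real set \<Rightarrow> real \<Rightarrow> real \<Rightarrow> (real \<times> real) set" for T x x' where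
  start: "(x, x') \<in> pair_orbit T x x'"
| step: "(a, b) \<in> pair_orbit T x x' \<Longrightarrow> y \<in> T \<Longrightarrow> (\<bar>a - y\<bar>, \<bar>b - y\<bar>) \<in> pair_orbit T x x'"

text \<open>
  If the infimum \<open>\<delta>\<close> of the distance over the orbit were positive, it would be attained in the
  closure of the orbit, and the midpoints \<open>u\<close> of the pairs attaining it would satisfy \<open>u \<ge> \<delta>/2\<close> and
  form a set invariant under \<open>u \<mapsto> \<bar>u - y\<bar>\<close>. Together with its translates by multiples of \<open>y\<^sub>0\<close> that set
  is invariant under the group generated by \<open>T\<close>, and so comes close to 0.
\<close>

lemma pair_orbit_distance:
  fixes T :: "real set" and P :: "(real \<times> real) set"
  assumes y0: "y0 \<in> T" "y0 > 0" and P: "closed P" "(x, x') \<in> P"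
    and stepP: "\<And>a b y. (a, b) \<in> P \<Longrightarrow> y \<in> T \<Longrightarrow> (\<bar>a - y\<bar>, \<bar>b - y\<bar>) \<in> P"
    and nonneg: "\<And>a b. (a, b) \<in> P \<Longrightarrow> a \<ge> 0 \<and> b \<ge> 0"
    and approx: "\<And>a b \<delta>. (a, b) \<in> P \<Longrightarrow> \<delta> > 0 \<Longrightarrow> \<exists>g\<in>group_closure T. \<bar>(a + b) / 2 + g\<bar> < \<delta>"
    and "\<epsilon> > 0"
  shows "\<exists>(a, b) \<in> pair_orbit T x x'. \<bar>a - b\<bar> < \<epsilon>"
proof -
  define Q where "Q = closure (pair_orbit T x x')"
  have "pair_orbit T x x' \<subseteq> P"
  proof -
    have "(a, b) \<in> P" if "(a, b) \<in> pair_orbit T x x'" for a b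
      using that by (induction rule: pair_orbit.induct) (auto intro: P stepP)
    then show ?thesis by auto
  qed
  then have QP: "Q \<subseteq> P" unfolding Q_def using P(1) by (simp add: closure_minimal)
  have Qstep: "(\<bar>a - y\<bar>, \<bar>b - y\<bar>) \<in> Q" if "(a, b) \<in> Q" "y \<in> T" for a b y
  proof -
    have "(\<lambda>p. (\<bar>fst p - y\<bar>, \<bar>snd p - y\<bar>)) ` Q \<subseteq> Q"
      unfolding Q_def
    proof (rule image_closure_subset)
      show "continuous_on (closure (pair_orbit T x x')) (\<lambda>p. (\<bar>fst p - y\<bar>, \<bar>snd p - y\<bar>))"
        by (intro continuous_intros)
      show "(\<lambda>p. (\<bar>fst p - y\<bar>, \<bar>snd p - y\<bar>)) ` pair_orbit T x x' \<subseteq> closure (pair_orbit T x x')"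
        using that(2) closure_subset by (fastforce intro: pair_orbit.step)
    qed simp
    with that show ?thesis by force
  qed
  have xQ: "(x, x') \<in> Q" unfolding Q_def using closure_subset pair_orbit.start by blast
  \<comment> \<open>The distance never exceeds its initial value, so a pair in the closure of the
    orbit whose first component is at most \<open>y0\<close> has its second component at most
    \<open>B\<close>. This makes the part of the closure on which the distance is minimised
    compact.\<close>
  define B where "B = y0 + \<bar>x - x'\<bar>"
  \<comment> \<open>Subtracting \<open>y0\<close> as long as the first component exceeds it brings
    every pair into that compact part without increasing its distance, so a minimum there is a
    minimum over the whole closure.\<close>
  have reduce: "\<exists>(a', b') \<in> Q. \<bar>a' - b'\<bar> \<le> \<bar>a - b\<bar> \<and> a' \<in> {0..y0}" if "(a, b) \<in> Q" for a b
  proof -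
    have "(a, b) \<in> Q \<Longrightarrow> a \<le> real n * y0 \<Longrightarrow> \<exists>(a', b') \<in> Q. \<bar>a' - b'\<bar> \<le> \<bar>a - b\<bar> \<and> a' \<in> {0..y0}" for n
    proof (induction n arbitrary: a b)
      case 0
      then show ?case using QP nonneg[of a b] y0 by (intro bexI[of _ "(a, b)"]) auto
    next
      case (Suc n)
      show ?case
      proof (cases "a \<le> y0")
        case True
        then show ?thesis using QP nonneg[of a b] Suc.prems by (intro bexI[of _ "(a, b)"]) auto
      next
        case False
        with Suc.prems have "\<bar>a - y0\<bar> \<le> real n * y0" by (simp add: algebra_simps)
        from Suc.IH[OF Qstep[OF Suc.prems(1) y0(1)] this]
        obtain a' b' where "(a', b') \<in> Q" "\<bar>a' - b'\<bar> \<le> \<bar>\<bar>a - y0\<bar> - \<bar>b - y0\<bar>\<bar>" "a' \<in> {0..y0}" by auto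
        then show ?thesis by (intro bexI[of _ "(a', b')"]) auto
      qed
    qed
    moreover obtain n where "a \<le> real n * y0"
      using reals_Archimedean3[OF y0(2)] less_imp_le by metis
    ultimately show ?thesis using that by blast
  qed
  have Qdist: "\<bar>a - b\<bar> \<le> \<bar>x - x'\<bar>" if "(a, b) \<in> Q" for a b
  proof -
    have "pair_orbit T x x' \<subseteq> {p. \<bar>fst p - snd p\<bar> \<le> \<bar>x - x'\<bar>}"
    proof -
      have "\<bar>a - b\<bar> \<le> \<bar>x - x'\<bar>" if "(a, b) \<in> pair_orbit T x x'" for a b
        using that by (induction rule: pair_orbit.induct) auto
      then show ?thesis by auto
    qed
    moreover have "closed {p :: real \<times> real. \<bar>fst p - snd p\<bar> \<le> \<bar>x - x'\<bar>}"
      by (intro closed_Collect_le continuous_intros)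
    ultimately have "Q \<subseteq> {p. \<bar>fst p - snd p\<bar> \<le> \<bar>x - x'\<bar>}" unfolding Q_def by (rule closure_minimal)
    with that show ?thesis by auto
  qed
  define Q0 where "Q0 = Q \<inter> ({0..y0} \<times> {0..B})"
  have comp: "compact Q0"
    unfolding Q0_def Q_def by (intro closed_Int_compact compact_Times) auto
  have inQ0: "(a, b) \<in> Q0" if "(a, b) \<in> Q" "a \<in> {0..y0}" for a b
    using that Qdist[OF that(1)] nonneg[of a b] QP by (auto simp: Q0_def B_def)
  have "Q0 \<noteq> {}" using reduce[OF xQ] inQ0 by auto
  have "continuous_on Q0 (\<lambda>p. \<bar>fst p - snd p\<bar>)" by (intro continuous_intros)
  from continuous_attains_inf[OF comp \<open>Q0 \<noteq> {}\<close> this]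
  obtain p where p: "p \<in> Q0" "\<And>q. q \<in> Q0 \<Longrightarrow> \<bar>fst p - snd p\<bar> \<le> \<bar>fst q - snd q\<bar>" by blast
  define \<delta> where "\<delta> = \<bar>fst p - snd p\<bar>"
  have \<delta>min: "\<delta> \<le> \<bar>a - b\<bar>" if "(a, b) \<in> Q" for a b
    using reduce[OF that] inQ0 p(2) by (force simp: \<delta>_def)
  have pQ: "(fst p, snd p) \<in> Q" using p(1) by (simp add: Q0_def)
  have "\<delta> = 0"
  proof (rule ccontr)
    assume "\<delta> \<noteq> 0"
    then have \<delta>: "\<delta> > 0" by (simp add: \<delta>_def)
    define K where "K = {(a + b) / 2 | a b. (a, b) \<in> Q \<and> \<bar>a - b\<bar> = \<delta>}"
    have Kge: "u \<ge> \<delta> / 2" if "u \<in> K" for u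
    proof -
      from that obtain a b where ab: "u = (a + b) / 2" "(a, b) \<in> Q" "\<bar>a - b\<bar> = \<delta>" by (auto simp: K_def)
      with QP nonneg[of a b] have "a \<ge> 0" "b \<ge> 0" by auto
      with ab show ?thesis by (auto simp: abs_if split: if_splits)
    qed
    have Kstep: "\<bar>u - y\<bar> \<in> K" if u: "u \<in> K" and y: "y \<in> T" for u y
    proof -
      from u obtain a b where ab: "u = (a + b) / 2" "(a, b) \<in> Q" "\<bar>a - b\<bar> = \<delta>" by (auto simp: K_def)
      have Q': "(\<bar>a - y\<bar>, \<bar>b - y\<bar>) \<in> Q" using Qstep[OF ab(2) y] .
      \<comment> \<open>A \<open>y\<close> strictly between \<open>a\<close> and \<open>b\<close>
        would bring the images closer than \<delta>. So both components lie on the same side of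
        \<open>y\<close>, and reflecting the pair amounts to reflecting its midpoint.\<close>
      from \<delta>min[OF this] ab(3) have eq: "\<bar>\<bar>a - y\<bar> - \<bar>b - y\<bar>\<bar> = \<delta>" by auto
      then have "\<bar>u - y\<bar> = (\<bar>a - y\<bar> + \<bar>b - y\<bar>) / 2" using ab \<delta> by (auto simp: abs_if field_simps split: if_splits)
      with Q' eq show ?thesis by (auto simp: K_def)
    qed
    have Kred: "\<exists>u'\<in>K. \<exists>n::int. u = u' + n * y0 \<and> u' \<le> y0" if "u \<in> K" for u
    proof -
      have "u \<in> K \<Longrightarrow> u \<le> real m * y0 \<Longrightarrow> \<exists>u'\<in>K. \<exists>n::int. u = u' + n * y0 \<and> u' \<le> y0" for m
      proof (induction m arbitrary: u)
        case 0
        then show ?case using Kge[of u] \<delta> by auto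
      next
        case (Suc m)
        show ?case
        proof (cases "u \<le> y0")
          case True
          then show ?thesis using Suc.prems by (intro bexI[of _ u] exI[of _ 0]) auto
        next
          case False
          with Suc.prems have "\<bar>u - y0\<bar> \<le> real m * y0" by (simp add: algebra_simps)
          from Suc.IH[OF Kstep[OF Suc.prems(1) y0(1)] this] obtain u' n
            where "u' \<in> K" "\<bar>u - y0\<bar> = u' + of_int n * y0" "u' \<le> y0" by auto
          with False show ?thesis by (intro bexI[of _ u'] exI[of _ "n + 1"]) (auto simp: algebra_simps)
        qed
      qed
      moreover obtain m where "u \<le> real m * y0"
        using reals_Archimedean3[OF y0(2)] less_imp_le by metis
      ultimately show ?thesis using that by blast
    qed
    define K' where "K' = {u + of_int n * y0 | u n. u \<in> K}"
    \<comment> \<open>Reflecting a representative \<open>u'\<close> below \<open>y0\<close> gives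
      \<open>y0 - u'\<close>, which is -u' up to a multiple of \<open>y0\<close>. This symmetry
      turns reflections into translations, on which a group can act.\<close>
    have K'_minus: "- t \<in> K'" if t: "t \<in> K'" for t
    proof -
      from t obtain u n where un: "t = u + of_int n * y0" "u \<in> K" by (auto simp: K'_def)
      from Kred[OF un(2)] obtain u' n' where u': "u' \<in> K" "u = u' + of_int n' * y0" "u' \<le> y0" by auto
      have "y0 - u' \<in> K" using Kstep[OF u'(1) y0(1)] u'(3) by simp
      moreover have "- t = (y0 - u') + of_int (- n - n' - 1) * y0" using un u' by (simp add: algebra_simps)
      ultimately show ?thesis unfolding K'_def by blast
    qed
    have K'_diff: "t - y \<in> K'" if t: "t \<in> K'" and y: "y \<in> T" for t y
    proof -
      from t obtain u n where un: "t = u + of_int n * y0" "u \<in> K" by (auto simp: K'_def)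
      have s: "\<bar>u - y\<bar> \<in> K" using Kstep[OF un(2) y] .
      show ?thesis
      proof (cases "u \<ge> y")
        case True
        then have "t - y = \<bar>u - y\<bar> + of_int n * y0" using un by simp
        with s show ?thesis unfolding K'_def by blast
      next
        case False
        then have "- (t - y) = \<bar>u - y\<bar> + of_int (- n) * y0" using un by simp
        with s have "- (t - y) \<in> K'" unfolding K'_def by blast
        from K'_minus[OF this] show ?thesis by simp
      qed
    qed
    have K'_group: "\<forall>t\<in>K'. t - g \<in> K'" if "g \<in> group_closure T" for g
      using that
    proof induction
      case (base s)
      then show ?case using K'_diff by auto
    next
      case (diff s t)
      show ?case
      proof
        fix r assume "r \<in> K'"
        then have "- (- (r - s) - t) \<in> K'" using diff.IH K'_minus by blast
        then show "r - (s - t) \<in> K'" by (simp add: algebra_simps)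
      qed
    qed
    define u where "u = (fst p + snd p) / 2"
    have uK: "u \<in> K" unfolding u_def K_def using pQ \<delta>_def by blast
    have "(fst p, snd p) \<in> P" using pQ QP by auto
    define \<eta> where "\<eta> = min (\<delta> / 2) y0"
    have "\<eta> > 0" using \<delta> y0 by (simp add: \<eta>_def)
    from approx[OF \<open>(fst p, snd p) \<in> P\<close> this] obtain g where g: "g \<in> group_closure T" "\<bar>u + g\<bar> < \<eta>"
      by (auto simp: u_def)
    have "- g \<in> group_closure T" using g(1) by simp
    moreover have "u \<in> K'" unfolding K'_def using uK by (intro CollectI exI[of _ u] exI[of _ 0]) auto
    ultimately have ug: "u + g \<in> K'" using K'_group by fastforce
    \<comment> \<open>Modulo \<open>y0\<close> every point of \<open>K'\<close> has a representative
      between \<delta>/2 and \<open>y0\<close> - \<delta>/2, so \<open>K'\<close> avoids [0,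
      \<eta>). But \<open>u + g\<close> or its negative lies there.\<close>
    have small: False if t: "t \<in> K'" "0 \<le> t" "t < \<eta>" for t
    proof -
      from t obtain v n where vn: "t = v + of_int n * y0" "v \<in> K" by (auto simp: K'_def)
      from Kred[OF vn(2)] obtain v' n' where v': "v' \<in> K" "v = v' + of_int n' * y0" "v' \<le> y0" by auto
      have tv: "t = v' + of_int (n + n') * y0" using vn v' by (simp add: algebra_simps)
      have v'ge: "v' \<ge> \<delta> / 2" by (rule Kge[OF v'(1)])
      have "y0 - v' \<in> K" using Kstep[OF v'(1) y0(1)] v'(3) by simp
      then have v'le: "v' \<le> y0 - \<delta> / 2" using Kge by fastforce
      consider "n + n' \<ge> 0" | "n + n' \<le> -1" by linarith
      then show False
      proof cases
        case 1
        then have "of_int (n + n') * y0 \<ge> 0" using y0 by (intro mult_nonneg_nonneg) auto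
        with tv v'ge t(3) show False by (simp add: \<eta>_def)
      next
        case 2
        then have "of_int (n + n') * y0 \<le> (-1) * y0" using y0 by (intro mult_right_mono) auto
        with tv v'le t(2) \<delta> show False by simp
      qed
    qed
    show False
      using small[OF ug] small[OF K'_minus[OF ug]] g(2) by (cases "u + g \<ge> 0") auto
  qed
  then have pp: "fst p = snd p" by (simp add: \<delta>_def)
  have "p \<in> closure (pair_orbit T x x')" using pQ by (simp add: Q_def)
  then obtain q where q: "q \<in> pair_orbit T x x'" "dist q p < \<epsilon> / 2"
    using \<open>\<epsilon> > 0\<close> by (auto simp: closure_approachable dest!: spec[of _ "\<epsilon> / 2"])
  have "\<bar>fst q - fst p\<bar> < \<epsilon> / 2" "\<bar>snd q - snd p\<bar> < \<epsilon> / 2"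
    using q(2) dist_fst_le[of q p] dist_snd_le[of q p] by (auto simp: dist_real_def)
  then have "\<bar>fst q - snd q\<bar> < \<epsilon>" using pp by linarith
  with q(1) show ?thesis by (intro bexI[of _ q]) (auto simp: case_prod_beta)
qed

section \<open>Reflected walks and the sequence space\<close>

text \<open>The increments are numbered from 0, so that a sample sequence is a point of a product
  indexed by all natural numbers; \<open>refl_walk\<close> numbers them from 1, hence the shift in
  \<open>refl_walk_eq_rwalk\<close>.\<close>

primrec rwalk :: "'a::{minus,abs} \<Rightarrow> (nat \<Rightarrow> 'a) \<Rightarrow> nat \<Rightarrow> 'a" where
  "rwalk x y 0 = x"
| "rwalk x y (Suc n) = \<bar>rwalk x y n - y n\<bar>"

lemma refl_walk_eq_rwalk: "refl_walk Y x n \<omega> = rwalk x (\<lambda>k. Y (Suc k) \<omega>) n"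
  by (induction n) auto

lemma rwalk_nth: "rwalk x y n $ i = rwalk (x $ i) (\<lambda>k. y k $ i) n"
  for x :: "real ^ 'r"
  by (induction n) (simp_all add: abs_vec_def)

lemma rwalk_cong: "(\<And>k. k < n \<Longrightarrow> y k = y' k) \<Longrightarrow> rwalk x y n = rwalk x y' n"
  by (induction n) auto

lemma rwalk_add: "rwalk x y (k + n) = rwalk (rwalk x y k) (\<lambda>i. y (i + k)) n"
  by (induction n) (auto simp: add.commute)

lemma rwalk_Suc_shift: "rwalk x y (Suc n) = rwalk \<bar>x - y 0\<bar> (\<lambda>i. y (Suc i)) n"
  using rwalk_add[of x y 1 n] by simp

text \<open>Each step is 1-Lipschitz in the position and in the increment. With equal increments
  this is nonexpansiveness; with unequal ones it lets a random path shadow a prescribed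
  path.\<close>

lemma rwalk_diff_le:
  fixes x x' :: real
  shows "\<bar>rwalk x y n - rwalk x' y' n\<bar> \<le> \<bar>x - x'\<bar> + (\<Sum>k<n. \<bar>y k - y' k\<bar>)"
  by (induction n) auto

lemma rwalk_nonexpansive_real:
  fixes x x' :: real
  shows "\<bar>rwalk x y n - rwalk x' y n\<bar> \<le> \<bar>x - x'\<bar>"
  using rwalk_diff_le[of x y n x' y] by simp

lemma rwalk_nonneg: "x \<ge> 0 \<Longrightarrow> rwalk x y n \<ge> (0::real)"
  by (cases n) auto

lemma rwalk_nonexpansive:
  fixes x x' :: "real ^ 'r"
  shows "norm (rwalk x y n - rwalk x' y n) \<le> norm (x - x')"
  by (rule norm_le_componentwise_cart) (simp add: rwalk_nth rwalk_nonexpansive_real)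

lemma rwalk_diff_antimono_real:
  fixes x x' :: real
  assumes "m \<le> n"
  shows "\<bar>rwalk x y n - rwalk x' y n\<bar> \<le> \<bar>rwalk x y m - rwalk x' y m\<bar>"
  using rwalk_nonexpansive_real[of "rwalk x y m" "\<lambda>i. y (i + m)" "n - m" "rwalk x' y m"] assms
  by (simp add: rwalk_add[symmetric])

section \<open>Measurability of the walk and return times\<close>

lemma continuous_on_abs_vec: "continuous_on A (\<lambda>x::real ^ 'r. \<bar>x\<bar>)"
  unfolding abs_vec_def by (intro continuous_intros)

lemma borel_measurable_abs_vec [measurable (raw)]:
  assumes "f \<in> borel_measurable N"
  shows "(\<lambda>x. \<bar>f x :: real ^ 'r\<bar>) \<in> borel_measurable N"
  using borel_measurable_continuous_onI[OF continuous_on_abs_vec] assms by (rule measurable_compose[rotated])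

lemma borel_measurable_vec_nth' [measurable (raw)]:
  assumes "f \<in> borel_measurable N"
  shows "(\<lambda>x. (f x :: real ^ 'r) $ i) \<in> borel_measurable N"
  using assms by (rule measurable_compose) (intro borel_measurable_continuous_onI continuous_intros)

lemma borel_measurable_rwalk [measurable (raw)]:
  fixes f :: "'a \<Rightarrow> real ^ 'r"
  assumes [measurable]: "f \<in> borel_measurable N" "\<And>k. (\<lambda>p. g p k) \<in> borel_measurable N"
  shows "(\<lambda>p. rwalk (f p) (g p) n) \<in> borel_measurable N"
  by (induction n) simp_all

lemma borel_measurable_rwalk_real [measurable (raw)]:
  fixes f :: "'a \<Rightarrow> real"
  assumes [measurable]: "f \<in> borel_measurable N" "\<And>k. (\<lambda>p. g p k) \<in> borel_measurable N"
  shows "(\<lambda>p. rwalk (f p) (g p) n) \<in> borel_measurable N"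
  by (induction n) simp_all

text \<open>An infimum over all indices, with the default \<infinity> where there is no visit, is a
  countable infimum of measurable functions; the set in the definition varies with the path.\<close>

lemma return_time_INF:
  "return_time X U = (INF n. if 1 \<le> n \<and> X n \<in> U then of_nat n else \<top>)" (is "_ = ?R")
  unfolding return_time_def
proof (rule antisym)
  show "Inf {of_nat n |n. 1 \<le> n \<and> X n \<in> U} \<le> ?R"
    by (rule INF_greatest) (auto intro: Inf_lower)
  show "?R \<le> Inf {of_nat n |n. 1 \<le> n \<and> X n \<in> U}"
  proof (rule Inf_greatest, clarify)
    fix n assume "1 \<le> n" "X n \<in> U"
    then show "?R \<le> of_nat n" by (intro INF_lower2[of n]) auto
  qed
qed

lemma return_time_le_imp:
  assumes "return_time X U \<le> of_nat j"
  shows "\<exists>n. 1 \<le> n \<and> n \<le> j \<and> X n \<in> U"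
proof -
  have "return_time X U < of_nat (Suc j)"
    using assms by (rule le_less_trans)
      (simp add: ennreal_of_nat_eq_real_of_nat ennreal_less_iff del: of_nat_Suc)
  then obtain n where "1 \<le> n" "X n \<in> U" "(of_nat n :: ennreal) < of_nat (Suc j)"
    by (auto simp: return_time_def Inf_less_iff)
  then show ?thesis 
    by (intro exI[of _ n]) (simp add: ennreal_of_nat_eq_real_of_nat ennreal_less_iff del: of_nat_Suc)
qed

lemma return_time_Suc_le:
  assumes "X 1 \<notin> U"
  shows "return_time (\<lambda>n. X (Suc n)) U \<le> return_time X U"
  unfolding return_time_def[of X]
proof (rule Inf_greatest, clarify)
  fix n assume n: "1 \<le> n" "X n \<in> U"
  with assms obtain m where m: "n = Suc m" "1 \<le> m" by (cases n) (auto simp: Suc_le_eq intro: gr0I)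
  have "return_time (\<lambda>n. X (Suc n)) U \<le> of_nat m"
    unfolding return_time_def using n m by (intro Inf_lower) auto
  also have "\<dots> \<le> of_nat n" using m by (simp add: ennreal_of_nat_eq_real_of_nat)
  finally show "return_time (\<lambda>n. X (Suc n)) U \<le> of_nat n" .
qed

section \<open>Independence and symmetries of the product measure\<close>

context sequence_space
begin

text \<open>\<open>comb_seq k\<close> glues the first \<open>k\<close> terms of one sequence to a
  second sequence; drawing the two independently gives the product measure again. This is the Markov
  property in the form used throughout.\<close>

lemma nn_integral_comb_seq:
  assumes [measurable]: "f \<in> borel_measurable S"
  shows "(\<integral>\<^sup>+ \<omega>. f \<omega> \<partial>S) = (\<integral>\<^sup>+ \<omega>. \<integral>\<^sup>+ \<omega>'. f (comb_seq k \<omega> \<omega>') \<partial>S \<partial>S)"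
proof -
  have "(\<integral>\<^sup>+ \<omega>. f \<omega> \<partial>S) = (\<integral>\<^sup>+ \<omega>. f \<omega> \<partial>distr (S \<Otimes>\<^sub>M S) S (\<lambda>(\<omega>, \<omega>'). comb_seq k \<omega> \<omega>'))"
    by (simp add: PiM_comb_seq)
  also have "\<dots> = (\<integral>\<^sup>+ p. f (case p of (\<omega>, \<omega>') \<Rightarrow> comb_seq k \<omega> \<omega>') \<partial>(S \<Otimes>\<^sub>M S))"
    by (subst nn_integral_distr) (auto intro: measurable_comb_seq)
  also have "\<dots> = (\<integral>\<^sup>+ \<omega>. \<integral>\<^sup>+ \<omega>'. f (comb_seq k \<omega> \<omega>') \<partial>S \<partial>S)"
    by (subst P.nn_integral_fst[symmetric]) auto
  finally show ?thesis .
qed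

lemma distr_shift: "distr S S (\<lambda>\<omega> i. \<omega> (i + k)) = S"
proof -
  have "distr S (Pi\<^sub>M UNIV (\<lambda>i. M)) (\<lambda>\<omega>. \<lambda>n\<in>UNIV. \<omega> (n + k)) = Pi\<^sub>M UNIV (\<lambda>i. M)"
    by (rule distr_PiM_reindex) (auto intro: prob_space inj_onI)
  then show ?thesis by (simp add: restrict_def)
qed

text \<open>Reversing finitely many increments preserves their joint law; this carries estimates for
  the walk over to the backward iteration.\<close>

lemma distr_reverse: "distr S S (\<lambda>\<omega> i. \<omega> (if i < k then k - 1 - i else i)) = S"
proof -
  have "distr S (Pi\<^sub>M UNIV (\<lambda>i. M)) (\<lambda>\<omega>. \<lambda>n\<in>UNIV. \<omega> (if n < k then k - 1 - n else n)) = Pi\<^sub>M UNIV (\<lambda>i. M)"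
    by (rule distr_PiM_reindex) (auto intro!: prob_space inj_onI split: if_splits)
  then show ?thesis by (simp add: restrict_def)
qed

end

text \<open>The canonical model: a sample point is the sequence of increment pairs. A process on an
  arbitrary probability space is transferred to it only in the final theorem.\<close>

locale joint_walk = mu: prob_space \<mu>
  for \<mu> :: "((real ^ 'r) \<times> (real ^ 's)) measure" +
  assumes sets_\<mu>: "sets \<mu> = sets borel"
begin

sublocale sequence_space \<mu>
  by (intro sequence_space.intro product_prob_spaceI mu.prob_space_axioms)

lemma space_\<mu> [simp]: "space \<mu> = UNIV"
  using sets_\<mu> by (simp add: sets_eq_imp_space_eq)

lemma space_S [simp]: "space S = UNIV"
  by (simp add: space_PiM)

lemma measurable_fst_\<mu> [measurable]: "fst \<in> borel_measurable \<mu>"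
  and measurable_snd_\<mu> [measurable]: "snd \<in> borel_measurable \<mu>"
  using measurable_cong_sets[OF sets_\<mu> refl] by (auto simp: borel_prod[symmetric])

lemma measurable_fst_component [measurable]: "(\<lambda>\<omega>. fst (\<omega> k)) \<in> borel_measurable S"
  and measurable_snd_component [measurable]: "(\<lambda>\<omega>. snd (\<omega> k)) \<in> borel_measurable S"
  by (auto intro!: measurable_compose[OF measurable_component_singleton])

lemma measurable_shift [measurable]: "(\<lambda>\<omega> i. \<omega> (i + k)) \<in> measurable S S"
  by (rule measurable_PiM_single') (auto intro!: measurable_component_singleton)

lemma measurable_Suc_shift [measurable]: "(\<lambda>\<omega> i. \<omega> (Suc i)) \<in> measurable S S"
  by (rule measurable_PiM_single') (auto intro!: measurable_component_singleton)

lemma measurable_reverse: "(\<lambda>\<omega> i. \<omega> (if i < k then k - 1 - i else i)) \<in> measurable S S"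
  by (rule measurable_PiM_single') (auto intro!: measurable_component_singleton)

lemma measurable_comb_seq1: "comb_seq k \<omega> \<in> measurable S S"
  by (rule measurable_comb_seq') (auto simp: space_PiM)

lemma sets_Collect_S: "Measurable.pred S P \<Longrightarrow> {\<omega>. P \<omega>} \<in> sets S"
  by (simp add: pred_def)

abbreviation X :: "real ^ 'r \<Rightarrow> nat \<Rightarrow> (nat \<Rightarrow> (real ^ 'r) \<times> (real ^ 's)) \<Rightarrow> real ^ 'r"
  where "X x n \<omega> \<equiv> rwalk x (\<lambda>k. fst (\<omega> k)) n"

abbreviation X1 :: "'r \<Rightarrow> real \<Rightarrow> nat \<Rightarrow> (nat \<Rightarrow> (real ^ 'r) \<times> (real ^ 's)) \<Rightarrow> real"
  where "X1 i x n \<omega> \<equiv> rwalk x (\<lambda>k. fst (\<omega> k) $ i) n"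

definition Z :: "nat \<Rightarrow> (nat \<Rightarrow> (real ^ 'r) \<times> (real ^ 's)) \<Rightarrow> real ^ 's"
  where "Z n \<omega> = (\<Sum>k<n. snd (\<omega> k))"

lemma measurable_Z [measurable]: "Z n \<in> borel_measurable S"
  unfolding Z_def by measurable

lemma X_comb_le: "n \<le> k \<Longrightarrow> X x n (comb_seq k \<omega> \<omega>') = X x n \<omega>"
  by (rule rwalk_cong) (simp add: comb_seq_less)

lemma X_comb: "X x (k + n) (comb_seq k \<omega> \<omega>') = X (X x k \<omega>) n \<omega>'"
  by (simp add: rwalk_add comb_seq_add X_comb_le)

lemma X1_comb_le: "n \<le> k \<Longrightarrow> X1 i x n (comb_seq k \<omega> \<omega>') = X1 i x n \<omega>"
  by (rule rwalk_cong) (simp add: comb_seq_less)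

lemma X1_comb: "X1 i x (k + n) (comb_seq k \<omega> \<omega>') = X1 i (X1 i x k \<omega>) n \<omega>'"
  by (simp add: rwalk_add comb_seq_add X1_comb_le)

lemma Z_comb_le: "n \<le> k \<Longrightarrow> Z n (comb_seq k \<omega> \<omega>') = Z n \<omega>"
  by (simp add: Z_def comb_seq_less)

lemma Z_add: "Z (k + n) \<omega> = Z k \<omega> + Z n (\<lambda>i. \<omega> (i + k))"
  by (induction n) (simp_all add: Z_def add.commute add.left_commute)

lemma Z_comb: "Z (k + n) (comb_seq k \<omega> \<omega>') = Z k \<omega> + Z n \<omega>'"
  by (simp add: Z_add comb_seq_add Z_comb_le)

lemma prob_comb:
  assumes [measurable]: "Measurable.pred S P"
  shows "ennreal (measure S {\<omega>. P \<omega>}) = (\<integral>\<^sup>+ \<omega>. ennreal (measure S {\<omega>'. P (comb_seq k \<omega> \<omega>')}) \<partial>S)"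
proof -
  have "ennreal (measure S {\<omega>. P \<omega>}) = (\<integral>\<^sup>+ \<omega>. indicator {\<omega>. P \<omega>} \<omega> \<partial>S)"
    using sets_Collect_S[OF assms] by (simp add: P.emeasure_eq_measure)
  also have "\<dots> = (\<integral>\<^sup>+ \<omega>. \<integral>\<^sup>+ \<omega>'. indicator {\<omega>. P \<omega>} (comb_seq k \<omega> \<omega>') \<partial>S \<partial>S)"
    using sets_Collect_S[OF assms] by (intro nn_integral_comb_seq) auto
  also have "\<dots> = (\<integral>\<^sup>+ \<omega>. ennreal (measure S {\<omega>'. P (comb_seq k \<omega> \<omega>')}) \<partial>S)"
  proof (rule nn_integral_cong)
    fix \<omega>
    have "{\<omega>'. P (comb_seq k \<omega> \<omega>')} \<in> sets S"
      using measurable_compose[OF measurable_comb_seq1 assms] by (rule sets_Collect_S)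
    moreover have "indicator {\<omega>. P \<omega>} (comb_seq k \<omega> \<omega>') = (indicator {\<omega>'. P (comb_seq k \<omega> \<omega>')} \<omega>' :: ennreal)" for \<omega>'
      by (simp add: indicator_def)
    ultimately show "(\<integral>\<^sup>+ \<omega>'. indicator {\<omega>. P \<omega>} (comb_seq k \<omega> \<omega>') \<partial>S) = ennreal (measure S {\<omega>'. P (comb_seq k \<omega> \<omega>')})"
      by (simp add: P.emeasure_eq_measure)
  qed
  finally show ?thesis .
qed

text \<open>Conditioning on the first \<open>k\<close> increments: the hypothesis on
  \<open>P\<close> says that it depends on these alone, so a uniform bound for the conditional
  probability of \<open>Q\<close> on \<open>P\<close> can be integrated.\<close>

lemma prob_comb_ge:
  assumes [measurable]: "Measurable.pred S P" "Measurable.pred S Q"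
    and P: "\<And>\<omega> \<omega>'. P (comb_seq k \<omega> \<omega>') \<longleftrightarrow> P \<omega>"
    and Q: "\<And>\<omega>. P \<omega> \<Longrightarrow> p \<le> measure S {\<omega>'. Q (comb_seq k \<omega> \<omega>')}" and "0 \<le> p"
  shows "p * measure S {\<omega>. P \<omega>} \<le> measure S {\<omega>. P \<omega> \<and> Q \<omega>}"
proof -
  have "ennreal (p * measure S {\<omega>. P \<omega>}) = (\<integral>\<^sup>+ \<omega>. ennreal p * indicator {\<omega>. P \<omega>} \<omega> \<partial>S)"
    using sets_Collect_S[OF assms(1)] \<open>0 \<le> p\<close>
    by (subst nn_integral_cmult) (auto simp: P.emeasure_eq_measure ennreal_mult)
  also have "\<dots> \<le> (\<integral>\<^sup>+ \<omega>. ennreal (measure S {\<omega>'. P (comb_seq k \<omega> \<omega>') \<and> Q (comb_seq k \<omega> \<omega>')}) \<partial>S)"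
    by (intro nn_integral_mono) (auto simp: P indicator_def intro!: ennreal_leI Q)
  also have "\<dots> = ennreal (measure S {\<omega>. P \<omega> \<and> Q \<omega>})"
    by (rule prob_comb[symmetric]) measurable
  finally show ?thesis by simp
qed

lemma prob_comb_le:
  assumes [measurable]: "Measurable.pred S P" "Measurable.pred S Q"
    and P: "\<And>\<omega> \<omega>'. P (comb_seq k \<omega> \<omega>') \<longleftrightarrow> P \<omega>"
    and Q: "\<And>\<omega>. P \<omega> \<Longrightarrow> measure S {\<omega>'. Q (comb_seq k \<omega> \<omega>')} \<le> p" and "0 \<le> p"
  shows "measure S {\<omega>. P \<omega> \<and> Q \<omega>} \<le> p * measure S {\<omega>. P \<omega>}"
proof -
  have "ennreal (measure S {\<omega>. P \<omega> \<and> Q \<omega>})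
      = (\<integral>\<^sup>+ \<omega>. ennreal (measure S {\<omega>'. P (comb_seq k \<omega> \<omega>') \<and> Q (comb_seq k \<omega> \<omega>')}) \<partial>S)"
    by (rule prob_comb) measurable
  also have "\<dots> \<le> (\<integral>\<^sup>+ \<omega>. ennreal p * indicator {\<omega>. P \<omega>} \<omega> \<partial>S)"
    by (intro nn_integral_mono) (auto simp: P indicator_def intro!: ennreal_leI Q)
  also have "\<dots> = ennreal (p * measure S {\<omega>. P \<omega>})"
    using sets_Collect_S[OF assms(1)] \<open>0 \<le> p\<close>
    by (subst nn_integral_cmult) (auto simp: P.emeasure_eq_measure ennreal_mult)
  finally show ?thesis using \<open>0 \<le> p\<close> by simp
qed

lemma prob_shift:
  assumes [measurable]: "Measurable.pred S Q"
  shows "measure S {\<omega>. Q (\<lambda>i. \<omega> (i + k))} = measure S {\<omega>. Q \<omega>}"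
proof -
  have "measure S {\<omega>. Q \<omega>} = measure (distr S S (\<lambda>\<omega> i. \<omega> (i + k))) {\<omega>. Q \<omega>}"
    by (simp add: distr_shift)
  also have "\<dots> = measure S {\<omega>. Q (\<lambda>i. \<omega> (i + k))}"
    using sets_Collect_S[OF assms] by (subst measure_distr) (auto simp: vimage_def)
  finally show ?thesis by simp
qed

text \<open>The two conditional bounds apply with p the probability of \<open>Q\<close>, because
  after gluing the shifted sequence is exactly the second sample.\<close>

lemma prob_indep_shift:
  assumes [measurable]: "Measurable.pred S P" "Measurable.pred S Q"
    and P: "\<And>\<omega> \<omega>'. P (comb_seq k \<omega> \<omega>') \<longleftrightarrow> P \<omega>"
  shows "measure S {\<omega>. P \<omega> \<and> Q (\<lambda>i. \<omega> (i + k))} = measure S {\<omega>. P \<omega>} * measure S {\<omega>. Q \<omega>}"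
proof (rule antisym)
  have [measurable]: "Measurable.pred S (\<lambda>\<omega>. Q (\<lambda>i. \<omega> (i + k)))"
    by (rule measurable_compose[OF measurable_shift assms(2)])
  have *: "(\<lambda>i. comb_seq k \<omega> \<omega>' (i + k)) = \<omega>'" for \<omega> \<omega>' :: "nat \<Rightarrow> (real ^ 'r) \<times> (real ^ 's)"
    by (rule ext) (rule comb_seq_add)
  have "measure S {\<omega>. P \<omega> \<and> Q (\<lambda>i. \<omega> (i + k))} \<le> measure S {\<omega>. Q \<omega>} * measure S {\<omega>. P \<omega>}"
    by (rule prob_comb_le[where k = k]) (measurable, simp_all only: * P order_refl measure_nonneg)
  then show "measure S {\<omega>. P \<omega> \<and> Q (\<lambda>i. \<omega> (i + k))} \<le> measure S {\<omega>. P \<omega>} * measure S {\<omega>. Q \<omega>}"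
    by (simp only: mult.commute)
  have "measure S {\<omega>. Q \<omega>} * measure S {\<omega>. P \<omega>} \<le> measure S {\<omega>. P \<omega> \<and> Q (\<lambda>i. \<omega> (i + k))}"
    by (rule prob_comb_ge[where k = k]) (measurable, simp_all only: * P order_refl measure_nonneg)
  then show "measure S {\<omega>. P \<omega>} * measure S {\<omega>. Q \<omega>} \<le> measure S {\<omega>. P \<omega> \<and> Q (\<lambda>i. \<omega> (i + k))}"
    by (simp only: mult.commute)
qed

lemma prob_component:
  assumes [measurable]: "Measurable.pred \<mu> Q"
  shows "measure S {\<omega>. Q (\<omega> k)} = measure \<mu> {y. Q y}"
proof -
  have Q: "{y. Q y} \<in> sets \<mu>" using assms by (simp add: pred_def)
  have "measure \<mu> {y. Q y} = measure (distr S \<mu> (\<lambda>\<omega>. \<omega> k)) {y. Q y}"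
    by (subst PiM_component) simp_all
  also have "\<dots> = measure S {\<omega>. Q (\<omega> k)}"
    by (subst measure_distr[OF _ Q]) (simp_all add: vimage_def)
  finally show ?thesis ..
qed

lemma prob_mono:
  assumes "Measurable.pred S Q" "\<And>\<omega>. P \<omega> \<Longrightarrow> Q \<omega>"
  shows "measure S {\<omega>. P \<omega>} \<le> measure S {\<omega>. Q \<omega>}"
  using assms sets_Collect_S[OF assms(1)] by (intro P.finite_measure_mono) auto

lemma prob_mono_AE:
  assumes "Measurable.pred S Q" "AE \<omega> in S. P \<omega> \<longrightarrow> Q \<omega>"
  shows "measure S {\<omega>. P \<omega>} \<le> measure S {\<omega>. Q \<omega>}"
  using assms(2) sets_Collect_S[OF assms(1)] by (intro P.finite_measure_mono_AE) auto

lemma prob_disj_le: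
  assumes "Measurable.pred S P" "Measurable.pred S Q"
  shows "measure S {\<omega>. P \<omega> \<or> Q \<omega>} \<le> measure S {\<omega>. P \<omega>} + measure S {\<omega>. Q \<omega>}"
  using measure_Un_le[of "{\<omega>. P \<omega>}" S "{\<omega>. Q \<omega>}"]
    assms[THEN sets_Collect_S] by (simp add: Collect_disj_eq)

lemma prob_not:
  assumes "Measurable.pred S P"
  shows "measure S {\<omega>. \<not> P \<omega>} = 1 - measure S {\<omega>. P \<omega>}"
proof -
  have "{\<omega>. \<not> P \<omega>} = space S - {\<omega>. P \<omega>}" by auto
  then show ?thesis using P.prob_compl[OF sets_Collect_S[OF assms]] by simp
qed

lemma prob_conj_ge:
  assumes [measurable]: "Measurable.pred S P" "Measurable.pred S Q"
  shows "measure S {\<omega>. P \<omega> \<and> Q \<omega>} \<ge> measure S {\<omega>. P \<omega>} - measure S {\<omega>. \<not> Q \<omega>}"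
proof -
  have "measure S {\<omega>. P \<omega>} \<le> measure S {\<omega>. (P \<omega> \<and> Q \<omega>) \<or> \<not> Q \<omega>}" by (rule prob_mono) auto
  also have "\<dots> \<le> measure S {\<omega>. P \<omega> \<and> Q \<omega>} + measure S {\<omega>. \<not> Q \<omega>}" by (rule prob_disj_le) auto
  finally show ?thesis by simp
qed

end

section \<open>Tightness of a coordinate\<close>

lemma borel_measurable_return_time [measurable (raw)]:
  fixes X :: "nat \<Rightarrow> 'a \<Rightarrow> real"
  assumes [measurable]: "\<And>n. X n \<in> borel_measurable N" "U \<in> sets borel"
  shows "(\<lambda>\<omega>. return_time (\<lambda>n. X n \<omega>) U) \<in> borel_measurable N"
  unfolding return_time_INF by measurable

lemma rwalk_le:
  fixes x :: real
  assumes "0 \<le> x"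
  shows "rwalk x y n \<le> x + (\<Sum>k<n. \<bar>y k\<bar>)"
proof -
  have "rwalk 0 (\<lambda>_. 0) n = (0::real)" by (induction n) auto
  with rwalk_diff_le[of x y n 0 "\<lambda>_. 0"] assms show ?thesis by simp
qed

text \<open>At most w + 1 natural numbers lie below w; this bounds the sum of the tail probabilities
  of a variable by its mean plus 1.\<close>

lemma sum_of_nat_less_ennreal: "(\<Sum>j<N. if of_nat j < w then 1 else 0) \<le> (w + 1 :: ennreal)"
proof (induction N)
  case (Suc N)
  show ?case
  proof (cases "of_nat N < w")
    case True
    have "(\<Sum>j<Suc N. if of_nat j < w then 1 else 0) \<le> (\<Sum>j<Suc N. 1 :: ennreal)"
      by (intro sum_mono) auto
    also have "\<dots> \<le> w + 1" using True by (auto simp: add.commute intro!: add_left_mono)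
    finally show ?thesis .
  qed (use Suc in simp)
qed simp

context joint_walk
begin

lemma prob_tail:
  fixes f :: "(nat \<Rightarrow> (real ^ 'r) \<times> (real ^ 's)) \<Rightarrow> real"
  assumes [measurable]: "f \<in> borel_measurable S" and "\<delta> > 0"
  obtains R where "measure S {\<omega>. f \<omega> > R} \<le> \<delta>"
proof -
  have "(\<lambda>n. measure S {\<omega>. f \<omega> > real n}) \<longlonglongrightarrow> measure S (\<Inter>n. {\<omega>. f \<omega> > real n})"
    by (rule P.finite_Lim_measure_decseq) (auto simp: decseq_def intro!: sets_Collect_S)
  moreover have "(\<Inter>n. {\<omega>. f \<omega> > real n}) = {}"
    using reals_Archimedean2 less_asym by fastforce
  ultimately have "(\<lambda>n. measure S {\<omega>. f \<omega> > real n}) \<longlonglongrightarrow> 0" by simp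
  from order_tendstoD(2)[OF this \<open>\<delta> > 0\<close>] obtain n where "measure S {\<omega>. f \<omega> > real n} < \<delta>"
    by (auto simp: eventually_sequentially)
  then show ?thesis by (intro that[of "real n"]) simp
qed

lemma prob_tail_sum:
  assumes [measurable]: "W \<in> borel_measurable S" and fin: "(\<integral>\<^sup>+ \<omega>. W \<omega> \<partial>S) < \<infinity>" and "\<delta> > 0"
  obtains m where "\<And>n. (\<Sum>j\<in>{m<..n}. measure S {\<omega>. of_nat j < W \<omega>}) \<le> \<delta>"
proof -
  define f where "f j = measure S {\<omega>. of_nat j < W \<omega>}" for j :: nat
  have "(\<Sum>j<N. f j) \<le> enn2real ((\<integral>\<^sup>+ \<omega>. W \<omega> \<partial>S) + 1)" for N
  proof -
    have "ennreal (\<Sum>j<N. f j) = (\<Sum>j<N. emeasure S {\<omega>. of_nat j < W \<omega>})"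
      by (simp add: f_def P.emeasure_eq_measure sum_ennreal)
    also have "\<dots> = (\<integral>\<^sup>+ \<omega>. (\<Sum>j<N. indicator {\<omega>. of_nat j < W \<omega>} \<omega>) \<partial>S)"
      by (subst nn_integral_sum) (auto intro!: sum.cong nn_integral_indicator[symmetric] sets_Collect_S)
    also have "\<dots> \<le> (\<integral>\<^sup>+ \<omega>. W \<omega> + 1 \<partial>S)"
    proof (rule nn_integral_mono)
      fix \<omega>
      show "(\<Sum>j<N. indicator {\<omega>. of_nat j < W \<omega>} \<omega>) \<le> W \<omega> + 1"
        using sum_of_nat_less_ennreal[of "W \<omega>" N] by (simp add: indicator_def of_bool_def)
    qed
    also have "\<dots> = (\<integral>\<^sup>+ \<omega>. W \<omega> \<partial>S) + 1"
      by (subst nn_integral_add) (auto simp: P.emeasure_space_1[simplified])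
    finally have "ennreal (\<Sum>j<N. f j) \<le> (\<integral>\<^sup>+ \<omega>. W \<omega> \<partial>S) + 1" .
    moreover have "(\<integral>\<^sup>+ \<omega>. W \<omega> \<partial>S) + 1 < \<top>" using fin by simp
    moreover have "0 \<le> (\<Sum>j<N. f j)" by (intro sum_nonneg) (simp add: f_def)
    ultimately show ?thesis by (metis enn2real_ennreal enn2real_mono)
  qed
  moreover have "0 \<le> f j" for j by (simp add: f_def)
  ultimately have "summable f" by (rule summableI_nonneg_bounded[rotated])
  then obtain m where m: "\<And>m' n. m' \<ge> m \<Longrightarrow> norm (sum f {m'..<n}) < \<delta>"
    using \<open>\<delta> > 0\<close> unfolding summable_Cauchy by meson
  show ?thesis
  proof
    fix n
    have "{m<..n} = {Suc m..<Suc n}" by auto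
    then show "(\<Sum>j\<in>{m<..n}. measure S {\<omega>. of_nat j < W \<omega>}) \<le> \<delta>"
      using m[of "Suc m" "Suc n"] by (simp add: f_def)
  qed
qed

abbreviation cm :: "'r \<Rightarrow> real measure" where "cm i \<equiv> coord_marginal (first_marginal \<mu>) i"

lemma cm_eq: "cm i = distr \<mu> borel (\<lambda>y. fst y $ i)"
proof -
  have "cm i = distr \<mu> borel ((\<lambda>x. x $ i) \<circ> fst)"
    unfolding coord_marginal_def first_marginal_def by (rule distr_distr) measurable
  then show ?thesis by (simp add: comp_def)
qed

lemma sets_cm: "sets (cm i) = sets borel"
  by (simp add: cm_eq)

lemma prob_space_cm: "prob_space (cm i)"
  unfolding cm_eq by (rule mu.prob_space_distr) measurable

lemma emeasure_cm: "A \<in> sets borel \<Longrightarrow> emeasure (cm i) A = emeasure \<mu> {y. fst y $ i \<in> A}"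
  by (simp add: cm_eq emeasure_distr vimage_def)

lemma AE_cm_support: "AE y in \<mu>. fst y $ i \<in> measure_support (cm i)"
proof -
  have "AE t in cm i. t \<in> measure_support (cm i)"
    using emeasure_measure_support_compl[OF sets_cm[of i]] closed_measure_support[of "cm i"]
    by (intro AE_I[where N = "- measure_support (cm i)"]) (auto simp: sets_cm)
  then show ?thesis
    unfolding cm_eq[of i] by (subst (asm) AE_distr_iff) (auto simp: closed_measure_support)
qed

lemma support_positive:
  assumes "emeasure (cm i) {0<..} > 0"
  obtains y0 where "y0 > 0" "y0 \<in> measure_support (cm i)"
proof -
  have "\<not> {0<..} \<subseteq> - measure_support (cm i)"
  proof
    assume "{0<..} \<subseteq> - measure_support (cm i)"
    then have "emeasure (cm i) {0<..} \<le> emeasure (cm i) (- measure_support (cm i))"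
      using closed_measure_support[of "cm i"] by (intro emeasure_mono) (auto simp: sets_cm)
    with assms show False by (simp add: emeasure_measure_support_compl[OF sets_cm])
  qed
  then show thesis using that by auto
qed

text \<open>The increments are independent, and each ball about a point of the support is charged;
  so a finite path through the support is shadowed with positive probability.\<close>

lemma prob_near_support:
  assumes "\<And>k. k < n \<Longrightarrow> y k \<in> measure_support (cm i)" "\<eta> > 0"
  shows "measure S {\<omega>. \<forall>k<n. \<bar>fst (\<omega> k) $ i - y k\<bar> < \<eta>} > 0"
  using assms(1)
proof (induction n)
  case 0
  then show ?case using P.prob_space by simp
next
  case (Suc n)
  have "measure S {\<omega>. \<forall>k<Suc n. \<bar>fst (\<omega> k) $ i - y k\<bar> < \<eta>} =
      measure S {\<omega>. (\<forall>k<n. \<bar>fst (\<omega> k) $ i - y k\<bar> < \<eta>) \<and> (\<lambda>\<omega>. \<bar>fst (\<omega> 0) $ i - y n\<bar> < \<eta>) (\<lambda>i. \<omega> (i + n))}"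
    by (rule arg_cong[where f = "measure S"]) (auto simp: less_Suc_eq)
  also have "\<dots> = measure S {\<omega>. \<forall>k<n. \<bar>fst (\<omega> k) $ i - y k\<bar> < \<eta>} * measure S {\<omega>. \<bar>fst (\<omega> 0) $ i - y n\<bar> < \<eta>}"
    by (rule prob_indep_shift) (measurable, simp add: comb_seq_less)
  also have "measure S {\<omega>. \<bar>fst (\<omega> 0) $ i - y n\<bar> < \<eta>} = measure \<mu> {z. \<bar>fst z $ i - y n\<bar> < \<eta>}"
    by (rule prob_component) measurable
  also have "\<dots> > 0"
  proof -
    have "emeasure (cm i) (ball (y n) \<eta>) > 0"
      using Suc.prems[of n] \<open>\<eta> > 0\<close> by (auto simp: measure_support_def)
    then have "emeasure \<mu> {z. \<bar>fst z $ i - y n\<bar> < \<eta>} > 0"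
      by (simp add: emeasure_cm ball_def dist_real_def abs_minus_commute)
    then show ?thesis by (simp add: mu.emeasure_eq_measure)
  qed
  ultimately show ?case using Suc by (simp add: zero_less_mult_iff)
qed

text \<open>
  Nonexpansiveness turns the return times of the walk from two points \<open>0\<close> and \<open>y'\<close> to \<open>[0,a)\<close> into
  a bound on the return time to \<open>[0,3a)\<close> which is valid for all starting points in \<open>[0,3a)\<close> at once.
\<close>

lemma X1_tight:
  assumes pos: "emeasure (cm i) {0<..} > 0"
    and ret: "\<And>a. a > 0 \<Longrightarrow> (\<integral>\<^sup>+ \<omega>. return_time (\<lambda>n. X1 i 0 n \<omega>) {..<a} \<partial>S) < \<infinity>"
    and "\<delta> > 0"
  obtains R where "\<And>n. measure S {\<omega>. X1 i 0 n \<omega> > R} \<le> \<delta>"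
proof -
  obtain y0 where y0: "y0 > 0" "y0 \<in> measure_support (cm i)" by (rule support_positive[OF pos])
  \<comment> \<open>The increments within \<open>a\<close> of \<open>y0\<close> exceed
    \<open>a\<close>. Such a step from 0 leaves [0, a), so that the return to [0, a) is still to
    come.\<close>
  define a where "a = y0 / 2"
  have a: "a > 0" using y0 by (simp add: a_def)
  have "measure S {\<omega>. \<forall>k<1. \<bar>fst (\<omega> k) $ i - y0\<bar> < a} > 0"
    using prob_near_support[of 1 "\<lambda>_. y0" i a] y0 a by auto
  then have pos': "measure S {\<omega>. \<bar>fst (\<omega> 0) $ i - y0\<bar> < a} > 0" by simp
  define \<tau> where "\<tau> x \<omega> = return_time (\<lambda>n. X1 i x n \<omega>) {..<a}" for x \<omega>
  have [measurable]: "\<tau> x \<in> borel_measurable S" for x unfolding \<tau>_def by measurable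
  have "(\<integral>\<^sup>+ \<omega>. \<integral>\<^sup>+ \<omega>'. \<tau> 0 (comb_seq 1 \<omega> \<omega>') \<partial>S \<partial>S) < \<infinity>"
    using ret[OF a] nn_integral_comb_seq[of "\<tau> 0" 1] by (simp add: \<tau>_def[abs_def])
  moreover have "(\<lambda>\<omega>. \<integral>\<^sup>+ \<omega>'. \<tau> 0 (comb_seq 1 \<omega> \<omega>') \<partial>S) \<in> borel_measurable S"
    by measurable
  \<comment> \<open>By Fubini the time that remains has finite mean for almost every first
    increment. As increments near \<open>y0\<close> have positive probability, one of these good
    increments can serve as the second starting point \<open>y'\<close>.\<close>
  ultimately have "AE \<omega> in S. (\<integral>\<^sup>+ \<omega>'. \<tau> 0 (comb_seq 1 \<omega> \<omega>') \<partial>S) \<noteq> \<infinity>"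
    by (intro nn_integral_noteq_infinite) auto
  then have ae: "AE \<omega> in S. (\<integral>\<^sup>+ \<omega>'. \<tau> 0 (comb_seq 1 \<omega> \<omega>') \<partial>S) < \<infinity>"
    by (simp add: less_top)
  have "\<exists>\<omega>. \<bar>fst (\<omega> 0) $ i - y0\<bar> < a \<and> (\<integral>\<^sup>+ \<omega>'. \<tau> 0 (comb_seq 1 \<omega> \<omega>') \<partial>S) < \<infinity>"
  proof (rule ccontr)
    assume "\<not> ?thesis"
    with ae have "AE \<omega> in S. \<not> \<bar>fst (\<omega> 0) $ i - y0\<bar> < a" by (auto elim: AE_mp)
    then have "measure S {\<omega>. \<bar>fst (\<omega> 0) $ i - y0\<bar> < a} \<le> measure S {\<omega>. False}"
      by (intro prob_mono_AE) auto
    with pos' show False by simp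
  qed
  then obtain \<omega>0 where w0: "\<bar>fst (\<omega>0 0) $ i - y0\<bar> < a" "(\<integral>\<^sup>+ \<omega>'. \<tau> 0 (comb_seq 1 \<omega>0 \<omega>') \<partial>S) < \<infinity>"
    by blast
  define y' where "y' = fst (\<omega>0 0) $ i"
  have y': "a < y'" "y' < 4 * a" using w0(1) y0(1) by (auto simp: a_def y'_def abs_if split: if_splits)
  have "\<tau> y' \<omega>' \<le> \<tau> 0 (comb_seq 1 \<omega>0 \<omega>')" for \<omega>'
  proof -
    have X1: "X1 i 0 (Suc n) (comb_seq 1 \<omega>0 \<omega>') = X1 i y' n \<omega>'" for n
      using y' a by (simp only: rwalk_Suc_shift) (simp add: y'_def)
    have X11: "X1 i 0 1 (comb_seq 1 \<omega>0 \<omega>') = y'" using X1[of 0] by simp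
    have "\<tau> y' \<omega>' = return_time (\<lambda>n. X1 i 0 (Suc n) (comb_seq 1 \<omega>0 \<omega>')) {..<a}"
      unfolding \<tau>_def X1 ..
    also have "\<dots> \<le> \<tau> 0 (comb_seq 1 \<omega>0 \<omega>')"
      unfolding \<tau>_def using y'(1) X11 by (intro return_time_Suc_le) auto
    finally show ?thesis .
  qed
  then have "(\<integral>\<^sup>+ \<omega>. \<tau> y' \<omega> \<partial>S) \<le> (\<integral>\<^sup>+ \<omega>'. \<tau> 0 (comb_seq 1 \<omega>0 \<omega>') \<partial>S)"
    by (intro nn_integral_mono) auto
  with w0(2) have fin': "(\<integral>\<^sup>+ \<omega>. \<tau> y' \<omega> \<partial>S) < \<infinity>" by (rule le_less_trans[rotated])
  define W where "W \<omega> = \<tau> 0 \<omega> + \<tau> y' \<omega>" for \<omega>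
  have [measurable]: "W \<in> borel_measurable S" unfolding W_def by measurable
  have "(\<integral>\<^sup>+ \<omega>. W \<omega> \<partial>S) < \<infinity>"
  proof -
    have "(\<integral>\<^sup>+ \<omega>. \<tau> 0 \<omega> \<partial>S) < \<infinity>" using ret[OF a] unfolding \<tau>_def .
    moreover have "(\<integral>\<^sup>+ \<omega>. W \<omega> \<partial>S) = (\<integral>\<^sup>+ \<omega>. \<tau> 0 \<omega> \<partial>S) + (\<integral>\<^sup>+ \<omega>. \<tau> y' \<omega> \<partial>S)"
      unfolding W_def by (rule nn_integral_add) measurable
    ultimately show ?thesis using fin' by simp
  qed
  have "\<delta> / 2 > 0" using \<open>\<delta> > 0\<close> by simp
  obtain m where m: "\<And>n. (\<Sum>j\<in>{m<..n}. measure S {\<omega>. of_nat j < W \<omega>}) \<le> \<delta> / 2"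
    by (rule prob_tail_sum[OF \<open>W \<in> borel_measurable S\<close> \<open>(\<integral>\<^sup>+ \<omega>. W \<omega> \<partial>S) < \<infinity>\<close> \<open>\<delta> / 2 > 0\<close>]) blast
  have "(\<lambda>\<omega>. \<Sum>l<m. \<bar>fst (\<omega> l) $ i\<bar>) \<in> borel_measurable S" by measurable
  then obtain R where R: "measure S {\<omega>. (\<Sum>l<m. \<bar>fst (\<omega> l) $ i\<bar>) > R} \<le> \<delta> / 2"
    by (rule prob_tail[OF _ \<open>\<delta> / 2 > 0\<close>])
  \<comment> \<open>A start in [0, 2a] is compared with the copy from 0, a start in (2a, 3a) with
    the copy from \<open>y'\<close>, which lies in (a, 4a). In both cases the distance is at most
    2a, so a visit of the copy to [0, a) is a visit of the walk to [0, 3a).\<close>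
  have ret': "\<exists>n. 1 \<le> n \<and> n \<le> j \<and> X1 i x n \<omega> < 3 * a"
    if "0 \<le> x" "x < 3 * a" "W \<omega> \<le> of_nat j" for x j \<omega>
  proof (cases "x \<le> 2 * a")
    case True
    have "\<tau> 0 \<omega> \<le> of_nat j" using that(3) order_trans[OF _ that(3), of "\<tau> 0 \<omega>"] by (simp add: W_def)
    then obtain n where n: "1 \<le> n" "n \<le> j" "X1 i 0 n \<omega> < a"
      using return_time_le_imp[of "\<lambda>n. X1 i 0 n \<omega>"] by (auto simp: \<tau>_def)
    then show ?thesis
      using rwalk_nonexpansive_real[of x "\<lambda>k. fst (\<omega> k) $ i" n 0] True that(1) by (intro exI[of _ n]) auto
  next
    case False
    have "\<tau> y' \<omega> \<le> of_nat j" using order_trans[OF _ that(3), of "\<tau> y' \<omega>"] by (simp add: W_def)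
    then obtain n where n: "1 \<le> n" "n \<le> j" "X1 i y' n \<omega> < a"
      using return_time_le_imp[of "\<lambda>n. X1 i y' n \<omega>"] by (auto simp: \<tau>_def)
    then show ?thesis
      using rwalk_nonexpansive_real[of x "\<lambda>k. fst (\<omega> k) $ i" n y'] False that(2) y'
      by (intro exI[of _ n]) auto
  qed
  \<comment> \<open>Decomposition at the last time \<open>k\<close> up to \<open>n\<close> spent
    below 3a. If \<open>n - k\<close> exceeds \<open>m\<close>, then the return time after
    \<open>k\<close> exceeds \<open>n - k\<close>; otherwise the growth since \<open>k\<close> is
    bounded by a sum of \<open>m\<close> consecutive increments. Both have small probability
    uniformly in \<open>n\<close>.\<close>
  have key: "(\<exists>j\<in>{m<..n}. of_nat j < W (\<lambda>i. \<omega> (i + (n - j)))) \<or> (\<Sum>l<m. \<bar>fst (\<omega> (l + (n - m))) $ i\<bar>) > R"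
    if big: "X1 i 0 n \<omega> > 3 * a + R" for n \<omega>
  proof (rule ccontr)
    assume "\<not> ?thesis"
    then have W: "\<And>j. m < j \<Longrightarrow> j \<le> n \<Longrightarrow> W (\<lambda>i. \<omega> (i + (n - j))) \<le> of_nat j"
      and small: "(\<Sum>l<m. \<bar>fst (\<omega> (l + (n - m))) $ i\<bar>) \<le> R" by (auto simp: not_less)
    define A where "A = {k. k \<le> n \<and> X1 i 0 k \<omega> < 3 * a}"
    define k where "k = Max A"
    have "finite A" "0 \<in> A" using a by (auto simp: A_def)
    then have "k \<in> A" unfolding k_def by (intro Max_in) auto
    then have k: "k \<le> n" "X1 i 0 k \<omega> < 3 * a" by (auto simp: A_def)
    have maxk: "k' \<le> k" if "k' \<in> A" for k' using that \<open>finite A\<close> by (simp add: k_def)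
    have nk: "n - k \<le> m"
    proof (rule ccontr)
      assume "\<not> n - k \<le> m"
      then have "W (\<lambda>i. \<omega> (i + k)) \<le> of_nat (n - k)" using W[of "n - k"] k by simp
      then obtain t where t: "1 \<le> t" "t \<le> n - k" "X1 i (X1 i 0 k \<omega>) t (\<lambda>i. \<omega> (i + k)) < 3 * a"
        using ret'[of "X1 i 0 k \<omega>"] k rwalk_nonneg by blast
      then have "k + t \<in> A" using k by (auto simp: A_def rwalk_add)
      from maxk[OF this] t(1) show False by simp
    qed
    have "X1 i 0 n \<omega> = rwalk (X1 i 0 k \<omega>) (\<lambda>l. fst (\<omega> (l + k)) $ i) (n - k)"
      using k(1) rwalk_add[of 0 "\<lambda>l. fst (\<omega> l) $ i" k "n - k"] by simp
    also have "\<dots> \<le> X1 i 0 k \<omega> + (\<Sum>l<n - k. \<bar>fst (\<omega> (l + k)) $ i\<bar>)"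
      by (rule rwalk_le) (rule rwalk_nonneg[OF order_refl])
    also have "(\<Sum>l<n - k. \<bar>fst (\<omega> (l + k)) $ i\<bar>) = (\<Sum>l\<in>{k..<n}. \<bar>fst (\<omega> l) $ i\<bar>)"
      using k(1) by (intro sum.reindex_bij_witness[of _ "\<lambda>l. l - k" "\<lambda>l. l + k"]) auto
    also have "\<dots> \<le> (\<Sum>l\<in>{n - m..<m + (n - m)}. \<bar>fst (\<omega> l) $ i\<bar>)"
      using nk by (intro sum_mono2) auto
    also have "\<dots> = (\<Sum>l<m. \<bar>fst (\<omega> (l + (n - m))) $ i\<bar>)"
      by (intro sum.reindex_bij_witness[of _ "\<lambda>l. l + (n - m)" "\<lambda>l. l - (n - m)"]) auto
    finally show False using big small k(2) by simp
  qed
  show thesis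
  proof (rule that[of "3 * a + R"])
    fix n
    have [measurable]: "Measurable.pred S (\<lambda>\<omega>. of_nat j < W (\<lambda>i. \<omega> (i + k)))" for j k :: nat
      by measurable
    have "measure S {\<omega>. X1 i 0 n \<omega> > 3 * a + R}
      \<le> measure S {\<omega>. (\<exists>j\<in>{m<..n}. of_nat j < W (\<lambda>i. \<omega> (i + (n - j)))) \<or> (\<Sum>l<m. \<bar>fst (\<omega> (l + (n - m))) $ i\<bar>) > R}"
      by (rule prob_mono[OF _ key]) measurable
    also have "\<dots> \<le> measure S {\<omega>. \<exists>j\<in>{m<..n}. of_nat j < W (\<lambda>i. \<omega> (i + (n - j)))}
        + measure S {\<omega>. (\<Sum>l<m. \<bar>fst (\<omega> (l + (n - m))) $ i\<bar>) > R}"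
      by (rule prob_disj_le) measurable
    also have "measure S {\<omega>. (\<Sum>l<m. \<bar>fst (\<omega> (l + (n - m))) $ i\<bar>) > R} = measure S {\<omega>. (\<Sum>l<m. \<bar>fst (\<omega> l) $ i\<bar>) > R}"
      by (rule prob_shift[of "\<lambda>\<omega>. (\<Sum>l<m. \<bar>fst (\<omega> l) $ i\<bar>) > R"]) measurable
    also have "measure S {\<omega>. \<exists>j\<in>{m<..n}. of_nat j < W (\<lambda>i. \<omega> (i + (n - j)))}
        = measure S (\<Union>j\<in>{m<..n}. {\<omega>. of_nat j < W (\<lambda>i. \<omega> (i + (n - j)))})"
      by (rule arg_cong[where f = "measure S"]) auto
    also have "\<dots> \<le> (\<Sum>j\<in>{m<..n}. measure S {\<omega>. of_nat j < W (\<lambda>i. \<omega> (i + (n - j)))})"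
      by (rule measure_UNION_le) (simp, rule sets_Collect_S, measurable)
    also have "\<dots> = (\<Sum>j\<in>{m<..n}. measure S {\<omega>. of_nat j < W \<omega>})"
      by (intro sum.cong refl prob_shift[of "\<lambda>\<omega>. of_nat _ < W \<omega>"]) measurable
    finally show "measure S {\<omega>. X1 i 0 n \<omega> > 3 * a + R} \<le> \<delta>" using m[of n] R by simp
  qed
qed

end

section \<open>Contraction of a coordinate\<close>

text \<open>In an integer coordinate the integrality of the half-sum says that \<open>a\<close> and
  \<open>b\<close> have the same parity, which is the invariant of the coupled motion. Stated
  through the midpoint it is a closed condition, and it is exactly what the gcd argument needs as
  input.\<close>

definition paired :: "'r set \<Rightarrow> 'r \<Rightarrow> (real \<times> real) set"
  where "paired I i = {(a, b). 0 \<le> a \<and> 0 \<le> b \<and> (i \<in> I \<longrightarrow> a \<in> \<int> \<and> b \<in> \<int> \<and> (a + b) / 2 \<in> \<int>)}"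

lemma closed_paired: "closed (paired I i)"
proof -
  have "closed {p :: real \<times> real. 0 \<le> fst p \<and> 0 \<le> snd p}"
    by (intro closed_Collect_conj closed_Collect_le continuous_intros)
  moreover have "closed ((fst -` \<int>) :: (real \<times> real) set)" "closed ((snd -` \<int>) :: (real \<times> real) set)"
    "closed (((\<lambda>p. (fst p + snd p) / 2) -` \<int>) :: (real \<times> real) set)"
    by (intro closed_vimage closed_Ints continuous_intros; simp)+
  moreover have "paired I i = {p. 0 \<le> fst p \<and> 0 \<le> snd p} \<inter>
      (if i \<in> I then fst -` \<int> \<inter> snd -` \<int> \<inter> (\<lambda>p. (fst p + snd p) / 2) -` \<int> else UNIV)"
    by (auto simp: paired_def)
  ultimately show ?thesis by auto
qed

lemma sets_paired [measurable]: "paired I i \<in> sets (borel \<Otimes>\<^sub>M borel)"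
  unfolding borel_prod by (rule borel_closed[OF closed_paired])

lemma paired_step:
  assumes "(a, b) \<in> paired I i" "i \<in> I \<Longrightarrow> y \<in> \<int>"
  shows "(\<bar>a - y\<bar>, \<bar>b - y\<bar>) \<in> paired I i"
proof (cases "i \<in> I")
  case True
  then have ab: "a \<in> \<int>" "b \<in> \<int>" "(a + b) / 2 \<in> \<int>" "y \<in> \<int>" using assms by (auto simp: paired_def)
  \<comment> \<open>The four forms correspond to the sides of \<open>y\<close> on which
    \<open>a\<close> and \<open>b\<close> lie; if \<open>y\<close> separates them, it cancels from
    the sum.\<close>
  consider "(\<bar>a - y\<bar> + \<bar>b - y\<bar>) / 2 = (a + b) / 2 - y" | "(\<bar>a - y\<bar> + \<bar>b - y\<bar>) / 2 = y - (a + b) / 2"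
    | "(\<bar>a - y\<bar> + \<bar>b - y\<bar>) / 2 = (a + b) / 2 - a" | "(\<bar>a - y\<bar> + \<bar>b - y\<bar>) / 2 = (a + b) / 2 - b"
    by (cases "y \<le> a"; cases "y \<le> b") (simp_all add: field_simps)
  then have "(\<bar>a - y\<bar> + \<bar>b - y\<bar>) / 2 \<in> \<int>" using ab by cases (simp_all only: Ints_diff)
  with ab True show ?thesis by (auto simp: paired_def)
qed (auto simp: paired_def)

lemma pair_orbit_rwalk:
  "(a, b) \<in> pair_orbit T x x' \<Longrightarrow>
    \<exists>y n. (\<forall>k<n. y k \<in> T) \<and> a = rwalk x y n \<and> b = rwalk x' y n"
proof (induction rule: pair_orbit.induct)
  case start
  then show ?case by (intro exI[of _ "\<lambda>_. 0"] exI[of _ 0]) auto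
next
  case (step a b y)
  then obtain z n where z: "\<forall>k<n. z k \<in> T" "a = rwalk x z n" "b = rwalk x' z n" by blast
  define z' where "z' = z(n := y)"
  have z': "z' n = y" "\<And>k. k < n \<Longrightarrow> z' k = z k" by (auto simp: z'_def)
  then have "rwalk x z' n = rwalk x z n" "rwalk x' z' n = rwalk x' z n"
    by (auto intro: rwalk_cong)
  with z z' step(2) show ?case by (intro exI[of _ z'] exI[of _ "Suc n"]) (auto simp: less_Suc_eq)
qed

text \<open>Positive recurrence enters in one form: finite mean return times of each coordinate from
  0 to every neighbourhood of 0.\<close>

locale refl_setting = joint_walk \<mu>
  for \<mu> :: "((real ^ 'r) \<times> (real ^ 's)) measure" +
  fixes I :: "'r set"
  assumes integer: "i \<in> I \<Longrightarrow> integer_aperiodic (cm i)"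
    and nonlattice: "i \<notin> I \<Longrightarrow> non_lattice (cm i)"
    and positive: "emeasure (cm i) {0<..} > 0"
    and returns: "a > 0 \<Longrightarrow> (\<integral>\<^sup>+ \<omega>. return_time (\<lambda>n. X1 i 0 n \<omega>) {..<a} \<partial>S) < \<infinity>"
begin

lemma AE_integer: "AE y in \<mu>. \<forall>i\<in>I. fst y $ i \<in> \<int>"
  using integer AE_cm_support unfolding integer_aperiodic_def
  by (intro eventually_ball_finite ballI) (fastforce elim!: eventually_mono)+

lemma AE_integers: "AE \<omega> in S. \<forall>k. \<forall>i\<in>I. fst (\<omega> k) $ i \<in> \<int>"
  unfolding AE_all_countable
proof
  fix k
  show "AE \<omega> in S. \<forall>i\<in>I. fst (\<omega> k) $ i \<in> \<int>"
    by (rule AE_component[where i = k, OF _ AE_integer]) simp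
qed

lemma paired_walk:
  assumes "(x, x') \<in> paired I i" "\<forall>k. \<forall>i\<in>I. fst (\<omega> k) $ i \<in> \<int>"
  shows "(X1 i x n \<omega>, X1 i x' n \<omega>) \<in> paired I i"
  using assms(1) by (induction n) (use assms(2) in \<open>auto intro!: paired_step\<close>)

text \<open>The deterministic orbit of the pair comes close to the diagonal after finitely many
  steps, and the random increments shadow these steps with positive probability.\<close>

lemma pair_contraction_possible:
  assumes "(x, x') \<in> paired I i" "\<epsilon> > 0"
  shows "\<exists>n. measure S {\<omega>. \<bar>X1 i x n \<omega> - X1 i x' n \<omega>\<bar> < \<epsilon>} > 0"
proof -
  let ?T = "measure_support (cm i)"
  obtain y0 where y0: "y0 > 0" "y0 \<in> ?T" by (rule support_positive[OF positive])
  have "\<exists>(a, b) \<in> pair_orbit ?T x x'. \<bar>a - b\<bar> < \<epsilon> / 2"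
  proof (rule pair_orbit_distance[OF y0(2,1) closed_paired assms(1)])
    show "(\<bar>a - y\<bar>, \<bar>b - y\<bar>) \<in> paired I i" if "(a, b) \<in> paired I i" "y \<in> ?T" for a b y
      using that integer[of i] by (intro paired_step) (auto simp: integer_aperiodic_def)
    show "0 \<le> a \<and> 0 \<le> b" if "(a, b) \<in> paired I i" for a b using that by (simp add: paired_def)
    show "\<exists>g\<in>group_closure ?T. \<bar>(a + b) / 2 + g\<bar> < \<delta>" if "(a, b) \<in> paired I i" "\<delta> > 0" for a b \<delta>
    proof (cases "i \<in> I")
      case True
      with that integer[OF True] show ?thesis
        by (intro Gcd_1_group_closure_dense[OF y0(2,1)]) (auto simp: integer_aperiodic_def paired_def)
    next
      case False
      with that nonlattice[OF False] show ?thesis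
        by (intro non_lattice_group_closure_dense[OF y0(2,1)]) (auto simp: non_lattice_def)
    qed
  qed (use assms(2) in simp)
  then obtain a b where ab: "(a, b) \<in> pair_orbit ?T x x'" "\<bar>a - b\<bar> < \<epsilon> / 2" by blast
  then obtain y n where y: "\<forall>k<n. y k \<in> ?T" "a = rwalk x y n" "b = rwalk x' y n"
    using pair_orbit_rwalk by blast
  \<comment> \<open>Errors below \<eta> in \<open>n\<close> increments displace each copy by at most
    \<epsilon>/4, which is added twice to the \<epsilon>/2 of the deterministic pair; n + 1 covers
    the empty path.\<close>
  define \<eta> where "\<eta> = \<epsilon> / (4 * (real n + 1))"
  have \<eta>: "\<eta> > 0" "real n * \<eta> \<le> \<epsilon> / 4"
    using assms(2) by (auto simp: \<eta>_def field_simps)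
  have close: "\<bar>X1 i x n \<omega> - X1 i x' n \<omega>\<bar> < \<epsilon>" if w: "\<forall>k<n. \<bar>fst (\<omega> k) $ i - y k\<bar> < \<eta>" for \<omega>
  proof -
    have "(\<Sum>k<n. \<bar>fst (\<omega> k) $ i - y k\<bar>) \<le> (\<Sum>k<n. \<eta>)" using w by (intro sum_mono) (auto intro: less_imp_le)
    then have "(\<Sum>k<n. \<bar>fst (\<omega> k) $ i - y k\<bar>) \<le> \<epsilon> / 4" using \<eta> by simp
    then have "\<bar>X1 i x n \<omega> - a\<bar> \<le> \<epsilon> / 4" "\<bar>X1 i x' n \<omega> - b\<bar> \<le> \<epsilon> / 4"
      using rwalk_diff_le[of x "\<lambda>k. fst (\<omega> k) $ i" n x y] rwalk_diff_le[of x' "\<lambda>k. fst (\<omega> k) $ i" n x' y] y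
      by auto
    with ab(2) show ?thesis by linarith
  qed
  have "0 < measure S {\<omega>. \<forall>k<n. \<bar>fst (\<omega> k) $ i - y k\<bar> < \<eta>}"
    using y(1) \<eta>(1) by (intro prob_near_support) auto
  also have "\<dots> \<le> measure S {\<omega>. \<bar>X1 i x n \<omega> - X1 i x' n \<omega>\<bar> < \<epsilon>}"
    by (rule prob_mono[OF _ close]) measurable
  finally show ?thesis by blast
qed

text \<open>Distances decrease along the walk, so the waiting times of a finite net of starting
  pairs may be replaced by their maximum, and the minimum of finitely many positive probabilities is
  positive.\<close>

lemma pair_contraction_uniform:
  assumes "\<epsilon> > 0"
  obtains N p where "0 < p" "p \<le> 1"
    "\<And>x x'. (x, x') \<in> paired I i \<Longrightarrow> x \<le> R \<Longrightarrow> x' \<le> R \<Longrightarrow>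
       p \<le> measure S {\<omega>. \<bar>X1 i x N \<omega> - X1 i x' N \<omega>\<bar> < \<epsilon>}"
proof -
  define K where "K = paired I i \<inter> ({0..R} \<times> {0..R})"
  have "compact K" unfolding K_def
    by (intro closed_Int_compact compact_Times closed_paired) auto
  define D where "D q n \<omega> = \<bar>X1 i (fst q) n \<omega> - X1 i (snd q) n \<omega>\<bar>" for q n \<omega>
  have "\<forall>q\<in>K. \<exists>n. measure S {\<omega>. D q n \<omega> < \<epsilon> / 2} > 0"
    using pair_contraction_possible[of _ _ i "\<epsilon> / 2"] assms by (auto simp: K_def D_def)
  then obtain n where n: "\<And>q. q \<in> K \<Longrightarrow> measure S {\<omega>. D q (n q) \<omega> < \<epsilon> / 2} > 0" by metis
  \<comment> \<open>Moving both starting points by less than \<epsilon>/8 changes the distance at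
    any time by less than \<epsilon>/4; added to \<epsilon>/2 this stays below \<epsilon>.\<close>
  obtain C where C: "C \<subseteq> K" "finite C" "K \<subseteq> (\<Union>q\<in>C. ball q (\<epsilon> / 8))"
    by (rule compactE_image[OF \<open>compact K\<close>, of K "\<lambda>q. ball q (\<epsilon> / 8)"]) (use assms in auto)
  define N where "N = Max (insert 0 (n ` C))"
  define p where "p = Min (insert 1 ((\<lambda>q. measure S {\<omega>. D q (n q) \<omega> < \<epsilon> / 2}) ` C))"
  show thesis
  proof
    show "0 < p" unfolding p_def using C n by (subst Min_gr_iff) auto
    show "p \<le> 1" unfolding p_def using C by (intro Min_le) auto
    fix x x' assume "(x, x') \<in> paired I i" "x \<le> R" "x' \<le> R"
    then have "(x, x') \<in> K" by (auto simp: K_def paired_def)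
    with C(3) obtain q where q: "q \<in> C" "dist q (x, x') < \<epsilon> / 8" by auto
    have qx: "\<bar>x - fst q\<bar> < \<epsilon> / 8" "\<bar>x' - snd q\<bar> < \<epsilon> / 8"
      using q(2) dist_fst_le[of q "(x, x')"] dist_snd_le[of q "(x, x')"]
      by (simp_all only: dist_real_def abs_minus_commute[of x] abs_minus_commute[of x'] fst_conv snd_conv)
    have close: "\<bar>X1 i x N \<omega> - X1 i x' N \<omega>\<bar> < \<epsilon>" if "D q (n q) \<omega> < \<epsilon> / 2" for \<omega>
    proof -
      have "n q \<le> N" unfolding N_def using C q by (intro Max_ge) auto
      then have "\<bar>X1 i x N \<omega> - X1 i x' N \<omega>\<bar> \<le> \<bar>X1 i x (n q) \<omega> - X1 i x' (n q) \<omega>\<bar>"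
        by (rule rwalk_diff_antimono_real)
      moreover have "\<bar>X1 i x (n q) \<omega> - X1 i (fst q) (n q) \<omega>\<bar> < \<epsilon> / 8" "\<bar>X1 i x' (n q) \<omega> - X1 i (snd q) (n q) \<omega>\<bar> < \<epsilon> / 8"
        by (rule le_less_trans[OF rwalk_nonexpansive_real qx(1)], rule le_less_trans[OF rwalk_nonexpansive_real qx(2)])
      ultimately show ?thesis using that \<open>\<epsilon> > 0\<close> unfolding D_def by arith
    qed
    have "p \<le> measure S {\<omega>. D q (n q) \<omega> < \<epsilon> / 2}" unfolding p_def using C q by (intro Min_le) auto
    also have "\<dots> \<le> measure S {\<omega>. \<bar>X1 i x N \<omega> - X1 i x' N \<omega>\<bar> < \<epsilon>}"
      by (rule prob_mono[OF _ close]) measurable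
    finally show "p \<le> measure S {\<omega>. \<bar>X1 i x N \<omega> - X1 i x' N \<omega>\<bar> < \<epsilon>}" .
  qed
qed

lemma coordinate_tight:
  assumes "\<delta> > 0"
  shows "\<exists>R. \<forall>n. measure S {\<omega>. X1 i 0 n \<omega> > R} \<le> \<delta>"
proof (rule X1_tight[where i = i and \<delta> = \<delta>])
  show "(\<integral>\<^sup>+ \<omega>. return_time (\<lambda>n. X1 i 0 n \<omega>) {..<a} \<partial>S) < \<infinity>" if "a > 0" for a
    using that by (rule returns)
qed (use positive assms in blast)+

text \<open>Time is cut into blocks of length \<open>N\<close>. Unless a copy is outside the box of
  size \<open>R1 + R\<close>, which tightness makes unlikely, each block brings a distant pair
  together with probability at least \<open>p\<close>; a pair once closer than \<epsilon> stays
  so.\<close>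

lemma X1_contraction:
  assumes "\<epsilon> > 0" "\<delta> > 0"
  obtains n0 where "\<And>n x x'. n \<ge> n0 \<Longrightarrow> (x, x') \<in> paired I i \<Longrightarrow> x \<le> R \<Longrightarrow> x' \<le> R \<Longrightarrow>
    measure S {\<omega>. \<bar>X1 i x n \<omega> - X1 i x' n \<omega>\<bar> \<ge> \<epsilon>} \<le> \<delta>"
proof -
  \<comment> \<open>A quarter of \<delta> for each copy and each block suffices. A start in [0, R]
    stays within \<open>R\<close> of the copy from 0, hence the box of size
    \<open>R1 + R\<close>.\<close>
  obtain R1 where R1: "\<And>n. measure S {\<omega>. X1 i 0 n \<omega> > R1} \<le> \<delta> / 4"
    using coordinate_tight[of "\<delta> / 4" i] assms(2) by auto
  obtain N p where Np: "0 < p" "p \<le> 1"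
    "\<And>x x'. (x, x') \<in> paired I i \<Longrightarrow> x \<le> R1 + R \<Longrightarrow> x' \<le> R1 + R \<Longrightarrow>
       p \<le> measure S {\<omega>. \<bar>X1 i x N \<omega> - X1 i x' N \<omega>\<bar> < \<epsilon>}"
    by (rule pair_contraction_uniform[OF assms(1), where i = i and R = "R1 + R"]) (rule that; blast)
  have tight: "measure S {\<omega>. X1 i x n \<omega> > R1 + R} \<le> \<delta> / 4" if "0 \<le> x" "x \<le> R" for x n
  proof -
    have "X1 i 0 n \<omega> > R1" if "X1 i x n \<omega> > R1 + R" for \<omega>
      using that \<open>x \<le> R\<close> \<open>0 \<le> x\<close> rwalk_nonexpansive_real[of x "\<lambda>k. fst (\<omega> k) $ i" n 0] by auto
    then have "measure S {\<omega>. X1 i x n \<omega> > R1 + R} \<le> measure S {\<omega>. X1 i 0 n \<omega> > R1}"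
      by (intro prob_mono) measurable
    with R1[of n] show ?thesis by simp
  qed
  have iterate: "measure S {\<omega>. \<bar>X1 i x (k * N) \<omega> - X1 i x' (k * N) \<omega>\<bar> \<ge> \<epsilon>} \<le> (1 - p) ^ k + \<delta> / 2"
    if xx: "(x, x') \<in> paired I i" "x \<le> R" "x' \<le> R" for x x' k
  proof (induction k)
    case 0
    have "measure S {\<omega>. \<bar>X1 i x (0 * N) \<omega> - X1 i x' (0 * N) \<omega>\<bar> \<ge> \<epsilon>} \<le> 1" by (rule P.prob_le_1)
    also have "1 \<le> (1 - p) ^ 0 + \<delta> / 2" using assms(2) by simp
    finally show ?case .
  next
    case (Suc k)
    define D where "D n \<omega> = \<bar>X1 i x n \<omega> - X1 i x' n \<omega>\<bar>" for n \<omega>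
    have [measurable]: "D n \<in> borel_measurable S" for n unfolding D_def by measurable
    define G where "G \<omega> \<longleftrightarrow> (X1 i x (k * N) \<omega>, X1 i x' (k * N) \<omega>) \<in> paired I i \<and>
      X1 i x (k * N) \<omega> \<le> R1 + R \<and> X1 i x' (k * N) \<omega> \<le> R1 + R" for \<omega>
    have [measurable]: "Measurable.pred S G"
      unfolding G_def by measurable
    have G_bad: "measure S {\<omega>. \<not> G \<omega>} \<le> \<delta> / 2"
    proof -
      have "AE \<omega> in S. \<not> G \<omega> \<longrightarrow> X1 i x (k * N) \<omega> > R1 + R \<or> X1 i x' (k * N) \<omega> > R1 + R"
        using AE_integers by eventually_elim (auto simp: G_def not_le paired_walk xx)
      then have "measure S {\<omega>. \<not> G \<omega>} \<le> measure S {\<omega>. X1 i x (k * N) \<omega> > R1 + R \<or> X1 i x' (k * N) \<omega> > R1 + R}"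
        by (intro prob_mono_AE) measurable
      also have "\<dots> \<le> measure S {\<omega>. X1 i x (k * N) \<omega> > R1 + R} + measure S {\<omega>. X1 i x' (k * N) \<omega> > R1 + R}"
        by (rule prob_disj_le) measurable
      also have "\<dots> \<le> \<delta> / 4 + \<delta> / 4" using xx by (intro add_mono tight) (auto simp: paired_def)
      finally show ?thesis by simp
    qed
    define A where "A = measure S {\<omega>. D (k * N) \<omega> \<ge> \<epsilon>}"
    define B where "B = measure S {\<omega>. D (k * N) \<omega> \<ge> \<epsilon> \<and> G \<omega>}"
    have B: "B \<ge> A - \<delta> / 2"
      using prob_conj_ge[of "\<lambda>\<omega>. D (k * N) \<omega> \<ge> \<epsilon>" G] G_bad by (simp add: A_def B_def)
    have split: "A = B + measure S {\<omega>. D (k * N) \<omega> \<ge> \<epsilon> \<and> \<not> G \<omega>}"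
    proof -
      have "A = measure S ({\<omega>. D (k * N) \<omega> \<ge> \<epsilon> \<and> G \<omega>} \<union> {\<omega>. D (k * N) \<omega> \<ge> \<epsilon> \<and> \<not> G \<omega>})"
        unfolding A_def by (rule arg_cong[where f = "measure S"]) auto
      also have "\<dots> = B + measure S {\<omega>. D (k * N) \<omega> \<ge> \<epsilon> \<and> \<not> G \<omega>}"
        unfolding B_def by (rule P.finite_measure_Union) (auto intro!: sets_Collect_S)
      finally show ?thesis .
    qed
    have Dmono: "D (Suc k * N) \<omega> \<le> D (k * N) \<omega>" for \<omega>
      unfolding D_def by (rule rwalk_diff_antimono_real) simp
    have 1: "measure S {\<omega>. (D (k * N) \<omega> \<ge> \<epsilon> \<and> G \<omega>) \<and> D (k * N + N) \<omega> \<ge> \<epsilon>} \<le> (1 - p) * B"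
      unfolding B_def
    proof (rule prob_comb_le[where k = "k * N"])
      fix \<omega> \<omega>'
      show "(D (k * N) (comb_seq (k * N) \<omega> \<omega>') \<ge> \<epsilon> \<and> G (comb_seq (k * N) \<omega> \<omega>')) = (D (k * N) \<omega> \<ge> \<epsilon> \<and> G \<omega>)"
        by (simp add: D_def G_def X1_comb_le)
    next
      fix \<omega> assume "D (k * N) \<omega> \<ge> \<epsilon> \<and> G \<omega>"
      then have "p \<le> measure S {\<omega>'. \<bar>X1 i (X1 i x (k * N) \<omega>) N \<omega>' - X1 i (X1 i x' (k * N) \<omega>) N \<omega>'\<bar> < \<epsilon>}"
        by (intro Np) (auto simp: G_def)
      also have "\<dots> = 1 - measure S {\<omega>'. \<not> \<bar>X1 i (X1 i x (k * N) \<omega>) N \<omega>' - X1 i (X1 i x' (k * N) \<omega>) N \<omega>'\<bar> < \<epsilon>}"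
        by (subst prob_not) simp_all
      finally show "measure S {\<omega>'. \<epsilon> \<le> D (k * N + N) (comb_seq (k * N) \<omega> \<omega>')} \<le> 1 - p"
        by (simp add: D_def X1_comb not_less)
    qed (use Np in auto)
    have "measure S {\<omega>. D (Suc k * N) \<omega> \<ge> \<epsilon>}
      \<le> measure S {\<omega>. ((D (k * N) \<omega> \<ge> \<epsilon> \<and> G \<omega>) \<and> D (k * N + N) \<omega> \<ge> \<epsilon>) \<or> (D (k * N) \<omega> \<ge> \<epsilon> \<and> \<not> G \<omega>)}"
      by (rule prob_mono) (measurable, use Dmono order_trans in \<open>auto simp: add.commute\<close>)
    also have "\<dots> \<le> measure S {\<omega>. (D (k * N) \<omega> \<ge> \<epsilon> \<and> G \<omega>) \<and> D (k * N + N) \<omega> \<ge> \<epsilon>} + measure S {\<omega>. D (k * N) \<omega> \<ge> \<epsilon> \<and> \<not> G \<omega>}"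
      by (rule prob_disj_le) measurable
    also have "\<dots> \<le> (1 - p) * B + (A - B)" using 1 split by simp
    also have "\<dots> = A - p * B" by (simp add: algebra_simps)
    also have "\<dots> \<le> A - p * (A - \<delta> / 2)" using B Np(1) by (intro diff_left_mono mult_left_mono) auto
    \<comment> \<open>The map A -> (1 - p) A + p \<delta>/2 has the fixed point \<delta>/2: the
      errors of the single blocks do not accumulate.\<close>
    also have "\<dots> = (1 - p) * A + p * (\<delta> / 2)" by (simp add: algebra_simps)
    also have "\<dots> \<le> (1 - p) * ((1 - p) ^ k + \<delta> / 2) + p * (\<delta> / 2)"
      using Suc.IH Np(2) by (intro add_right_mono mult_left_mono) (auto simp: A_def D_def)
    also have "\<dots> = (1 - p) ^ Suc k + \<delta> / 2" by (simp add: field_simps)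
    finally show ?case by (simp only: D_def)
  qed
  have "(\<lambda>k. (1 - p) ^ k) \<longlonglongrightarrow> 0" using Np by (intro LIMSEQ_power_zero) auto
  from order_tendstoD(2)[OF this, of "\<delta> / 2"] assms(2) obtain k where k: "(1 - p) ^ k < \<delta> / 2"
    by (auto simp: eventually_sequentially)
  show thesis
  proof (rule that[of "k * N"])
    fix n x x' assume *: "n \<ge> k * N" "(x, x') \<in> paired I i" "x \<le> R" "x' \<le> R"
    have "measure S {\<omega>. \<bar>X1 i x n \<omega> - X1 i x' n \<omega>\<bar> \<ge> \<epsilon>} \<le> measure S {\<omega>. \<bar>X1 i x (k * N) \<omega> - X1 i x' (k * N) \<omega>\<bar> \<ge> \<epsilon>}"
      by (rule prob_mono) (measurable, erule order_trans[OF _ rwalk_diff_antimono_real[OF *(1)]])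
    with iterate[OF *(2-4), of k] k show "measure S {\<omega>. \<bar>X1 i x n \<omega> - X1 i x' n \<omega>\<bar> \<ge> \<epsilon>} \<le> \<delta>" by simp
  qed
qed

end

section \<open>Parity classes\<close>

instance bit :: finite
proof
  have "(UNIV :: bit set) = {0, 1}" by (auto intro: bit.exhaust)
  then show "finite (UNIV :: bit set)" by (metis finite.emptyI finite.insertI)
qed

lemma of_int_bit_eq_0_iff: "(of_int k :: bit) = 0 \<longleftrightarrow> even k"
proof (cases "even k")
  case True
  then obtain m where "k = 2 * m" by (elim evenE)
  then show ?thesis by simp
next
  case False
  then obtain m where "k = 2 * m + 1" by (elim oddE)
  then show ?thesis by simp
qed

lemma add_self_bit_vec [simp]: "(g :: bit ^ 'r) + g = 0"
  by (simp add: vec_eq_iff)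

lemma minus_bit_vec: "(g :: bit ^ 'r) - h = g + h"
  by (simp add: vec_eq_iff)

lemma add_add_bit_vec [simp]: "(g :: bit ^ 'r) + h + h = g"
  by (simp add: add.assoc)

lemma mem_state_space_iff: "x \<in> state_space I \<longleftrightarrow> (\<forall>i. 0 \<le> x $ i \<and> (i \<in> I \<longrightarrow> x $ i \<in> \<int>))"
  unfolding state_space_def coord_space_def
  by (auto simp: Nats_altdef2 split: if_splits)

text \<open>The fibre over a single parity vector. Contraction acts inside one fibre, whereas a
  coset space is a union of fibres between which the walk moves.\<close>

definition parity_class :: "'r set \<Rightarrow> bit ^ 'r \<Rightarrow> (real ^ 'r) set"
  where "parity_class I h = {x \<in> state_space I. parity I x = h}"

text \<open>A standard starting point in each fibre, bounded independently of
  \<open>h\<close>.\<close>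

definition parity_rep :: "bit ^ 'r \<Rightarrow> real ^ 'r"
  where "parity_rep h = (\<chi> i. if h $ i = 0 then 0 else 1)"

lemma parity_in_group: "parity I x \<in> parity_group I"
  by (simp add: parity_group_def parity_def)

lemma parity_group_add: "g \<in> parity_group I \<Longrightarrow> h \<in> parity_group I \<Longrightarrow> g + h \<in> parity_group I"
  by (simp add: parity_group_def)

lemma parity_rep_in_class: "h \<in> parity_group I \<Longrightarrow> parity_rep h \<in> parity_class I h"
  by (auto simp: parity_class_def mem_state_space_iff parity_rep_def parity_def parity_group_def vec_eq_iff)

lemma half_sum_Ints_iff:
  assumes "a \<in> \<int>" "b \<in> \<int>"
  shows "(a + b) / 2 \<in> (\<int> :: real set) \<longleftrightarrow> (of_int \<lfloor>a\<rfloor> :: bit) = of_int \<lfloor>b\<rfloor>"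
proof -
  obtain k l :: int where kl: "a = k" "b = l" using assms by (auto elim!: Ints_cases)
  have "(real_of_int k + real_of_int l) / 2 \<in> \<int> \<longleftrightarrow> even (k + l)"
  proof
    assume "(real_of_int k + real_of_int l) / 2 \<in> \<int>"
    then obtain m :: int where "(real_of_int k + real_of_int l) / 2 = m" by (auto elim: Ints_cases)
    then have "real_of_int (k + l) = real_of_int (2 * m)" by simp
    then have "k + l = 2 * m" by (simp only: of_int_eq_iff)
    then show "even (k + l)" by simp
  next
    assume "even (k + l)"
    then obtain m where "k + l = 2 * m" by (elim evenE)
    then have "real_of_int k + real_of_int l = 2 * real_of_int m" by (metis of_int_add of_int_mult of_int_numeral)
    then show "(real_of_int k + real_of_int l) / 2 \<in> \<int>" by simp
  qed
  also have "even (k + l) \<longleftrightarrow> (of_int (k - l) :: bit) = 0" by (subst of_int_bit_eq_0_iff) simp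
  also have "\<dots> \<longleftrightarrow> (of_int k :: bit) = of_int l" by (simp only: of_int_diff right_minus_eq)
  finally show ?thesis by (simp add: kl)
qed

lemma parity_class_paired:
  assumes "x \<in> parity_class I h" "x' \<in> parity_class I h"
  shows "(x $ i, x' $ i) \<in> paired I i"
proof -
  have *: "x \<in> state_space I" "x' \<in> state_space I" "parity I x $ i = parity I x' $ i"
    using assms by (auto simp: parity_class_def)
  then have "i \<in> I \<Longrightarrow> (of_int \<lfloor>x $ i\<rfloor> :: bit) = of_int \<lfloor>x' $ i\<rfloor>" by (simp add: parity_def)
  with *(1,2) show ?thesis
    using half_sum_Ints_iff[of "x $ i" "x' $ i"] by (auto simp: paired_def mem_state_space_iff)
qed

text \<open>The floor in \<open>parity\<close> is discontinuous; comparison with one fixed point of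
  the fibre expresses membership through the closed set \<open>paired\<close>, and so shows that
  fibres are closed.\<close>

lemma parity_class_eq:
  assumes "h \<in> parity_group I"
  shows "parity_class I h = {x. \<forall>i. (x $ i, parity_rep h $ i) \<in> paired I i}"
proof (intro set_eqI iffI)
  fix x assume "x \<in> parity_class I h"
  then show "x \<in> {x. \<forall>i. (x $ i, parity_rep h $ i) \<in> paired I i}"
    using parity_class_paired parity_rep_in_class[OF assms] by blast
next
  fix x assume "x \<in> {x. \<forall>i. (x $ i, parity_rep h $ i) \<in> paired I i}"
  then have x: "\<And>i. (x $ i, parity_rep h $ i) \<in> paired I i" by simp
  then have ss: "x \<in> state_space I" by (auto simp: mem_state_space_iff paired_def)
  have "parity I x $ i = parity I (parity_rep h) $ i" for i
    using x[of i] half_sum_Ints_iff[of "x $ i" "parity_rep h $ i"] by (auto simp: paired_def parity_def)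
  then have "parity I x = parity I (parity_rep h)" by (simp add: vec_eq_iff)
  with ss parity_rep_in_class[OF assms] show "x \<in> parity_class I h" by (simp add: parity_class_def)
qed

lemma closed_parity_class:
  assumes "h \<in> parity_group I"
  shows "closed (parity_class I h)"
proof -
  have "closed {x. (x $ i, parity_rep h $ i) \<in> paired I i}" for i
    using closed_vimage[OF closed_paired, of "\<lambda>x. (x $ i, parity_rep h $ i)" I i]
    by (simp add: vimage_def continuous_intros)
  then show ?thesis unfolding parity_class_eq[OF assms] by (rule closed_Collect_all)
qed

text \<open>Modulo 2 neither the sign of the increment nor the absolute value matters, so the parity
  vector moves by addition.\<close>

lemma parity_step:
  assumes "x \<in> state_space I" "\<forall>i\<in>I. y $ i \<in> \<int>"
  shows "\<bar>x - y\<bar> \<in> parity_class I (parity I x + parity I y)"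
proof -
  have "\<bar>x - y\<bar> \<in> state_space I"
    using assms by (auto simp: mem_state_space_iff abs_vec_def)
  moreover have "parity I \<bar>x - y\<bar> $ i = (parity I x + parity I y) $ i" for i
  proof (cases "i \<in> I")
    case True
    then have "x $ i \<in> \<int>" "y $ i \<in> \<int>" using assms by (auto simp: mem_state_space_iff)
    then obtain k l :: int where kl: "x $ i = k" "y $ i = l" by (auto elim!: Ints_cases)
    have "\<lfloor>\<bar>x - y\<bar> $ i\<rfloor> = \<bar>k - l\<bar>" by (simp add: abs_vec_def kl flip: of_int_diff of_int_abs)
    moreover have "(of_int \<bar>k - l\<bar> :: bit) = of_int k + of_int l"
      by (cases "k \<ge> l") auto
    ultimately show ?thesis using True by (simp add: parity_def kl)
  qed (simp add: parity_def)
  ultimately show ?thesis by (simp add: parity_class_def vec_eq_iff)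
qed

lemma measurable_parity [measurable]:
  fixes I :: "'r::finite set"
  shows "parity I \<in> measurable borel (count_space UNIV)"
proof (rule measurable_count_space_eq2[THEN iffD2, OF finite], intro conjI ballI)
  fix h :: "bit ^ 'r"
  have [measurable]: "Measurable.pred borel (\<lambda>x :: real ^ 'r. (of_int \<lfloor>x $ i\<rfloor> :: bit) = c)" for i c
  proof -
    have "(\<lambda>x :: real ^ 'r. \<lfloor>x $ i\<rfloor>) \<in> measurable borel (count_space UNIV)" by measurable
    then show ?thesis by measurable
  qed
  have "parity I -` {h} \<inter> space borel = {x \<in> space borel. \<forall>i. (if i \<in> I then of_int \<lfloor>x $ i\<rfloor> else 0) = h $ i}"
    by (auto simp: parity_def vec_eq_iff)
  also have "\<dots> \<in> sets borel" by measurable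
  finally show "parity I -` {h} \<inter> space borel \<in> sets borel" .
qed simp

context refl_setting
begin

lemma X_tight:
  assumes "\<delta> > 0"
  shows "\<exists>R. \<forall>n. measure S {\<omega>. norm (X 0 n \<omega>) > R} \<le> \<delta>"
proof -
  define c where "c = real CARD('r)"
  have c: "c > 0" by (simp add: c_def)
  have "\<forall>i. \<exists>R. \<forall>n. measure S {\<omega>. X1 i 0 n \<omega> > R} \<le> \<delta> / c"
    using coordinate_tight[of "\<delta> / c"] assms c by simp
  then obtain R where R: "\<And>i n. measure S {\<omega>. X1 i 0 n \<omega> > R i} \<le> \<delta> / c" by metis
  have "measure S {\<omega>. norm (X 0 n \<omega>) > (\<Sum>i\<in>UNIV. R i)} \<le> \<delta>" for n
  proof -
    have "\<exists>i\<in>UNIV. X1 i 0 n \<omega> > R i" if "norm (X 0 n \<omega>) > (\<Sum>i\<in>UNIV. R i)" for \<omega>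
    proof (rule ccontr)
      assume "\<not> ?thesis"
      then have "(\<Sum>i\<in>UNIV. \<bar>X 0 n \<omega> $ i\<bar>) \<le> (\<Sum>i\<in>UNIV. R i)"
        by (intro sum_mono) (auto simp: rwalk_nth not_less rwalk_nonneg)
      with norm_le_l1_cart[of "X 0 n \<omega>"] that show False by linarith
    qed
    then have "measure S {\<omega>. norm (X 0 n \<omega>) > (\<Sum>i\<in>UNIV. R i)} \<le> measure S {\<omega>. \<exists>i\<in>UNIV. X1 i 0 n \<omega> > R i}"
      by (intro prob_mono) measurable
    also have "\<dots> = measure S (\<Union>i\<in>UNIV. {\<omega>. X1 i 0 n \<omega> > R i})"
      by (rule arg_cong[where f = "measure S"]) auto
    also have "\<dots> \<le> (\<Sum>i\<in>UNIV. measure S {\<omega>. X1 i 0 n \<omega> > R i})"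
      by (rule measure_UNION_le) (simp, rule sets_Collect_S, measurable)
    also have "\<dots> \<le> (\<Sum>i\<in>(UNIV :: 'r set). \<delta> / c)" by (intro sum_mono R)
    also have "\<dots> = \<delta>" using c by (simp add: c_def)
    finally show ?thesis .
  qed
  then show ?thesis by blast
qed

lemma X_tight':
  assumes "\<delta> > 0"
  shows "\<exists>R. \<forall>n x. norm x \<le> R0 \<longrightarrow> measure S {\<omega>. norm (X x n \<omega>) > R} \<le> \<delta>"
proof -
  obtain R where R: "\<And>n. measure S {\<omega>. norm (X 0 n \<omega>) > R} \<le> \<delta>" using X_tight[OF assms] by blast
  have "measure S {\<omega>. norm (X x n \<omega>) > R + R0} \<le> \<delta>" if "norm x \<le> R0" for n x
  proof -
    have "norm (X 0 n \<omega>) > R" if "norm (X x n \<omega>) > R + R0" for \<omega>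
      using that \<open>norm x \<le> R0\<close> rwalk_nonexpansive[of x "\<lambda>k. fst (\<omega> k)" n 0]
        norm_triangle_ineq2[of "X x n \<omega>" "X 0 n \<omega>"] by simp
    then have "measure S {\<omega>. norm (X x n \<omega>) > R + R0} \<le> measure S {\<omega>. norm (X 0 n \<omega>) > R}"
      by (intro prob_mono) measurable
    with R[of n] show ?thesis by simp
  qed
  then show ?thesis by blast
qed

text \<open>A distance of at least \<epsilon> forces a distance of at least \<epsilon>/c in one of
  the c coordinates, and a union bound over the coordinates suffices: their dependence never
  matters.\<close>

lemma X_contraction:
  assumes "\<epsilon> > 0" "\<delta> > 0"
  shows "\<exists>n0. \<forall>n\<ge>n0. \<forall>x x' h. x \<in> parity_class I h \<longrightarrow> x' \<in> parity_class I h \<longrightarrow> norm x \<le> R \<longrightarrow> norm x' \<le> R \<longrightarrow>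
    measure S {\<omega>. norm (X x n \<omega> - X x' n \<omega>) \<ge> \<epsilon>} \<le> \<delta>"
proof -
  define c where "c = real CARD('r)"
  have c: "c > 0" by (simp add: c_def)
  have ec: "\<epsilon> / c > 0" "\<delta> / c > 0" using assms c by auto
  have "\<exists>n0. \<forall>n\<ge>n0. \<forall>x x'. (x, x') \<in> paired I i \<longrightarrow> x \<le> R \<longrightarrow> x' \<le> R \<longrightarrow>
    measure S {\<omega>. \<bar>X1 i x n \<omega> - X1 i x' n \<omega>\<bar> \<ge> \<epsilon> / c} \<le> \<delta> / c" for i
    by (rule X1_contraction[OF ec, where i = i and R = R]) blast
  then have "\<forall>i. \<exists>n0. \<forall>n\<ge>n0. \<forall>x x'. (x, x') \<in> paired I i \<longrightarrow> x \<le> R \<longrightarrow> x' \<le> R \<longrightarrow>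
    measure S {\<omega>. \<bar>X1 i x n \<omega> - X1 i x' n \<omega>\<bar> \<ge> \<epsilon> / c} \<le> \<delta> / c" ..
  from choice[OF this] obtain n0 where n0: "\<forall>i. \<forall>n\<ge>n0 i. \<forall>x x'. (x, x') \<in> paired I i \<longrightarrow> x \<le> R \<longrightarrow> x' \<le> R \<longrightarrow>
    measure S {\<omega>. \<bar>X1 i x n \<omega> - X1 i x' n \<omega>\<bar> \<ge> \<epsilon> / c} \<le> \<delta> / c" ..
  have "measure S {\<omega>. norm (X x n \<omega> - X x' n \<omega>) \<ge> \<epsilon>} \<le> \<delta>"
    if n: "n \<ge> Max (range n0)" and xx: "x \<in> parity_class I h" "x' \<in> parity_class I h" "norm x \<le> R" "norm x' \<le> R" for n x x' h
  proof -
    have "\<exists>i\<in>UNIV. \<bar>X1 i (x $ i) n \<omega> - X1 i (x' $ i) n \<omega>\<bar> \<ge> \<epsilon> / c" if "norm (X x n \<omega> - X x' n \<omega>) \<ge> \<epsilon>" for \<omega>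
    proof (rule ccontr)
      assume "\<not> ?thesis"
      then have "(\<Sum>i\<in>UNIV. \<bar>(X x n \<omega> - X x' n \<omega>) $ i\<bar>) < (\<Sum>i\<in>(UNIV :: 'r set). \<epsilon> / c)"
        by (intro sum_strict_mono) (auto simp: rwalk_nth not_le)
      also have "\<dots> = \<epsilon>" using c by (simp add: c_def)
      finally show False using norm_le_l1_cart[of "X x n \<omega> - X x' n \<omega>"] that by simp
    qed
    then have "measure S {\<omega>. norm (X x n \<omega> - X x' n \<omega>) \<ge> \<epsilon>}
        \<le> measure S {\<omega>. \<exists>i\<in>UNIV. \<bar>X1 i (x $ i) n \<omega> - X1 i (x' $ i) n \<omega>\<bar> \<ge> \<epsilon> / c}"
      by (intro prob_mono) measurable
    also have "\<dots> = measure S (\<Union>i\<in>UNIV. {\<omega>. \<bar>X1 i (x $ i) n \<omega> - X1 i (x' $ i) n \<omega>\<bar> \<ge> \<epsilon> / c})"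
      by (rule arg_cong[where f = "measure S"]) auto
    also have "\<dots> \<le> (\<Sum>i\<in>UNIV. measure S {\<omega>. \<bar>X1 i (x $ i) n \<omega> - X1 i (x' $ i) n \<omega>\<bar> \<ge> \<epsilon> / c})"
      by (rule measure_UNION_le) (simp, rule sets_Collect_S, measurable)
    also have "\<dots> \<le> (\<Sum>i\<in>(UNIV :: 'r set). \<delta> / c)"
    proof (intro sum_mono n0[rule_format])
      fix i
      show "n0 i \<le> n" using n by (meson Max_ge finite_code finite_imageI order_trans rangeI)
      show "(x $ i, x' $ i) \<in> paired I i" using xx parity_class_paired by blast
      show "x $ i \<le> R" "x' $ i \<le> R"
        using xx component_le_norm_cart[of x i] component_le_norm_cart[of x' i] by auto
    qed
    also have "\<dots> = \<delta>" using c by (simp add: c_def)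
    finally show ?thesis .
  qed
  then show ?thesis by blast
qed

definition par :: "(real ^ 'r) \<times> (real ^ 's) \<Rightarrow> bit ^ 'r" where "par y = parity I (fst y)"

definition ps :: "nat \<Rightarrow> (nat \<Rightarrow> (real ^ 'r) \<times> (real ^ 's)) \<Rightarrow> bit ^ 'r"
  where "ps n \<omega> = (\<Sum>k<n. par (\<omega> k))"

lemma measurable_par [measurable]: "par \<in> measurable \<mu> (count_space UNIV)"
  unfolding par_def by measurable

lemma measurable_par_component [measurable]: "(\<lambda>\<omega>. par (\<omega> k)) \<in> measurable S (count_space UNIV)"
  by (rule measurable_compose[OF _ measurable_par]) simp

lemma measurable_ps [measurable]: "ps n \<in> measurable S (count_space UNIV)"
  unfolding ps_def by (induction n) simp_all

lemma ps_in_group: "ps n \<omega> \<in> parity_group I"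
proof (induction n)
  case 0
  then show ?case by (simp add: ps_def parity_group_def)
next
  case (Suc n)
  then show ?case by (simp add: ps_def par_def parity_group_add parity_in_group)
qed

lemma X_in_class:
  assumes "x \<in> state_space I" "\<forall>k. \<forall>i\<in>I. fst (\<omega> k) $ i \<in> \<int>"
  shows "X x n \<omega> \<in> parity_class I (parity I x + ps n \<omega>)"
proof (induction n)
  case 0
  then show ?case using assms(1) by (simp add: parity_class_def ps_def)
next
  case (Suc n)
  then have "X x n \<omega> \<in> state_space I" "parity I (X x n \<omega>) = parity I x + ps n \<omega>"
    by (auto simp: parity_class_def)
  with parity_step[of "X x n \<omega>" I "fst (\<omega> n)"] assms(2) show ?case
    by (simp add: ps_def par_def add.assoc)
qed

definition \<Gamma> :: "(bit ^ 'r) set" where "\<Gamma> = parity_subgroup (first_marginal \<mu>) I"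

lemma atoms_eq: "emeasure (distr (first_marginal \<mu>) (count_space UNIV) (parity I)) {g} = emeasure \<mu> {y. par y = g}"
proof -
  have "distr (first_marginal \<mu>) (count_space UNIV) (parity I) = distr \<mu> (count_space UNIV) (parity I \<circ> fst)"
    unfolding first_marginal_def by (rule distr_distr) measurable
  also have "parity I \<circ> fst = par" by (auto simp: par_def)
  finally show ?thesis by (simp add: emeasure_distr vimage_def)
qed

lemma atom_in_\<Gamma>: "emeasure \<mu> {y. par y = g} > 0 \<Longrightarrow> g \<in> \<Gamma>"
  unfolding \<Gamma>_def parity_subgroup_def by (rule group_closure.base) (simp add: atoms_eq)

lemma zero_in_\<Gamma>: "0 \<in> \<Gamma>"
  by (simp add: \<Gamma>_def parity_subgroup_def)

lemma \<Gamma>_add: "g \<in> \<Gamma> \<Longrightarrow> h \<in> \<Gamma> \<Longrightarrow> g + h \<in> \<Gamma>"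
  unfolding \<Gamma>_def parity_subgroup_def by (rule group_closure_add)

text \<open>\<open>group_closure\<close> is generated by differences. Every element here is its own
  inverse, so subtraction is addition, and \<Gamma> is exhausted by adding one atom of the parity
  law at a time.\<close>

lemma \<Gamma>_induct:
  assumes "g \<in> \<Gamma>" "Q 0" "\<And>g h. g \<in> \<Gamma> \<Longrightarrow> Q g \<Longrightarrow> emeasure \<mu> {y. par y = h} > 0 \<Longrightarrow> Q (g + h)"
  shows "Q g"
proof -
  have "\<forall>g\<in>\<Gamma>. Q g \<longrightarrow> Q (g + h)" if "h \<in> \<Gamma>" for h
    using that unfolding \<Gamma>_def parity_subgroup_def
  proof (induction rule: group_closure.induct)
    case (base s)
    then show ?case
      using assms(3)[of _ s] by (auto simp: atoms_eq \<Gamma>_def parity_subgroup_def)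
  next
    case (diff s t)
    show ?case
    proof (intro ballI impI)
      fix g assume g: "g \<in> group_closure {g. 0 < emeasure (distr (first_marginal \<mu>) (count_space UNIV) (parity I)) {g}}" "Q g"
      then have "Q (g + s)" using diff.IH by blast
      moreover have "g + s \<in> group_closure {g. 0 < emeasure (distr (first_marginal \<mu>) (count_space UNIV) (parity I)) {g}}"
        using g(1) diff.hyps(1) by (rule group_closure_add)
      ultimately have "Q (g + s + t)" using diff.IH by blast
      then show "Q (g + (s - t))" by (simp add: minus_bit_vec add.assoc)
    qed
  qed
  from this[OF assms(1)] zero_in_\<Gamma> assms(2) show ?thesis by fastforce
qed

lemma \<Gamma>_subset: "\<Gamma> \<subseteq> parity_group I"
proof
  fix g assume "g \<in> \<Gamma>"
  then show "g \<in> parity_group I"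
  proof (rule \<Gamma>_induct)
    fix g h assume *: "g \<in> parity_group I" "emeasure \<mu> {y. par y = h} > 0"
    have "{y. par y = h} \<noteq> {}" using *(2) by (metis emeasure_empty less_irrefl)
    then obtain y where "par y = h" by blast
    with *(1) show "g + h \<in> parity_group I"
      using parity_group_add[OF _ parity_in_group] unfolding par_def by blast
  qed (simp add: parity_group_def)
qed

lemma sets_par: "{y. par y = g} \<in> sets \<mu>"
proof -
  have "{y \<in> space \<mu>. par y = g} \<in> sets \<mu>" by measurable
  then show ?thesis by simp
qed

lemma AE_par_\<Gamma>: "AE y in \<mu>. par y \<in> \<Gamma>"
proof -
  have "AE y in \<mu>. \<forall>g\<in>UNIV. par y = g \<longrightarrow> g \<in> \<Gamma>"
  proof (intro eventually_ball_finite ballI)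
    fix g
    show "AE y in \<mu>. par y = g \<longrightarrow> g \<in> \<Gamma>"
    proof (cases "emeasure \<mu> {y. par y = g} = 0")
      case True
      then show ?thesis by (intro AE_I[where N = "{y. par y = g}"]) (auto simp: sets_par)
    qed (use atom_in_\<Gamma>[of g] in \<open>auto simp: zero_less_iff_neq_zero\<close>)
  qed simp
  then show ?thesis by simp
qed

end

section \<open>Backward iteration\<close>

lemma convergent_geometric_steps:
  fixes a :: "nat \<Rightarrow> 'a::banach"
  assumes "eventually (\<lambda>j. norm (a (Suc j) - a j) < (1 / 2) ^ j) sequentially"
  shows "convergent a"
proof -
  have "summable (\<lambda>j. a (Suc j) - a j)"
    by (rule summable_comparison_test_ev[where g = "\<lambda>j. (1 / 2 :: real) ^ j"])
      (use assms in \<open>auto elim: eventually_mono simp: summable_geometric\<close>)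
  then have "convergent (\<lambda>n. \<Sum>j<n. a (Suc j) - a j)" by (simp only: summable_iff_convergent)
  then have "convergent (\<lambda>n. a n - a 0)" by (simp only: sum_lessThan_telescope)
  then have "convergent (\<lambda>n. (a n - a 0) + a 0)" by (intro convergent_add convergent_const)
  then show ?thesis by simp
qed

lemma isCont_abs_diff_vec: "isCont (\<lambda>x :: real ^ 'r. \<bar>x - c\<bar>) z"
proof -
  have "continuous_on UNIV (\<lambda>x :: real ^ 'r. \<bar>x - c\<bar>)"
    by (rule continuous_on_compose2[OF continuous_on_abs_vec[of UNIV]]) (auto intro: continuous_intros)
  then show ?thesis by (simp add: continuous_on_eq_continuous_at)
qed

lemma norm_parity_rep_le: "norm (parity_rep h :: real ^ 'r) \<le> real CARD('r)"
proof -
  have "norm (parity_rep h :: real ^ 'r) \<le> (\<Sum>i\<in>UNIV. \<bar>parity_rep h $ i\<bar>)" by (rule norm_le_l1_cart)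
  also have "\<dots> \<le> (\<Sum>i\<in>(UNIV :: 'r set). 1)" by (intro sum_mono) (simp add: parity_rep_def)
  finally show ?thesis by simp
qed

lemma parity_parity_rep: "h \<in> parity_group I \<Longrightarrow> parity I (parity_rep h) = h"
  using parity_rep_in_class by (auto simp: parity_class_def)

lemma parity_rep_in_state_space: "h \<in> parity_group I \<Longrightarrow> parity_rep h \<in> state_space I"
  using parity_rep_in_class by (auto simp: parity_class_def)

context refl_setting
begin

text \<open>
  The backward iteration applies the maps \<open>x \<mapsto> \<bar>x - Y\<^sub>k\<bar>\<close> in reverse order. It has the same
  distribution as the walk, but its values converge. The starting point is adjusted so that the
  parity class of the result is \<open>h\<close>.
\<close>

primrec bw :: "nat \<Rightarrow> bit ^ 'r \<Rightarrow> (nat \<Rightarrow> (real ^ 'r) \<times> (real ^ 's)) \<Rightarrow> real ^ 'r" where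
  "bw 0 h \<omega> = parity_rep h"
| "bw (Suc n) h \<omega> = \<bar>bw n (h + par (\<omega> 0)) (\<lambda>i. \<omega> (Suc i)) - fst (\<omega> 0)\<bar>"

lemma measurable_bw [measurable]: "bw n h \<in> borel_measurable S"
proof (induction n arbitrary: h)
  case 0
  have "bw 0 h = (\<lambda>\<omega>. parity_rep h)" by (rule ext) simp
  then show ?case by simp
next
  case (Suc n)
  have [measurable]: "(\<lambda>\<omega>. bw n (h + par (\<omega> 0)) (\<lambda>i. \<omega> (Suc i))) \<in> borel_measurable S"
  proof (rule measurable_compose_countable'[where I = UNIV and g = "\<lambda>\<omega>. h + par (\<omega> 0)"])
    show "(\<lambda>\<omega>. bw n g (\<lambda>i. \<omega> (Suc i))) \<in> borel_measurable S" for g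
      by (rule measurable_compose[OF measurable_Suc_shift Suc])
    show "(\<lambda>\<omega>. h + par (\<omega> 0)) \<in> measurable S (count_space UNIV)"
      by (rule measurable_compose[OF measurable_par_component]) simp
  qed (simp add: countable_finite)
  have "bw (Suc n) h = (\<lambda>\<omega>. \<bar>bw n (h + par (\<omega> 0)) (\<lambda>i. \<omega> (Suc i)) - fst (\<omega> 0)\<bar>)" by (rule ext) simp
  then show ?case by simp
qed

lemma ps_Suc_shift: "ps (Suc n) \<omega> = par (\<omega> 0) + ps n (\<lambda>i. \<omega> (Suc i))"
  unfolding ps_def by (rule sum.lessThan_Suc_shift)

lemma ps_comb_le: "n \<le> k \<Longrightarrow> ps n (comb_seq k \<omega> \<omega>') = ps n \<omega>"
  by (simp add: ps_def comb_seq_less)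

text \<open>The outer \<open>n\<close> steps form a walk through the first \<open>n\<close>
  increments in reverse order, started from what the later increments have produced.\<close>

lemma bw_add:
  "bw (n + m) h \<omega> = rwalk (bw m (h + ps n \<omega>) (\<lambda>i. \<omega> (i + n))) (\<lambda>k. fst (\<omega> (n - 1 - k))) n"
proof (induction n arbitrary: h \<omega>)
  case 0
  then show ?case by (simp add: ps_def)
next
  case (Suc n)
  have "rwalk z (\<lambda>k. fst (\<omega> (Suc (n - 1 - k)))) n = rwalk z (\<lambda>k. fst (\<omega> (n - k))) n" for z
    by (rule rwalk_cong) (simp add: Suc_diff_Suc)
  then show ?case using Suc[of "h + par (\<omega> 0)" "\<lambda>i. \<omega> (Suc i)"] by (simp add: ps_Suc_shift add.assoc)
qed

lemma bw_eq: "bw n h \<omega> = rwalk (parity_rep (h + ps n \<omega>)) (\<lambda>k. fst (\<omega> (n - 1 - k))) n"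
  using bw_add[of n 0] by simp

text \<open>Reversing all n + m increments makes both backward values positions of a walk over the
  same last \<open>n\<close> increments: one is started at a representative, the other where an
  \<open>m\<close>-step walk has arrived. Their difference is thus governed by the contraction of
  pairs.\<close>

lemma bw_reverse:
  fixes \<omega> :: "nat \<Rightarrow> (real ^ 'r) \<times> (real ^ 's)" and n m :: nat
  defines "\<rho> \<equiv> \<lambda>i. \<omega> (if i < n + m then n + m - 1 - i else i)"
  shows "bw n h \<rho> = X (parity_rep (h + ps n \<rho>)) n (\<lambda>i. \<omega> (i + m))"
    and "bw (n + m) h \<rho> = X (X (parity_rep (h + ps n \<rho> + ps m \<omega>)) m \<omega>) n (\<lambda>i. \<omega> (i + m))"
proof -
  have *: "rwalk z (\<lambda>k. fst (\<rho> (n - 1 - k))) n = X z n (\<lambda>i. \<omega> (i + m))" for z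
  proof (rule rwalk_cong)
    fix k assume "k < n"
    then have "n + m - 1 - (n - 1 - k) = k + m" by simp
    moreover have "n - 1 - k < n + m" using \<open>k < n\<close> by simp
    ultimately show "fst (\<rho> (n - 1 - k)) = fst (\<omega> (k + m))" unfolding \<rho>_def by presburger
  qed
  show "bw n h \<rho> = X (parity_rep (h + ps n \<rho>)) n (\<lambda>i. \<omega> (i + m))"
    by (subst bw_eq) (rule *)
  have **: "\<rho> (m - 1 - k + n) = \<omega> k" if "k < m" for k
  proof -
    have "n + m - 1 - (m - 1 - k + n) = k" using that by simp
    moreover have "m - 1 - k + n < n + m" using that by simp
    ultimately show ?thesis unfolding \<rho>_def by presburger
  qed
  have "ps m (\<lambda>i. \<rho> (i + n)) = (\<Sum>k<m. par (\<rho> (m - Suc k + n)))"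
    unfolding ps_def by (rule sum.nat_diff_reindex[symmetric])
  also have "\<dots> = ps m \<omega>" unfolding ps_def using ** by (intro sum.cong) auto
  finally have ps: "ps m (\<lambda>i. \<rho> (i + n)) = ps m \<omega>" .
  have "bw m g (\<lambda>i. \<rho> (i + n)) = X (parity_rep (g + ps m \<omega>)) m \<omega>" for g
    unfolding bw_eq ps by (rule rwalk_cong) (use ** in simp)
  then show "bw (n + m) h \<rho> = X (X (parity_rep (h + ps n \<rho> + ps m \<omega>)) m \<omega>) n (\<lambda>i. \<omega> (i + m))"
    unfolding bw_add * by simp
qed

lemma bw_Cauchy:
  assumes "\<epsilon> > 0" "\<delta> > 0"
  shows "\<exists>n0. \<forall>n\<ge>n0. \<forall>m. \<forall>h\<in>parity_group I.
    measure S {\<omega>. norm (bw (n + m) h \<omega> - bw n h \<omega>) \<ge> \<epsilon>} \<le> \<delta>"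
proof -
  \<comment> \<open>The fibre in which the two copies start their common steps depends on those same
    increments. A union bound over all parity vectors removes this dependence, at the price of the
    factor \<kappa>.\<close>
  define \<kappa> where "\<kappa> = real (card (parity_group I))"
  have "(0 :: bit ^ 'r) \<in> parity_group I" by (simp add: parity_group_def)
  then have \<kappa>: "\<kappa> > 0" by (auto simp: \<kappa>_def card_gt_0_iff)
  define c where "c = real CARD('r)"
  have "\<delta> / (2 * \<kappa>) > 0" using assms \<kappa> by simp
  then obtain R0 where R0: "\<And>n. measure S {\<omega>. norm (X 0 n \<omega>) > R0} \<le> \<delta> / (2 * \<kappa>)"
    using X_tight by blast
  from X_contraction[OF assms(1) \<open>\<delta> / (2 * \<kappa>) > 0\<close>, of "R0 + c"]
  obtain n0 where n0: "\<forall>n\<ge>n0. \<forall>x x' h. x \<in> parity_class I h \<longrightarrow> x' \<in> parity_class I h \<longrightarrow> norm x \<le> R0 + c \<longrightarrow> norm x' \<le> R0 + c \<longrightarrow>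
    measure S {\<omega>. norm (X x n \<omega> - X x' n \<omega>) \<ge> \<epsilon>} \<le> \<delta> / (2 * \<kappa>)" by blast
  have c_rep: "norm (parity_rep g :: real ^ 'r) \<le> c" for g unfolding c_def by (rule norm_parity_rep_le)
  \<comment> \<open>With \<open>R0\<close> nonnegative the representatives lie in the ball of radius
    \<open>R0 + c\<close> too. A negative \<open>R0\<close> is possible only if the bound for the
    tail is at least 1, and then the estimates hold trivially.\<close>
  have "R0 \<ge> 0 \<or> \<delta> / (2 * \<kappa>) \<ge> 1"
  proof (rule disjCI)
    assume "\<not> \<delta> / (2 * \<kappa>) \<ge> 1"
    show "R0 \<ge> 0"
    proof (rule ccontr)
      assume "\<not> R0 \<ge> 0"
      then have "{\<omega> :: nat \<Rightarrow> (real ^ 'r) \<times> (real ^ 's). norm (X 0 0 \<omega>) > R0} = space S" by auto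
      with R0[of 0] P.prob_space \<open>\<not> \<delta> / (2 * \<kappa>) \<ge> 1\<close> show False by simp
    qed
  qed
  then have nonneg: "R0 \<ge> 0 \<or> \<delta> / (2 * \<kappa>) \<ge> 1" .
  have one: "measure S {\<omega>. norm (X (X (parity_rep (g + ps m \<omega>)) m \<omega>) n (\<lambda>i. \<omega> (i + m))
      - X (parity_rep g) n (\<lambda>i. \<omega> (i + m))) \<ge> \<epsilon>} \<le> \<delta> / \<kappa>" (is "measure S {\<omega>. ?E \<omega>} \<le> _")
    if n: "n \<ge> n0" and g: "g \<in> parity_group I" for n m g
  proof -
    define W where "W \<omega> = X (parity_rep (g + ps m \<omega>)) m \<omega>" for \<omega>
    have [measurable]: "(\<lambda>\<omega>. parity_rep (g + ps m \<omega>) :: real ^ 'r) \<in> borel_measurable S"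
      by (rule measurable_compose[OF measurable_ps]) simp
    have [measurable]: "W \<in> borel_measurable S" unfolding W_def by measurable
    have [measurable]: "parity_class I g \<in> sets borel" by (rule borel_closed[OF closed_parity_class[OF g]])
    define G where "G \<omega> \<longleftrightarrow> W \<omega> \<in> parity_class I g \<and> norm (W \<omega>) \<le> R0 + c" for \<omega>
    have [measurable]: "Measurable.pred S G" unfolding G_def by measurable
    have [measurable]: "Measurable.pred S ?E" unfolding W_def[symmetric] by measurable
    have bad: "measure S {\<omega>. \<not> G \<omega>} \<le> \<delta> / (2 * \<kappa>)"
    proof -
      have "AE \<omega> in S. \<not> G \<omega> \<longrightarrow> norm (X 0 m \<omega>) > R0"
        using AE_integers
      proof eventually_elim
        case (elim \<omega>)
        have gp: "g + ps m \<omega> \<in> parity_group I" by (intro parity_group_add g ps_in_group)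
        have "W \<omega> \<in> parity_class I g"
          using X_in_class[OF parity_rep_in_state_space[OF gp] elim, of m] parity_parity_rep[OF gp]
          by (simp add: W_def)
        moreover have "norm (W \<omega>) \<le> norm (X 0 m \<omega>) + c"
          using rwalk_nonexpansive[of "parity_rep (g + ps m \<omega>)" "\<lambda>k. fst (\<omega> k)" m 0] c_rep[of "g + ps m \<omega>"]
            norm_triangle_ineq2[of "W \<omega>" "X 0 m \<omega>"] unfolding W_def by simp
        ultimately show ?case unfolding G_def by auto
      qed
      then have "measure S {\<omega>. \<not> G \<omega>} \<le> measure S {\<omega>. norm (X 0 m \<omega>) > R0}"
        by (intro prob_mono_AE) measurable
      with R0[of m] show ?thesis by simp
    qed
    have "measure S {\<omega>. G \<omega> \<and> ?E \<omega>} \<le> \<delta> / (2 * \<kappa>) * measure S {\<omega>. G \<omega>}"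
    proof (rule prob_comb_le[where k = m])
      show "G (comb_seq m \<omega> \<omega>') \<longleftrightarrow> G \<omega>" for \<omega> \<omega>'
        by (simp add: G_def W_def ps_comb_le X_comb_le)
    next
      fix \<omega> assume G: "G \<omega>"
      have eq: "?E (comb_seq m \<omega> \<omega>') \<longleftrightarrow> norm (X (W \<omega>) n \<omega>' - X (parity_rep g) n \<omega>') \<ge> \<epsilon>" for \<omega>'
        by (simp add: W_def ps_comb_le X_comb_le comb_seq_add)
      show "measure S {\<omega>'. ?E (comb_seq m \<omega> \<omega>')} \<le> \<delta> / (2 * \<kappa>)"
      proof (cases "R0 \<ge> 0")
        case True
        then have "norm (parity_rep g :: real ^ 'r) \<le> R0 + c" using c_rep[of g] by simp
        then show ?thesis unfolding eq
          using n0 n G parity_rep_in_class[OF g] unfolding G_def by blast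
      next
        case False
        then have "1 \<le> \<delta> / (2 * \<kappa>)" using nonneg by simp
        then show ?thesis using P.prob_le_1 order_trans by blast
      qed
    qed (use \<open>\<delta> / (2 * \<kappa>) > 0\<close> in auto)
    also have "\<dots> \<le> \<delta> / (2 * \<kappa>) * 1"
      using \<open>\<delta> / (2 * \<kappa>) > 0\<close> P.prob_le_1 by (intro mult_left_mono) auto
    finally have good: "measure S {\<omega>. G \<omega> \<and> ?E \<omega>} \<le> \<delta> / (2 * \<kappa>)" by simp
    have "measure S {\<omega>. ?E \<omega>} \<le> measure S {\<omega>. (G \<omega> \<and> ?E \<omega>) \<or> \<not> G \<omega>}" by (rule prob_mono) auto
    also have "\<dots> \<le> measure S {\<omega>. G \<omega> \<and> ?E \<omega>} + measure S {\<omega>. \<not> G \<omega>}" by (rule prob_disj_le) auto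
    also have "\<dots> \<le> \<delta> / (2 * \<kappa>) + \<delta> / (2 * \<kappa>)" using good bad by (rule add_mono)
    finally show ?thesis by (simp add: field_simps)
  qed
  have "measure S {\<omega>. norm (bw (n + m) h \<omega> - bw n h \<omega>) \<ge> \<epsilon>} \<le> \<delta>"
    if n: "n \<ge> n0" and h: "h \<in> parity_group I" for n m h
  proof -
    let ?\<rho> = "\<lambda>\<omega> i. \<omega> (if i < n + m then n + m - 1 - i else i) :: (real ^ 'r) \<times> (real ^ 's)"
    let ?E = "\<lambda>g \<omega>. norm (X (X (parity_rep (g + ps m \<omega>)) m \<omega>) n (\<lambda>i. \<omega> (i + m))
      - X (parity_rep g) n (\<lambda>i. \<omega> (i + m))) \<ge> \<epsilon>"
    have [measurable]: "(\<lambda>\<omega>. parity_rep (g + ps m \<omega>) :: real ^ 'r) \<in> borel_measurable S" for g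
      by (rule measurable_compose[OF measurable_ps]) simp
    have sets: "{\<omega>. norm (bw (n + m) h \<omega> - bw n h \<omega>) \<ge> \<epsilon>} \<in> sets S"
      by (rule sets_Collect_S) measurable
    have "measure S {\<omega>. norm (bw (n + m) h \<omega> - bw n h \<omega>) \<ge> \<epsilon>}
        = measure (distr S S ?\<rho>) {\<omega>. norm (bw (n + m) h \<omega> - bw n h \<omega>) \<ge> \<epsilon>}"
      by (simp only: distr_reverse)
    also have "\<dots> = measure S {\<omega>. norm (bw (n + m) h (?\<rho> \<omega>) - bw n h (?\<rho> \<omega>)) \<ge> \<epsilon>}"
      by (subst measure_distr[OF measurable_reverse sets]) (simp add: vimage_def)
    also have "\<dots> \<le> measure S {\<omega>. \<exists>g\<in>parity_group I. ?E g \<omega>}"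
    proof (rule prob_mono)
      fix \<omega> assume "norm (bw (n + m) h (?\<rho> \<omega>) - bw n h (?\<rho> \<omega>)) \<ge> \<epsilon>"
      then have "?E (h + ps n (?\<rho> \<omega>)) \<omega>" unfolding bw_reverse .
      then show "\<exists>g\<in>parity_group I. ?E g \<omega>" using parity_group_add[OF h ps_in_group] by blast
    qed measurable
    also have "\<dots> = measure S (\<Union>g\<in>parity_group I. {\<omega>. ?E g \<omega>})"
      by (rule arg_cong[where f = "measure S"]) auto
    also have "\<dots> \<le> (\<Sum>g\<in>parity_group I. measure S {\<omega>. ?E g \<omega>})"
      by (rule measure_UNION_le) (simp, rule sets_Collect_S, measurable)
    also have "\<dots> \<le> (\<Sum>g\<in>parity_group I. \<delta> / \<kappa>)" using one[OF n] by (intro sum_mono)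
    also have "\<dots> = \<kappa> * (\<delta> / \<kappa>)" by (simp add: \<kappa>_def)
    also have "\<dots> = \<delta>" using \<kappa> by simp
    finally show ?thesis .
  qed
  then show ?thesis by blast
qed

lemma bw_in_class:
  assumes "h \<in> parity_group I" "\<forall>k. \<forall>i\<in>I. fst (\<omega> k) $ i \<in> \<int>"
  shows "bw n h \<omega> \<in> parity_class I h"
  using assms
proof (induction n arbitrary: h \<omega>)
  case 0
  then show ?case by (simp add: parity_rep_in_class)
next
  case (Suc n)
  have "bw n (h + par (\<omega> 0)) (\<lambda>i. \<omega> (Suc i)) \<in> parity_class I (h + par (\<omega> 0))"
    using Suc.prems by (intro Suc.IH) (auto simp: par_def intro: parity_group_add parity_in_group)
  then show ?case
    using parity_step[of "bw n (h + par (\<omega> 0)) (\<lambda>i. \<omega> (Suc i))" I "fst (\<omega> 0)"] Suc.prems(2)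
    by (auto simp: parity_class_def par_def)
qed

lemma AE_shift:
  assumes "AE \<omega> in S. Q \<omega>"
  shows "AE \<omega> in S. Q (\<lambda>i. \<omega> (i + k))"
  by (rule AE_distrD[OF measurable_shift]) (simp only: distr_shift assms)

text \<open>Along a fast subsequence the Cauchy estimate is summable, and Borel-Cantelli gives
  almost sure convergence. The recursion of \<open>bw\<close> becomes a fixed point equation in the
  limit: \<open>G h\<close> is one step of the walk applied to an independent copy of the limit, in
  the matching fibre.\<close>

lemma backward_limit:
  obtains G where "\<And>h. G h \<in> borel_measurable S"
    "\<And>h. h \<in> parity_group I \<Longrightarrow> AE \<omega> in S. G h \<omega> \<in> parity_class I h"
    "AE \<omega> in S. \<forall>h\<in>parity_group I. G h \<omega> = \<bar>G (h + par (\<omega> 0)) (\<lambda>i. \<omega> (Suc i)) - fst (\<omega> 0)\<bar>"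
proof -
  have "\<forall>j. \<exists>n0. \<forall>n\<ge>n0. \<forall>m. \<forall>h\<in>parity_group I.
    measure S {\<omega>. norm (bw (n + m) h \<omega> - bw n h \<omega>) \<ge> (1 / 2) ^ j} \<le> (1 / 2) ^ j"
    using bw_Cauchy[of "(1 / 2) ^ _" "(1 / 2) ^ _"] by simp
  from choice[OF this] obtain n0 where n0: "\<forall>j. \<forall>n\<ge>n0 j. \<forall>m. \<forall>h\<in>parity_group I.
    measure S {\<omega>. norm (bw (n + m) h \<omega> - bw n h \<omega>) \<ge> (1 / 2) ^ j} \<le> (1 / 2) ^ j" ..
  \<comment> \<open>As a sum, \<open>r j\<close> dominates \<open>n0 j\<close> and grows by exactly
    \<open>n0 (Suc j)\<close>, which fits the form n + m of the Cauchy estimate.\<close>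
  define r where "r j = (\<Sum>i\<le>j. n0 i)" for j
  have r: "n0 j \<le> r j" for j by (cases j) (auto simp: r_def)
  \<comment> \<open>Used twice: with \<open>m j = n0 (Suc j)\<close> for the convergence, and with
    \<open>m j = 1\<close> to show that one further backward step does not change the limit.\<close>
  have step: "AE \<omega> in S. eventually (\<lambda>j. norm (bw (r j + m j) h \<omega> - bw (r j) h \<omega>) < (1 / 2) ^ j) sequentially"
    if h: "h \<in> parity_group I" for h m
  proof -
    define A where "A j = {\<omega>. norm (bw (r j + m j) h \<omega> - bw (r j) h \<omega>) \<ge> (1 / 2) ^ j}" for j
    have "AE \<omega> in S. eventually (\<lambda>j. \<omega> \<in> space S - A j) sequentially"
    proof (rule borel_cantelli_AE1)
      show "A j \<in> sets S" for j unfolding A_def by (rule sets_Collect_S) measurable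
      show "emeasure S (A j) < \<infinity>" for j by (simp add: P.emeasure_eq_measure)
      show "summable (\<lambda>j. measure S (A j))"
      proof (rule summable_comparison_test')
        show "summable (\<lambda>j. (1 / 2 :: real) ^ j)" by (simp add: summable_geometric)
        show "norm (measure S (A j)) \<le> (1 / 2) ^ j" if "j \<ge> 0" for j
          using n0 r h by (simp add: A_def)
      qed
    qed
    then show ?thesis by eventually_elim (auto simp: A_def not_le elim: eventually_mono)
  qed
  \<comment> \<open>\<open>Lim\<close> makes \<open>G\<close> total and measurable; its value
    matters only on the almost sure event of convergence.\<close>
  define G where "G h \<omega> = Lim sequentially (\<lambda>j. bw (r j) h \<omega>)" for h \<omega>
  have "AE \<omega> in S. \<forall>h\<in>parity_group I. (\<lambda>j. bw (r j) h \<omega>) \<longlonglongrightarrow> G h \<omega>"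
  proof (intro eventually_ball_finite ballI)
    fix h :: "bit ^ 'r" assume h: "h \<in> parity_group I"
    show "AE \<omega> in S. (\<lambda>j. bw (r j) h \<omega>) \<longlonglongrightarrow> G h \<omega>"
      using step[OF h, of "\<lambda>j. n0 (Suc j)"]
    proof eventually_elim
      case (elim \<omega>)
      then have "convergent (\<lambda>j. bw (r j) h \<omega>)"
        by (intro convergent_geometric_steps) (simp add: r_def)
      then show ?case by (simp add: G_def convergent_LIMSEQ_iff)
    qed
  qed simp
  note lim = this
  show thesis
  proof
    show "G h \<in> borel_measurable S" for h unfolding G_def by measurable
    show "AE \<omega> in S. G h \<omega> \<in> parity_class I h" if h: "h \<in> parity_group I" for h
      using lim AE_integers
    proof eventually_elim
      case (elim \<omega>)
      show ?case
        by (rule closed_sequentially[OF closed_parity_class[OF h] _ elim(1)[rule_format, OF h]])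
          (rule bw_in_class[OF h elim(2)])
    qed
    have "AE \<omega> in S. \<forall>h\<in>parity_group I.
        eventually (\<lambda>j. norm (bw (r j + 1) h \<omega> - bw (r j) h \<omega>) < (1 / 2) ^ j) sequentially"
      using step[of _ "\<lambda>_. 1"] by (intro eventually_ball_finite ballI) auto
    then show "AE \<omega> in S. \<forall>h\<in>parity_group I. G h \<omega> = \<bar>G (h + par (\<omega> 0)) (\<lambda>i. \<omega> (Suc i)) - fst (\<omega> 0)\<bar>"
      using lim AE_shift[OF lim, of 1]
    proof eventually_elim
      case (elim \<omega>)
      show ?case
      proof
        fix h :: "bit ^ 'r" assume h: "h \<in> parity_group I"
        have h': "h + par (\<omega> 0) \<in> parity_group I"
          using h by (auto simp: par_def intro: parity_group_add parity_in_group)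
        have "(\<lambda>j. bw (r j) (h + par (\<omega> 0)) (\<lambda>i. \<omega> (Suc i))) \<longlonglongrightarrow> G (h + par (\<omega> 0)) (\<lambda>i. \<omega> (Suc i))"
          using elim(3) h' by simp
        moreover have "isCont (\<lambda>x :: real ^ 'r. \<bar>x - fst (\<omega> 0)\<bar>) z" for z
          by (rule isCont_abs_diff_vec)
        ultimately have "(\<lambda>j. bw (r j + 1) h \<omega>) \<longlonglongrightarrow> \<bar>G (h + par (\<omega> 0)) (\<lambda>i. \<omega> (Suc i)) - fst (\<omega> 0)\<bar>"
          using isCont_tendsto_compose by fastforce
        moreover have "(\<lambda>j. bw (r j + 1) h \<omega> - bw (r j) h \<omega>) \<longlonglongrightarrow> 0"
        proof (rule Lim_null_comparison[where g = "\<lambda>j. (1 / 2) ^ j"])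
          show "eventually (\<lambda>j. norm (bw (r j + 1) h \<omega> - bw (r j) h \<omega>) \<le> (1 / 2) ^ j) sequentially"
            using elim(1)[rule_format, OF h] by eventually_elim simp
        qed (simp add: LIMSEQ_power_zero)
        ultimately have "(\<lambda>j. bw (r j + 1) h \<omega> - (bw (r j + 1) h \<omega> - bw (r j) h \<omega>)) \<longlonglongrightarrow>
            \<bar>G (h + par (\<omega> 0)) (\<lambda>i. \<omega> (Suc i)) - fst (\<omega> 0)\<bar> - 0"
          by (rule tendsto_diff)
        then have "(\<lambda>j. bw (r j) h \<omega>) \<longlonglongrightarrow> \<bar>G (h + par (\<omega> 0)) (\<lambda>i. \<omega> (Suc i)) - fst (\<omega> 0)\<bar>"
          by (simp only: diff_diff_eq2 add_diff_cancel_left' diff_zero)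
        with elim(2) h show "G h \<omega> = \<bar>G (h + par (\<omega> 0)) (\<lambda>i. \<omega> (Suc i)) - fst (\<omega> 0)\<bar>"
          using LIMSEQ_unique by blast
      qed
    qed
  qed
qed

end

section \<open>Existence of stationary measures\<close>

lemma coset_space_eq: "coset_space I C = (\<Union>h\<in>C. parity_class I h)"
  by (auto simp: coset_space_def parity_class_def)

context refl_setting
begin

lemma emeasure_component:
  assumes "Measurable.pred \<mu> Q"
  shows "emeasure S {\<omega>. Q (\<omega> k)} = emeasure \<mu> {y. Q y}"
  using prob_component[OF assms, of k] by (simp add: P.emeasure_eq_measure mu.emeasure_eq_measure)

lemma kernel_eq:
  assumes [measurable]: "B \<in> sets borel"
  shows "emeasure (first_marginal \<mu>) {y. \<bar>x - y\<bar> \<in> B} = emeasure S {\<omega>. X x 1 \<omega> \<in> B}"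
proof -
  have "{y \<in> space borel. \<bar>x - y\<bar> \<in> B} \<in> sets borel" by measurable
  then have "emeasure (first_marginal \<mu>) {y. \<bar>x - y\<bar> \<in> B} = emeasure \<mu> {y. \<bar>x - fst y\<bar> \<in> B}"
    unfolding first_marginal_def by (subst emeasure_distr) (auto simp: vimage_def)
  also have "\<dots> = emeasure S {\<omega>. \<bar>x - fst (\<omega> 0)\<bar> \<in> B}"
    by (rule emeasure_component[symmetric]) measurable
  finally show ?thesis by simp
qed

definition coset :: "(bit ^ 'r) set \<Rightarrow> bool"
  where "coset C \<longleftrightarrow> (\<exists>g\<in>parity_group I. C = (+) g ` \<Gamma>)"

lemma parity_cosets_iff: "C \<in> parity_cosets (first_marginal \<mu>) I \<longleftrightarrow> coset C"
  by (auto simp: parity_cosets_def coset_def \<Gamma>_def)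

lemma coset_add: "coset C \<Longrightarrow> h \<in> C \<Longrightarrow> \<gamma> \<in> \<Gamma> \<Longrightarrow> h + \<gamma> \<in> C"
  by (auto simp: coset_def image_iff add.assoc intro: \<Gamma>_add)

lemma coset_diff:
  assumes "coset C" "h \<in> C" "h' \<in> C"
  shows "h + h' \<in> \<Gamma>"
proof -
  obtain g a b where "h = g + a" "h' = g + b" "a \<in> \<Gamma>" "b \<in> \<Gamma>"
    using assms by (auto simp: coset_def)
  moreover have "(g + a) + (g + b) = a + b" by (simp add: vec_eq_iff algebra_simps)
  ultimately show ?thesis using \<Gamma>_add by simp
qed

lemma coset_nonempty: "coset C \<Longrightarrow> C \<noteq> {}"
  using zero_in_\<Gamma> by (auto simp: coset_def)

lemma coset_subset: "coset C \<Longrightarrow> C \<subseteq> parity_group I"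
  using \<Gamma>_subset parity_group_add by (auto simp: coset_def)

lemma closed_coset_space: "coset C \<Longrightarrow> closed (coset_space I C)"
  unfolding coset_space_eq using coset_subset closed_parity_class by (intro closed_UN) auto

abbreviation stationary :: "(bit ^ 'r) set \<Rightarrow> (real ^ 'r) measure \<Rightarrow> bool"
  where "stationary C \<nu> \<equiv> invariant_prob_on (first_marginal \<mu>) (coset_space I C) \<nu>"

text \<open>The measure is the law of \<open>G h\<close> with \<open>h\<close> uniform on the coset
  and independent of the increments. One step of the walk from \<open>G h\<close> reproduces this
  law by the fixed point equation, because the parity of the step merely permutes the coset.\<close>

lemma stationary_exists:
  assumes C: "coset C"
  shows "\<exists>\<nu>. stationary C \<nu>"
proof (rule backward_limit)
  fix G :: "bit ^ 'r \<Rightarrow> (nat \<Rightarrow> (real ^ 'r) \<times> (real ^ 's)) \<Rightarrow> real ^ 'r"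
  assume G [measurable]: "\<And>h. G h \<in> borel_measurable S"
    and cls: "\<And>h. h \<in> parity_group I \<Longrightarrow> AE \<omega> in S. G h \<omega> \<in> parity_class I h"
    and fixpt: "AE \<omega> in S. \<forall>h\<in>parity_group I. G h \<omega> = \<bar>G (h + par (\<omega> 0)) (\<lambda>i. \<omega> (Suc i)) - fst (\<omega> 0)\<bar>"
  interpret SS: pair_sigma_finite S S ..
  note Cpg = coset_subset[OF C]
  have fin: "finite C" "C \<noteq> {}" using coset_nonempty[OF C] by auto
  define U where "U = measure_pmf (pmf_of_set C)"
  define \<nu> where "\<nu> = distr (U \<Otimes>\<^sub>M S) borel (\<lambda>(h, \<omega>). G h \<omega>)"
  have [measurable]: "(\<lambda>(h, \<omega>). G h \<omega>) \<in> borel_measurable (U \<Otimes>\<^sub>M S)"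
  proof -
    have "(\<lambda>(h, \<omega>). G h \<omega>) \<in> borel_measurable (count_space UNIV \<Otimes>\<^sub>M S)"
      by (rule measurable_pair_measure_countable1) (auto simp: countable_finite)
    moreover have "sets (U \<Otimes>\<^sub>M S) = sets (count_space UNIV \<Otimes>\<^sub>M S)"
      by (rule sets_pair_measure_cong) (auto simp: U_def)
    ultimately show ?thesis using measurable_cong_sets by blast
  qed
  have int: "(\<integral>\<^sup>+ x. f x \<partial>\<nu>) = (\<Sum>h\<in>C. \<integral>\<^sup>+ \<omega>. f (G h \<omega>) \<partial>S) / card C"
    if [measurable]: "f \<in> borel_measurable borel" for f
  proof -
    have "(\<integral>\<^sup>+ x. f x \<partial>\<nu>) = (\<integral>\<^sup>+ p. f (case p of (h, \<omega>) \<Rightarrow> G h \<omega>) \<partial>(U \<Otimes>\<^sub>M S))"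
      unfolding \<nu>_def by (rule nn_integral_distr) auto
    also have "\<dots> = (\<integral>\<^sup>+ h. \<integral>\<^sup>+ \<omega>. f (G h \<omega>) \<partial>S \<partial>U)"
      by (subst P.nn_integral_fst[symmetric]) auto
    also have "\<dots> = (\<Sum>h\<in>C. \<integral>\<^sup>+ \<omega>. f (G h \<omega>) \<partial>S) / card C"
      unfolding U_def using fin by (subst nn_integral_pmf_of_set) auto
    finally show ?thesis .
  qed
  have em: "emeasure \<nu> B = (\<Sum>h\<in>C. emeasure S {\<omega>. G h \<omega> \<in> B}) / card C" if B [measurable]: "B \<in> sets borel" for B
  proof -
    have "emeasure \<nu> B = (\<integral>\<^sup>+ x. indicator B x \<partial>\<nu>)" using B by (simp add: \<nu>_def)
    also have "\<dots> = (\<Sum>h\<in>C. \<integral>\<^sup>+ \<omega>. indicator B (G h \<omega>) \<partial>S) / card C" by (rule int) measurable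
    also have "(\<lambda>h. \<integral>\<^sup>+ \<omega>. indicator B (G h \<omega>) \<partial>S) = (\<lambda>h. emeasure S {\<omega>. G h \<omega> \<in> B})"
    proof
      fix h
      have "{\<omega>. G h \<omega> \<in> B} \<in> sets S" by (rule sets_Collect_S) measurable
      then have "emeasure S {\<omega>. G h \<omega> \<in> B} = (\<integral>\<^sup>+ \<omega>. indicator {\<omega>. G h \<omega> \<in> B} \<omega> \<partial>S)" by simp
      then show "(\<integral>\<^sup>+ \<omega>. indicator B (G h \<omega>) \<partial>S) = emeasure S {\<omega>. G h \<omega> \<in> B}" by (simp add: indicator_def)
    qed
    finally show ?thesis .
  qed
  have card: "of_nat (card C) / of_nat (card C) = (1 :: ennreal)"
    using fin by (intro ennreal_divide_self) (auto simp: ennreal_of_nat_eq_real_of_nat)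
  have inB: "emeasure \<nu> B = 1" if "B \<in> sets borel" "\<And>h. h \<in> C \<Longrightarrow> AE \<omega> in S. G h \<omega> \<in> B" for B
  proof -
    have "emeasure S {\<omega>. G h \<omega> \<in> B} = 1" if "h \<in> C" for h
    proof -
      have "{\<omega> \<in> space S. G h \<omega> \<in> B} \<in> sets S" using \<open>B \<in> sets borel\<close> by measurable
      then show ?thesis
        using P.prob_Collect_eq_1[of "\<lambda>\<omega>. G h \<omega> \<in> B"] that \<open>\<And>h. h \<in> C \<Longrightarrow> AE \<omega> in S. G h \<omega> \<in> B\<close>
        by (simp add: P.emeasure_eq_measure)
    qed
    then show ?thesis using em[OF that(1)] card by simp
  qed
  have sets\<nu>: "sets \<nu> = sets borel" by (simp add: \<nu>_def)
  have "stationary C \<nu>"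
    unfolding invariant_prob_on_def
  proof (intro conjI ballI)
    show "prob_space \<nu>"
      using inB[of UNIV] by (intro prob_spaceI) (simp add: \<nu>_def)
    show "sets \<nu> = sets borel" by (rule sets\<nu>)
    show "emeasure \<nu> (coset_space I C) = 1"
    proof (rule inB)
      show "coset_space I C \<in> sets borel" by (rule borel_closed[OF closed_coset_space[OF C]])
      fix h assume h: "h \<in> C"
      with Cpg have "h \<in> parity_group I" by auto
      from cls[OF this] show "AE \<omega> in S. G h \<omega> \<in> coset_space I C"
        by eventually_elim (use h in \<open>auto simp: coset_space_eq\<close>)
    qed
    fix B :: "(real ^ 'r) set" assume B [measurable]: "B \<in> sets borel"
    define F where "F h \<omega> \<omega>' = (indicator B \<bar>G h \<omega>' - fst (\<omega> 0)\<bar> :: ennreal)"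
      for h and \<omega> \<omega>' :: "nat \<Rightarrow> (real ^ 'r) \<times> (real ^ 's)"
    have [measurable]: "(\<lambda>p. F h (fst p) (snd p)) \<in> borel_measurable (S \<Otimes>\<^sub>M S)" for h
      unfolding F_def by measurable
    have [measurable]: "(\<lambda>p. F (h + par (fst p 0)) (fst p) (snd p)) \<in> borel_measurable (S \<Otimes>\<^sub>M S)" for h
      by (rule measurable_compose_countable'[where I = UNIV and g = "\<lambda>p. h + par (fst p 0)"])
        (auto simp: countable_finite)
    have 1: "emeasure S {\<omega>. G h \<omega> \<in> B} = (\<integral>\<^sup>+ \<omega>. \<integral>\<^sup>+ \<omega>'. F (h + par (\<omega> 0)) \<omega> \<omega>' \<partial>S \<partial>S)" if "h \<in> C" for h
    proof -
      have "{\<omega>. G h \<omega> \<in> B} \<in> sets S" by (rule sets_Collect_S) measurable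
      then have "emeasure S {\<omega>. G h \<omega> \<in> B} = (\<integral>\<^sup>+ \<omega>. indicator {\<omega>. G h \<omega> \<in> B} \<omega> \<partial>S)" by simp
      also have "\<dots> = (\<integral>\<^sup>+ \<omega>. F (h + par (\<omega> 0)) \<omega> (\<lambda>i. \<omega> (Suc i)) \<partial>S)"
      proof (rule nn_integral_cong_AE)
        show "AE \<omega> in S. indicator {\<omega>. G h \<omega> \<in> B} \<omega> = F (h + par (\<omega> 0)) \<omega> (\<lambda>i. \<omega> (Suc i))"
          using fixpt by eventually_elim (use that Cpg in \<open>auto simp: F_def indicator_def\<close>)
      qed
      also have "\<dots> = (\<integral>\<^sup>+ \<omega>. \<integral>\<^sup>+ \<omega>'. F (h + par (comb_seq 1 \<omega> \<omega>' 0)) (comb_seq 1 \<omega> \<omega>') (\<lambda>i. comb_seq 1 \<omega> \<omega>' (Suc i)) \<partial>S \<partial>S)"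
      proof (rule nn_integral_comb_seq)
        have "(\<lambda>\<omega>. (\<omega>, \<lambda>i. \<omega> (Suc i))) \<in> measurable S (S \<Otimes>\<^sub>M S)" by measurable
        from measurable_compose[OF this \<open>(\<lambda>p. F (h + par (fst p 0)) (fst p) (snd p)) \<in> borel_measurable (S \<Otimes>\<^sub>M S)\<close>]
        show "(\<lambda>\<omega>. F (h + par (\<omega> 0)) \<omega> (\<lambda>i. \<omega> (Suc i))) \<in> borel_measurable S" by simp
      qed
      also have "\<dots> = (\<integral>\<^sup>+ \<omega>. \<integral>\<^sup>+ \<omega>'. F (h + par (\<omega> 0)) \<omega> \<omega>' \<partial>S \<partial>S)"
        by (simp add: F_def)
      finally show ?thesis .
    qed
    have "(\<Sum>h\<in>C. emeasure S {\<omega>. G h \<omega> \<in> B}) = (\<Sum>h\<in>C. \<integral>\<^sup>+ \<omega>. \<integral>\<^sup>+ \<omega>'. F (h + par (\<omega> 0)) \<omega> \<omega>' \<partial>S \<partial>S)"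
      using 1 by (intro sum.cong) auto
    also have "\<dots> = (\<integral>\<^sup>+ \<omega>. (\<Sum>h\<in>C. \<integral>\<^sup>+ \<omega>'. F (h + par (\<omega> 0)) \<omega> \<omega>' \<partial>S) \<partial>S)"
    proof (rule nn_integral_sum[symmetric])
      fix h
      show "(\<lambda>\<omega>. \<integral>\<^sup>+ \<omega>'. F (h + par (\<omega> 0)) \<omega> \<omega>' \<partial>S) \<in> borel_measurable S"
        using P.borel_measurable_nn_integral_fst[OF \<open>(\<lambda>p. F (h + par (fst p 0)) (fst p) (snd p)) \<in> borel_measurable (S \<Otimes>\<^sub>M S)\<close>]
        by simp
    qed
    \<comment> \<open>For a fixed first increment, whose parity is almost surely in \<Gamma>, adding
      that parity is an involution of \<open>C\<close>; the summands are only rearranged.\<close>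
    also have "\<dots> = (\<integral>\<^sup>+ \<omega>. (\<Sum>h\<in>C. \<integral>\<^sup>+ \<omega>'. F h \<omega> \<omega>' \<partial>S) \<partial>S)"
    proof (rule nn_integral_cong_AE)
      have "AE \<omega> in S. par (\<omega> 0) \<in> \<Gamma>" by (rule AE_component[where i = 0, OF _ AE_par_\<Gamma>]) simp
      then show "AE \<omega> in S. (\<Sum>h\<in>C. \<integral>\<^sup>+ \<omega>'. F (h + par (\<omega> 0)) \<omega> \<omega>' \<partial>S) = (\<Sum>h\<in>C. \<integral>\<^sup>+ \<omega>'. F h \<omega> \<omega>' \<partial>S)"
      proof eventually_elim
        case (elim \<omega>)
        then show ?case
          using coset_add[OF C]
          by (intro sum.reindex_bij_witness[of _ "\<lambda>h. h + par (\<omega> 0)" "\<lambda>h. h + par (\<omega> 0)"]) auto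
      qed
    qed
    also have "\<dots> = (\<Sum>h\<in>C. \<integral>\<^sup>+ \<omega>. \<integral>\<^sup>+ \<omega>'. F h \<omega> \<omega>' \<partial>S \<partial>S)"
    proof (rule nn_integral_sum)
      fix h
      show "(\<lambda>\<omega>. \<integral>\<^sup>+ \<omega>'. F h \<omega> \<omega>' \<partial>S) \<in> borel_measurable S"
        using P.borel_measurable_nn_integral_fst[OF \<open>(\<lambda>p. F h (fst p) (snd p)) \<in> borel_measurable (S \<Otimes>\<^sub>M S)\<close>]
        by simp
    qed
    also have "\<dots> = (\<Sum>h\<in>C. \<integral>\<^sup>+ \<omega>'. \<integral>\<^sup>+ \<omega>. F h \<omega> \<omega>' \<partial>S \<partial>S)"
    proof (rule sum.cong[OF refl])
      fix h
      show "(\<integral>\<^sup>+ \<omega>. \<integral>\<^sup>+ \<omega>'. F h \<omega> \<omega>' \<partial>S \<partial>S) = (\<integral>\<^sup>+ \<omega>'. \<integral>\<^sup>+ \<omega>. F h \<omega> \<omega>' \<partial>S \<partial>S)"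
        using SS.Fubini'[of "F h"] by (simp add: case_prod_beta')
    qed
    also have "\<dots> = (\<Sum>h\<in>C. \<integral>\<^sup>+ \<omega>'. emeasure (first_marginal \<mu>) {y. \<bar>G h \<omega>' - y\<bar> \<in> B} \<partial>S)"
    proof (intro sum.cong refl nn_integral_cong)
      fix h \<omega>'
      have "{\<omega>. X (G h \<omega>') 1 \<omega> \<in> B} \<in> sets S" by (rule sets_Collect_S) measurable
      then have "emeasure S {\<omega>. X (G h \<omega>') 1 \<omega> \<in> B} = (\<integral>\<^sup>+ \<omega>. indicator {\<omega>. X (G h \<omega>') 1 \<omega> \<in> B} \<omega> \<partial>S)"
        by (rule nn_integral_indicator[symmetric])
      then show "(\<integral>\<^sup>+ \<omega>. F h \<omega> \<omega>' \<partial>S) = emeasure (first_marginal \<mu>) {y. \<bar>G h \<omega>' - y\<bar> \<in> B}"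
        unfolding kernel_eq[OF B] by (simp add: F_def indicator_def)
    qed
    finally have "emeasure \<nu> B = (\<Sum>h\<in>C. \<integral>\<^sup>+ \<omega>'. emeasure (first_marginal \<mu>) {y. \<bar>G h \<omega>' - y\<bar> \<in> B} \<partial>S) / card C"
      by (simp add: em[OF B])
    also have "\<dots> = (\<integral>\<^sup>+ x. emeasure (first_marginal \<mu>) {y. \<bar>x - y\<bar> \<in> B} \<partial>\<nu>)"
    proof (rule int[symmetric])
      have "(\<lambda>x. \<integral>\<^sup>+ y. indicator B \<bar>x - fst y\<bar> \<partial>\<mu>) \<in> borel_measurable borel"
        by (rule mu.borel_measurable_nn_integral) measurable
      moreover have "(\<integral>\<^sup>+ y. indicator B \<bar>x - fst y\<bar> \<partial>\<mu>) = emeasure (first_marginal \<mu>) {y. \<bar>x - y\<bar> \<in> B}" for x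
      proof -
        have *: "{y \<in> space borel. \<bar>x - y\<bar> \<in> B} \<in> sets borel" by measurable
        then have "emeasure (first_marginal \<mu>) {y. \<bar>x - y\<bar> \<in> B} = (\<integral>\<^sup>+ y. indicator {y. \<bar>x - y\<bar> \<in> B} y \<partial>distr \<mu> borel fst)"
          unfolding first_marginal_def by simp
        also have "\<dots> = (\<integral>\<^sup>+ y. indicator {y. \<bar>x - y\<bar> \<in> B} (fst y) \<partial>\<mu>)"
          using * by (intro nn_integral_distr) auto
        finally show ?thesis by (simp add: indicator_def)
      qed
      ultimately show "(\<lambda>x. emeasure (first_marginal \<mu>) {y. \<bar>x - y\<bar> \<in> B}) \<in> borel_measurable borel" by simp
    qed
    finally show "(\<integral>\<^sup>+ x. emeasure (first_marginal \<mu>) {y. \<bar>x - y\<bar> \<in> B} \<partial>\<nu>) = emeasure \<nu> B" ..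
  qed
  then show ?thesis ..
qed

end

section \<open>Uniqueness of stationary measures and reachability\<close>

context refl_setting
begin

lemma measurable_prob_X:
  assumes [measurable]: "B \<in> sets borel"
  shows "(\<lambda>x. measure S {\<omega>. X x n \<omega> \<in> B}) \<in> borel_measurable borel"
proof -
  have "(\<lambda>x. \<integral>\<^sup>+ \<omega>. indicator B (X x n \<omega>) \<partial>S) \<in> borel_measurable borel"
    by (rule P.borel_measurable_nn_integral) measurable
  moreover have "(\<integral>\<^sup>+ \<omega>. indicator B (X x n \<omega>) \<partial>S) = ennreal (measure S {\<omega>. X x n \<omega> \<in> B})" for x
  proof -
    have "{\<omega>. X x n \<omega> \<in> B} \<in> sets S" by (rule sets_Collect_S) measurable
    then have "emeasure S {\<omega>. X x n \<omega> \<in> B} = (\<integral>\<^sup>+ \<omega>. indicator {\<omega>. X x n \<omega> \<in> B} \<omega> \<partial>S)" by simp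
    then show ?thesis by (simp add: P.emeasure_eq_measure indicator_def)
  qed
  ultimately have "(\<lambda>x. ennreal (measure S {\<omega>. X x n \<omega> \<in> B})) \<in> borel_measurable borel" by simp
  then have "(\<lambda>x. enn2real (ennreal (measure S {\<omega>. X x n \<omega> \<in> B}))) \<in> borel_measurable borel" by measurable
  then show ?thesis by simp
qed

text \<open>The last step is split off, not the first: by induction the position at time
  \<open>n\<close> has the law \<nu> again, and the definition of invariance applies to one more
  step.\<close>

lemma stationary_n_step:
  assumes \<nu>: "stationary C \<nu>" and B: "B \<in> sets borel"
  shows "(\<integral>\<^sup>+ x. ennreal (measure S {\<omega>. X x n \<omega> \<in> B}) \<partial>\<nu>) = emeasure \<nu> B"
  using B
proof (induction n arbitrary: B)
  case (0 B)
  have [measurable_cong]: "sets \<nu> = sets borel" using \<nu> by (simp add: invariant_prob_on_def)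
  have "ennreal (measure S {\<omega>. X x 0 \<omega> \<in> B}) = indicator B x" for x
    using P.prob_space by (cases "x \<in> B") auto
  then show ?case using 0 by simp
next
  case (Suc n)
  note [measurable] = Suc.prems
  have sets\<nu> [measurable_cong]: "sets \<nu> = sets borel" using \<nu> by (simp add: invariant_prob_on_def)
  interpret \<nu>: prob_space \<nu> using \<nu> by (simp add: invariant_prob_on_def)
  interpret \<nu>S: pair_sigma_finite \<nu> S ..
  define N where "N = distr (\<nu> \<Otimes>\<^sub>M S) borel (\<lambda>(x, \<omega>). X x n \<omega>)"
  have [measurable]: "(\<lambda>(x, \<omega>). X x n \<omega>) \<in> borel_measurable (\<nu> \<Otimes>\<^sub>M S)" by measurable
  have "N = \<nu>"
  proof (rule measure_eqI)
    fix A assume "A \<in> sets N"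
    then have A [measurable]: "A \<in> sets borel" by (simp add: N_def)
    have "emeasure N A = (\<integral>\<^sup>+ z. indicator A z \<partial>N)" using A by (simp add: N_def)
    also have "\<dots> = (\<integral>\<^sup>+ p. indicator A (case p of (x, \<omega>) \<Rightarrow> X x n \<omega>) \<partial>(\<nu> \<Otimes>\<^sub>M S))"
      unfolding N_def by (rule nn_integral_distr) auto
    also have "\<dots> = (\<integral>\<^sup>+ x. \<integral>\<^sup>+ \<omega>. indicator A (X x n \<omega>) \<partial>S \<partial>\<nu>)"
      by (subst P.nn_integral_fst[symmetric]) auto
    also have "\<dots> = (\<integral>\<^sup>+ x. ennreal (measure S {\<omega>. X x n \<omega> \<in> A}) \<partial>\<nu>)"
    proof (rule nn_integral_cong)
      fix x
      have "{\<omega>. X x n \<omega> \<in> A} \<in> sets S" by (rule sets_Collect_S) measurable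
      then have "emeasure S {\<omega>. X x n \<omega> \<in> A} = (\<integral>\<^sup>+ \<omega>. indicator {\<omega>. X x n \<omega> \<in> A} \<omega> \<partial>S)" by simp
      then show "(\<integral>\<^sup>+ \<omega>. indicator A (X x n \<omega>) \<partial>S) = ennreal (measure S {\<omega>. X x n \<omega> \<in> A})"
        by (simp add: P.emeasure_eq_measure indicator_def)
    qed
    also have "\<dots> = emeasure \<nu> A" by (rule Suc.IH[OF A])
    finally show "emeasure N A = emeasure \<nu> A" .
  qed (simp add: N_def sets\<nu>)
  have [measurable]: "(\<lambda>z. ennreal (measure S {\<omega>. X z 1 \<omega> \<in> B})) \<in> borel_measurable borel"
    using measurable_prob_X[OF Suc.prems, of 1] by measurable
  have "(\<integral>\<^sup>+ x. ennreal (measure S {\<omega>. X x (Suc n) \<omega> \<in> B}) \<partial>\<nu>)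
      = (\<integral>\<^sup>+ x. \<integral>\<^sup>+ \<omega>. ennreal (measure S {\<omega>'. X (X x n \<omega>) 1 \<omega>' \<in> B}) \<partial>S \<partial>\<nu>)"
  proof (rule nn_integral_cong)
    fix x
    have "ennreal (measure S {\<omega>. X x (n + 1) \<omega> \<in> B})
        = (\<integral>\<^sup>+ \<omega>. ennreal (measure S {\<omega>'. X x (n + 1) (comb_seq n \<omega> \<omega>') \<in> B}) \<partial>S)"
      by (rule prob_comb) measurable
    then show "ennreal (measure S {\<omega>. X x (Suc n) \<omega> \<in> B}) = (\<integral>\<^sup>+ \<omega>. ennreal (measure S {\<omega>'. X (X x n \<omega>) 1 \<omega>' \<in> B}) \<partial>S)"
      unfolding X_comb by (simp only: Suc_eq_plus1)
  qed
  also have "\<dots> = (\<integral>\<^sup>+ p. ennreal (measure S {\<omega>'. X (case p of (x, \<omega>) \<Rightarrow> X x n \<omega>) 1 \<omega>' \<in> B}) \<partial>(\<nu> \<Otimes>\<^sub>M S))"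
    by (subst P.nn_integral_fst[symmetric]) (auto intro: measurable_compose[OF \<open>(\<lambda>(x, \<omega>). X x n \<omega>) \<in> borel_measurable (\<nu> \<Otimes>\<^sub>M S)\<close>])
  also have "\<dots> = (\<integral>\<^sup>+ z. ennreal (measure S {\<omega>'. X z 1 \<omega>' \<in> B}) \<partial>N)"
    unfolding N_def by (rule nn_integral_distr[symmetric]) auto
  also have "\<dots> = (\<integral>\<^sup>+ z. emeasure (first_marginal \<mu>) {y. \<bar>z - y\<bar> \<in> B} \<partial>\<nu>)"
    unfolding \<open>N = \<nu>\<close> kernel_eq[OF Suc.prems] P.emeasure_eq_measure ..
  also have "\<dots> = emeasure \<nu> B" using \<nu> Suc.prems by (simp add: invariant_prob_on_def)
  finally show ?case .
qed

lemma stationary_AE: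
  assumes "stationary C \<nu>" "coset C"
  shows "AE x in \<nu>. x \<in> coset_space I C"
proof -
  interpret \<nu>: prob_space \<nu> using assms by (simp add: invariant_prob_on_def)
  have "{x \<in> space \<nu>. x \<in> coset_space I C} = coset_space I C"
    using assms by (auto simp: invariant_prob_on_def dest: sets_eq_imp_space_eq)
  moreover have "coset_space I C \<in> sets \<nu>"
    using borel_closed[OF closed_coset_space[OF assms(2)]] assms(1) by (simp add: invariant_prob_on_def)
  ultimately show ?thesis
    using assms by (subst \<nu>.prob_Collect_eq_1[symmetric]) (auto simp: invariant_prob_on_def measure_def)
qed

text \<open>The coset space is the disjoint union of its fibres, so exactly one term of the sum
  survives.\<close>

lemma sum_indicator_class:
  assumes "z \<in> coset_space I C" "finite C"
  shows "(\<Sum>h\<in>C. indicator (parity_class I h) z * f h) = (f (parity I z) :: ennreal)"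
proof -
  have "z \<in> state_space I" "parity I z \<in> C" using assms(1) by (auto simp: coset_space_def)
  have "(\<Sum>h\<in>C. indicator (parity_class I h) z * f h) = (\<Sum>h\<in>C. if parity I z = h then f h else 0)"
    using \<open>z \<in> state_space I\<close> by (intro sum.cong) (auto simp: parity_class_def indicator_def)
  also have "\<dots> = f (parity I z)" using assms(2) \<open>parity I z \<in> C\<close> by simp
  finally show ?thesis .
qed

text \<open>By invariance \<nu> is a mixture of the laws at time \<open>n\<close> over its own
  starting points. Contraction replaces each starting point by the chosen point \<open>w h\<close>
  of its fibre, at the cost of enlarging the set by \<epsilon> and the probability by \<delta>.
  Uniqueness needs both directions.\<close>

lemma stationary_compare:
  assumes C: "coset C" and \<nu>: "stationary C \<nu>" and w: "\<forall>h\<in>C. w h \<in> parity_class I h"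
    and A: "A \<in> sets borel" and B: "B \<in> sets borel" and "\<epsilon> > 0" "\<delta> > 0"
    and AB: "\<forall>x y. x \<in> A \<longrightarrow> norm (x - y) < \<epsilon> \<longrightarrow> y \<in> B"
  shows "\<exists>n0. \<forall>n\<ge>n0.
      measure \<nu> A \<le> (\<Sum>h\<in>C. measure \<nu> (parity_class I h) * measure S {\<omega>. X (w h) n \<omega> \<in> B}) + \<delta> \<and>
      (\<Sum>h\<in>C. measure \<nu> (parity_class I h) * measure S {\<omega>. X (w h) n \<omega> \<in> A}) \<le> measure \<nu> B + \<delta>"
proof -
  have sets\<nu> [measurable_cong]: "sets \<nu> = sets borel" using \<nu> by (simp add: invariant_prob_on_def)
  interpret \<nu>: prob_space \<nu> using \<nu> by (simp add: invariant_prob_on_def)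
  have space\<nu>: "space \<nu> = UNIV" using sets_eq_imp_space_eq[OF sets\<nu>] by simp
  note [measurable] = A B
  have clsets [measurable]: "h \<in> C \<Longrightarrow> parity_class I h \<in> sets borel" for h
    using coset_subset[OF C] closed_parity_class by (intro borel_closed) auto
  have finC: "finite C" by simp
  have "\<delta> / 2 > 0" using \<open>\<delta> > 0\<close> by simp
  have "(\<lambda>n. measure \<nu> {x. norm x > real n}) \<longlonglongrightarrow> measure \<nu> (\<Inter>n. {x. norm x > real n})"
    by (rule \<nu>.finite_Lim_measure_decseq) (auto simp: decseq_def sets\<nu>)
  moreover have "(\<Inter>n. {x :: real ^ 'r. norm x > real n}) = {}"
    using reals_Archimedean2 less_asym by fastforce
  ultimately have "(\<lambda>n. measure \<nu> {x. norm x > real n}) \<longlonglongrightarrow> 0" by simp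
  from order_tendstoD(2)[OF this \<open>\<delta> / 2 > 0\<close>]
  obtain m0 where m0: "\<And>m. m \<ge> m0 \<Longrightarrow> measure \<nu> {x. norm x > real m} < \<delta> / 2"
    by (auto simp: eventually_sequentially)
  obtain m1 where m1: "(\<Sum>h\<in>C. norm (w h)) \<le> real m1" using real_arch_simple by blast
  define R where "R = real (max m0 m1)"
  have tail: "measure \<nu> {x. norm x > R} < \<delta> / 2" unfolding R_def by (rule m0) simp
  have wR: "norm (w h) \<le> R" if "h \<in> C" for h
  proof -
    have "norm (w h) \<le> (\<Sum>h\<in>C. norm (w h))" using that finC by (intro member_le_sum) auto
    then show ?thesis using m1 by (simp add: R_def)
  qed
  from X_contraction[OF \<open>\<epsilon> > 0\<close> \<open>\<delta> / 2 > 0\<close>, of R]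
  obtain n0 where n0: "\<forall>n\<ge>n0. \<forall>x x' h. x \<in> parity_class I h \<longrightarrow> x' \<in> parity_class I h \<longrightarrow> norm x \<le> R \<longrightarrow> norm x' \<le> R \<longrightarrow>
    measure S {\<omega>. norm (X x n \<omega> - X x' n \<omega>) \<ge> \<epsilon>} \<le> \<delta> / 2" by blast
  have compare: "measure S {\<omega>. X z n \<omega> \<in> A} \<le> measure S {\<omega>. X z' n \<omega> \<in> B} + \<delta> / 2"
    if "n \<ge> n0" "z \<in> parity_class I h" "z' \<in> parity_class I h" "norm z \<le> R" "norm z' \<le> R" for n z z' h
  proof -
    have "measure S {\<omega>. X z n \<omega> \<in> A} \<le> measure S {\<omega>. X z' n \<omega> \<in> B \<or> norm (X z n \<omega> - X z' n \<omega>) \<ge> \<epsilon>}"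
      by (rule prob_mono) (measurable, use AB in \<open>auto simp: not_le[symmetric]\<close>)
    also have "\<dots> \<le> measure S {\<omega>. X z' n \<omega> \<in> B} + measure S {\<omega>. norm (X z n \<omega> - X z' n \<omega>) \<ge> \<epsilon>}"
      by (rule prob_disj_le) measurable
    also have "measure S {\<omega>. norm (X z n \<omega> - X z' n \<omega>) \<ge> \<epsilon>} \<le> \<delta> / 2"
      using n0 that by blast
    finally show ?thesis by simp
  qed
  have tailset [measurable]: "{x :: real ^ 'r. norm x > R} \<in> sets borel" by measurable
  have err: "(\<integral>\<^sup>+ z. ennreal (\<delta> / 2) + indicator {x. norm x > R} z \<partial>\<nu>) \<le> ennreal \<delta>"
  proof -
    have "(\<integral>\<^sup>+ z. ennreal (\<delta> / 2) + indicator {x. norm x > R} z \<partial>\<nu>) = ennreal (\<delta> / 2) + emeasure \<nu> {x. norm x > R}"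
      by (subst nn_integral_add) (auto simp: \<nu>.emeasure_space_1 sets\<nu>)
    also have "\<dots> = ennreal (\<delta> / 2 + measure \<nu> {x. norm x > R})"
      using \<open>\<delta> > 0\<close> by (simp add: \<nu>.emeasure_eq_measure ennreal_plus)
    also have "\<dots> \<le> ennreal \<delta>" using tail by (intro ennreal_leI) simp
    finally show ?thesis .
  qed
  have mixture: "(\<integral>\<^sup>+ z. (\<Sum>h\<in>C. indicator (parity_class I h) z * ennreal (f h)) \<partial>\<nu>)
      = ennreal (\<Sum>h\<in>C. measure \<nu> (parity_class I h) * f h)" if "\<And>h. f h \<ge> 0" for f
  proof -
    have "(\<integral>\<^sup>+ z. (\<Sum>h\<in>C. indicator (parity_class I h) z * ennreal (f h)) \<partial>\<nu>)
        = (\<Sum>h\<in>C. \<integral>\<^sup>+ z. indicator (parity_class I h) z * ennreal (f h) \<partial>\<nu>)"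
      by (rule nn_integral_sum) measurable
    also have "\<dots> = (\<Sum>h\<in>C. ennreal (measure \<nu> (parity_class I h) * f h))"
      using clsets by (intro sum.cong refl) (simp add: nn_integral_multc sets\<nu> \<nu>.emeasure_eq_measure ennreal_mult that)
    also have "\<dots> = ennreal (\<Sum>h\<in>C. measure \<nu> (parity_class I h) * f h)"
      using that by (intro sum_ennreal) simp
    finally show ?thesis .
  qed
  have [measurable]: "(\<lambda>z. measure S {\<omega>. X z n \<omega> \<in> B}) \<in> borel_measurable borel"
    "(\<lambda>z. measure S {\<omega>. X z n \<omega> \<in> A}) \<in> borel_measurable borel" for n
    by (rule measurable_prob_X, simp add: A B)+
  have main: "measure \<nu> A \<le> (\<Sum>h\<in>C. measure \<nu> (parity_class I h) * measure S {\<omega>. X (w h) n \<omega> \<in> B}) + \<delta> \<and>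
      (\<Sum>h\<in>C. measure \<nu> (parity_class I h) * measure S {\<omega>. X (w h) n \<omega> \<in> A}) \<le> measure \<nu> B + \<delta>"
    if n: "n \<ge> n0" for n
  proof
    let ?err = "\<lambda>z. ennreal (\<delta> / 2) + indicator {x. norm x > R} z"
    \<comment> \<open>Inside the ball the comparison costs \<delta>/2; outside, the indicator alone
      exceeds any probability. Integrated, the two errors give at most \<delta>.\<close>
    have le: "ennreal a \<le> ennreal b + ?err z" if "norm z \<le> R \<Longrightarrow> a \<le> b + \<delta> / 2" "a \<le> 1" "b \<ge> 0" for a b z
    proof (cases "norm z \<le> R")
      case True
      then have "ennreal a \<le> ennreal (b + \<delta> / 2)" by (intro ennreal_leI that)
      with True \<open>\<delta> > 0\<close> that(3) show ?thesis by (simp add: ennreal_plus)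
    next
      case False
      then have "ennreal a \<le> indicator {x. norm x > R} z" using that(2) by (simp add: ennreal_leI flip: ennreal_1)
      also have "\<dots> \<le> ennreal b + ?err z" by (simp add: add_increasing)
      finally show ?thesis .
    qed
    have "ennreal (measure \<nu> A) = (\<integral>\<^sup>+ z. ennreal (measure S {\<omega>. X z n \<omega> \<in> A}) \<partial>\<nu>)"
      by (simp add: stationary_n_step[OF \<nu> A] \<nu>.emeasure_eq_measure)
    also have "\<dots> \<le> (\<integral>\<^sup>+ z. (\<Sum>h\<in>C. indicator (parity_class I h) z * ennreal (measure S {\<omega>. X (w h) n \<omega> \<in> B})) + ?err z \<partial>\<nu>)"
    proof (rule nn_integral_mono_AE)
      show "AE z in \<nu>. ennreal (measure S {\<omega>. X z n \<omega> \<in> A})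
          \<le> (\<Sum>h\<in>C. indicator (parity_class I h) z * ennreal (measure S {\<omega>. X (w h) n \<omega> \<in> B})) + ?err z"
        using stationary_AE[OF \<nu> C]
      proof eventually_elim
        case (elim z)
        then have z: "parity I z \<in> C" "z \<in> parity_class I (parity I z)" by (auto simp: coset_space_def parity_class_def)
        show ?case
          unfolding sum_indicator_class[OF elim finC]
          by (rule le[OF compare[OF n z(2) w[rule_format, OF z(1)] _ wR[OF z(1)]] P.prob_le_1 measure_nonneg])
      qed
    qed
    also have "\<dots> = (\<integral>\<^sup>+ z. (\<Sum>h\<in>C. indicator (parity_class I h) z * ennreal (measure S {\<omega>. X (w h) n \<omega> \<in> B})) \<partial>\<nu>) + (\<integral>\<^sup>+ z. ?err z \<partial>\<nu>)"
      by (rule nn_integral_add) measurable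
    also have "(\<integral>\<^sup>+ z. (\<Sum>h\<in>C. indicator (parity_class I h) z * ennreal (measure S {\<omega>. X (w h) n \<omega> \<in> B})) \<partial>\<nu>)
        = ennreal (\<Sum>h\<in>C. measure \<nu> (parity_class I h) * measure S {\<omega>. X (w h) n \<omega> \<in> B})"
      by (rule mixture) (rule measure_nonneg)
    also have "ennreal (\<Sum>h\<in>C. measure \<nu> (parity_class I h) * measure S {\<omega>. X (w h) n \<omega> \<in> B}) + (\<integral>\<^sup>+ z. ?err z \<partial>\<nu>)
        \<le> ennreal (\<Sum>h\<in>C. measure \<nu> (parity_class I h) * measure S {\<omega>. X (w h) n \<omega> \<in> B}) + ennreal \<delta>"
      by (rule add_left_mono[OF err])
    also have "\<dots> = ennreal ((\<Sum>h\<in>C. measure \<nu> (parity_class I h) * measure S {\<omega>. X (w h) n \<omega> \<in> B}) + \<delta>)"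
      using \<open>\<delta> > 0\<close> by (intro ennreal_plus[symmetric] sum_nonneg) auto
    finally show "measure \<nu> A \<le> (\<Sum>h\<in>C. measure \<nu> (parity_class I h) * measure S {\<omega>. X (w h) n \<omega> \<in> B}) + \<delta>"
      using \<open>\<delta> > 0\<close> by (subst (asm) ennreal_le_iff) (auto intro!: add_nonneg_nonneg sum_nonneg)
    have "ennreal (\<Sum>h\<in>C. measure \<nu> (parity_class I h) * measure S {\<omega>. X (w h) n \<omega> \<in> A})
        = (\<integral>\<^sup>+ z. (\<Sum>h\<in>C. indicator (parity_class I h) z * ennreal (measure S {\<omega>. X (w h) n \<omega> \<in> A})) \<partial>\<nu>)"
      by (rule mixture[symmetric]) (rule measure_nonneg)
    also have "\<dots> \<le> (\<integral>\<^sup>+ z. ennreal (measure S {\<omega>. X z n \<omega> \<in> B}) + ?err z \<partial>\<nu>)"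
    proof (rule nn_integral_mono_AE)
      show "AE z in \<nu>. (\<Sum>h\<in>C. indicator (parity_class I h) z * ennreal (measure S {\<omega>. X (w h) n \<omega> \<in> A}))
          \<le> ennreal (measure S {\<omega>. X z n \<omega> \<in> B}) + ?err z"
        using stationary_AE[OF \<nu> C]
      proof eventually_elim
        case (elim z)
        then have z: "parity I z \<in> C" "z \<in> parity_class I (parity I z)" by (auto simp: coset_space_def parity_class_def)
        show ?case
          unfolding sum_indicator_class[OF elim finC]
          by (rule le[OF compare[OF n w[rule_format, OF z(1)] z(2) wR[OF z(1)]] P.prob_le_1 measure_nonneg])
      qed
    qed
    also have "\<dots> = (\<integral>\<^sup>+ z. ennreal (measure S {\<omega>. X z n \<omega> \<in> B}) \<partial>\<nu>) + (\<integral>\<^sup>+ z. ?err z \<partial>\<nu>)"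
      by (rule nn_integral_add) measurable
    also have "(\<integral>\<^sup>+ z. ennreal (measure S {\<omega>. X z n \<omega> \<in> B}) \<partial>\<nu>) = emeasure \<nu> B"
      by (rule stationary_n_step[OF \<nu> B])
    also have "emeasure \<nu> B + (\<integral>\<^sup>+ z. ?err z \<partial>\<nu>) \<le> emeasure \<nu> B + ennreal \<delta>" by (rule add_left_mono[OF err])
    also have "\<dots> = ennreal (measure \<nu> B + \<delta>)"
      using \<open>\<delta> > 0\<close> by (simp add: \<nu>.emeasure_eq_measure ennreal_plus)
    finally show "(\<Sum>h\<in>C. measure \<nu> (parity_class I h) * measure S {\<omega>. X (w h) n \<omega> \<in> A}) \<le> measure \<nu> B + \<delta>"
      using \<open>\<delta> > 0\<close> by (subst (asm) ennreal_le_iff) auto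
  qed
  then show ?thesis by blast
qed

text \<open>The masses of the fibres are stationary for the random walk on the coset whose steps are
  the parities of the increments. A maximum principle makes them equal: from a fibre of maximal
  mass, every atom of the step law leads to another one, and the atoms generate \<Gamma>.\<close>

lemma stationary_class_mass:
  assumes C: "coset C" and \<nu>: "stationary C \<nu>" and "h \<in> C"
  shows "measure \<nu> (parity_class I h) = 1 / real (card C)"
proof -
  have sets\<nu> [measurable_cong]: "sets \<nu> = sets borel" using \<nu> by (simp add: invariant_prob_on_def)
  interpret \<nu>: prob_space \<nu> using \<nu> by (simp add: invariant_prob_on_def)
  have clsets [measurable]: "h \<in> C \<Longrightarrow> parity_class I h \<in> sets borel" for h
    using coset_subset[OF C] closed_parity_class by (intro borel_closed) auto
  have finC: "finite C" by simp
  define p where "p h = measure \<nu> (parity_class I h)" for h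
  define q where "q \<gamma> = measure \<mu> {y. par y = \<gamma>}" for \<gamma>
  have balance: "p h = (\<Sum>g\<in>C. p g * q (h + g))" if h: "h \<in> C" for h
  proof -
    have kernel: "emeasure (first_marginal \<mu>) {y. \<bar>x - y\<bar> \<in> parity_class I h} = ennreal (q (h + parity I x))"
      if "x \<in> coset_space I C" for x
    proof -
      have "{y \<in> space \<mu>. \<bar>x - fst y\<bar> \<in> parity_class I h} \<in> sets \<mu>" using clsets[OF h] by measurable
      then have "emeasure (first_marginal \<mu>) {y. \<bar>x - y\<bar> \<in> parity_class I h} = emeasure \<mu> {y. \<bar>x - fst y\<bar> \<in> parity_class I h}"
        using clsets[OF h] unfolding first_marginal_def by (subst emeasure_distr) (auto simp: vimage_def)
      also have "\<dots> = emeasure \<mu> {y. par y = h + parity I x}"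
      proof (rule emeasure_eq_AE)
        show "AE y in \<mu>. y \<in> {y. \<bar>x - fst y\<bar> \<in> parity_class I h} \<longleftrightarrow> y \<in> {y. par y = h + parity I x}"
          using AE_integer
        proof eventually_elim
          case (elim y)
          have "\<bar>x - fst y\<bar> \<in> parity_class I (parity I x + par y)"
            unfolding par_def using that elim by (intro parity_step) (auto simp: coset_space_def)
          then have "\<bar>x - fst y\<bar> \<in> parity_class I h \<longleftrightarrow> parity I x + par y = h" by (auto simp: parity_class_def)
          also have "\<dots> \<longleftrightarrow> par y = h + parity I x"
            by (metis add.commute add_add_bit_vec)
          finally show ?case by simp
        qed
      qed (use \<open>{y \<in> space \<mu>. _} \<in> sets \<mu>\<close> sets_par in auto)
      finally show ?thesis by (simp add: q_def mu.emeasure_eq_measure)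
    qed
    have "ennreal (p h) = (\<integral>\<^sup>+ x. emeasure (first_marginal \<mu>) {y. \<bar>x - y\<bar> \<in> parity_class I h} \<partial>\<nu>)"
      using \<nu> clsets[OF h] by (simp add: invariant_prob_on_def p_def \<nu>.emeasure_eq_measure)
    also have "\<dots> = (\<integral>\<^sup>+ x. (\<Sum>g\<in>C. indicator (parity_class I g) x * ennreal (q (h + g))) \<partial>\<nu>)"
    proof (rule nn_integral_cong_AE)
      show "AE x in \<nu>. emeasure (first_marginal \<mu>) {y. \<bar>x - y\<bar> \<in> parity_class I h}
          = (\<Sum>g\<in>C. indicator (parity_class I g) x * ennreal (q (h + g)))"
        using stationary_AE[OF \<nu> C] by eventually_elim (simp only: kernel sum_indicator_class[OF _ finC])
    qed
    also have "\<dots> = (\<Sum>g\<in>C. \<integral>\<^sup>+ x. indicator (parity_class I g) x * ennreal (q (h + g)) \<partial>\<nu>)"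
      by (rule nn_integral_sum) measurable
    also have "\<dots> = (\<Sum>g\<in>C. ennreal (p g * q (h + g)))"
      using clsets by (intro sum.cong refl) (simp add: nn_integral_multc sets\<nu> \<nu>.emeasure_eq_measure ennreal_mult p_def q_def)
    also have "\<dots> = ennreal (\<Sum>g\<in>C. p g * q (h + g))"
      by (intro sum_ennreal) (simp add: p_def q_def)
    finally show ?thesis
      by (subst (asm) ennreal_inj) (auto simp: p_def q_def intro!: sum_nonneg)
  qed
  have q1: "(\<Sum>g\<in>C. q (h + g)) = 1" if h: "h \<in> C" for h
  proof -
    have "(\<Sum>g\<in>C. q (h + g)) = (\<Sum>\<gamma>\<in>\<Gamma>. q \<gamma>)"
    proof (rule sum.reindex_bij_witness[of _ "\<lambda>\<gamma>. h + \<gamma>" "\<lambda>g. h + g"])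
      show "h + (h + g) = g" for g by (simp add: add.assoc[symmetric])
      show "h + (h + g) = g" for g by (simp add: add.assoc[symmetric])
    qed (use coset_add[OF C h] coset_diff[OF C h] in auto)
    also have "\<dots> = measure \<mu> (\<Union>\<gamma>\<in>\<Gamma>. {y. par y = \<gamma>})"
      unfolding q_def by (rule mu.finite_measure_finite_Union[symmetric]) (auto simp: sets_par disjoint_family_on_def)
    also have "\<dots> = 1"
    proof -
      have "(\<Union>\<gamma>\<in>\<Gamma>. {y. par y = \<gamma>}) \<in> sets \<mu>" by (intro sets.finite_UN) (auto simp: sets_par)
      then show ?thesis using AE_par_\<Gamma> mu.prob_eq_1[of "\<Union>\<gamma>\<in>\<Gamma>. {y. par y = \<gamma>}"] by auto
    qed
    finally show ?thesis .
  qed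
  define M where "M = Max (p ` C)"
  have "M \<in> p ` C" unfolding M_def using coset_nonempty[OF C] by (intro Max_in) auto
  then obtain h0 where h0: "h0 \<in> C" "p h0 = M" by auto
  have pM: "p g \<le> M" if "g \<in> C" for g unfolding M_def using that by (intro Max_ge) auto
  \<comment> \<open>A weighted mean of the masses with weights \<open>q\<close> equals the maximum,
    so every mass with positive weight is maximal.\<close>
  have spread: "p (h + \<gamma>) = M" if h: "h \<in> C" "p h = M" and \<gamma>: "emeasure \<mu> {y. par y = \<gamma>} > 0" for h \<gamma>
  proof -
    have "(\<Sum>g\<in>C. (M - p g) * q (h + g)) = M * (\<Sum>g\<in>C. q (h + g)) - (\<Sum>g\<in>C. p g * q (h + g))"
      by (simp add: algebra_simps sum_subtractf sum_distrib_left)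
    also have "\<dots> = 0" using balance[OF h(1)] q1[OF h(1)] h(2) by simp
    finally have "\<forall>g\<in>C. (M - p g) * q (h + g) = 0"
      using pM by (subst (asm) sum_nonneg_eq_0_iff) (auto simp: q_def)
    moreover have "h + \<gamma> \<in> C" using coset_add[OF C h(1) atom_in_\<Gamma>[OF \<gamma>]] .
    ultimately have "(M - p (h + \<gamma>)) * q (h + (h + \<gamma>)) = 0" by blast
    moreover have "h + (h + \<gamma>) = \<gamma>" by (simp add: add.assoc[symmetric])
    moreover have "q \<gamma> > 0" using \<gamma> by (simp add: q_def mu.emeasure_eq_measure)
    ultimately show ?thesis by simp
  qed
  have "p (h0 + \<gamma>) = M" if "\<gamma> \<in> \<Gamma>" for \<gamma>
    using that
  proof (rule \<Gamma>_induct)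
    fix g h assume "g \<in> \<Gamma>" "p (h0 + g) = M" "emeasure \<mu> {y. par y = h} > 0"
    then show "p (h0 + (g + h)) = M"
      using spread[of "h0 + g" h] coset_add[OF C h0(1)] by (simp add: add.assoc)
  qed (use h0 in simp)
  moreover have "h0 + (h0 + g) = g" for g by (simp add: add.assoc[symmetric])
  ultimately have all: "p g = M" if "g \<in> C" for g
    using coset_diff[OF C h0(1) that] by metis
  have "(\<Sum>g\<in>C. p g) = measure \<nu> (\<Union>g\<in>C. parity_class I g)"
    unfolding p_def using clsets
    by (intro \<nu>.finite_measure_finite_Union[symmetric]) (auto simp: sets\<nu> disjoint_family_on_def parity_class_def)
  also have "\<dots> = 1" using \<nu> unfolding invariant_prob_on_def coset_space_eq by (simp add: measure_def)
  finally have "real (card C) * M = 1" using all by simp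
  then show ?thesis using all[OF \<open>h \<in> C\<close>] coset_nonempty[OF C] by (simp add: p_def eq_divide_eq mult.commute)
qed

text \<open>Both measures are compared with the same mixture of walks started at the
  representatives; the weights agree by \<open>stationary_class_mass\<close>. Each comparison
  enlarges a closed set by \<epsilon>/2, and closed sets are the limits of their neighbourhoods and
  generate the Borel sets.\<close>

lemma stationary_unique:
  assumes C: "coset C" and \<nu>: "stationary C \<nu>1" "stationary C \<nu>2"
  shows "\<nu>1 = \<nu>2"
proof -
  have le: "measure \<nu> F \<le> measure \<nu>' F" if \<nu>: "stationary C \<nu>" and \<nu>': "stationary C \<nu>'" and F: "closed F" for \<nu> \<nu>' F
  proof -
    have sets\<nu>': "sets \<nu>' = sets borel" using \<nu>' by (simp add: invariant_prob_on_def)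
    interpret \<nu>': prob_space \<nu>' using \<nu>' by (simp add: invariant_prob_on_def)
    define nb where "nb \<epsilon> = (\<Union>x\<in>F. ball x \<epsilon>)" for \<epsilon>
    have op: "open (nb \<epsilon>)" for \<epsilon> unfolding nb_def by auto
    have rep: "\<forall>h\<in>C. parity_rep h \<in> parity_class I h"
      using coset_subset[OF C] parity_rep_in_class by auto
    have "measure \<nu> F \<le> measure \<nu>' (nb \<epsilon>)" if "\<epsilon> > 0" for \<epsilon>
    proof (rule field_le_epsilon)
      fix \<delta> :: real assume "\<delta> > 0"
      then have e: "\<epsilon> / 2 > 0" "\<delta> / 2 > 0" using \<open>\<epsilon> > 0\<close> by auto
      have AB1: "\<forall>x y. x \<in> F \<longrightarrow> norm (x - y) < \<epsilon> / 2 \<longrightarrow> y \<in> nb (\<epsilon> / 2)"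
        by (auto simp: nb_def dist_norm)
      have AB2: "\<forall>x y. x \<in> nb (\<epsilon> / 2) \<longrightarrow> norm (x - y) < \<epsilon> / 2 \<longrightarrow> y \<in> nb \<epsilon>"
      proof (intro allI impI)
        fix x y assume x: "x \<in> nb (\<epsilon> / 2)" and xy: "norm (x - y) < \<epsilon> / 2"
        from x obtain z where z: "z \<in> F" "dist z x < \<epsilon> / 2" by (auto simp: nb_def)
        have "dist z y < \<epsilon>" using dist_triangle_less_add[of z x "\<epsilon> / 2" y "\<epsilon> / 2"] z(2) xy by (simp add: dist_norm norm_minus_commute)
        with z(1) show "y \<in> nb \<epsilon>" by (auto simp: nb_def)
      qed
      obtain n1 where n1: "\<forall>n\<ge>n1. measure \<nu> F \<le> (\<Sum>h\<in>C. measure \<nu> (parity_class I h) * measure S {\<omega>. X (parity_rep h) n \<omega> \<in> nb (\<epsilon> / 2)}) + \<delta> / 2"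
        using stationary_compare[OF C \<nu> rep borel_closed[OF F] borel_open[OF op] e AB1] by blast
      obtain n2 where n2: "\<forall>n\<ge>n2. (\<Sum>h\<in>C. measure \<nu>' (parity_class I h) * measure S {\<omega>. X (parity_rep h) n \<omega> \<in> nb (\<epsilon> / 2)}) \<le> measure \<nu>' (nb \<epsilon>) + \<delta> / 2"
        using stationary_compare[OF C \<nu>' rep borel_open[OF op] borel_open[OF op] e AB2] by blast
      have "measure \<nu> F \<le> (\<Sum>h\<in>C. measure \<nu> (parity_class I h) * measure S {\<omega>. X (parity_rep h) (max n1 n2) \<omega> \<in> nb (\<epsilon> / 2)}) + \<delta> / 2"
        using n1 by simp
      also have "(\<Sum>h\<in>C. measure \<nu> (parity_class I h) * measure S {\<omega>. X (parity_rep h) (max n1 n2) \<omega> \<in> nb (\<epsilon> / 2)})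
          = (\<Sum>h\<in>C. measure \<nu>' (parity_class I h) * measure S {\<omega>. X (parity_rep h) (max n1 n2) \<omega> \<in> nb (\<epsilon> / 2)})"
        using stationary_class_mass[OF C \<nu>] stationary_class_mass[OF C \<nu>'] by (intro sum.cong) auto
      also have "\<dots> \<le> measure \<nu>' (nb \<epsilon>) + \<delta> / 2" using n2 by simp
      finally show "measure \<nu> F \<le> measure \<nu>' (nb \<epsilon>) + \<delta>" by simp
    qed
    then have "\<And>n. measure \<nu> F \<le> measure \<nu>' (nb (1 / Suc n))" by simp
    moreover have "(\<lambda>n. measure \<nu>' (nb (1 / Suc n))) \<longlonglongrightarrow> measure \<nu>' (\<Inter>n. nb (1 / Suc n))"
    proof (rule \<nu>'.finite_Lim_measure_decseq)
      show "range (\<lambda>n. nb (1 / Suc n)) \<subseteq> sets \<nu>'" using op by (auto simp: sets\<nu>')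
      show "decseq (\<lambda>n. nb (1 / Suc n))"
        unfolding decseq_def nb_def by (intro allI impI UN_mono subset_refl subset_ball) (simp add: frac_le)
    qed
    moreover have "(\<Inter>n. nb (1 / Suc n)) = F"
    proof
      show "(\<Inter>n. nb (1 / Suc n)) \<subseteq> F"
      proof
        fix x assume x: "x \<in> (\<Inter>n. nb (1 / Suc n))"
        have "x \<in> closure F"
          unfolding closure_approachable
        proof (intro allI impI)
          fix e :: real assume "e > 0"
          then obtain n where n: "1 / real (Suc n) < e" using nat_approx_posE by blast
          have "x \<in> nb (1 / Suc n)" using x by blast
          then obtain z where "z \<in> F" "dist z x < 1 / Suc n" by (auto simp: nb_def)
          with n show "\<exists>y\<in>F. dist y x < e" by (intro bexI[of _ z]) auto
        qed
        with F show "x \<in> F" by simp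
      qed
    qed (auto simp: nb_def)
    ultimately show ?thesis by (intro LIMSEQ_le_const) auto
  qed
  have s: "sets \<nu>1 = sets borel" "sets \<nu>2 = sets borel" using \<nu> by (auto simp: invariant_prob_on_def)
  interpret N1: prob_space \<nu>1 using \<nu> by (simp add: invariant_prob_on_def)
  interpret N2: prob_space \<nu>2 using \<nu> by (simp add: invariant_prob_on_def)
  have gen: "sets borel = sigma_sets UNIV (Collect closed :: (real ^ 'r) set set)"
    unfolding borel_eq_closed by simp
  show ?thesis
  proof (rule measure_eqI_generator_eq[where E = "Collect closed" and \<Omega> = UNIV and A = "\<lambda>_. UNIV"])
    show "Int_stable (Collect closed)" by (auto simp: Int_stable_def)
    fix F assume "F \<in> Collect (closed :: (real ^ 'r) set \<Rightarrow> bool)"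
    then have "measure \<nu>1 F = measure \<nu>2 F" using le \<nu> by (intro antisym) auto
    then show "emeasure \<nu>1 F = emeasure \<nu>2 F" by (simp add: N1.emeasure_eq_measure N2.emeasure_eq_measure)
  qed (use s gen in auto)
qed

lemma the_stationary:
  assumes "coset C"
  shows "stationary C (THE \<nu>. stationary C \<nu>)"
  using stationary_exists[OF assms] stationary_unique[OF assms] by (metis (no_types, lifting) the_equality)

text \<open>If the walk from \<open>z\<close> almost surely misses the ball at every time, so does
  the walk from almost every successor; following the atoms of the parity law yields such a bad
  point in every fibre of the coset. Comparing \<nu> with the walks from these points makes the ball
  of half the radius null, against \<open>x\<close> being in the support. One point per fibre is
  required because \<open>stationary_compare\<close> exchanges starting points only within a
  fibre.\<close>

lemma reach:
  assumes C: "coset C" and \<nu>: "stationary C \<nu>" and x: "x \<in> measure_support \<nu>"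
    and z: "z \<in> coset_space I C" and "\<epsilon> > 0"
  shows "\<exists>j. measure S {\<omega>. norm (X z j \<omega> - x) < \<epsilon>} > 0"
proof (rule ccontr)
  interpret \<nu>: prob_space \<nu> using \<nu> by (simp add: invariant_prob_on_def)
  define bad where "bad z \<longleftrightarrow> (\<forall>j. measure S {\<omega>. norm (X z j \<omega> - x) < \<epsilon>} = 0)" for z
  assume "\<not> ?thesis"
  then have "bad z" unfolding bad_def by (simp add: zero_less_measure_iff)
  have "\<exists>z'\<in>parity_class I (parity I z + \<gamma>). bad z'" if "\<gamma> \<in> \<Gamma>" for \<gamma>
    using that
  proof (rule \<Gamma>_induct)
    show "\<exists>z'\<in>parity_class I (parity I z + 0). bad z'"
      using z \<open>bad z\<close> by (auto simp: coset_space_def parity_class_def)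
    fix g h assume "\<exists>z'\<in>parity_class I (parity I z + g). bad z'" and h: "emeasure \<mu> {y. par y = h} > 0"
    then obtain z' where z': "z' \<in> parity_class I (parity I z + g)" "bad z'" by blast
    have "AE \<omega> in S. \<forall>j. measure S {\<omega>'. norm (X \<bar>z' - fst (\<omega> 0)\<bar> j \<omega>' - x) < \<epsilon>} = 0"
      unfolding AE_all_countable
    proof
      fix j
      have "(\<integral>\<^sup>+ \<omega>. ennreal (measure S {\<omega>'. norm (X z' (1 + j) (comb_seq 1 \<omega> \<omega>') - x) < \<epsilon>}) \<partial>S)
          = ennreal (measure S {\<omega>. norm (X z' (1 + j) \<omega> - x) < \<epsilon>})"
        by (rule prob_comb[symmetric]) measurable
      also have "\<dots> = 0" using z'(2) unfolding bad_def by (simp only: ennreal_0)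
      finally have "(\<integral>\<^sup>+ \<omega>. ennreal (measure S {\<omega>'. norm (X (X z' 1 \<omega>) j \<omega>' - x) < \<epsilon>}) \<partial>S) = 0"
        unfolding X_comb .
      moreover have "(\<lambda>\<omega>. ennreal (measure S {\<omega>'. norm (X (X z' 1 \<omega>) j \<omega>' - x) < \<epsilon>})) \<in> borel_measurable S"
      proof -
        have "{y :: real ^ 'r. norm (y - x) < \<epsilon>} \<in> sets borel" by measurable
        from measurable_prob_X[OF this, of j]
        have m: "(\<lambda>z. measure S {\<omega>. norm (X z j \<omega> - x) < \<epsilon>}) \<in> borel_measurable borel" by simp
        have "(\<lambda>\<omega>. X z' 1 \<omega>) \<in> borel_measurable S" by measurable
        from measurable_compose[OF measurable_compose[OF this m] measurable_ennreal] show ?thesis .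
      qed
      ultimately have "AE \<omega> in S. ennreal (measure S {\<omega>'. norm (X (X z' 1 \<omega>) j \<omega>' - x) < \<epsilon>}) = 0"
        by (subst (asm) nn_integral_0_iff_AE) auto
      then show "AE \<omega> in S. measure S {\<omega>'. norm (X \<bar>z' - fst (\<omega> 0)\<bar> j \<omega>' - x) < \<epsilon>} = 0"
        by eventually_elim (simp add: ennreal_eq_0_iff measure_le_0_iff)
    qed
    moreover note AE_integers
    ultimately have ae: "AE \<omega> in S. bad \<bar>z' - fst (\<omega> 0)\<bar> \<and> (\<forall>i\<in>I. fst (\<omega> 0) $ i \<in> \<int>)"
      by eventually_elim (auto simp: bad_def)
    have "\<exists>\<omega> :: nat \<Rightarrow> (real ^ 'r) \<times> (real ^ 's). (bad \<bar>z' - fst (\<omega> 0)\<bar> \<and> (\<forall>i\<in>I. fst (\<omega> 0) $ i \<in> \<int>)) \<and> par (\<omega> 0) = h"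
    proof (rule ccontr)
      assume no: "\<not> ?thesis"
      have "AE \<omega> in S. par (\<omega> 0) = h \<longrightarrow> False"
        using ae by eventually_elim (use no in blast)
      then have "measure S {\<omega>. par (\<omega> 0) = h} \<le> measure S {\<omega>. False}" by (intro prob_mono_AE) auto
      moreover have "measure S {\<omega>. par (\<omega> 0) = h} = measure \<mu> {y. par y = h}"
        by (rule prob_component) measurable
      ultimately show False using h by (simp add: mu.emeasure_eq_measure)
    qed
    then obtain \<omega> :: "nat \<Rightarrow> (real ^ 'r) \<times> (real ^ 's)" where w: "bad \<bar>z' - fst (\<omega> 0)\<bar>" "\<forall>i\<in>I. fst (\<omega> 0) $ i \<in> \<int>" "par (\<omega> 0) = h" by blast
    have "\<bar>z' - fst (\<omega> 0)\<bar> \<in> parity_class I (parity I z' + parity I (fst (\<omega> 0)))"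
      using z'(1) w(2) by (intro parity_step) (auto simp: parity_class_def)
    moreover have "parity I z' = parity I z + g" using z'(1) by (simp add: parity_class_def)
    ultimately have "\<bar>z' - fst (\<omega> 0)\<bar> \<in> parity_class I (parity I z + (g + h))"
      using w(3) by (simp add: par_def add.assoc)
    with w(1) show "\<exists>z'\<in>parity_class I (parity I z + (g + h)). bad z'" by blast
  qed
  then have "\<forall>h\<in>C. \<exists>z'. z' \<in> parity_class I h \<and> bad z'"
  proof (intro ballI)
    fix h assume h: "h \<in> C" and *: "\<And>\<gamma>. \<gamma> \<in> \<Gamma> \<Longrightarrow> \<exists>z'\<in>parity_class I (parity I z + \<gamma>). bad z'"
    have "parity I z \<in> C" using z by (simp add: coset_space_def)
    from coset_diff[OF C this h] * have "\<exists>z'\<in>parity_class I (parity I z + (parity I z + h)). bad z'" by blast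
    then show "\<exists>z'. z' \<in> parity_class I h \<and> bad z'" by (simp add: add.assoc[symmetric]) blast
  qed
  from bchoice[OF this] obtain w where w: "\<forall>h\<in>C. w h \<in> parity_class I h \<and> bad (w h)" ..
  have "measure \<nu> (ball x (\<epsilon> / 2)) \<le> 0"
  proof (rule field_le_epsilon)
    fix \<delta> :: real assume "\<delta> > 0"
    have AB: "\<forall>x' y. x' \<in> ball x (\<epsilon> / 2) \<longrightarrow> norm (x' - y) < \<epsilon> / 2 \<longrightarrow> y \<in> {y. norm (y - x) < \<epsilon>}"
    proof (intro allI impI)
      fix x' y assume "x' \<in> ball x (\<epsilon> / 2)" "norm (x' - y) < \<epsilon> / 2"
      then show "y \<in> {y. norm (y - x) < \<epsilon>}"
        using norm_triangle_lt[of "x - x'" "x' - y" \<epsilon>] by (simp add: dist_norm norm_minus_commute)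
    qed
    have w': "\<forall>h\<in>C. w h \<in> parity_class I h" using w by blast
    have e: "\<epsilon> / 2 > 0" using \<open>\<epsilon> > 0\<close> by simp
    have "{y. norm (y - x) < \<epsilon>} \<in> sets borel" by measurable
    from stationary_compare[OF C \<nu> w' borel_open[OF open_ball] this e \<open>\<delta> > 0\<close> AB]
    obtain n0 where "\<forall>n\<ge>n0. measure \<nu> (ball x (\<epsilon> / 2)) \<le>
        (\<Sum>h\<in>C. measure \<nu> (parity_class I h) * measure S {\<omega>. X (w h) n \<omega> \<in> {y. norm (y - x) < \<epsilon>}}) + \<delta>" by blast
    then have "measure \<nu> (ball x (\<epsilon> / 2)) \<le>
        (\<Sum>h\<in>C. measure \<nu> (parity_class I h) * measure S {\<omega>. X (w h) n0 \<omega> \<in> {y. norm (y - x) < \<epsilon>}}) + \<delta>" by blast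
    also have "(\<Sum>h\<in>C. measure \<nu> (parity_class I h) * measure S {\<omega>. X (w h) n0 \<omega> \<in> {y. norm (y - x) < \<epsilon>}}) = 0"
      using w by (intro sum.neutral) (auto simp: bad_def)
    finally show "measure \<nu> (ball x (\<epsilon> / 2)) \<le> 0 + \<delta>" by simp
  qed
  moreover have "emeasure \<nu> (ball x (\<epsilon> / 2)) > 0"
    using x \<open>\<epsilon> > 0\<close> by (simp add: measure_support_def)
  ultimately show False by (simp add: \<nu>.emeasure_eq_measure)
qed

end

section \<open>Recurrence from divergence of occupation sums\<close>

text \<open>In a cubic grid of mesh \<epsilon>/d, with d the dimension, two points of the same cell
  are less than \<epsilon> apart in the sum norm; so the cells meeting the ball bound the number of
  points.\<close>

lemma separated_card_bound:
  fixes z :: "'k \<Rightarrow> real ^ 's"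
  assumes "finite T" "\<epsilon> > 0" and sep: "\<And>k l. k \<in> T \<Longrightarrow> l \<in> T \<Longrightarrow> k \<noteq> l \<Longrightarrow> norm (z k - z l) \<ge> \<epsilon>"
    and ball: "\<And>k. k \<in> T \<Longrightarrow> norm (z k) \<le> r" and "r \<ge> 0"
  shows "real (card T) \<le> (2 * r * real CARD('s) / \<epsilon> + 3) ^ CARD('s)"
proof -
  define d where "d = real CARD('s)"
  have d: "d > 0" by (simp add: d_def)
  \<comment> \<open>The index of the cell of \<open>z k\<close>; along each axis the indices range
    over 2A + 1 values, and rounding up in \<open>A\<close> accounts for the 3 in the bound.\<close>
  define \<phi> where "\<phi> k = (\<lambda>j. \<lfloor>z k $ j * d / \<epsilon>\<rfloor>)" for k
  define A where "A = nat \<lceil>r * d / \<epsilon>\<rceil>"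
  have inj: "inj_on \<phi> T"
  proof (rule inj_onI, rule ccontr)
    fix k l assume kl: "k \<in> T" "l \<in> T" "\<phi> k = \<phi> l" "k \<noteq> l"
    have "\<bar>(z k - z l) $ j\<bar> < \<epsilon> / d" for j
    proof -
      have "\<lfloor>z k $ j * d / \<epsilon>\<rfloor> = \<lfloor>z l $ j * d / \<epsilon>\<rfloor>" using kl(3) by (simp add: \<phi>_def fun_eq_iff)
      then have "\<bar>z k $ j * d / \<epsilon> - z l $ j * d / \<epsilon>\<bar> < 1" by linarith
      moreover have "z k $ j * d / \<epsilon> - z l $ j * d / \<epsilon> = ((z k - z l) $ j) * (d / \<epsilon>)" by (simp add: algebra_simps diff_divide_distrib)
      ultimately have "\<bar>(z k - z l) $ j\<bar> * (d / \<epsilon>) < 1" using d \<open>\<epsilon> > 0\<close> by (simp add: abs_mult)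
      then show ?thesis using d \<open>\<epsilon> > 0\<close> by (simp add: field_simps)
    qed
    then have "(\<Sum>j\<in>UNIV. \<bar>(z k - z l) $ j\<bar>) < (\<Sum>j\<in>(UNIV :: 's set). \<epsilon> / d)" by (intro sum_strict_mono) auto
    also have "\<dots> = \<epsilon>" using d by (simp add: d_def)
    finally have "norm (z k - z l) < \<epsilon>" using norm_le_l1_cart[of "z k - z l"] by simp
    with sep[OF kl(1,2,4)] show False by simp
  qed
  have "\<phi> ` T \<subseteq> (UNIV :: 's set) \<rightarrow>\<^sub>E {- int A..int A}"
  proof (rule image_subsetI, rule PiE_I)
    fix k j assume "k \<in> T"
    then have "\<bar>z k $ j\<bar> \<le> r" using ball component_le_norm_cart[of "z k" j] by fastforce
    then have "\<bar>z k $ j * d / \<epsilon>\<bar> \<le> r * d / \<epsilon>"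
      using d \<open>\<epsilon> > 0\<close> by (simp add: abs_mult divide_right_mono mult_right_mono)
    moreover have "r * d / \<epsilon> \<le> real A" unfolding A_def by (rule real_nat_ceiling_ge)
    ultimately have "\<bar>z k $ j * d / \<epsilon>\<bar> \<le> real A" by linarith
    then have "- int A \<le> \<lfloor>z k $ j * d / \<epsilon>\<rfloor>" "\<lfloor>z k $ j * d / \<epsilon>\<rfloor> \<le> int A" by linarith+
    then show "\<phi> k j \<in> {- int A..int A}" by (simp add: \<phi>_def)
  qed simp
  then have "card T \<le> card ((UNIV :: 's set) \<rightarrow>\<^sub>E {- int A..int A})"
    by (rule card_inj_on_le[OF inj]) (simp add: finite_PiE)
  also have "\<dots> = (2 * A + 1) ^ CARD('s)" by (simp add: card_funcsetE nat_add_distrib nat_mult_distrib)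
  finally have "real (card T) \<le> real (2 * A + 1) ^ CARD('s)" by (metis of_nat_le_iff of_nat_power)
  also have "\<dots> \<le> (2 * r * d / \<epsilon> + 3) ^ CARD('s)"
  proof (rule power_mono)
    have "r * d / \<epsilon> \<ge> 0" using \<open>r \<ge> 0\<close> d \<open>\<epsilon> > 0\<close> by simp
    then have "real A \<le> r * d / \<epsilon> + 1" unfolding A_def by linarith
    then show "real (2 * A + 1) \<le> 2 * r * d / \<epsilon> + 3" by simp
  qed simp
  finally show ?thesis by (simp add: d_def)
qed

context refl_setting
begin

text \<open>Nonexpansiveness spreads \<open>reach\<close> from a point to a ball about it, and
  finitely many balls cover the compact set. Truncating \<open>Z\<close> costs at most half of each
  probability and ensures that reaching \<open>x\<close> does not spoil the control of the second
  component.\<close>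

lemma reach_uniform:
  assumes C: "coset C" and \<nu>: "stationary C \<nu>" and x: "x \<in> measure_support \<nu>" and "\<epsilon> > 0"
  obtains J p R0 where "p > 0"
    "\<forall>z. z \<in> coset_space I C \<longrightarrow> norm z \<le> K \<longrightarrow> p \<le> measure S {\<omega>. \<exists>j\<le>J. norm (X z j \<omega> - x) < \<epsilon> \<and> norm (Z j \<omega>) \<le> R0}"
proof -
  define E where "E = coset_space I C \<inter> cball 0 K"
  have "compact E" unfolding E_def by (intro closed_Int_compact closed_coset_space C compact_cball)
  define h where "h z j R = measure S {\<omega>. norm (X z j \<omega> - x) < \<epsilon> / 2 \<and> norm (Z j \<omega>) \<le> R}" for z j R
  have "\<forall>z\<in>E. \<exists>jR. h z (fst jR) (snd jR) > 0"
  proof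
    fix z assume "z \<in> E"
    then obtain j where j: "measure S {\<omega>. norm (X z j \<omega> - x) < \<epsilon> / 2} > 0"
      using reach[OF C \<nu> x, of z "\<epsilon> / 2"] \<open>\<epsilon> > 0\<close> by (auto simp: E_def)
    have m: "(\<lambda>\<omega>. norm (Z j \<omega>)) \<in> borel_measurable S" by measurable
    have "measure S {\<omega>. norm (X z j \<omega> - x) < \<epsilon> / 2} / 2 > 0" using j by simp
    then obtain R where R: "measure S {\<omega>. norm (Z j \<omega>) > R} \<le> measure S {\<omega>. norm (X z j \<omega> - x) < \<epsilon> / 2} / 2"
      by (rule prob_tail[OF m])
    have "h z j R \<ge> measure S {\<omega>. norm (X z j \<omega> - x) < \<epsilon> / 2} - measure S {\<omega>. \<not> norm (Z j \<omega>) \<le> R}"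
      unfolding h_def by (rule prob_conj_ge) measurable
    with j R have "h z j R > 0" by (simp add: not_le)
    then show "\<exists>jR. h z (fst jR) (snd jR) > 0" by (intro exI[of _ "(j, R)"]) simp
  qed
  from bchoice[OF this] obtain f where f: "\<forall>z\<in>E. h z (fst (f z)) (snd (f z)) > 0" ..
  obtain D where D: "D \<subseteq> E" "finite D" "E \<subseteq> (\<Union>z\<in>D. ball z (\<epsilon> / 2))"
    by (rule compactE_image[OF \<open>compact E\<close>, of E "\<lambda>z. ball z (\<epsilon> / 2)"]) (use \<open>\<epsilon> > 0\<close> in auto)
  define J where "J = Max (insert 0 ((fst \<circ> f) ` D))"
  define R0 where "R0 = Max (insert 0 ((snd \<circ> f) ` D))"
  define p where "p = Min (insert 1 ((\<lambda>z. h z (fst (f z)) (snd (f z))) ` D))"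
  show thesis
  proof
    show "p > 0" unfolding p_def using D f by (subst Min_gr_iff) auto
    show "\<forall>z. z \<in> coset_space I C \<longrightarrow> norm z \<le> K \<longrightarrow> p \<le> measure S {\<omega>. \<exists>j\<le>J. norm (X z j \<omega> - x) < \<epsilon> \<and> norm (Z j \<omega>) \<le> R0}"
    proof (intro allI impI)
      fix z assume "z \<in> coset_space I C" "norm z \<le> K"
      then have "z \<in> E" by (simp add: E_def)
      then obtain y where y: "y \<in> D" "dist y z < \<epsilon> / 2" using D by auto
      obtain j R where fy: "f y = (j, R)" by (cases "f y")
      have "fst (f y) \<le> J" unfolding J_def using D y(1) by (intro Max_ge) (auto simp: image_iff intro!: bexI[of _ y])
      then have j: "j \<le> J" by (simp add: fy)
      have "snd (f y) \<le> R0" unfolding R0_def using D y(1) by (intro Max_ge) (auto simp: image_iff intro!: bexI[of _ y])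
      then have R: "R \<le> R0" by (simp add: fy)
      have "h y (fst (f y)) (snd (f y)) \<ge> p" unfolding p_def using D y(1) by (intro Min_le) auto
      then have "p \<le> h y j R" by (simp add: fy)
      also have "\<dots> \<le> measure S {\<omega>. \<exists>j\<le>J. norm (X z j \<omega> - x) < \<epsilon> \<and> norm (Z j \<omega>) \<le> R0}"
        unfolding h_def
      proof (rule prob_mono)
        fix \<omega> assume *: "norm (X y j \<omega> - x) < \<epsilon> / 2 \<and> norm (Z j \<omega>) \<le> R"
        have "norm (X z j \<omega> - X y j \<omega>) < \<epsilon> / 2"
          using rwalk_nonexpansive[of z "\<lambda>k. fst (\<omega> k)" j y] y(2) by (simp add: dist_norm norm_minus_commute)
        with * have "norm (X z j \<omega> - x) < \<epsilon>"
          using norm_triangle_lt[of "X z j \<omega> - X y j \<omega>" "X y j \<omega> - x" \<epsilon>] by simp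
        with * j R show "\<exists>j\<le>J. norm (X z j \<omega> - x) < \<epsilon> \<and> norm (Z j \<omega>) \<le> R0" by auto
      qed measurable
      finally show "p \<le> measure S {\<omega>. \<exists>j\<le>J. norm (X z j \<omega> - x) < \<epsilon> \<and> norm (Z j \<omega>) \<le> R0}" .
    qed
  qed
qed

text \<open>Time 0 is excluded, since the start is always in the neighbourhood; an empty set means
  that there is no return.\<close>

definition hits :: "real ^ 'r \<Rightarrow> real \<Rightarrow> (nat \<Rightarrow> (real ^ 'r) \<times> (real ^ 's)) \<Rightarrow> nat set"
  where "hits x \<epsilon> \<omega> = {n. 1 \<le> n \<and> norm (X x n \<omega> - x) < \<epsilon> \<and> norm (Z n \<omega>) < \<epsilon>}"

lemma measurable_hits [measurable]: "Measurable.pred S (\<lambda>\<omega>. n \<in> hits x \<epsilon> \<omega>)"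
  unfolding hits_def by measurable

lemma hits_empty_measurable [measurable]: "Measurable.pred S (\<lambda>\<omega>. hits x \<epsilon> \<omega> = {})"
proof -
  have eq: "(\<lambda>\<omega>. hits x \<epsilon> \<omega> = {}) = (\<lambda>\<omega>. \<forall>n. n \<notin> hits x \<epsilon> \<omega>)" by (rule ext) blast
  show ?thesis unfolding eq by measurable
qed

text \<open>
  At the times \<open>k\<close> at which \<open>X\<close> is near \<open>x\<close> and from which on \<open>(X, Z)\<close> never again comes close to
  \<open>(x, Z\<^sub>k)\<close>, the values \<open>Z\<^sub>k\<close> are \<open>\<epsilon>\<close>-separated; so few of them lie in a ball.
\<close>

lemma no_return_bound:
  assumes "\<epsilon> > 0" "r \<ge> 0"
  shows "measure S {\<omega>. hits x \<epsilon> \<omega> = {}} * (\<Sum>k<N. measure S {\<omega>. norm (X x k \<omega> - x) < \<epsilon> / 2 \<and> norm (Z k \<omega>) \<le> r})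
    \<le> (2 * r * real CARD('s) / \<epsilon> + 3) ^ CARD('s)" (is "_ \<le> ?c")
proof -
  \<comment> \<open>What happens after \<open>k\<close> concerns the copy restarted at
    \<open>x\<close>, not the walk at its current position, and is therefore independent of the
    first \<open>k\<close> increments. The price is the radius \<epsilon>/2 for the visit: the copy
    stays within that distance of the walk.\<close>
  define A where "A k \<omega> \<longleftrightarrow> (norm (X x k \<omega> - x) < \<epsilon> / 2 \<and> norm (Z k \<omega>) \<le> r) \<and> hits x \<epsilon> (\<lambda>i. \<omega> (i + k)) = {}" for k \<omega>
  have [measurable]: "Measurable.pred S (\<lambda>\<omega>. hits x \<epsilon> (\<lambda>i. \<omega> (i + k)) = {})" for k
    by (rule measurable_compose[OF measurable_shift hits_empty_measurable])
  have [measurable]: "Measurable.pred S (A k)" for k unfolding A_def by measurable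
  have sep: "norm (Z k \<omega> - Z l \<omega>) \<ge> \<epsilon>" if kl: "k < l" "A k \<omega>" "A l \<omega>" for k l \<omega>
  proof (rule ccontr)
    assume *: "\<not> norm (Z k \<omega> - Z l \<omega>) \<ge> \<epsilon>"
    define m where "m = l - k"
    have l: "l = k + m" "1 \<le> m" using kl(1) by (auto simp: m_def)
    have "norm (Z m (\<lambda>i. \<omega> (i + k))) < \<epsilon>"
      using * by (simp add: l Z_add norm_minus_commute)
    moreover have "norm (X x m (\<lambda>i. \<omega> (i + k)) - x) < \<epsilon>"
    proof -
      have "norm (X x m (\<lambda>i. \<omega> (i + k)) - X x l \<omega>) \<le> norm (x - X x k \<omega>)"
        unfolding l(1) rwalk_add by (rule rwalk_nonexpansive)
      also have "\<dots> < \<epsilon> / 2" using kl(2) by (simp add: A_def norm_minus_commute)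
      finally show ?thesis
        using kl(3) norm_triangle_lt[of "X x m (\<lambda>i. \<omega> (i + k)) - X x l \<omega>" "X x l \<omega> - x" \<epsilon>] by (simp add: A_def)
    qed
    ultimately have "m \<in> hits x \<epsilon> (\<lambda>i. \<omega> (i + k))" using l(2) by (simp add: hits_def)
    with kl(2) show False by (simp add: A_def)
  qed
  have card: "real (card {k. k < N \<and> A k \<omega>}) \<le> ?c" for \<omega>
  proof (rule separated_card_bound[where z = "\<lambda>k. Z k \<omega>"])
    fix k l assume "k \<in> {k. k < N \<and> A k \<omega>}" "l \<in> {k. k < N \<and> A k \<omega>}" "k \<noteq> l"
    then show "norm (Z k \<omega> - Z l \<omega>) \<ge> \<epsilon>"
      using sep[of k l \<omega>] sep[of l k \<omega>] by (auto simp: norm_minus_commute neq_iff)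
  qed (use assms in \<open>auto simp: A_def\<close>)
  have c: "?c \<ge> 0" using assms by simp
  have "ennreal (\<Sum>k<N. measure S {\<omega>. A k \<omega>}) = (\<Sum>k<N. emeasure S {\<omega>. A k \<omega>})"
    by (simp add: P.emeasure_eq_measure sum_ennreal)
  also have "\<dots> = (\<integral>\<^sup>+ \<omega>. (\<Sum>k<N. indicator {\<omega>. A k \<omega>} \<omega>) \<partial>S)"
    by (subst nn_integral_sum) (auto intro!: sum.cong nn_integral_indicator[symmetric] sets_Collect_S)
  also have "\<dots> \<le> (\<integral>\<^sup>+ \<omega>. ennreal ?c \<partial>S)"
  proof (rule nn_integral_mono)
    fix \<omega>
    have "(\<Sum>k<N. indicator {\<omega>. A k \<omega>} \<omega>) = (\<Sum>k\<in>{k. k < N \<and> A k \<omega>}. 1 :: ennreal)"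
      by (rule sum.mono_neutral_cong_right) (auto simp: indicator_def)
    also have "\<dots> = ennreal (real (card {k. k < N \<and> A k \<omega>}))" by (simp add: ennreal_of_nat_eq_real_of_nat)
    also have "\<dots> \<le> ennreal ?c" using card by (rule ennreal_leI)
    finally show "(\<Sum>k<N. indicator {\<omega>. A k \<omega>} \<omega>) \<le> ennreal ?c" .
  qed
  also have "\<dots> = ennreal ?c" using P.emeasure_space_1 by simp
  finally have "(\<Sum>k<N. measure S {\<omega>. A k \<omega>}) \<le> ?c" using c by (simp add: ennreal_le_iff)
  moreover have "measure S {\<omega>. A k \<omega>}
      = measure S {\<omega>. norm (X x k \<omega> - x) < \<epsilon> / 2 \<and> norm (Z k \<omega>) \<le> r} * measure S {\<omega>. hits x \<epsilon> \<omega> = {}}" for k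
    unfolding A_def
    by (rule prob_indep_shift[where Q = "\<lambda>\<omega>. hits x \<epsilon> \<omega> = {}"]) (measurable, simp add: X_comb_le Z_comb_le)
  ultimately show ?thesis by (simp add: sum_distrib_left mult.commute)
qed

text \<open>After a hit at time n the copy restarted at \<open>x\<close> has \<open>m\<close> hits
  of half the radius, and nonexpansiveness makes them hits of the walk at the delayed times. A
  random n is allowed because the almost sure statement holds for all n at once.\<close>

lemma hits_many:
  assumes "\<And>\<epsilon>. \<epsilon> > 0 \<Longrightarrow> AE \<omega> in S. hits x \<epsilon> \<omega> \<noteq> {}" and "\<epsilon> > 0"
  shows "AE \<omega> in S. \<exists>T. finite T \<and> card T = m \<and> T \<subseteq> hits x \<epsilon> \<omega>"
  using \<open>\<epsilon> > 0\<close>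
proof (induction m arbitrary: \<epsilon>)
  case 0
  have "\<exists>T. finite T \<and> card T = 0 \<and> T \<subseteq> hits x \<epsilon> \<omega>" for \<omega> by (intro exI[of _ "{}"]) auto
  then show ?case by simp
next
  case (Suc m)
  have e: "\<epsilon> / 2 > 0" using Suc.prems by simp
  have "AE \<omega> in S. \<forall>n. \<exists>T. finite T \<and> card T = m \<and> T \<subseteq> hits x (\<epsilon> / 2) (\<lambda>i. \<omega> (i + n))"
    unfolding AE_all_countable
  proof
    fix n
    show "AE \<omega> in S. \<exists>T. finite T \<and> card T = m \<and> T \<subseteq> hits x (\<epsilon> / 2) (\<lambda>i. \<omega> (i + n))"
      by (rule AE_shift[OF Suc.IH[OF e]])
  qed
  then show ?case using assms(1)[OF e]
  proof eventually_elim
    case (elim \<omega>)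
    then obtain n where n: "n \<in> hits x (\<epsilon> / 2) \<omega>" by auto
    from elim obtain T where T: "finite T" "card T = m" "T \<subseteq> hits x (\<epsilon> / 2) (\<lambda>i. \<omega> (i + n))" by blast
    have "n + t \<in> hits x \<epsilon> \<omega>" if "t \<in> T" for t
    proof -
      have t: "1 \<le> t" "norm (X x t (\<lambda>i. \<omega> (i + n)) - x) < \<epsilon> / 2" "norm (Z t (\<lambda>i. \<omega> (i + n))) < \<epsilon> / 2"
        using T(3) that by (auto simp: hits_def)
      have "norm (X x (n + t) \<omega> - X x t (\<lambda>i. \<omega> (i + n))) \<le> norm (X x n \<omega> - x)"
        unfolding rwalk_add by (rule rwalk_nonexpansive)
      also have "\<dots> < \<epsilon> / 2" using n by (simp add: hits_def)
      finally have "norm (X x (n + t) \<omega> - x) < \<epsilon>"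
        using t(2) norm_triangle_lt[of "X x (n + t) \<omega> - X x t (\<lambda>i. \<omega> (i + n))" "X x t (\<lambda>i. \<omega> (i + n)) - x" \<epsilon>] by simp
      moreover have "norm (Z (n + t) \<omega>) < \<epsilon>"
        using t(3) n norm_triangle_lt[of "Z n \<omega>" "Z t (\<lambda>i. \<omega> (i + n))" \<epsilon>] by (simp add: Z_add hits_def)
      ultimately show ?thesis using t(1) by (simp add: hits_def)
    qed
    moreover have "n \<in> hits x \<epsilon> \<omega>" using n e by (auto simp: hits_def)
    moreover have "n \<notin> (+) n ` T" using T(3) by (auto simp: hits_def)
    moreover have "card ((+) n ` T) = m" using T(2) by (simp add: card_image)
    ultimately show ?case using T(1) by (intro exI[of _ "insert n ((+) n ` T)"]) auto
  qed
qed

lemma hits_infinite: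
  assumes "\<And>\<epsilon>. \<epsilon> > 0 \<Longrightarrow> AE \<omega> in S. hits x \<epsilon> \<omega> \<noteq> {}" and "\<epsilon> > 0"
  shows "AE \<omega> in S. infinite (hits x \<epsilon> \<omega>)"
proof -
  have "AE \<omega> in S. \<forall>m. \<exists>T. finite T \<and> card T = m \<and> T \<subseteq> hits x \<epsilon> \<omega>"
    unfolding AE_all_countable using hits_many[OF assms] by blast
  then show ?thesis
  proof eventually_elim
    case (elim \<omega>)
    show ?case
    proof
      assume fin: "finite (hits x \<epsilon> \<omega>)"
      obtain T where T: "card T = Suc (card (hits x \<epsilon> \<omega>))" "T \<subseteq> hits x \<epsilon> \<omega>" using elim by blast
      from card_mono[OF fin T(2)] T(1) show False by simp
    qed
  qed
qed

text \<open>For r \<ge> 1 the counting bound is at most a constant times r^s, so a positive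
  probability of no return would keep the occupation sums below a multiple of r^s.\<close>

lemma hits_infinite_of_divergence:
  assumes div: "\<And>\<epsilon> M. \<epsilon> > 0 \<Longrightarrow> \<exists>r\<ge>1. \<exists>N. (\<Sum>k<N. measure S {\<omega>. norm (X x k \<omega> - x) < \<epsilon> \<and> norm (Z k \<omega>) \<le> r}) > M * r ^ CARD('s)"
    and "\<epsilon> > 0"
  shows "AE \<omega> in S. infinite (hits x \<epsilon> \<omega>)"
proof (rule hits_infinite[OF _ \<open>\<epsilon> > 0\<close>])
  fix \<epsilon> :: real assume "\<epsilon> > 0"
  define q where "q = measure S {\<omega>. hits x \<epsilon> \<omega> = {}}"
  have "q = 0"
  proof (rule ccontr)
    assume "q \<noteq> 0"
    then have q: "q > 0" by (simp add: q_def zero_less_measure_iff)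
    define c where "c = (2 * real CARD('s) / \<epsilon> + 3) ^ CARD('s)"
    have "\<epsilon> / 2 > 0" using \<open>\<epsilon> > 0\<close> by simp
    from div[OF this, of "c / q"] obtain r N where r: "r \<ge> 1"
      "(\<Sum>k<N. measure S {\<omega>. norm (X x k \<omega> - x) < \<epsilon> / 2 \<and> norm (Z k \<omega>) \<le> r}) > c / q * r ^ CARD('s)" by blast
    have "c * r ^ CARD('s) = q * (c / q * r ^ CARD('s))" using q by simp
    also have "\<dots> < q * (\<Sum>k<N. measure S {\<omega>. norm (X x k \<omega> - x) < \<epsilon> / 2 \<and> norm (Z k \<omega>) \<le> r})"
      using r(2) q by (rule mult_strict_left_mono)
    also have "\<dots> \<le> (2 * r * real CARD('s) / \<epsilon> + 3) ^ CARD('s)"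
      unfolding q_def using \<open>\<epsilon> > 0\<close> r(1) by (intro no_return_bound) auto
    also have "\<dots> \<le> ((2 * real CARD('s) / \<epsilon> + 3) * r) ^ CARD('s)"
      using r(1) \<open>\<epsilon> > 0\<close> by (intro power_mono) (auto simp: algebra_simps)
    also have "\<dots> = c * r ^ CARD('s)" by (simp add: c_def power_mult_distrib)
    finally show False by simp
  qed
  then have "measure S {\<omega> \<in> space S. \<not> hits x \<epsilon> \<omega> \<noteq> {}} = 0" by (simp add: q_def)
  then show "AE \<omega> in S. hits x \<epsilon> \<omega> \<noteq> {}"
    using P.prob_Collect_eq_0[of "\<lambda>\<omega>. hits x \<epsilon> \<omega> = {}"] sets_Collect_S[OF hits_empty_measurable[of x \<epsilon>]] by simp
qed

text \<open>A visit to the box is followed within \<open>J\<close> steps by a visit near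
  \<open>x\<close> with probability at least \<open>p\<close>, while \<open>Z\<close> moves by at
  most \<open>R0\<close>. So the occupation sum of the box is dominated, up to a constant, by that
  of the ball about \<open>x\<close> at radius 2r.\<close>

lemma divergence_of_box_divergence:
  assumes C: "coset C" and \<nu>: "stationary C \<nu>" and x: "x \<in> measure_support \<nu>" and "\<epsilon> > 0"
    and box: "\<And>M R. \<exists>r\<ge>R. \<exists>N. (\<Sum>k<N. measure S {\<omega>. norm (X x k \<omega>) \<le> K \<and> norm (Z k \<omega>) \<le> r}) > M * r ^ CARD('s)"
  shows "\<exists>r\<ge>1. \<exists>N. (\<Sum>k<N. measure S {\<omega>. norm (X x k \<omega> - x) < \<epsilon> \<and> norm (Z k \<omega>) \<le> r}) > M * r ^ CARD('s)"
proof -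
  have "x \<in> coset_space I C"
    using measure_support_subset_closed[OF _ _ closed_coset_space[OF C]] \<nu> x by (auto simp: invariant_prob_on_def)
  then have xs: "x \<in> state_space I" "parity I x \<in> C" by (auto simp: coset_space_def)
  obtain J p R0 where p: "p > 0" and reach: "\<forall>z. z \<in> coset_space I C \<longrightarrow> norm z \<le> K \<longrightarrow>
      p \<le> measure S {\<omega>. \<exists>j\<le>J. norm (X z j \<omega> - x) < \<epsilon> \<and> norm (Z j \<omega>) \<le> R0}"
    by (rule reach_uniform[OF C \<nu> x \<open>\<epsilon> > 0\<close>])
  \<comment> \<open>This absorbs three losses: the radius 2r in place of r costs 2^s, a visit near
    \<open>x\<close> can be counted with \<open>J + 1\<close> different delays, and the passage has
    probability at least \<open>p\<close>.\<close>
  define M' where "M' = \<bar>M\<bar> * 2 ^ CARD('s) * (real J + 1) / p"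
  obtain r N where r: "r \<ge> max 1 R0"
    "(\<Sum>k<N. measure S {\<omega>. norm (X x k \<omega>) \<le> K \<and> norm (Z k \<omega>) \<le> r}) > M' * r ^ CARD('s)" using box by blast
  define h where "h k = measure S {\<omega>. norm (X x k \<omega> - x) < \<epsilon> \<and> norm (Z k \<omega>) \<le> 2 * r}" for k
  have AEc: "AE \<omega> in S. X x k \<omega> \<in> coset_space I C" for k
  proof -
    have "AE \<omega> in S. \<forall>k. par (\<omega> k) \<in> \<Gamma>"
      unfolding AE_all_countable by (intro allI AE_component[OF _ AE_par_\<Gamma>]) simp
    then show ?thesis using AE_integers
    proof eventually_elim
      case (elim \<omega>)
      have "ps k \<omega> \<in> \<Gamma>" unfolding ps_def using elim(1) by (induction k) (auto simp: zero_in_\<Gamma> \<Gamma>_add)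
      with coset_add[OF C xs(2)] X_in_class[OF xs(1) elim(2), of k] show ?case
        by (auto simp: coset_space_eq)
    qed
  qed
  have [measurable]: "coset_space I C \<in> sets borel" by (rule borel_closed[OF closed_coset_space[OF C]])
  have step: "p * measure S {\<omega>. norm (X x k \<omega>) \<le> K \<and> norm (Z k \<omega>) \<le> r} \<le> (\<Sum>j\<le>J. h (k + j))" for k
  proof -
    define P' where "P' \<omega> \<longleftrightarrow> (norm (X x k \<omega>) \<le> K \<and> norm (Z k \<omega>) \<le> r) \<and> X x k \<omega> \<in> coset_space I C" for \<omega>
    define Q' where "Q' \<omega> \<longleftrightarrow> (\<exists>j\<le>J. norm (X x (k + j) \<omega> - x) < \<epsilon> \<and> norm (Z (k + j) \<omega> - Z k \<omega>) \<le> R0)" for \<omega>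
    have [measurable]: "Measurable.pred S P'" "Measurable.pred S Q'" unfolding P'_def Q'_def by measurable
    have "measure S {\<omega>. norm (X x k \<omega>) \<le> K \<and> norm (Z k \<omega>) \<le> r} \<le> measure S {\<omega>. P' \<omega>}"
      by (rule prob_mono_AE) (use AEc[of k] in \<open>auto simp: P'_def\<close>)
    then have "p * measure S {\<omega>. norm (X x k \<omega>) \<le> K \<and> norm (Z k \<omega>) \<le> r} \<le> p * measure S {\<omega>. P' \<omega>}"
      using p by (intro mult_left_mono) auto
    also have "\<dots> \<le> measure S {\<omega>. P' \<omega> \<and> Q' \<omega>}"
    proof (rule prob_comb_ge[where k = k])
      show "P' (comb_seq k \<omega> \<omega>') \<longleftrightarrow> P' \<omega>" for \<omega> \<omega>' by (simp add: P'_def X_comb_le Z_comb_le)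
      show "p \<le> measure S {\<omega>'. Q' (comb_seq k \<omega> \<omega>')}" if "P' \<omega>" for \<omega>
        using reach that by (simp add: Q'_def P'_def X_comb Z_comb Z_comb_le)
    qed (use p in auto)
    also have "\<dots> \<le> measure S (\<Union>j\<in>{..J}. {\<omega>. norm (X x (k + j) \<omega> - x) < \<epsilon> \<and> norm (Z (k + j) \<omega>) \<le> 2 * r})"
    proof (rule P.finite_measure_mono)
      show "{\<omega>. P' \<omega> \<and> Q' \<omega>} \<subseteq> (\<Union>j\<in>{..J}. {\<omega>. norm (X x (k + j) \<omega> - x) < \<epsilon> \<and> norm (Z (k + j) \<omega>) \<le> 2 * r})"
      proof
        fix \<omega> assume "\<omega> \<in> {\<omega>. P' \<omega> \<and> Q' \<omega>}"
        then obtain j where j: "j \<le> J" "norm (X x (k + j) \<omega> - x) < \<epsilon>" "norm (Z (k + j) \<omega> - Z k \<omega>) \<le> R0" "norm (Z k \<omega>) \<le> r"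
          by (auto simp: P'_def Q'_def)
        have "norm (Z (k + j) \<omega>) \<le> 2 * r"
          using j norm_triangle_ineq[of "Z (k + j) \<omega> - Z k \<omega>" "Z k \<omega>"] r(1) by simp
        with j show "\<omega> \<in> (\<Union>j\<in>{..J}. {\<omega>. norm (X x (k + j) \<omega> - x) < \<epsilon> \<and> norm (Z (k + j) \<omega>) \<le> 2 * r})" by auto
      qed
      show "(\<Union>j\<in>{..J}. {\<omega>. norm (X x (k + j) \<omega> - x) < \<epsilon> \<and> norm (Z (k + j) \<omega>) \<le> 2 * r}) \<in> sets S"
        by (intro sets.finite_UN sets_Collect_S) (simp, measurable)
    qed
    also have "\<dots> \<le> (\<Sum>j\<le>J. h (k + j))"
      unfolding h_def by (rule measure_UNION_le) (simp, rule sets_Collect_S, measurable)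
    finally show ?thesis .
  qed
  have hnn: "h k \<ge> 0" for k by (simp add: h_def)
  have "p * (\<Sum>k<N. measure S {\<omega>. norm (X x k \<omega>) \<le> K \<and> norm (Z k \<omega>) \<le> r}) \<le> (\<Sum>k<N. \<Sum>j\<le>J. h (k + j))"
    unfolding sum_distrib_left by (intro sum_mono step)
  also have "\<dots> = (\<Sum>j\<le>J. \<Sum>k<N. h (k + j))" by (rule sum.swap)
  also have "\<dots> \<le> (\<Sum>j\<le>J. \<Sum>k<N + J. h k)"
  proof (rule sum_mono)
    fix j assume "j \<in> {..J}"
    have "(\<Sum>k<N. h (k + j)) = (\<Sum>k\<in>(\<lambda>k. k + j) ` {..<N}. h k)" by (subst sum.reindex) auto
    also have "\<dots> \<le> (\<Sum>k<N + J. h k)" using \<open>j \<in> {..J}\<close> hnn by (intro sum_mono2) auto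
    finally show "(\<Sum>k<N. h (k + j)) \<le> (\<Sum>k<N + J. h k)" .
  qed
  also have "\<dots> = (real J + 1) * (\<Sum>k<N + J. h k)" by simp
  finally have 1: "p * (\<Sum>k<N. measure S {\<omega>. norm (X x k \<omega>) \<le> K \<and> norm (Z k \<omega>) \<le> r}) \<le> (real J + 1) * (\<Sum>k<N + J. h k)" .
  have "(real J + 1) * (\<bar>M\<bar> * (2 * r) ^ CARD('s)) = p * (M' * r ^ CARD('s))"
    using p by (simp add: M'_def power_mult_distrib field_simps)
  also have "\<dots> < p * (\<Sum>k<N. measure S {\<omega>. norm (X x k \<omega>) \<le> K \<and> norm (Z k \<omega>) \<le> r})"
    using r(2) p by (rule mult_strict_left_mono)
  also note 1
  finally have "\<bar>M\<bar> * (2 * r) ^ CARD('s) < (\<Sum>k<N + J. h k)" by (rule mult_left_less_imp_less) simp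
  moreover have "M * (2 * r) ^ CARD('s) \<le> \<bar>M\<bar> * (2 * r) ^ CARD('s)" using r(1) by (intro mult_right_mono) auto
  ultimately have "(\<Sum>k<N + J. h k) > M * (2 * r) ^ CARD('s)" by linarith
  then show ?thesis using r(1) unfolding h_def by (intro exI[of _ "2 * r"] conjI exI[of _ "N + J"]) simp_all
qed

end

section \<open>The unreflected walk\<close>

abbreviation gauss :: "real measure" where "gauss \<equiv> std_normal_distribution"

interpretation gauss: prob_space gauss
  using real_dist_normal_dist by (simp add: real_distribution_def)

text \<open>The real and imaginary parts of the characteristic function. Read from right to left,
  the first identity writes a Gaussian weight as an average of cosines, whose expectations are
  accessible to limit theorems.\<close>

lemma gauss_cos: "(\<integral>s. cos (\<alpha> * s) \<partial>gauss) = exp (- \<alpha>\<^sup>2 / 2)"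
  and gauss_sin: "(\<integral>s. sin (\<alpha> * s) \<partial>gauss) = 0"
proof -
  have int: "integrable gauss (\<lambda>s. iexp (\<alpha> * s))"
    by (rule gauss.integrable_const_bound[where B = 1]) auto
  have char: "(CLINT s|gauss. iexp (\<alpha> * s)) = complex_of_real (exp (- \<alpha>\<^sup>2 / 2))"
    using fun_cong[OF char_std_normal_distribution, of \<alpha>] by (simp add: char_def)
  have "(\<integral>s. Re (iexp (\<alpha> * s)) \<partial>gauss) = exp (- \<alpha>\<^sup>2 / 2)"
    by (subst integral_Re[OF int]) (simp only: char Re_complex_of_real)
  then show "(\<integral>s. cos (\<alpha> * s) \<partial>gauss) = exp (- \<alpha>\<^sup>2 / 2)" by (simp add: Re_exp)
  have "(\<integral>s. Im (iexp (\<alpha> * s)) \<partial>gauss) = 0"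
    by (subst integral_Im[OF int]) (simp only: char Im_complex_of_real)
  then show "(\<integral>s. sin (\<alpha> * s) \<partial>gauss) = 0" by (simp add: Im_exp)
qed

interpretation gauss2: pair_prob_space gauss gauss ..

abbreviation gauss2 :: "(real \<times> real) measure" where "gauss2 \<equiv> gauss \<Otimes>\<^sub>M gauss"

lemma gauss2_cos: "(\<integral>p. cos (fst p * x + snd p * y) \<partial>gauss2) = exp (- (x\<^sup>2 + y\<^sup>2) / 2)"
proof -
  have "integrable gauss2 (\<lambda>p. cos (fst p * x + snd p * y))"
    by (rule gauss2.integrable_const_bound[where B = 1]) auto
  then have "(\<integral>p. cos (fst p * x + snd p * y) \<partial>gauss2) = (\<integral>s. \<integral>t. cos (s * x + t * y) \<partial>gauss \<partial>gauss)"
    by (subst gauss2.integral_fst'[symmetric]) auto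
  also have "\<dots> = (\<integral>s. cos (x * s) * exp (- y\<^sup>2 / 2) \<partial>gauss)"
  proof (rule Bochner_Integration.integral_cong[OF refl])
    fix s
    have i: "integrable gauss (\<lambda>t. cos (x * s) * cos (y * t))" "integrable gauss (\<lambda>t. sin (x * s) * sin (y * t))"
      by (auto intro!: gauss.integrable_const_bound[where B = 1] simp: abs_mult mult_le_one)
    have "(\<integral>t. cos (s * x + t * y) \<partial>gauss) = (\<integral>t. cos (x * s) * cos (y * t) - sin (x * s) * sin (y * t) \<partial>gauss)"
      by (simp add: cos_add mult.commute)
    also have "\<dots> = cos (x * s) * exp (- y\<^sup>2 / 2)"
      by (subst Bochner_Integration.integral_diff[OF i]) (simp add: gauss_cos gauss_sin)
    finally show "(\<integral>t. cos (s * x + t * y) \<partial>gauss) = cos (x * s) * exp (- y\<^sup>2 / 2)" .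
  qed
  also have "\<dots> = exp (- x\<^sup>2 / 2) * exp (- y\<^sup>2 / 2)" by (simp add: gauss_cos)
  also have "\<dots> = exp (- (x\<^sup>2 + y\<^sup>2) / 2)" by (simp add: exp_add[symmetric] field_simps)
  finally show ?thesis .
qed

lemma std_normal_density_scale: "std_normal_density (sqrt 2 * u) \<le> std_normal_density u"
  unfolding std_normal_density_def by (intro mult_left_mono) (auto simp: power_mult_distrib)

text \<open>Substituting s = sqrt 2 u gives the constant as Jacobian, and the density only grows
  when its argument sqrt 2 u is replaced by u. In the plane the two Jacobians multiply to 2.\<close>

lemma gauss_scale:
  assumes [measurable]: "f \<in> borel_measurable borel"
  shows "(\<integral>\<^sup>+ s. f s \<partial>gauss) \<le> ennreal (sqrt 2) * (\<integral>\<^sup>+ u. f (sqrt 2 * u) \<partial>gauss)"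
proof -
  have "(\<integral>\<^sup>+ s. f s \<partial>gauss) = (\<integral>\<^sup>+ s. ennreal (std_normal_density s) * f s \<partial>lborel)"
    by (subst nn_integral_density) auto
  also have "\<dots> = ennreal (sqrt 2) * (\<integral>\<^sup>+ u. ennreal (std_normal_density (sqrt 2 * u)) * f (sqrt 2 * u) \<partial>lborel)"
    by (subst nn_integral_real_affine[where c = "sqrt 2" and t = 0]) auto
  also have "\<dots> \<le> ennreal (sqrt 2) * (\<integral>\<^sup>+ u. ennreal (std_normal_density u) * f (sqrt 2 * u) \<partial>lborel)"
    by (intro mult_left_mono nn_integral_mono mult_right_mono ennreal_leI std_normal_density_scale) auto
  also have "(\<integral>\<^sup>+ u. ennreal (std_normal_density u) * f (sqrt 2 * u) \<partial>lborel) = (\<integral>\<^sup>+ u. f (sqrt 2 * u) \<partial>gauss)"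
    by (subst nn_integral_density) auto
  finally show ?thesis .
qed

lemma gauss2_scale:
  assumes [measurable]: "f \<in> borel_measurable (borel \<Otimes>\<^sub>M borel)"
  shows "(\<integral>\<^sup>+ p. f p \<partial>gauss2) \<le> 2 * (\<integral>\<^sup>+ p. f (sqrt 2 * fst p, sqrt 2 * snd p) \<partial>gauss2)"
proof -
  have [measurable]: "(\<lambda>s. \<integral>\<^sup>+ v. f (s, sqrt 2 * v) \<partial>gauss) \<in> borel_measurable borel"
    by measurable
  have "(\<integral>\<^sup>+ p. f p \<partial>gauss2) = (\<integral>\<^sup>+ s. \<integral>\<^sup>+ t. f (s, t) \<partial>gauss \<partial>gauss)"
    by (rule gauss.nn_integral_fst[symmetric]) measurable
  also have "\<dots> \<le> (\<integral>\<^sup>+ s. ennreal (sqrt 2) * (\<integral>\<^sup>+ v. f (s, sqrt 2 * v) \<partial>gauss) \<partial>gauss)"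
    by (intro nn_integral_mono gauss_scale) measurable
  also have "\<dots> = ennreal (sqrt 2) * (\<integral>\<^sup>+ s. \<integral>\<^sup>+ v. f (s, sqrt 2 * v) \<partial>gauss \<partial>gauss)"
    by (rule nn_integral_cmult) measurable
  also have "\<dots> \<le> ennreal (sqrt 2) * (ennreal (sqrt 2) * (\<integral>\<^sup>+ u. \<integral>\<^sup>+ v. f (sqrt 2 * u, sqrt 2 * v) \<partial>gauss \<partial>gauss))"
    by (intro mult_left_mono gauss_scale) auto
  also have "\<dots> = 2 * (\<integral>\<^sup>+ u. \<integral>\<^sup>+ v. f (sqrt 2 * u, sqrt 2 * v) \<partial>gauss \<partial>gauss)"
    by (simp add: mult.assoc[symmetric] ennreal_mult[symmetric])
  also have "(\<integral>\<^sup>+ u. \<integral>\<^sup>+ v. f (sqrt 2 * u, sqrt 2 * v) \<partial>gauss \<partial>gauss) = (\<integral>\<^sup>+ p. f (sqrt 2 * fst p, sqrt 2 * snd p) \<partial>gauss2)"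
    by (subst gauss.nn_integral_fst[symmetric]) auto
  finally show ?thesis .
qed

lemma gauss_interval:
  assumes "0 \<le> \<delta>" "\<delta> \<le> 1"
  shows "measure gauss {-\<delta>..\<delta>} \<ge> 2 * std_normal_density 1 * \<delta>"
proof -
  have "ennreal (2 * std_normal_density 1 * \<delta>) = (\<integral>\<^sup>+ s. ennreal (std_normal_density 1) * indicator {-\<delta>..\<delta>} s \<partial>lborel)"
    using assms by (simp add: nn_integral_cmult_indicator ennreal_mult[symmetric] mult.commute mult.left_commute)
  also have "\<dots> \<le> (\<integral>\<^sup>+ s. ennreal (std_normal_density s) * indicator {-\<delta>..\<delta>} s \<partial>lborel)"
  proof (rule nn_integral_mono)
    fix s :: real
    show "ennreal (std_normal_density 1) * indicator {-\<delta>..\<delta>} s \<le> ennreal (std_normal_density s) * indicator {-\<delta>..\<delta>} s"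
    proof (cases "s \<in> {-\<delta>..\<delta>}")
      case True
      then have "\<bar>s\<bar> \<le> 1" using assms by auto
      then have "s\<^sup>2 \<le> 1" by (simp add: abs_square_le_1)
      then have "std_normal_density 1 \<le> std_normal_density s"
        unfolding std_normal_density_def by (intro mult_left_mono) auto
      with True show ?thesis by (simp add: ennreal_leI)
    qed simp
  qed
  also have "\<dots> = emeasure gauss {-\<delta>..\<delta>}" by (simp add: emeasure_density)
  finally show ?thesis by (simp add: gauss.emeasure_eq_measure)
qed

section \<open>Limit theorems and the probability that the unreflected walk is small\<close>

context joint_walk
begin

lemma indep_components: "P.indep_vars (\<lambda>_. \<mu>) (\<lambda>k \<omega>. \<omega> k) UNIV"
proof (subst P.indep_vars_iff_distr_eq_PiM')
  have "distr S S (\<lambda>x. \<lambda>i\<in>UNIV. x i) = S" by (simp add: restrict_def distr_id2)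
  also have "S = Pi\<^sub>M UNIV (\<lambda>i. distr S \<mu> (\<lambda>\<omega>. \<omega> i))" by (subst PiM_component) simp_all
  finally show "distr S S (\<lambda>x. \<lambda>i\<in>UNIV. x i) = Pi\<^sub>M UNIV (\<lambda>i. distr S \<mu> (\<lambda>\<omega>. \<omega> i))" .
qed simp_all

lemma distr_component: "distr S \<mu> (\<lambda>\<omega>. \<omega> k) = \<mu>"
  by (rule PiM_component) simp

lemma integral_component:
  fixes f :: "_ \<Rightarrow> real"
  assumes [measurable]: "f \<in> borel_measurable \<mu>"
  shows "(\<integral>\<omega>. f (\<omega> k) \<partial>S) = (\<integral>y. f y \<partial>\<mu>)"
proof -
  have "(\<integral>y. f y \<partial>\<mu>) = (\<integral>y. f y \<partial>distr S \<mu> (\<lambda>\<omega>. \<omega> k))" by (simp only: distr_component)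
  also have "\<dots> = (\<integral>\<omega>. f (\<omega> k) \<partial>S)" by (rule integral_distr) measurable
  finally show ?thesis ..
qed

lemma integrable_component:
  fixes f :: "_ \<Rightarrow> real"
  assumes [measurable]: "f \<in> borel_measurable \<mu>" and "integrable \<mu> f"
  shows "integrable S (\<lambda>\<omega>. f (\<omega> k))"
proof -
  have "integrable (distr S \<mu> (\<lambda>\<omega>. \<omega> k)) f" by (simp only: distr_component assms(2))
  then show ?thesis by (subst (asm) integrable_distr_eq) simp_all
qed

text \<open>The central limit theorem read through characteristic functions: evaluation at \<sigma>
  undoes the normalisation by the standard deviation. For variance 0, where this normalisation is
  impossible, the sums vanish almost surely.\<close>

lemma clt_cos:
  fixes W :: "(real ^ 'r) \<times> (real ^ 's) \<Rightarrow> real"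
  assumes W [measurable]: "W \<in> borel_measurable \<mu>" and sq: "integrable \<mu> (\<lambda>y. (W y)\<^sup>2)" and mean: "(\<integral>y. W y \<partial>\<mu>) = 0"
  shows "(\<lambda>n. \<integral>\<omega>. cos ((\<Sum>k<n. W (\<omega> k)) / sqrt n) \<partial>S) \<longlonglongrightarrow> exp (- (\<integral>y. (W y)\<^sup>2 \<partial>\<mu>) / 2)"
proof -
  define v where "v = (\<integral>y. (W y)\<^sup>2 \<partial>\<mu>)"
  have "v \<ge> 0" unfolding v_def by (rule Bochner_Integration.integral_nonneg) simp
  then consider "v = 0" | "v > 0" by linarith
  then show ?thesis
  proof cases
    case 1
    then have "AE y in \<mu>. (W y)\<^sup>2 = 0"
      using integral_nonneg_eq_0_iff_AE[OF sq] by (simp add: v_def)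
    then have "AE y in \<mu>. W y = 0" by simp
    then have ae: "AE \<omega> in S. \<forall>k. W (\<omega> k) = 0"
      unfolding AE_all_countable by (intro allI AE_component) simp_all
    have "(\<integral>\<omega>. cos ((\<Sum>k<n. W (\<omega> k)) / sqrt n) \<partial>S) = (\<integral>\<omega>. 1 \<partial>S)" for n
    proof (rule integral_cong_AE)
      show "AE \<omega> in S. cos ((\<Sum>k<n. W (\<omega> k)) / sqrt n) = 1" using ae by eventually_elim simp
    qed measurable
    then show ?thesis using 1 P.prob_space by (simp add: v_def)
  next
    case 2
    define \<sigma> where "\<sigma> = sqrt v"
    have \<sigma>: "\<sigma> > 0" "\<sigma>\<^sup>2 = v" using 2 by (auto simp: \<sigma>_def)
    let ?D = "\<lambda>n. distr S borel (\<lambda>\<omega>. (\<Sum>i<n. W (\<omega> i)) / sqrt (real n * \<sigma>\<^sup>2))"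
    have "weak_conv_m ?D gauss"
    proof (rule P.central_limit_theorem_zero_mean[where \<mu> = "distr \<mu> borel W" and X = "\<lambda>i \<omega>. W (\<omega> i)"])
      show "P.indep_vars (\<lambda>i. borel) (\<lambda>i \<omega>. W (\<omega> i)) UNIV"
        by (rule P.indep_vars_compose2[OF indep_components]) (rule W)
      show mean': "P.expectation (\<lambda>\<omega>. W (\<omega> n)) = 0" for n
        by (simp add: integral_component mean)
      show "\<sigma> > 0" by (rule \<sigma>)
      show "integrable S (\<lambda>\<omega>. (W (\<omega> n))\<^sup>2)" for n
        by (rule integrable_component[OF _ sq]) measurable
      show "P.variance (\<lambda>\<omega>. W (\<omega> n)) = \<sigma>\<^sup>2" for n
        unfolding mean' \<sigma> v_def by (simp add: integral_component[where f = "\<lambda>y. (W y)\<^sup>2"])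
      show "distr S borel (\<lambda>\<omega>. W (\<omega> n)) = distr \<mu> borel W" for n
      proof -
        have "distr S borel (W \<circ> (\<lambda>\<omega>. \<omega> n)) = distr (distr S \<mu> (\<lambda>\<omega>. \<omega> n)) borel W"
          by (rule distr_distr[symmetric]) measurable
        then show ?thesis by (simp add: distr_component comp_def)
      qed
    qed
    then have "(\<lambda>n. char (?D n) \<sigma>) \<longlonglongrightarrow> char gauss \<sigma>"
      by (intro levy_continuity1 real_dist_normal_dist P.real_distribution_distr) measurable
    then have "(\<lambda>n. Re (char (?D n) \<sigma>)) \<longlonglongrightarrow> Re (char gauss \<sigma>)" by (rule tendsto_Re)
    moreover have "Re (char gauss \<sigma>) = exp (- v / 2)" by (simp add: char_std_normal_distribution \<sigma>)
    moreover have "Re (char (?D n) \<sigma>) = (\<integral>\<omega>. cos ((\<Sum>k<n. W (\<omega> k)) / sqrt n) \<partial>S)" for n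
    proof -
      have eq: "\<sigma> * ((\<Sum>i<n. W (\<omega> i)) / sqrt (real n * \<sigma>\<^sup>2)) = (\<Sum>k<n. W (\<omega> k)) / sqrt n" for \<omega>
        using \<sigma>(1) by (simp add: real_sqrt_mult)
      have "char (?D n) \<sigma> = (CLINT \<omega>|S. iexp (\<sigma> * ((\<Sum>i<n. W (\<omega> i)) / sqrt (real n * \<sigma>\<^sup>2))))"
        unfolding char_def by (rule integral_distr) measurable
      also have "\<dots> = (CLINT \<omega>|S. iexp ((\<Sum>k<n. W (\<omega> k)) / sqrt n))" by (simp only: eq)
      also have "Re \<dots> = (\<integral>\<omega>. Re (iexp ((\<Sum>k<n. W (\<omega> k)) / sqrt n)) \<partial>S)"
        by (rule integral_Re[symmetric]) (rule P.integrable_const_bound[where B = 1], auto)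
      finally show ?thesis by (simp add: Re_exp)
    qed
    ultimately show ?thesis by (simp add: v_def)
  qed
qed

lemma sum_components_Z: "(\<Sum>k<n. snd (\<omega> k) $ j) = Z n \<omega> $ j"
  by (simp add: Z_def)

text \<open>The Gaussian weight of a vector in the plane is an average of cosines of its
  projections. After Fubini each direction involves a one-dimensional sum, to which
  \<open>clt_cos\<close> applies, and boundedness moves the limit inside the Gaussian
  integral.\<close>

lemma smoothing_limit:
  assumes sq: "\<And>j. integrable \<mu> (\<lambda>y. (snd y $ j)\<^sup>2)" and mean: "\<And>j. (\<integral>y. snd y $ j \<partial>\<mu>) = 0"
  shows "(\<lambda>n. \<integral>\<omega>. exp (- a\<^sup>2 * ((Z n \<omega> $ j1)\<^sup>2 + (Z n \<omega> $ j2)\<^sup>2) / (2 * real n)) \<partial>S)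
    \<longlonglongrightarrow> (\<integral>p. exp (- a\<^sup>2 * (\<integral>y. (fst p * snd y $ j1 + snd p * snd y $ j2)\<^sup>2 \<partial>\<mu>) / 2) \<partial>gauss2)"
proof -
  interpret SG: pair_prob_space S gauss2 ..
  define W where "W p y = a * (fst p * snd y $ j1 + snd p * snd y $ j2)" for p :: "real \<times> real" and y :: "(real ^ 'r) \<times> (real ^ 's)"
  define q where "q p = (\<integral>y. (fst p * snd y $ j1 + snd p * snd y $ j2)\<^sup>2 \<partial>\<mu>)" for p
  have [measurable]: "(\<lambda>y. snd y $ j) \<in> borel_measurable \<mu>" for j by measurable
  have int1: "integrable \<mu> (\<lambda>y. snd y $ j)" for j
    by (rule mu.square_integrable_imp_integrable[OF _ sq]) measurable
  have sqW: "integrable \<mu> (\<lambda>y. (W p y)\<^sup>2)" for p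
  proof (rule Bochner_Integration.integrable_bound)
    show "integrable \<mu> (\<lambda>y. 2 * (a * fst p)\<^sup>2 * (snd y $ j1)\<^sup>2 + 2 * (a * snd p)\<^sup>2 * (snd y $ j2)\<^sup>2)"
      by (intro Bochner_Integration.integrable_add integrable_mult_right sq)
    show "(\<lambda>y. (W p y)\<^sup>2) \<in> borel_measurable \<mu>" unfolding W_def by measurable
    have *: "(u + v)\<^sup>2 \<le> 2 * u\<^sup>2 + 2 * v\<^sup>2" for u v :: real
      using sum_squares_bound[of u v] by (simp add: power2_sum)
    have "(W p y)\<^sup>2 \<le> 2 * (a * fst p)\<^sup>2 * (snd y $ j1)\<^sup>2 + 2 * (a * snd p)\<^sup>2 * (snd y $ j2)\<^sup>2" for y
      using *[of "a * fst p * snd y $ j1" "a * snd p * snd y $ j2"]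
      by (simp add: W_def algebra_simps power_mult_distrib)
    then show "AE y in \<mu>. norm ((W p y)\<^sup>2) \<le> norm (2 * (a * fst p)\<^sup>2 * (snd y $ j1)\<^sup>2 + 2 * (a * snd p)\<^sup>2 * (snd y $ j2)\<^sup>2)"
      by (intro AE_I2) simp
  qed
  have meanW: "(\<integral>y. W p y \<partial>\<mu>) = 0" for p
    unfolding W_def by (simp add: int1 mean)
  have W2: "(\<integral>y. (W p y)\<^sup>2 \<partial>\<mu>) = a\<^sup>2 * q p" for p
    by (simp add: W_def q_def power_mult_distrib)
  have sumW: "(\<Sum>k<n. W p (\<omega> k)) = a * (fst p * Z n \<omega> $ j1 + snd p * Z n \<omega> $ j2)" for n p \<omega>
    by (simp only: W_def sum_distrib_left[symmetric] sum.distrib sum_components_Z)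
  have [measurable]: "(\<lambda>x. Z n (fst x) $ j) \<in> borel_measurable (S \<Otimes>\<^sub>M gauss2)" for n j
    by (rule measurable_compose[OF measurable_fst]) measurable
  have swap: "(\<integral>\<omega>. exp (- a\<^sup>2 * ((Z n \<omega> $ j1)\<^sup>2 + (Z n \<omega> $ j2)\<^sup>2) / (2 * real n)) \<partial>S)
      = (\<integral>p. \<integral>\<omega>. cos ((\<Sum>k<n. W p (\<omega> k)) / sqrt n) \<partial>S \<partial>gauss2)" for n
  proof -
    have "(\<integral>\<omega>. exp (- a\<^sup>2 * ((Z n \<omega> $ j1)\<^sup>2 + (Z n \<omega> $ j2)\<^sup>2) / (2 * real n)) \<partial>S)
        = (\<integral>\<omega>. \<integral>p. cos (fst p * (a * Z n \<omega> $ j1 / sqrt n) + snd p * (a * Z n \<omega> $ j2 / sqrt n)) \<partial>gauss2 \<partial>S)"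
    proof (rule Bochner_Integration.integral_cong[OF refl])
      fix \<omega>
      have "- a\<^sup>2 * ((Z n \<omega> $ j1)\<^sup>2 + (Z n \<omega> $ j2)\<^sup>2) / (2 * real n)
          = - ((a * Z n \<omega> $ j1 / sqrt n)\<^sup>2 + (a * Z n \<omega> $ j2 / sqrt n)\<^sup>2) / 2"
        by (cases "n = 0") (simp_all add: power_divide power_mult_distrib field_simps)
      then show "exp (- a\<^sup>2 * ((Z n \<omega> $ j1)\<^sup>2 + (Z n \<omega> $ j2)\<^sup>2) / (2 * real n))
          = (\<integral>p. cos (fst p * (a * Z n \<omega> $ j1 / sqrt n) + snd p * (a * Z n \<omega> $ j2 / sqrt n)) \<partial>gauss2)"
        by (simp only: gauss2_cos)
    qed
    also have "\<dots> = (\<integral>p. \<integral>\<omega>. cos (fst p * (a * Z n \<omega> $ j1 / sqrt n) + snd p * (a * Z n \<omega> $ j2 / sqrt n)) \<partial>S \<partial>gauss2)"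
    proof (rule SG.Fubini_integral[symmetric])
      show "integrable (S \<Otimes>\<^sub>M gauss2) (\<lambda>(\<omega>, p). cos (fst p * (a * Z n \<omega> $ j1 / sqrt n) + snd p * (a * Z n \<omega> $ j2 / sqrt n)))"
        by (rule SG.integrable_const_bound[where B = 1]) (auto simp: case_prod_beta')
    qed
    also have "\<dots> = (\<integral>p. \<integral>\<omega>. cos ((\<Sum>k<n. W p (\<omega> k)) / sqrt n) \<partial>S \<partial>gauss2)"
      unfolding sumW by (simp add: algebra_simps add_divide_distrib)
    finally show ?thesis .
  qed
  have "(\<lambda>n. \<integral>p. \<integral>\<omega>. cos ((\<Sum>k<n. W p (\<omega> k)) / sqrt n) \<partial>S \<partial>gauss2) \<longlonglongrightarrow> (\<integral>p. exp (- a\<^sup>2 * q p / 2) \<partial>gauss2)"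
  proof (rule integral_dominated_convergence[where w = "\<lambda>_. 1"])
    show "(\<lambda>p. exp (- a\<^sup>2 * q p / 2)) \<in> borel_measurable gauss2"
    proof -
      have "q \<in> borel_measurable gauss2"
        unfolding q_def by (rule mu.borel_measurable_lebesgue_integral) measurable
      then show ?thesis by measurable
    qed
    show "(\<lambda>p. \<integral>\<omega>. cos ((\<Sum>k<n. W p (\<omega> k)) / sqrt n) \<partial>S) \<in> borel_measurable gauss2" for n
      unfolding sumW by (rule P.borel_measurable_lebesgue_integral) (simp add: case_prod_beta')
    show "integrable gauss2 (\<lambda>_. 1 :: real)" by simp
    show "AE p in gauss2. (\<lambda>n. \<integral>\<omega>. cos ((\<Sum>k<n. W p (\<omega> k)) / sqrt n) \<partial>S) \<longlonglongrightarrow> exp (- a\<^sup>2 * q p / 2)"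
    proof (rule AE_I2)
      fix p
      have "W p \<in> borel_measurable \<mu>" unfolding W_def by measurable
      from clt_cos[OF this sqW meanW]
      show "(\<lambda>n. \<integral>\<omega>. cos ((\<Sum>k<n. W p (\<omega> k)) / sqrt n) \<partial>S) \<longlonglongrightarrow> exp (- a\<^sup>2 * q p / 2)" by (simp add: W2)
    qed
    show "AE p in gauss2. norm (\<integral>\<omega>. cos ((\<Sum>k<n. W p (\<omega> k)) / sqrt n) \<partial>S) \<le> 1" for n
    proof (rule AE_I2)
      fix p
      have "norm (\<integral>\<omega>. cos ((\<Sum>k<n. W p (\<omega> k)) / sqrt n) \<partial>S) \<le> (\<integral>\<omega>. norm (cos ((\<Sum>k<n. W p (\<omega> k)) / sqrt n)) \<partial>S)"
        by (rule integral_norm_bound)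
      also have "\<dots> \<le> (\<integral>\<omega>. 1 \<partial>S)"
      proof (rule integral_mono)
        have "W p \<in> borel_measurable \<mu>" unfolding W_def by measurable
        then show "integrable S (\<lambda>\<omega>. norm (cos ((\<Sum>k<n. W p (\<omega> k)) / sqrt n)))"
          by (intro P.integrable_const_bound[where B = 1]) auto
      qed simp_all
      finally show "norm (\<integral>\<omega>. cos ((\<Sum>k<n. W p (\<omega> k)) / sqrt n) \<partial>S) \<le> 1" using P.prob_space by simp
    qed
  qed
  then show ?thesis unfolding swap q_def .
qed

text \<open>
  The Gaussian smoothing \<open>exp(-a\<^sup>2\<bar>z\<bar>\<^sup>2/2)\<close> exceeds the indicator of \<open>\<bar>z\<bar> \<le> 3/a\<close> by at most a quarter of the
  smoothing at scale \<open>a/\<surd>2\<close>, whose limit is at most twice as large by rescaling. This needs no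
  assumption on the rank of the covariance.
\<close>

lemma Z_lower_bound_2:
  assumes card: "CARD('s) = 2"
    and sq: "\<And>j. integrable \<mu> (\<lambda>y. (snd y $ j)\<^sup>2)" and mean: "\<And>j. (\<integral>y. snd y $ j \<partial>\<mu>) = 0"
  shows "\<exists>c>0. \<forall>a\<ge>1. \<exists>k0. \<forall>k\<ge>k0. measure S {\<omega>. norm (Z k \<omega>) \<le> sqrt k / a} \<ge> c / a\<^sup>2"
proof -
  obtain j1 j2 :: 's where j: "UNIV = {j1, j2}" "j1 \<noteq> j2" using card by (auto simp: card_2_iff)
  have norm2: "(norm z)\<^sup>2 = (z $ j1)\<^sup>2 + (z $ j2)\<^sup>2" for z :: "real ^ 's"
    unfolding power2_norm_eq_inner inner_vec_def j(1) using j(2) by (simp add: power2_eq_square)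
  define q where "q p = (\<integral>y. (fst p * snd y $ j1 + snd p * snd y $ j2)\<^sup>2 \<partial>\<mu>)" for p :: "real \<times> real"
  have [measurable]: "(\<lambda>y. snd y $ j) \<in> borel_measurable \<mu>" for j by measurable
  have q_meas [measurable]: "q \<in> borel_measurable (borel \<Otimes>\<^sub>M borel)"
    unfolding q_def by (rule mu.borel_measurable_lebesgue_integral) measurable
  have q_meas' [measurable]: "q \<in> borel_measurable gauss2" by (simp cong: measurable_cong_sets)
  have q_nonneg: "q p \<ge> 0" for p unfolding q_def by (rule Bochner_Integration.integral_nonneg) simp
  have q_scale: "q (sqrt 2 * s, sqrt 2 * t) = 2 * q (s, t)" for s t
  proof -
    have "(sqrt 2 * s * u + sqrt 2 * t * v)\<^sup>2 = 2 * (s * u + t * v)\<^sup>2" for u v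
    proof -
      have "sqrt 2 * s * u + sqrt 2 * t * v = sqrt 2 * (s * u + t * v)" by (simp add: algebra_simps)
      then show ?thesis by (simp only: power_mult_distrib) simp
    qed
    then show ?thesis by (simp add: q_def)
  qed
  define Q where "Q = 2 * (\<integral>y. (snd y $ j1)\<^sup>2 \<partial>\<mu>) + 2 * (\<integral>y. (snd y $ j2)\<^sup>2 \<partial>\<mu>)"
  define L where "L a = (\<integral>p. exp (- a\<^sup>2 * q p / 2) \<partial>gauss2)" for a
  have int_exp: "integrable gauss2 (\<lambda>p. exp (- a\<^sup>2 * q p / 2))" for a
    by (rule gauss2.integrable_const_bound[where B = 1]) (auto intro!: AE_I2 simp: q_nonneg)
  have L_scale: "L (a / sqrt 2) \<le> 2 * L a" for a
  proof -
    have "ennreal (L (a / sqrt 2)) = (\<integral>\<^sup>+ p. ennreal (exp (- (a / sqrt 2)\<^sup>2 * q p / 2)) \<partial>gauss2)"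
      unfolding L_def by (rule nn_integral_eq_integral[symmetric, OF int_exp]) simp
    also have "\<dots> \<le> 2 * (\<integral>\<^sup>+ p. ennreal (exp (- (a / sqrt 2)\<^sup>2 * q (sqrt 2 * fst p, sqrt 2 * snd p) / 2)) \<partial>gauss2)"
      by (rule gauss2_scale) measurable
    also have "\<dots> = 2 * (\<integral>\<^sup>+ p. ennreal (exp (- a\<^sup>2 * q p / 2)) \<partial>gauss2)"
      by (simp add: q_scale power_divide)
    also have "\<dots> = 2 * ennreal (L a)"
      unfolding L_def by (simp only: nn_integral_eq_integral[OF int_exp] AE_I2 exp_ge_zero)
    also have "\<dots> = ennreal (2 * L a)" by (simp add: ennreal_mult' L_def)
    finally show ?thesis
      by (subst (asm) ennreal_le_iff) (auto simp: L_def intro!: Bochner_Integration.integral_nonneg)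
  qed
  \<comment> \<open>On the square |s|, |t| \<le> 1/a one has a^2 q \<le> \<open>Q\<close>, so the
    integrand is at least exp(-Q/2) there; by \<open>gauss_interval\<close> the square has mass at
    least (2 f(1)/a)^2, with f the normal density.\<close>
  define c1 where "c1 = (2 * std_normal_density 1)\<^sup>2 * exp (- Q / 2)"
  have c1: "c1 > 0" by (simp add: c1_def std_normal_density_def)
  have L_lower: "L a \<ge> c1 / a\<^sup>2" if a: "a \<ge> 1" for a
  proof -
    let ?I = "{- (1 / a)..1 / a}"
    have q_le: "a\<^sup>2 * q (s, t) \<le> Q" if st: "\<bar>s\<bar> \<le> 1 / a" "\<bar>t\<bar> \<le> 1 / a" for s t
    proof -
      have "\<bar>a * s\<bar> \<le> 1" "\<bar>a * t\<bar> \<le> 1" using st a by (auto simp: abs_mult field_simps)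
      then have as: "(a * s)\<^sup>2 \<le> 1" "(a * t)\<^sup>2 \<le> 1" by (simp_all only: abs_square_le_1)
      have *: "(u + v)\<^sup>2 \<le> 2 * u\<^sup>2 + 2 * v\<^sup>2" for u v :: real
        using sum_squares_bound[of u v] by (simp add: power2_sum)
      have "a\<^sup>2 * q (s, t) = (\<integral>y. (a * s * snd y $ j1 + a * t * snd y $ j2)\<^sup>2 \<partial>\<mu>)"
      proof -
        have "(a * s * u + a * t * v)\<^sup>2 = a\<^sup>2 * (s * u + t * v)\<^sup>2" for u v
        proof -
          have "a * s * u + a * t * v = a * (s * u + t * v)" by (simp add: algebra_simps)
          then show ?thesis by (simp only: power_mult_distrib)
        qed
        then show ?thesis by (simp add: q_def)
      qed
      also have "\<dots> \<le> (\<integral>y. 2 * (snd y $ j1)\<^sup>2 + 2 * (snd y $ j2)\<^sup>2 \<partial>\<mu>)"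
      proof (rule integral_mono_AE')
        show "integrable \<mu> (\<lambda>y. 2 * (snd y $ j1)\<^sup>2 + 2 * (snd y $ j2)\<^sup>2)"
          by (intro Bochner_Integration.integrable_add integrable_mult_right sq)
        show "AE y in \<mu>. (a * s * snd y $ j1 + a * t * snd y $ j2)\<^sup>2 \<le> 2 * (snd y $ j1)\<^sup>2 + 2 * (snd y $ j2)\<^sup>2"
        proof (rule AE_I2)
          fix y :: "(real ^ 'r) \<times> (real ^ 's)"
          have "(a * s * snd y $ j1 + a * t * snd y $ j2)\<^sup>2 \<le> 2 * ((a * s)\<^sup>2 * (snd y $ j1)\<^sup>2) + 2 * ((a * t)\<^sup>2 * (snd y $ j2)\<^sup>2)"
            using *[of "a * s * snd y $ j1" "a * t * snd y $ j2"] by (simp only: power_mult_distrib mult.assoc)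
          also have "\<dots> \<le> 2 * (1 * (snd y $ j1)\<^sup>2) + 2 * (1 * (snd y $ j2)\<^sup>2)"
            using as by (intro add_mono mult_left_mono mult_right_mono) auto
          finally show "(a * s * snd y $ j1 + a * t * snd y $ j2)\<^sup>2 \<le> 2 * (snd y $ j1)\<^sup>2 + 2 * (snd y $ j2)\<^sup>2" by simp
        qed
        show "AE y in \<mu>. 0 \<le> 2 * (snd y $ j1)\<^sup>2 + 2 * (snd y $ j2)\<^sup>2" by simp
      qed
      also have "\<dots> = Q" by (simp add: Q_def sq)
      finally show ?thesis .
    qed
    have "c1 / a\<^sup>2 = (2 * std_normal_density 1 * (1 / a))\<^sup>2 * exp (- Q / 2)"
      by (simp add: c1_def power_divide power_mult_distrib)
    also have "\<dots> \<le> (measure gauss ?I)\<^sup>2 * exp (- Q / 2)"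
      using gauss_interval[of "1 / a"] a
      by (intro mult_right_mono power_mono) (auto simp: std_normal_density_def)
    also have "(measure gauss ?I)\<^sup>2 = measure gauss2 (?I \<times> ?I)"
      by (simp add: measure_def gauss.emeasure_pair_measure_Times enn2real_mult power2_eq_square)
    also have "measure gauss2 (?I \<times> ?I) * exp (- Q / 2) = (\<integral>p. indicator (?I \<times> ?I) p * exp (- Q / 2) \<partial>gauss2)"
      by simp
    also have "\<dots> \<le> L a"
      unfolding L_def
    proof (rule integral_mono_AE')
      show "integrable gauss2 (\<lambda>p. exp (- a\<^sup>2 * q p / 2))" by (rule int_exp)
      show "AE p in gauss2. indicator (?I \<times> ?I) p * exp (- Q / 2) \<le> exp (- a\<^sup>2 * q p / 2)"
      proof (rule AE_I2)
        fix p :: "real \<times> real"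
        show "indicator (?I \<times> ?I) p * exp (- Q / 2) \<le> exp (- a\<^sup>2 * q p / 2)"
        proof (cases "p \<in> ?I \<times> ?I")
          case True
          then have "a\<^sup>2 * q (fst p, snd p) \<le> Q" by (intro q_le) (auto simp: abs_le_iff)
          with True show ?thesis by simp
        qed simp
      qed
    qed simp
    finally show ?thesis .
  qed
  define E where "E a n = (\<integral>\<omega>. exp (- a\<^sup>2 * (norm (Z n \<omega>))\<^sup>2 / (2 * real n)) \<partial>S)" for a n
  have E_lim: "(\<lambda>n. E a n) \<longlonglongrightarrow> L a" for a
    using smoothing_limit[OF sq mean, of a j1 j2] by (simp add: E_def L_def q_def norm2)
  have int_E: "integrable S (\<lambda>\<omega>. exp (- a\<^sup>2 * (norm (Z n \<omega>))\<^sup>2 / (2 * real n)))" for a n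
    by (rule P.integrable_const_bound[where B = 1]) (auto intro!: AE_I2)
  \<comment> \<open>This fixes the radius 3: outside the ball of radius 3 sqrt n/a the quantity
    \<open>w\<close> is at least 9, hence exp(-w/4) \<le> 1/4 and exp(-w/2) is at most a quarter of
    exp(-w/4).\<close>
  have e94: "exp (- 9 / 4) \<le> (1 / 4 :: real)"
  proof -
    have "1 + 9 / 4 + (9 / 4)\<^sup>2 / 2 \<le> exp (9 / 4 :: real)" by (rule exp_lower_Taylor_quadratic) simp
    then have "4 \<le> exp (9 / 4 :: real)" by (simp add: power2_eq_square)
    then have "inverse (exp (9 / 4)) \<le> inverse (4 :: real)" by (rule le_imp_inverse_le) simp
    then show ?thesis by (simp add: exp_minus)
  qed
  have P_lower: "measure S {\<omega>. norm (Z n \<omega>) \<le> 3 * sqrt n / a} \<ge> E a n - E (a / sqrt 2) n / 4"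
    if a: "a > 0" and n: "n \<ge> 1" for a n
  proof -
    have sets: "{\<omega>. norm (Z n \<omega>) \<le> 3 * sqrt n / a} \<in> sets S" by (rule sets_Collect_S) measurable
    have "E a n - E (a / sqrt 2) n / 4 = (\<integral>\<omega>. exp (- a\<^sup>2 * (norm (Z n \<omega>))\<^sup>2 / (2 * real n))
        - exp (- (a / sqrt 2)\<^sup>2 * (norm (Z n \<omega>))\<^sup>2 / (2 * real n)) / 4 \<partial>S)"
      unfolding E_def using int_E by simp
    also have "\<dots> \<le> (\<integral>\<omega>. indicator {\<omega>. norm (Z n \<omega>) \<le> 3 * sqrt n / a} \<omega> \<partial>S)"
    proof (rule integral_mono)
      show "integrable S (\<lambda>\<omega>. exp (- a\<^sup>2 * (norm (Z n \<omega>))\<^sup>2 / (2 * real n))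
          - exp (- (a / sqrt 2)\<^sup>2 * (norm (Z n \<omega>))\<^sup>2 / (2 * real n)) / 4)"
        using int_E[of a n] int_E[of "a / sqrt 2" n] by simp
      show "integrable S (indicator {\<omega>. norm (Z n \<omega>) \<le> 3 * sqrt n / a} :: _ \<Rightarrow> real)"
        using sets by (simp add: P.emeasure_eq_measure)
      fix \<omega>
      define w where "w = a\<^sup>2 * (norm (Z n \<omega>))\<^sup>2 / real n"
      have w: "- a\<^sup>2 * (norm (Z n \<omega>))\<^sup>2 / (2 * real n) = - w / 2"
        "- (a / sqrt 2)\<^sup>2 * (norm (Z n \<omega>))\<^sup>2 / (2 * real n) = - w / 4"
        by (auto simp: w_def power_divide)
      have "w \<ge> 0" by (simp add: w_def)
      show "exp (- a\<^sup>2 * (norm (Z n \<omega>))\<^sup>2 / (2 * real n)) - exp (- (a / sqrt 2)\<^sup>2 * (norm (Z n \<omega>))\<^sup>2 / (2 * real n)) / 4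
          \<le> indicator {\<omega>. norm (Z n \<omega>) \<le> 3 * sqrt n / a} \<omega>"
        unfolding w
      proof (cases "norm (Z n \<omega>) \<le> 3 * sqrt n / a")
        case True
        have "exp (- w / 2) - exp (- w / 4) / 4 \<le> exp (- w / 2)" by simp
        also have "\<dots> \<le> 1" using \<open>w \<ge> 0\<close> by simp
        finally show "exp (- w / 2) - exp (- w / 4) / 4 \<le> indicator {\<omega>. norm (Z n \<omega>) \<le> 3 * sqrt n / a} \<omega>"
          using True by simp
      next
        case False
        then have "3 * sqrt n < a * norm (Z n \<omega>)" using a by (simp add: field_simps)
        then have "(3 * sqrt n)\<^sup>2 \<le> (a * norm (Z n \<omega>))\<^sup>2" by (intro power_mono) auto
        then have "w \<ge> 9" using n by (simp add: w_def power_mult_distrib field_simps)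
        then have "exp (- w / 4) \<le> exp (- 9 / 4)" by simp
        then have "exp (- w / 4) \<le> 1 / 4" using e94 by (rule order_trans)
        then have le: "exp (- w / 4) * exp (- w / 4) \<le> (1 / 4) * exp (- w / 4)" by (intro mult_right_mono) auto
        have eq: "exp (- w / 4) * exp (- w / 4) = exp (- w / 2)" by (simp add: exp_add[symmetric])
        have "exp (- w / 2) \<le> (1 / 4) * exp (- w / 4)" using le unfolding eq .
        then show "exp (- w / 2) - exp (- w / 4) / 4 \<le> indicator {\<omega>. norm (Z n \<omega>) \<le> 3 * sqrt n / a} \<omega>"
          using False by simp
      qed
    qed
    also have "\<dots> = measure S {\<omega>. norm (Z n \<omega>) \<le> 3 * sqrt n / a}" by simp
    finally show ?thesis .
  qed
  show ?thesis
  \<comment> \<open>The scale \<open>b = 3 * a\<close> turns the radius 3 sqrt k/b into sqrt k/a.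
    The 9 in b^2 and the 4 from keeping a quarter of \<open>L b\<close> make 36.\<close>
  proof (intro exI[of _ "c1 / 36"] conjI allI impI)
    show "c1 / 36 > 0" using c1 by simp
    fix a :: real assume a: "a \<ge> 1"
    define b where "b = 3 * a"
    have b: "b \<ge> 1" "b > 0" using a by (auto simp: b_def)
    have Lb: "L b > 0" using L_lower[OF b(1)] c1 b(2) by (smt (verit) divide_pos_pos zero_less_power)
    have "(\<lambda>n. E b n - E (b / sqrt 2) n / 4) \<longlonglongrightarrow> L b - L (b / sqrt 2) / 4"
      by (intro tendsto_intros E_lim) simp
    \<comment> \<open>By \<open>L_scale\<close> the limit is at least half of \<open>L b\<close>, so
      a quarter leaves room for a strict inequality at finite times.\<close>
    moreover have "L b / 4 < L b - L (b / sqrt 2) / 4" using L_scale[of b] Lb by simp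
    ultimately have "eventually (\<lambda>n. E b n - E (b / sqrt 2) n / 4 > L b / 4) sequentially"
      by (rule order_tendstoD(1))
    then obtain k0 where k0: "\<And>n. n \<ge> k0 \<Longrightarrow> E b n - E (b / sqrt 2) n / 4 > L b / 4"
      by (auto simp: eventually_sequentially)
    show "\<exists>k0. \<forall>k\<ge>k0. measure S {\<omega>. norm (Z k \<omega>) \<le> sqrt k / a} \<ge> c1 / 36 / a\<^sup>2"
    proof (intro exI[of _ "max 1 k0"] allI impI)
      fix k assume k: "k \<ge> max 1 k0"
      have "c1 / 36 / a\<^sup>2 = (c1 / b\<^sup>2) / 4" by (simp add: b_def power_mult_distrib)
      also have "\<dots> \<le> L b / 4" using L_lower[OF b(1)] by simp
      also have "\<dots> \<le> E b k - E (b / sqrt 2) k / 4" using k0[of k] k by simp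
      also have "\<dots> \<le> measure S {\<omega>. norm (Z k \<omega>) \<le> 3 * sqrt k / b}" using k b by (intro P_lower) auto
      also have "3 * sqrt k / b = sqrt k / a" using a by (simp add: b_def)
      finally show "measure S {\<omega>. norm (Z k \<omega>) \<le> sqrt k / a} \<ge> c1 / 36 / a\<^sup>2" .
    qed
  qed
qed

text \<open>A weak law of large numbers under a first moment only. As the mean vanishes, the
  characteristic function of one term differs from 1 by o(t) at t -> 0; its n-th power at \<theta>/n
  therefore differs from 1 by at most n times o(1/n).\<close>

lemma lln_cos:
  fixes W :: "(real ^ 'r) \<times> (real ^ 's) \<Rightarrow> real"
  assumes int: "integrable \<mu> W" and mean: "(\<integral>y. W y \<partial>\<mu>) = 0"
  shows "(\<lambda>n. \<integral>\<omega>. cos (\<theta> * (\<Sum>k<n. W (\<omega> k)) / real n) \<partial>S) \<longlonglongrightarrow> 1"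
proof -
  have W [measurable]: "W \<in> borel_measurable \<mu>" using int by simp
  define D where "D = distr \<mu> borel W"
  interpret D: real_distribution D unfolding D_def by (rule mu.real_distribution_distr) (rule W)
  have intD: "integrable D (\<lambda>x. x ^ k)" if "k \<le> 1" for k
  proof -
    have "k = 0 \<or> k = 1" using that by linarith
    then show ?thesis using int by (auto simp: D_def integrable_distr_eq)
  qed
  have intD1: "integrable D (\<lambda>x. x)" using intD[of 1] by simp
  have meanD: "D.expectation (\<lambda>x. x) = 0" using mean by (simp add: D_def integral_distr)
  \<comment> \<open>The truncated Taylor remainder: 4|x| is an integrable majorant, while the other
    term tends to 0 with \<open>t\<close> for each x.\<close>
  define e where "e t = D.expectation (\<lambda>x. min (4 * \<bar>x\<bar>) (\<bar>t\<bar> * x\<^sup>2))" for t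
  have approx: "cmod (char D t - 1) \<le> \<bar>t\<bar> / 2 * e t" for t
  proof -
    have "cmod (char D t - (\<Sum>k\<le>1. ((\<i> * t) ^ k / fact k) * D.expectation (\<lambda>x. x ^ k))) \<le>
        (\<bar>t\<bar> ^ 1 / fact (Suc 1)) * D.expectation (\<lambda>x. min (2 * \<bar>x\<bar> ^ 1 * Suc 1) (\<bar>t\<bar> * \<bar>x\<bar> ^ Suc 1))"
      by (rule D.char_approx2) (rule intD)
    moreover have "(\<Sum>k\<le>1. ((\<i> * t) ^ k / fact k) * D.expectation (\<lambda>x. x ^ k)) = 1"
      using D.prob_space meanD by simp
    moreover have "D.expectation (\<lambda>x. min (2 * \<bar>x\<bar> ^ 1 * Suc 1) (\<bar>t\<bar> * \<bar>x\<bar> ^ Suc 1)) = e t"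
      unfolding e_def by (rule Bochner_Integration.integral_cong) (auto simp: power2_eq_square)
    ultimately show ?thesis by simp
  qed
  have e0: "(\<lambda>n. e (\<theta> / real n)) \<longlonglongrightarrow> 0"
  proof -
    have "(\<lambda>n. e (\<theta> / real n)) \<longlonglongrightarrow> (\<integral>x. 0 \<partial>D)"
      unfolding e_def
    proof (rule integral_dominated_convergence[where w = "\<lambda>x. 4 * \<bar>x\<bar>"])
      show "integrable D (\<lambda>x. 4 * \<bar>x\<bar>)" using intD1 by simp
      show "AE x in D. (\<lambda>n. min (4 * \<bar>x\<bar>) (\<bar>\<theta> / real n\<bar> * x\<^sup>2)) \<longlonglongrightarrow> 0"
      proof (rule AE_I2)
        fix x :: real
        have "(\<lambda>n. \<bar>\<theta> / real n\<bar> * x\<^sup>2) \<longlonglongrightarrow> 0 * x\<^sup>2"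
          by (intro tendsto_mult_right tendsto_rabs_zero lim_const_over_n)
        from tendsto_min[OF tendsto_const[of "4 * \<bar>x\<bar>"] this]
        show "(\<lambda>n. min (4 * \<bar>x\<bar>) (\<bar>\<theta> / real n\<bar> * x\<^sup>2)) \<longlonglongrightarrow> 0" by simp
      qed
      show "AE x in D. norm (min (4 * \<bar>x\<bar>) (\<bar>\<theta> / real n\<bar> * x\<^sup>2)) \<le> 4 * \<bar>x\<bar>" for n
        by (rule AE_I2) (auto simp: min_def abs_mult)
    qed (auto simp: D_def)
    then show ?thesis by simp
  qed
  have distr_W: "distr S borel (\<lambda>\<omega>. W (\<omega> k)) = D" for k
  proof -
    have "distr S borel (W \<circ> (\<lambda>\<omega>. \<omega> k)) = distr (distr S \<mu> (\<lambda>\<omega>. \<omega> k)) borel W"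
      by (rule distr_distr[symmetric]) measurable
    then show ?thesis by (simp add: distr_component comp_def D_def)
  qed
  have bound: "\<bar>(\<integral>\<omega>. cos (\<theta> * (\<Sum>k<n. W (\<omega> k)) / real n) \<partial>S) - 1\<bar> \<le> \<bar>\<theta>\<bar> / 2 * e (\<theta> / real n)" if n: "n \<ge> 1" for n
  proof -
    let ?c = "char (distr S borel (\<lambda>\<omega>. \<Sum>k<n. W (\<omega> k))) (\<theta> / real n)"
    have "P.indep_vars (\<lambda>i. borel) (\<lambda>k \<omega>. W (\<omega> k)) {..<n}"
      by (rule P.indep_vars_subset[OF P.indep_vars_compose2[OF indep_components W]]) simp
    from P.char_distr_sum[OF this, of "\<theta> / real n"]
    have c: "?c = char D (\<theta> / real n) ^ n" by (simp add: distr_W)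
    have "cmod (char D (\<theta> / real n) ^ n - 1 ^ n) \<le> real n * cmod (char D (\<theta> / real n) - 1)"
      by (rule norm_power_diff) (auto intro: D.cmod_char_le_1)
    also have "\<dots> \<le> real n * (\<bar>\<theta> / real n\<bar> / 2 * e (\<theta> / real n))"
      by (intro mult_left_mono approx) simp
    also have "\<dots> = \<bar>\<theta>\<bar> / 2 * e (\<theta> / real n)" using n by simp
    finally have "cmod (?c - 1) \<le> \<bar>\<theta>\<bar> / 2 * e (\<theta> / real n)" by (simp add: c)
    moreover have "Re ?c = (\<integral>\<omega>. cos (\<theta> * (\<Sum>k<n. W (\<omega> k)) / real n) \<partial>S)"
    proof -
      have "?c = (CLINT \<omega>|S. iexp (\<theta> / real n * (\<Sum>k<n. W (\<omega> k))))"
        unfolding char_def by (rule integral_distr) measurable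
      also have "\<dots> = (CLINT \<omega>|S. iexp (\<theta> * (\<Sum>k<n. W (\<omega> k)) / real n))" by simp
      also have "Re \<dots> = (\<integral>\<omega>. Re (iexp (\<theta> * (\<Sum>k<n. W (\<omega> k)) / real n)) \<partial>S)"
        by (rule integral_Re[symmetric]) (rule P.integrable_const_bound[where B = 1], auto)
      finally show ?thesis by (simp add: Re_exp)
    qed
    ultimately show ?thesis using abs_Re_le_cmod[of "?c - 1"] by simp
  qed
  have "(\<lambda>n. (\<integral>\<omega>. cos (\<theta> * (\<Sum>k<n. W (\<omega> k)) / real n) \<partial>S) - 1) \<longlonglongrightarrow> 0"
  proof (rule Lim_null_comparison)
    show "eventually (\<lambda>n. norm ((\<integral>\<omega>. cos (\<theta> * (\<Sum>k<n. W (\<omega> k)) / real n) \<partial>S) - 1) \<le> \<bar>\<theta>\<bar> / 2 * e (\<theta> / real n)) sequentially"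
      using bound by (auto simp: eventually_sequentially intro!: exI[of _ 1])
    show "(\<lambda>n. \<bar>\<theta>\<bar> / 2 * e (\<theta> / real n)) \<longlonglongrightarrow> 0" using tendsto_mult_right_zero[OF e0] by blast
  qed
  then show ?thesis by (simp add: LIM_zero_iff)
qed

text \<open>Smoothing with the normalisation 1/k: the smoothed expectation tends to 1, but every
  path outside the interval lowers it by at least \<open>d\<close>, so such paths have probability
  below 1/2 eventually.\<close>

lemma Z_lower_bound_1:
  assumes card: "CARD('s) = 1"
    and int: "\<And>j. integrable \<mu> (\<lambda>y. snd y $ j)" and mean: "\<And>j. (\<integral>y. snd y $ j \<partial>\<mu>) = 0" and a: "a \<ge> 1"
  shows "\<exists>k0. \<forall>k\<ge>k0. measure S {\<omega>. norm (Z k \<omega>) \<le> real k / a} \<ge> 1 / 2"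
proof -
  obtain j :: 's where j: "UNIV = {j}" using card by (auto simp: card_1_singleton_iff)
  have norm1: "norm z = \<bar>z $ j\<bar>" for z :: "real ^ 's"
    unfolding norm_vec_def j by (simp add: L2_set_def)
  interpret SG: pair_prob_space S gauss ..
  define E where "E n = (\<integral>\<omega>. exp (- (a * Z n \<omega> $ j / real n)\<^sup>2 / 2) \<partial>S)" for n
  have E_eq: "E n = (\<integral>s. \<integral>\<omega>. cos (s * a * (\<Sum>k<n. snd (\<omega> k) $ j) / real n) \<partial>S \<partial>gauss)" for n
  proof -
    have "E n = (\<integral>\<omega>. \<integral>s. cos (a * Z n \<omega> $ j / real n * s) \<partial>gauss \<partial>S)"
      by (simp only: E_def gauss_cos)
    also have "\<dots> = (\<integral>s. \<integral>\<omega>. cos (a * Z n \<omega> $ j / real n * s) \<partial>S \<partial>gauss)"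
    proof (rule SG.Fubini_integral[symmetric])
      have [measurable]: "(\<lambda>x. Z n (fst x) $ j) \<in> borel_measurable (S \<Otimes>\<^sub>M gauss)"
        by (rule measurable_compose[OF measurable_fst]) measurable
      show "integrable (S \<Otimes>\<^sub>M gauss) (\<lambda>(\<omega>, s). cos (a * Z n \<omega> $ j / real n * s))"
        by (rule SG.integrable_const_bound[where B = 1]) (auto simp: case_prod_beta')
    qed
    also have "\<dots> = (\<integral>s. \<integral>\<omega>. cos (s * a * (\<Sum>k<n. snd (\<omega> k) $ j) / real n) \<partial>S \<partial>gauss)"
      by (simp add: sum_components_Z ac_simps)
    finally show ?thesis .
  qed
  have "(\<lambda>n. \<integral>s. \<integral>\<omega>. cos (s * a * (\<Sum>k<n. snd (\<omega> k) $ j) / real n) \<partial>S \<partial>gauss) \<longlonglongrightarrow> (\<integral>s. 1 \<partial>gauss)"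
  proof (rule integral_dominated_convergence[where w = "\<lambda>_. 1"])
    show "(\<lambda>s. \<integral>\<omega>. cos (s * a * (\<Sum>k<n. snd (\<omega> k) $ j) / real n) \<partial>S) \<in> borel_measurable gauss" for n
      by (rule P.borel_measurable_lebesgue_integral) (simp add: case_prod_beta')
    show "AE s in gauss. (\<lambda>n. \<integral>\<omega>. cos (s * a * (\<Sum>k<n. snd (\<omega> k) $ j) / real n) \<partial>S) \<longlonglongrightarrow> 1"
      by (rule AE_I2) (rule lln_cos[OF int mean])
    show "AE s in gauss. norm (\<integral>\<omega>. cos (s * a * (\<Sum>k<n. snd (\<omega> k) $ j) / real n) \<partial>S) \<le> 1" for n
    proof (rule AE_I2)
      fix s
      have "norm (\<integral>\<omega>. cos (s * a * (\<Sum>k<n. snd (\<omega> k) $ j) / real n) \<partial>S)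
          \<le> (\<integral>\<omega>. norm (cos (s * a * (\<Sum>k<n. snd (\<omega> k) $ j) / real n)) \<partial>S)"
        by (rule integral_norm_bound)
      also have "\<dots> \<le> (\<integral>\<omega>. 1 \<partial>S)"
        by (rule integral_mono) (auto intro!: P.integrable_const_bound[where B = 1])
      finally show "norm (\<integral>\<omega>. cos (s * a * (\<Sum>k<n. snd (\<omega> k) $ j) / real n) \<partial>S) \<le> 1" using P.prob_space by simp
    qed
  qed simp_all
  then have "(\<lambda>n. E n) \<longlonglongrightarrow> (\<integral>s. 1 \<partial>gauss)" by (simp only: E_eq)
  then have E1: "E \<longlonglongrightarrow> 1" using gauss.prob_space by simp
  \<comment> \<open>The loss at the boundary |Z| = k/a, where the exponent is -1/2.\<close>
  define d where "d = 1 - exp (- 1 / 2 :: real)"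
  have d: "d > 0" by (simp add: d_def)
  have "eventually (\<lambda>n. E n > 1 - d / 2) sequentially" by (rule order_tendstoD(1)[OF E1]) (use d in simp)
  then obtain k0 where k0: "\<And>n. n \<ge> k0 \<Longrightarrow> E n > 1 - d / 2" by (auto simp: eventually_sequentially)
  have "measure S {\<omega>. norm (Z k \<omega>) \<le> real k / a} \<ge> 1 / 2" if k: "k \<ge> max 1 k0" for k
  proof -
    let ?B = "{\<omega>. \<not> norm (Z k \<omega>) \<le> real k / a}"
    have sets: "?B \<in> sets S" by (rule sets_Collect_S) measurable
    have iB: "integrable S (\<lambda>\<omega>. d * indicator ?B \<omega>)"
      using sets by (intro integrable_mult_right integrable_real_indicator) (simp_all only: P.emeasure_eq_measure infinity_ennreal_def ennreal_less_top)
    have "E k \<le> (\<integral>\<omega>. 1 - d * indicator ?B \<omega> \<partial>S)"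
      unfolding E_def
    proof (rule integral_mono)
      show "integrable S (\<lambda>\<omega>. exp (- (a * Z k \<omega> $ j / real k)\<^sup>2 / 2))"
        by (rule P.integrable_const_bound[where B = 1]) (auto intro!: AE_I2)
      show "integrable S (\<lambda>\<omega>. 1 - d * indicator ?B \<omega>)"
        by (rule Bochner_Integration.integrable_diff[OF _ iB]) simp
      fix \<omega>
      show "exp (- (a * Z k \<omega> $ j / real k)\<^sup>2 / 2) \<le> 1 - d * indicator ?B \<omega>"
      proof (cases "\<omega> \<in> ?B")
        case True
        then have "real k < a * \<bar>Z k \<omega> $ j\<bar>" using a by (simp add: norm1 field_simps)
        then have "1 \<le> \<bar>a * Z k \<omega> $ j / real k\<bar>" using a k by (simp add: abs_mult field_simps)
        then have "1\<^sup>2 \<le> \<bar>a * Z k \<omega> $ j / real k\<bar>\<^sup>2" by (intro power_mono) auto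
        then have "1 \<le> (a * Z k \<omega> $ j / real k)\<^sup>2" by (simp only: power2_abs one_power2)
        then have "exp (- (a * Z k \<omega> $ j / real k)\<^sup>2 / 2) \<le> exp (- 1 / 2)" by simp
        with True show ?thesis by (simp add: d_def)
      qed simp
    qed
    also have "\<dots> = 1 - d * measure S ?B"
    proof -
      have "(\<integral>\<omega>. 1 - d * indicator ?B \<omega> \<partial>S) = (\<integral>\<omega>. 1 \<partial>S) - (\<integral>\<omega>. d * indicator ?B \<omega> \<partial>S)"
        by (rule Bochner_Integration.integral_diff[OF _ iB]) simp
      moreover have "(\<integral>\<omega>. 1 \<partial>S) = (1 :: real)" using P.prob_space by simp
      moreover have "(\<integral>\<omega>. d * indicator ?B \<omega> \<partial>S) = d * measure S ?B"
        by simp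
      ultimately show ?thesis by (simp only:)
    qed
    finally have "1 - d / 2 < 1 - d * measure S ?B" using k0[of k] k by simp
    then have "d * measure S ?B < d * (1 / 2)" by simp
    then have "measure S ?B < 1 / 2" using d by (simp only: mult_less_cancel_left_pos)
    moreover have "measure S ?B = 1 - measure S {\<omega>. norm (Z k \<omega>) \<le> real k / a}"
      by (rule prob_not) measurable
    ultimately show ?thesis by simp
  qed
  then show ?thesis by blast
qed

text \<open>The classical argument for the maximal ergodic inequality: W is integrated over the
  event that some partial sum of bounded length is positive, and by hypothesis these events exhaust
  the space as the length grows.\<close>

lemma maximal_ergodic:
  fixes W :: "(real ^ 'r) \<times> (real ^ 's) \<Rightarrow> real"
  assumes int: "integrable \<mu> W" and pos: "AE \<omega> in S. \<exists>n. (\<Sum>k<n. W (\<omega> k)) > 0"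
  shows "(\<integral>y. W y \<partial>\<mu>) \<ge> 0"
proof -
  have W [measurable]: "W \<in> borel_measurable \<mu>" using int by simp
  \<comment> \<open>\<open>m n\<close> is the largest of the partial sums of length 0 to
    \<open>n\<close>, written as a recursion along the shift.\<close>
  define m :: "nat \<Rightarrow> (nat \<Rightarrow> (real ^ 'r) \<times> (real ^ 's)) \<Rightarrow> real"
    where "m = rec_nat (\<lambda>_. 0) (\<lambda>n f \<omega>. max 0 (W (\<omega> 0) + f (\<lambda>i. \<omega> (Suc i))))"
  have m0: "m 0 = (\<lambda>_. 0)" and mSuc: "m (Suc n) = (\<lambda>\<omega>. max 0 (W (\<omega> 0) + m n (\<lambda>i. \<omega> (Suc i))))" for n
    by (simp_all add: m_def)
  have shift: "distr S S (\<lambda>\<omega> i. \<omega> (Suc i)) = S" using distr_shift[of 1] by simp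
  have intW: "integrable S (\<lambda>\<omega>. W (\<omega> 0))" by (rule integrable_component[OF W int])
  have int_shift: "integrable S (\<lambda>\<omega>. f (\<lambda>i. \<omega> (Suc i)))" "(\<integral>\<omega>. f (\<lambda>i. \<omega> (Suc i)) \<partial>S) = (\<integral>\<omega>. f \<omega> \<partial>S)"
    if f: "integrable S f" for f :: "_ \<Rightarrow> real"
  proof -
    have "integrable (distr S S (\<lambda>\<omega> i. \<omega> (Suc i))) f" by (simp only: shift f)
    then show "integrable S (\<lambda>\<omega>. f (\<lambda>i. \<omega> (Suc i)))" by (rule integrable_distr[OF measurable_Suc_shift])
    have "(\<integral>\<omega>. f \<omega> \<partial>S) = (\<integral>\<omega>. f \<omega> \<partial>distr S S (\<lambda>\<omega> i. \<omega> (Suc i)))" by (simp only: shift)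
    also have "\<dots> = (\<integral>\<omega>. f (\<lambda>i. \<omega> (Suc i)) \<partial>S)"
      by (rule integral_distr[OF measurable_Suc_shift]) (use f in simp)
    finally show "(\<integral>\<omega>. f (\<lambda>i. \<omega> (Suc i)) \<partial>S) = (\<integral>\<omega>. f \<omega> \<partial>S)" ..
  qed
  have int_m: "integrable S (m n)" for n
  proof (induction n)
    case (Suc n)
    have "integrable S (\<lambda>\<omega>. max 0 (W (\<omega> 0) + m n (\<lambda>i. \<omega> (Suc i))))"
      by (rule integrable_max[OF _ Bochner_Integration.integrable_add[OF intW int_shift(1)[OF Suc]]]) simp
    then show ?case by (simp only: mSuc)
  qed (simp add: m0)
  have m_mono: "m n \<omega> \<le> m (Suc n) \<omega>" for n \<omega>
  proof (induction n arbitrary: \<omega>)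
    case (Suc n)
    show ?case by (subst (1 2) mSuc) (use Suc[of "\<lambda>i. \<omega> (Suc i)"] in \<open>auto simp: max_def\<close>)
  qed (simp add: m0 mSuc)
  have m_nonneg: "m n \<omega> \<ge> 0" for n \<omega> by (cases n) (auto simp: m0 mSuc)
  have m_ge: "(\<Sum>k<j. W (\<omega> k)) \<le> m n \<omega>" if "j \<le> n" for j n \<omega>
    using that
  proof (induction n arbitrary: j \<omega>)
    case (Suc n)
    show ?case
    proof (cases j)
      case (Suc i)
      then have "(\<Sum>k<i. W (\<omega> (Suc k))) \<le> m n (\<lambda>i. \<omega> (Suc i))" using Suc.prems by (intro Suc.IH) auto
      then show ?thesis unfolding Suc sum.lessThan_Suc_shift mSuc by simp
    qed (simp add: m_nonneg)
  qed (simp add: m0)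
  define A where "A n = {\<omega>. m (Suc n) \<omega> > 0}" for n
  have [measurable]: "m n \<in> borel_measurable S" for n using int_m by simp
  have A [measurable]: "A n \<in> sets S" for n unfolding A_def by (rule sets_Collect_S) measurable
  have ge0: "0 \<le> (\<integral>\<omega>. indicator (A n) \<omega> * W (\<omega> 0) \<partial>S)" for n
  proof -
    \<comment> \<open>By shift invariance \<open>m n\<close> may be evaluated along the shifted
      sequence. Then the difference is exactly W (\<omega> 0) on \<open>A n\<close>, and at most 0
      elsewhere because \<open>m (Suc n)\<close> vanishes there.\<close>
    have "0 \<le> (\<integral>\<omega>. m (Suc n) \<omega> \<partial>S) - (\<integral>\<omega>. m n \<omega> \<partial>S)"
      using integral_mono[OF int_m[of n] int_m[of "Suc n"] m_mono] by simp
    also have "(\<integral>\<omega>. m n \<omega> \<partial>S) = (\<integral>\<omega>. m n (\<lambda>i. \<omega> (Suc i)) \<partial>S)" by (rule int_shift(2)[OF int_m, symmetric])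
    also have "(\<integral>\<omega>. m (Suc n) \<omega> \<partial>S) - (\<integral>\<omega>. m n (\<lambda>i. \<omega> (Suc i)) \<partial>S) = (\<integral>\<omega>. m (Suc n) \<omega> - m n (\<lambda>i. \<omega> (Suc i)) \<partial>S)"
      by (rule Bochner_Integration.integral_diff[symmetric, OF int_m int_shift(1)[OF int_m]])
    also have "\<dots> \<le> (\<integral>\<omega>. indicator (A n) \<omega> * W (\<omega> 0) \<partial>S)"
    proof (rule integral_mono)
      show "integrable S (\<lambda>\<omega>. m (Suc n) \<omega> - m n (\<lambda>i. \<omega> (Suc i)))"
        by (rule Bochner_Integration.integrable_diff[OF int_m int_shift(1)[OF int_m]])
      show "integrable S (\<lambda>\<omega>. indicator (A n) \<omega> * W (\<omega> 0))"
        by (rule Bochner_Integration.integrable_bound[OF intW]) (auto simp: indicator_def)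
      fix \<omega>
      show "m (Suc n) \<omega> - m n (\<lambda>i. \<omega> (Suc i)) \<le> indicator (A n) \<omega> * W (\<omega> 0)"
      proof (cases "\<omega> \<in> A n")
        case True
        then have "m (Suc n) \<omega> > 0" by (simp add: A_def)
        then have "m (Suc n) \<omega> = W (\<omega> 0) + m n (\<lambda>i. \<omega> (Suc i))" by (simp add: mSuc max_def split: if_splits)
        with True show ?thesis by simp
      next
        case False
        then have "m (Suc n) \<omega> \<le> 0" by (simp add: A_def)
        with False m_nonneg[of n "\<lambda>i. \<omega> (Suc i)"] show ?thesis by simp
      qed
    qed
    finally show ?thesis .
  qed
  have "(\<lambda>n. \<integral>\<omega>. indicator (A n) \<omega> * W (\<omega> 0) \<partial>S) \<longlonglongrightarrow> (\<integral>\<omega>. W (\<omega> 0) \<partial>S)"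
  proof (rule integral_dominated_convergence[where w = "\<lambda>\<omega>. \<bar>W (\<omega> 0)\<bar>"])
    show "integrable S (\<lambda>\<omega>. \<bar>W (\<omega> 0)\<bar>)" using intW by simp
    show "AE \<omega> in S. (\<lambda>n. indicator (A n) \<omega> * W (\<omega> 0)) \<longlonglongrightarrow> W (\<omega> 0)"
      using pos
    proof eventually_elim
      case (elim \<omega>)
      then obtain j where j: "(\<Sum>k<j. W (\<omega> k)) > 0" by blast
      have "\<omega> \<in> A n" if "n \<ge> j" for n
        using m_ge[of j "Suc n" \<omega>] j that by (simp add: A_def)
      then have "eventually (\<lambda>n. indicator (A n) \<omega> * W (\<omega> 0) = W (\<omega> 0)) sequentially"
        by (auto simp: eventually_sequentially intro!: exI[of _ j])
      then show ?case by (rule tendsto_eventually)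
    qed
    show "AE \<omega> in S. norm (indicator (A n) \<omega> * W (\<omega> 0)) \<le> \<bar>W (\<omega> 0)\<bar>" for n
      by (rule AE_I2) (simp add: indicator_def)
  qed measurable
  then have "(\<integral>\<omega>. W (\<omega> 0) \<partial>S) \<ge> 0" using ge0 by (intro LIMSEQ_le_const) auto
  then show ?thesis by (simp add: integral_component)
qed

end

section \<open>The recurrence criterion\<close>

context refl_setting
begin

text \<open>The event for \<open>Z\<close> has probability at least 1/2 at every scale, so one box
  that \<open>X\<close> leaves with probability at most 1/4 serves all scales.\<close>

lemma box_lower_1:
  assumes card: "CARD('s) = 1"
    and int: "\<And>j. integrable \<mu> (\<lambda>y. snd y $ j)" and mean: "\<And>j. (\<integral>y. snd y $ j \<partial>\<mu>) = 0"
  shows "\<exists>K. \<forall>a\<ge>1. \<exists>k0. \<forall>k\<ge>k0. measure S {\<omega>. norm (X x k \<omega>) \<le> K \<and> norm (Z k \<omega>) \<le> real k / a} \<ge> 1 / 4"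
proof -
  have "(1 / 4 :: real) > 0" by simp
  from X_tight'[OF this, of "norm x"]
  obtain K where K: "\<And>n. measure S {\<omega>. norm (X x n \<omega>) > K} \<le> 1 / 4" by blast
  show ?thesis
  proof (intro exI[of _ K] allI impI)
    fix a :: real assume "a \<ge> 1"
    from Z_lower_bound_1[OF card int mean this]
    obtain k0 where k0: "\<forall>k\<ge>k0. measure S {\<omega>. norm (Z k \<omega>) \<le> real k / a} \<ge> 1 / 2" ..
    have "measure S {\<omega>. norm (X x k \<omega>) \<le> K \<and> norm (Z k \<omega>) \<le> real k / a} \<ge> 1 / 4" if "k \<ge> k0" for k
    proof -
      have "measure S {\<omega>. norm (Z k \<omega>) \<le> real k / a \<and> norm (X x k \<omega>) \<le> K}
          \<ge> measure S {\<omega>. norm (Z k \<omega>) \<le> real k / a} - measure S {\<omega>. \<not> norm (X x k \<omega>) \<le> K}"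
        by (rule prob_conj_ge) measurable
      moreover have "measure S {\<omega>. norm (Z k \<omega>) \<le> real k / a} \<ge> 1 / 2" using k0 that by blast
      moreover have "measure S {\<omega>. \<not> norm (X x k \<omega>) \<le> K} \<le> 1 / 4" using K by (simp add: not_le)
      ultimately show ?thesis by (simp add: conj_commute)
    qed
    then show "\<exists>k0. \<forall>k\<ge>k0. measure S {\<omega>. norm (X x k \<omega>) \<le> K \<and> norm (Z k \<omega>) \<le> real k / a} \<ge> 1 / 4" by blast
  qed
qed

text \<open>
  Conditionally on the rare event that \<open>Z\<^sub>k\<close> is small, \<open>X\<^sub>k\<close> is only known to lie in a box that depends
  on the scale \<open>a\<close>; running the walk for a bounded time more brings it back to a fixed box.
\<close>

lemma box_lower_2:
  assumes card: "CARD('s) = 2" and x: "x \<in> state_space I"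
    and sq: "\<And>j. integrable \<mu> (\<lambda>y. (snd y $ j)\<^sup>2)" and mean: "\<And>j. (\<integral>y. snd y $ j \<partial>\<mu>) = 0"
  shows "\<exists>K. \<exists>c>0. \<forall>a\<ge>1. \<exists>k0. \<forall>k\<ge>k0. measure S {\<omega>. norm (X x k \<omega>) \<le> K \<and> norm (Z k \<omega>) \<le> sqrt k / a} \<ge> c / a\<^sup>2"
proof -
  from Z_lower_bound_2[OF card sq mean]
  obtain c where c: "c > 0" and
    Zlow: "\<forall>a\<ge>1. \<exists>k0. \<forall>k\<ge>k0. measure S {\<omega>. norm (Z k \<omega>) \<le> sqrt k / a} \<ge> c / a\<^sup>2" by blast
  have quarter: "(1 / 4 :: real) > 0" by simp
  \<comment> \<open>\<open>K1\<close> serves all parity representatives, which have norm at most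
    CARD('r), and is fixed before the scale \<open>a\<close>.\<close>
  from X_tight'[OF this, of "real CARD('r)"]
  obtain K1 where K1: "\<And>n z. norm z \<le> real CARD('r) \<Longrightarrow> measure S {\<omega>. norm (X z n \<omega>) > K1} \<le> 1 / 4" by blast
  have main: "\<exists>k0. \<forall>k\<ge>k0. measure S {\<omega>. norm (X x k \<omega>) \<le> K1 + 1 \<and> norm (Z k \<omega>) \<le> sqrt k / a} \<ge> (c / 32) / a\<^sup>2"
    if a: "a \<ge> 1" for a
  proof -
    \<comment> \<open>Half of the bound c/(4 a^2) for \<open>Z\<close> at scale 2a. The doubled
      scale reserves half of the radius for the displacement of \<open>Z\<close> during the recovery
      time \<open>m\<close>.\<close>
    define \<delta> where "\<delta> = c / (8 * a\<^sup>2)"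
    have \<delta>: "\<delta> > 0" using c a by (simp add: \<delta>_def)
    from X_tight'[OF this, of "norm x"]
    obtain K' where K': "\<And>n. measure S {\<omega>. norm (X x n \<omega>) > K'} \<le> \<delta>" by blast
    define R where "R = max K' (real CARD('r))"
    have zero_less_one: "(1 :: real) > 0" by simp
    from X_contraction[OF zero_less_one quarter, of R]
    obtain m where m: "\<forall>n\<ge>m. \<forall>z z' h. z \<in> parity_class I h \<longrightarrow> z' \<in> parity_class I h \<longrightarrow> norm z \<le> R \<longrightarrow> norm z' \<le> R \<longrightarrow>
      measure S {\<omega>. norm (X z n \<omega> - X z' n \<omega>) \<ge> 1} \<le> 1 / 4" by blast
    have "(\<lambda>\<omega>. norm (Z m \<omega>)) \<in> borel_measurable S" by measurable
    then obtain \<rho> where \<rho>: "measure S {\<omega>. norm (Z m \<omega>) > \<rho>} \<le> 1 / 4" by (rule prob_tail[OF _ quarter])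
    \<comment> \<open>Three failures of probability at most 1/4 each: the walk has not come close to
      the copy from the representative, this copy is outside its box, or \<open>Z\<close> has moved
      by more than \<rho>.\<close>
    have recover: "1 / 4 \<le> measure S {\<omega>. norm (X z m \<omega>) \<le> K1 + 1 \<and> norm (Z m \<omega>) \<le> \<rho>}"
      if z: "z \<in> state_space I" "norm z \<le> R" for z
    proof -
      define w :: "real ^ 'r" where "w = parity_rep (parity I z)"
      have w: "w \<in> parity_class I (parity I z)" "norm w \<le> R" "norm w \<le> real CARD('r)"
        using parity_rep_in_class[OF parity_in_group] norm_parity_rep_le[of "parity I z"] by (auto simp: w_def R_def)
      have zc: "z \<in> parity_class I (parity I z)" using z by (simp add: parity_class_def)
      have "measure S {\<omega>. \<not> (norm (X z m \<omega>) \<le> K1 + 1 \<and> norm (Z m \<omega>) \<le> \<rho>)}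
          \<le> measure S {\<omega>. (norm (X z m \<omega> - X w m \<omega>) \<ge> 1 \<or> norm (X w m \<omega>) > K1) \<or> norm (Z m \<omega>) > \<rho>}"
      proof (rule prob_mono)
        fix \<omega> assume *: "\<not> (norm (X z m \<omega>) \<le> K1 + 1 \<and> norm (Z m \<omega>) \<le> \<rho>)"
        show "(norm (X z m \<omega> - X w m \<omega>) \<ge> 1 \<or> norm (X w m \<omega>) > K1) \<or> norm (Z m \<omega>) > \<rho>"
          using * norm_triangle_ineq2[of "X z m \<omega>" "X w m \<omega>"] by linarith
      qed measurable
      also have "\<dots> \<le> measure S {\<omega>. norm (X z m \<omega> - X w m \<omega>) \<ge> 1 \<or> norm (X w m \<omega>) > K1} + measure S {\<omega>. norm (Z m \<omega>) > \<rho>}"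
        by (rule prob_disj_le) measurable
      also have "measure S {\<omega>. norm (X z m \<omega> - X w m \<omega>) \<ge> 1 \<or> norm (X w m \<omega>) > K1}
          \<le> measure S {\<omega>. norm (X z m \<omega> - X w m \<omega>) \<ge> 1} + measure S {\<omega>. norm (X w m \<omega>) > K1}"
        by (rule prob_disj_le) measurable
      also have "measure S {\<omega>. norm (X z m \<omega> - X w m \<omega>) \<ge> 1} \<le> 1 / 4" using m zc w z by blast
      also have "measure S {\<omega>. norm (X w m \<omega>) > K1} \<le> 1 / 4" by (rule K1[OF w(3)])
      also note \<rho>
      finally have "measure S {\<omega>. \<not> (norm (X z m \<omega>) \<le> K1 + 1 \<and> norm (Z m \<omega>) \<le> \<rho>)} \<le> 3 / 4" by simp
      moreover have "measure S {\<omega>. \<not> (norm (X z m \<omega>) \<le> K1 + 1 \<and> norm (Z m \<omega>) \<le> \<rho>)}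
          = 1 - measure S {\<omega>. norm (X z m \<omega>) \<le> K1 + 1 \<and> norm (Z m \<omega>) \<le> \<rho>}"
        by (rule prob_not) measurable
      ultimately show ?thesis by simp
    qed
    have "2 * a \<ge> 1" using a by simp
    with Zlow obtain k1 where k1: "\<forall>k\<ge>k1. measure S {\<omega>. norm (Z k \<omega>) \<le> sqrt k / (2 * a)} \<ge> c / (2 * a)\<^sup>2" by blast
    \<comment> \<open>From time \<open>k2\<close> on, \<rho> is at most the reserved half radius
      sqrt k/(2a).\<close>
    obtain k2 :: nat where k2: "real k2 \<ge> (2 * a * \<rho>)\<^sup>2" using real_arch_simple by blast
    have [measurable]: "state_space I \<in> sets borel"
    proof -
      have "state_space I = (\<Union>h\<in>parity_group I. parity_class I h)"
        using parity_in_group by (auto simp: parity_class_def)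
      then show ?thesis using closed_parity_class by (auto intro!: borel_closed closed_UN)
    qed
    have step: "measure S {\<omega>. norm (X x (k + m) \<omega>) \<le> K1 + 1 \<and> norm (Z (k + m) \<omega>) \<le> sqrt (k + m) / a} \<ge> (c / 32) / a\<^sup>2"
      if k: "k \<ge> max k1 k2" for k
    proof -
      define P' where "P' \<omega> \<longleftrightarrow> (norm (Z k \<omega>) \<le> sqrt k / (2 * a) \<and> norm (X x k \<omega>) \<le> K') \<and> X x k \<omega> \<in> state_space I" for \<omega>
      define Q' where "Q' \<omega> \<longleftrightarrow> norm (X x (k + m) \<omega>) \<le> K1 + 1 \<and> norm (Z (k + m) \<omega> - Z k \<omega>) \<le> \<rho>" for \<omega>
      have [measurable]: "Measurable.pred S P'" "Measurable.pred S Q'" unfolding P'_def Q'_def by measurable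
      have "c / (2 * a)\<^sup>2 - \<delta> \<le> measure S {\<omega>. norm (Z k \<omega>) \<le> sqrt k / (2 * a)} - measure S {\<omega>. \<not> norm (X x k \<omega>) \<le> K'}"
        using k1 k K'[of k] by (intro diff_mono) (auto simp: not_le)
      also have "\<dots> \<le> measure S {\<omega>. norm (Z k \<omega>) \<le> sqrt k / (2 * a) \<and> norm (X x k \<omega>) \<le> K'}"
        by (rule prob_conj_ge) measurable
      also have "\<dots> \<le> measure S {\<omega>. P' \<omega>}"
      proof (rule prob_mono_AE)
        show "AE \<omega> in S. norm (Z k \<omega>) \<le> sqrt k / (2 * a) \<and> norm (X x k \<omega>) \<le> K' \<longrightarrow> P' \<omega>"
          using AE_integers by eventually_elim (use X_in_class[OF x] in \<open>auto simp: P'_def parity_class_def\<close>)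
      qed measurable
      finally have P': "c / (2 * a)\<^sup>2 - \<delta> \<le> measure S {\<omega>. P' \<omega>}" .
      have "c / (2 * a)\<^sup>2 - \<delta> = c / 8 / a\<^sup>2" by (simp add: \<delta>_def power_mult_distrib field_simps)
      with P' have "c / 8 / a\<^sup>2 \<le> measure S {\<omega>. P' \<omega>}" by simp
      then have "(c / 32) / a\<^sup>2 \<le> 1 / 4 * measure S {\<omega>. P' \<omega>}" by simp
      also have "\<dots> \<le> measure S {\<omega>. P' \<omega> \<and> Q' \<omega>}"
      proof (rule prob_comb_ge[where k = k])
        show "P' (comb_seq k \<omega> \<omega>') \<longleftrightarrow> P' \<omega>" for \<omega> \<omega>' by (simp add: P'_def X_comb_le Z_comb_le)
        show "1 / 4 \<le> measure S {\<omega>'. Q' (comb_seq k \<omega> \<omega>')}" if "P' \<omega>" for \<omega>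
        proof -
          have "X x k \<omega> \<in> state_space I" "norm (X x k \<omega>) \<le> R" using that by (auto simp: P'_def R_def)
          from recover[OF this] show ?thesis by (simp add: Q'_def X_comb Z_comb Z_comb_le)
        qed
      qed auto
      also have "\<dots> \<le> measure S {\<omega>. norm (X x (k + m) \<omega>) \<le> K1 + 1 \<and> norm (Z (k + m) \<omega>) \<le> sqrt (k + m) / a}"
      proof (rule prob_mono)
        fix \<omega> assume *: "P' \<omega> \<and> Q' \<omega>"
        have "2 * a * \<rho> \<le> \<bar>2 * a * \<rho>\<bar>" by simp
        also have "\<dots> = sqrt ((2 * a * \<rho>)\<^sup>2)" by simp
        also have "\<dots> \<le> sqrt k" using k k2 by (intro real_sqrt_le_mono) simp
        finally have "\<rho> \<le> sqrt k / (2 * a)" using a by (simp add: field_simps)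
        then have "norm (Z (k + m) \<omega>) \<le> sqrt k / (2 * a) + sqrt k / (2 * a)"
          using * norm_triangle_ineq[of "Z (k + m) \<omega> - Z k \<omega>" "Z k \<omega>"] by (simp add: P'_def Q'_def)
        also have "\<dots> = sqrt k / a" using a by (simp add: field_simps)
        also have "\<dots> \<le> sqrt (k + m) / a" using a by (intro divide_right_mono real_sqrt_le_mono) auto
        finally show "norm (X x (k + m) \<omega>) \<le> K1 + 1 \<and> norm (Z (k + m) \<omega>) \<le> sqrt (k + m) / a"
          using * by (simp add: Q'_def)
      qed measurable
      finally show ?thesis .
    qed
    show ?thesis
    proof (intro exI[of _ "max k1 k2 + m"] allI impI)
      fix k assume "k \<ge> max k1 k2 + m"
      then have "k - m \<ge> max k1 k2" "k - m + m = k" by auto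
      with step[of "k - m"] show "measure S {\<omega>. norm (X x k \<omega>) \<le> K1 + 1 \<and> norm (Z k \<omega>) \<le> sqrt k / a} \<ge> (c / 32) / a\<^sup>2"
        by (simp only:)
    qed
  qed
  \<comment> \<open>A bound c/8 remains after subtracting \<delta>, and recovery succeeds with
    probability at least 1/4.\<close>
  have "c / 32 > 0" using c by simp
  with main show ?thesis by blast
qed

text \<open>For times k from r to A r, being below k/A implies being below r. So each of these (A -
  1) r terms is at least 1/4, with A as large as desired.\<close>

lemma box_divergence_1:
  assumes card: "CARD('s) = 1"
    and low: "\<forall>a\<ge>1. \<exists>k0. \<forall>k\<ge>k0. measure S {\<omega>. norm (X x k \<omega>) \<le> K \<and> norm (Z k \<omega>) \<le> real k / a} \<ge> 1 / 4"
  shows "\<exists>r\<ge>R. \<exists>N. (\<Sum>k<N. measure S {\<omega>. norm (X x k \<omega>) \<le> K \<and> norm (Z k \<omega>) \<le> r}) > M * r ^ CARD('s)"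
proof -
  obtain A :: nat where A: "real A \<ge> 4 * \<bar>M\<bar> + 2" using real_arch_simple by blast
  then have "real A \<ge> 1" by simp
  with low obtain k0 where k0: "\<forall>k\<ge>k0. measure S {\<omega>. norm (X x k \<omega>) \<le> K \<and> norm (Z k \<omega>) \<le> real k / A} \<ge> 1 / 4" by blast
  obtain r0 :: nat where r0: "real r0 \<ge> R" using real_arch_simple by blast
  define r where "r = max r0 (max k0 1)"
  have r: "real r \<ge> R" "r \<ge> k0" "r \<ge> 1" using r0 by (auto simp: r_def)
  let ?f = "\<lambda>k. measure S {\<omega>. norm (X x k \<omega>) \<le> K \<and> norm (Z k \<omega>) \<le> real r}"
  have f: "?f k \<ge> 1 / 4" if "k \<in> {r..<A * r}" for k
  proof -
    have "real k \<le> real A * real r" using that by (simp flip: of_nat_mult)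
    then have "real k / A \<le> real r" using \<open>real A \<ge> 1\<close> by (simp add: field_simps)
    then have "measure S {\<omega>. norm (X x k \<omega>) \<le> K \<and> norm (Z k \<omega>) \<le> real k / A} \<le> ?f k"
      by (intro prob_mono) auto
    moreover have "measure S {\<omega>. norm (X x k \<omega>) \<le> K \<and> norm (Z k \<omega>) \<le> real k / A} \<ge> 1 / 4"
      using k0 that r by auto
    ultimately show ?thesis by simp
  qed
  have "r \<le> A * r" using \<open>real A \<ge> 1\<close> by simp
  have "\<bar>M\<bar> * real r < (real A - 1) / 4 * real r" using A r(3) by (intro mult_strict_right_mono) auto
  also have "\<dots> = (\<Sum>k\<in>{r..<A * r}. 1 / 4)" using \<open>r \<le> A * r\<close> by (simp add: of_nat_diff algebra_simps diff_divide_distrib)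
  also have "\<dots> \<le> (\<Sum>k\<in>{r..<A * r}. ?f k)" by (intro sum_mono f)
  also have "\<dots> \<le> (\<Sum>k<A * r. ?f k)" by (intro sum_mono2) auto
  finally have "\<bar>M\<bar> * real r < (\<Sum>k<A * r. ?f k)" .
  moreover have "M * real r \<le> \<bar>M\<bar> * real r" by (intro mult_right_mono) auto
  ultimately have "M * real r ^ CARD('s) < (\<Sum>k<A * r. ?f k)" by (simp add: card)
  with r(1) show ?thesis by blast
qed

text \<open>The block of times from r^2 4^j to r^2 4^(j+1) has 3 r^2 4^j terms, each at least
  c/4^(j+1) by the bound at scale 2^(j+1). So every block contributes 3c/4 times r^2, and the number
  \<open>l\<close> of blocks is the logarithmic factor.\<close>

lemma box_divergence_2:
  assumes card: "CARD('s) = 2" and c: "c > 0"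
    and low: "\<forall>a\<ge>1. \<exists>k0. \<forall>k\<ge>k0. measure S {\<omega>. norm (X x k \<omega>) \<le> K \<and> norm (Z k \<omega>) \<le> sqrt k / a} \<ge> c / a\<^sup>2"
  shows "\<exists>r\<ge>R. \<exists>N. (\<Sum>k<N. measure S {\<omega>. norm (X x k \<omega>) \<le> K \<and> norm (Z k \<omega>) \<le> r}) > M * r ^ CARD('s)"
proof -
  have "\<exists>k0. \<forall>k\<ge>k0. measure S {\<omega>. norm (X x k \<omega>) \<le> K \<and> norm (Z k \<omega>) \<le> sqrt k / 2 ^ Suc j} \<ge> c / (2 ^ Suc j)\<^sup>2" for j
  proof -
    have "(1 :: real) \<le> 2 ^ Suc j" by (rule one_le_power) simp
    with low show ?thesis by blast
  qed
  then have "\<forall>j. \<exists>k0. \<forall>k\<ge>k0. measure S {\<omega>. norm (X x k \<omega>) \<le> K \<and> norm (Z k \<omega>) \<le> sqrt k / 2 ^ Suc j} \<ge> c / (2 ^ Suc j)\<^sup>2" ..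
  from choice[OF this] obtain k0 where
    k0: "\<forall>j. \<forall>k\<ge>k0 j. measure S {\<omega>. norm (X x k \<omega>) \<le> K \<and> norm (Z k \<omega>) \<le> sqrt k / 2 ^ Suc j} \<ge> c / (2 ^ Suc j)\<^sup>2" ..
  obtain l :: nat where l: "real l > \<bar>M\<bar> / (3 * c / 4)" using reals_Archimedean2 by blast
  obtain r0 :: nat where r0: "real r0 \<ge> R" using real_arch_simple by blast
  \<comment> \<open>The thresholds of all scales in use must lie below the start of the blocks; so
    \<open>l\<close> is fixed before \<open>r\<close>.\<close>
  define r where "r = max r0 (max (\<Sum>j<l. k0 j) 1)"
  have r: "real r \<ge> R" "r \<ge> 1" using r0 by (auto simp: r_def)
  have rk: "r \<ge> k0 j" if "j < l" for j
  proof -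
    have "k0 j \<le> (\<Sum>j<l. k0 j)" using that by (intro member_le_sum) auto
    then show ?thesis by (simp add: r_def)
  qed
  have four: "((2 :: real) ^ n)\<^sup>2 = 4 ^ n" for n
    by (simp add: power2_eq_square flip: power_mult_distrib)
  let ?f = "\<lambda>k. measure S {\<omega>. norm (X x k \<omega>) \<le> K \<and> norm (Z k \<omega>) \<le> real r}"
  have f: "?f k \<ge> c / 4 ^ Suc j" if j: "j < l" and k: "k \<in> {r\<^sup>2 * 4 ^ j..<r\<^sup>2 * 4 ^ Suc j}" for j k
  proof -
    have "r * 1 \<le> r * r" using r(2) by (intro mult_le_mono) auto
    also have "r * r \<le> r\<^sup>2 * 4 ^ j" by (simp add: power2_eq_square)
    finally have "k0 j \<le> k" using rk[OF j] k by simp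
    have "real k \<le> real (r\<^sup>2 * 4 ^ Suc j)" using k by (simp only: of_nat_le_iff atLeastLessThan_iff less_imp_le)
    also have "\<dots> = (real r)\<^sup>2 * (2 ^ Suc j)\<^sup>2" by (simp only: of_nat_mult of_nat_power of_nat_numeral four)
    finally have "sqrt k \<le> sqrt ((real r)\<^sup>2 * (2 ^ Suc j)\<^sup>2)" by (rule real_sqrt_le_mono)
    then have "sqrt k \<le> real r * 2 ^ Suc j" by (simp add: real_sqrt_mult)
    then have "sqrt k / 2 ^ Suc j \<le> real r" by (simp add: field_simps)
    then have "measure S {\<omega>. norm (X x k \<omega>) \<le> K \<and> norm (Z k \<omega>) \<le> sqrt k / 2 ^ Suc j} \<le> ?f k"
      by (intro prob_mono) auto
    moreover have "measure S {\<omega>. norm (X x k \<omega>) \<le> K \<and> norm (Z k \<omega>) \<le> sqrt k / 2 ^ Suc j} \<ge> c / (2 ^ Suc j)\<^sup>2"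
      using k0 \<open>k0 j \<le> k\<close> by blast
    ultimately show ?thesis by (simp only: four)
  qed
  have sum: "real i * (3 * c / 4 * (real r)\<^sup>2) \<le> (\<Sum>k<r\<^sup>2 * 4 ^ i. ?f k)" if "i \<le> l" for i
    using that
  proof (induction i)
    case 0
    show ?case by (simp add: sum_nonneg)
  next
    case (Suc i)
    have le: "r\<^sup>2 * 4 ^ i \<le> r\<^sup>2 * 4 ^ Suc i" by simp
    have "3 * c / 4 * (real r)\<^sup>2 = real (card {r\<^sup>2 * 4 ^ i..<r\<^sup>2 * 4 ^ Suc i}) * (c / 4 ^ Suc i)"
      by (simp add: field_simps)
    also have "\<dots> = (\<Sum>k\<in>{r\<^sup>2 * 4 ^ i..<r\<^sup>2 * 4 ^ Suc i}. c / 4 ^ Suc i)" by (simp only: sum_constant)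
    also have "\<dots> \<le> (\<Sum>k\<in>{r\<^sup>2 * 4 ^ i..<r\<^sup>2 * 4 ^ Suc i}. ?f k)" using Suc.prems by (intro sum_mono f) auto
    finally have "real (Suc i) * (3 * c / 4 * (real r)\<^sup>2)
        \<le> (\<Sum>k<r\<^sup>2 * 4 ^ i. ?f k) + (\<Sum>k\<in>{r\<^sup>2 * 4 ^ i..<r\<^sup>2 * 4 ^ Suc i}. ?f k)"
      using Suc by (simp add: algebra_simps)
    also have "\<dots> = (\<Sum>k<r\<^sup>2 * 4 ^ Suc i. ?f k)"
      using sum.atLeastLessThan_concat[OF _ le, of 0 ?f] by (simp add: lessThan_atLeast0)
    finally show ?case .
  qed
  have "\<bar>M\<bar> < real l * (3 * c / 4)" using l c by (simp add: field_simps)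
  then have "\<bar>M\<bar> * (real r)\<^sup>2 < real l * (3 * c / 4) * (real r)\<^sup>2" using r(2) by (intro mult_strict_right_mono) auto
  also have "\<dots> \<le> (\<Sum>k<r\<^sup>2 * 4 ^ l. ?f k)" using sum[of l] by (simp add: mult.assoc)
  finally have "\<bar>M\<bar> * (real r)\<^sup>2 < (\<Sum>k<r\<^sup>2 * 4 ^ l. ?f k)" .
  moreover have "M * (real r)\<^sup>2 \<le> \<bar>M\<bar> * (real r)\<^sup>2" by (intro mult_right_mono) auto
  ultimately have "M * real r ^ CARD('s) < (\<Sum>k<r\<^sup>2 * 4 ^ l. ?f k)" by (simp add: card)
  with r(1) show ?thesis by blast
qed

section \<open>Moments of the unreflected steps and the two directions of the criterion\<close>

lemma last_marginal_integrable:
  assumes "CARD('s) \<in> {1, 2}" "finite_moment (last_marginal \<mu>) CARD('s)"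
  shows "integrable \<mu> snd" "CARD('s) = 2 \<Longrightarrow> integrable \<mu> (\<lambda>y. (snd y $ j)\<^sup>2)"
proof -
  have pw: "integrable \<mu> (\<lambda>y. norm (snd y) ^ CARD('s))"
    using assms(2) unfolding finite_moment_def last_marginal_def by (subst (asm) integrable_distr_eq) auto
  show "integrable \<mu> snd"
  proof (cases "CARD('s) = 1")
    case True
    with pw have "integrable \<mu> (\<lambda>y. norm (snd y))" by simp
    then show ?thesis by (rule integrable_norm_cancel) measurable
  next
    case False
    with assms(1) have "CARD('s) = 2" by simp
    with pw have "integrable \<mu> (\<lambda>y. (norm (snd y))\<^sup>2)" by simp
    from mu.square_integrable_imp_integrable[OF _ this] have "integrable \<mu> (\<lambda>y. norm (snd y))" by simp
    then show ?thesis by (rule integrable_norm_cancel) measurable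
  qed
  show "integrable \<mu> (\<lambda>y. (snd y $ j)\<^sup>2)" if "CARD('s) = 2"
  proof (rule Bochner_Integration.integrable_bound)
    show "integrable \<mu> (\<lambda>y. (norm (snd y))\<^sup>2)" using pw that by simp
    have "(snd y $ j)\<^sup>2 \<le> (norm (snd y))\<^sup>2" for y :: "(real ^ 'r) \<times> (real ^ 's)"
      using component_le_norm_cart[of "snd y" j] by (metis abs_ge_zero power2_abs power_mono)
    then show "AE y in \<mu>. norm ((snd y $ j)\<^sup>2) \<le> norm ((norm (snd y))\<^sup>2)" by (intro AE_I2) simp
  qed measurable
qed

lemma centred_iff:
  assumes "integrable \<mu> snd"
  shows "centred (last_marginal \<mu>) \<longleftrightarrow> (\<forall>j. (\<integral>y. snd y $ j \<partial>\<mu>) = 0)"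
    and "integrable \<mu> (\<lambda>y. snd y $ j)"
proof -
  have eq: "integral\<^sup>L (last_marginal \<mu>) (\<lambda>v. v) = (\<integral>y. snd y \<partial>\<mu>)"
    unfolding last_marginal_def by (rule integral_distr) measurable
  have "(\<integral>y. snd y \<partial>\<mu>) $ j = (\<integral>y. snd y $ j \<partial>\<mu>)" for j
    using integral_bounded_linear[OF bounded_linear_vec_nth assms, of j] by simp
  then show "centred (last_marginal \<mu>) \<longleftrightarrow> (\<forall>j. (\<integral>y. snd y $ j \<partial>\<mu>) = 0)"
    unfolding centred_def eq by (simp add: vec_eq_iff)
  show "integrable \<mu> (\<lambda>y. snd y $ j)"
    using integrable_bounded_linear[OF bounded_linear_vec_nth assms] .
qed

lemma centred_imp_hits_infinite:
  assumes card: "CARD('s) \<in> {1, 2}" and mom: "finite_moment (last_marginal \<mu>) CARD('s)"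
    and cen: "centred (last_marginal \<mu>)"
    and C: "coset C" and \<nu>: "stationary C \<nu>" and x: "x \<in> measure_support \<nu>" and "\<epsilon> > 0"
  shows "AE \<omega> in S. infinite (hits x \<epsilon> \<omega>)"
proof (rule hits_infinite_of_divergence[OF _ \<open>\<epsilon> > 0\<close>])
  fix \<epsilon> M :: real assume "\<epsilon> > 0"
  have "x \<in> coset_space I C"
    using measure_support_subset_closed[OF _ _ closed_coset_space[OF C]] \<nu> x by (auto simp: invariant_prob_on_def)
  then have xs: "x \<in> state_space I" by (auto simp: coset_space_def)
  note int = last_marginal_integrable[OF card mom]
  have mean: "(\<integral>y. snd y $ j \<partial>\<mu>) = 0" for j using cen centred_iff(1)[OF int(1)] by blast
  have "\<exists>K. \<forall>M R. \<exists>r\<ge>R. \<exists>N. (\<Sum>k<N. measure S {\<omega>. norm (X x k \<omega>) \<le> K \<and> norm (Z k \<omega>) \<le> r}) > M * r ^ CARD('s)"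
  proof (cases "CARD('s) = 1")
    case True
    from box_lower_1[OF True centred_iff(2)[OF int(1)] mean, of x] box_divergence_1[OF True] show ?thesis by blast
  next
    case False
    with card have 2: "CARD('s) = 2" by simp
    from box_lower_2[OF 2 xs int(2)[OF 2] mean] box_divergence_2[OF 2] show ?thesis by blast
  qed
  then obtain K where box: "\<And>M R. \<exists>r\<ge>R. \<exists>N. (\<Sum>k<N. measure S {\<omega>. norm (X x k \<omega>) \<le> K \<and> norm (Z k \<omega>) \<le> r}) > M * r ^ CARD('s)"
    by blast
  show "\<exists>r\<ge>1. \<exists>N. (\<Sum>k<N. measure S {\<omega>. norm (X x k \<omega> - x) < \<epsilon> \<and> norm (Z k \<omega>) \<le> r}) > M * r ^ CARD('s)"
    by (rule divergence_of_box_divergence[OF C \<nu> x \<open>\<epsilon> > 0\<close> box])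
qed

text \<open>If a coordinate had the drift m, the steps c - \<sigma> V with c = |m|/2 and \<sigma>
  the sign of m would have mean -c. Yet at a late time n with |Z_n| < 1 their sum exceeds c n - 1 >
  0, so \<open>maximal_ergodic\<close> would make that mean nonnegative.\<close>

lemma infinite_returns_imp_centred:
  assumes int: "integrable \<mu> snd" and ret: "AE \<omega> in S. infinite {n. norm (Z n \<omega>) < 1}"
  shows "centred (last_marginal \<mu>)"
proof (rule ccontr)
  assume "\<not> ?thesis"
  then obtain j where j: "(\<integral>y. snd y $ j \<partial>\<mu>) \<noteq> 0" using centred_iff(1)[OF int] by blast
  define m where "m = (\<integral>y. snd y $ j \<partial>\<mu>)"
  define \<sigma> where "\<sigma> = sgn m"
  define c where "c = \<bar>m\<bar> / 2"
  have c: "c > 0" "\<sigma> * m = 2 * c" "\<bar>\<sigma>\<bar> = 1" using j by (auto simp: m_def c_def \<sigma>_def abs_sgn sgn_if)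
  have intj: "integrable \<mu> (\<lambda>y. snd y $ j)" by (rule centred_iff(2)[OF int])
  have "(\<integral>y. c - \<sigma> * snd y $ j \<partial>\<mu>) \<ge> 0"
  proof (rule maximal_ergodic)
    show "integrable \<mu> (\<lambda>y. c - \<sigma> * snd y $ j)" using intj by simp
    show "AE \<omega> in S. \<exists>n. (\<Sum>k<n. c - \<sigma> * snd (\<omega> k) $ j) > 0"
      using ret
    proof eventually_elim
      case (elim \<omega>)
      obtain N :: nat where N: "real N > 1 / c" using reals_Archimedean2 by blast
      from elim obtain n where n: "n \<ge> N" "norm (Z n \<omega>) < 1"
        by (auto simp: infinite_nat_iff_unbounded_le)
      have "\<bar>\<sigma> * Z n \<omega> $ j\<bar> < 1"
        using component_le_norm_cart[of "Z n \<omega>" j] n(2) c(3) by (simp add: abs_mult)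
      moreover have "c * real n > 1"
      proof -
        have "1 / c < real n" using N n(1) by linarith
        then show ?thesis using c(1) by (simp add: field_simps)
      qed
      moreover have "(\<Sum>k<n. c - \<sigma> * snd (\<omega> k) $ j) = c * real n - \<sigma> * Z n \<omega> $ j"
        by (simp add: sum_subtractf sum_distrib_left[symmetric] sum_components_Z mult.commute)
      ultimately have "(\<Sum>k<n. c - \<sigma> * snd (\<omega> k) $ j) > 0" by linarith
      then show ?case by blast
    qed
  qed
  moreover have "(\<integral>y. c - \<sigma> * snd y $ j \<partial>\<mu>) = c - \<sigma> * m"
    using intj mu.prob_space by (simp add: m_def)
  ultimately show False using c by simp
qed

lemma recurrent_iff_centred:
  assumes card: "CARD('s) \<in> {1, 2}" and mom: "finite_moment (last_marginal \<mu>) CARD('s)"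
  shows "(\<forall>L \<in> essential_classes (first_marginal \<mu>) I. \<forall>x \<in> L. \<forall>v. \<forall>U. open U \<longrightarrow> (x, v) \<in> U \<longrightarrow>
      (AE \<omega> in S. infinite {n. (X x n \<omega>, v + Z n \<omega>) \<in> U})) \<longleftrightarrow> centred (last_marginal \<mu>)" (is "?rec \<longleftrightarrow> _")
proof
  assume rec: ?rec
  \<comment> \<open>Any coset would do; what matters is that at least one essential class exists and
    has a point.\<close>
  define C where "C = (+) 0 ` \<Gamma>"
  have C: "coset C" unfolding C_def coset_def by (intro bexI[of _ 0]) (auto simp: parity_group_def)
  define \<nu> where "\<nu> = (THE \<nu>. stationary C \<nu>)"
  have \<nu>: "stationary C \<nu>" unfolding \<nu>_def by (rule the_stationary[OF C])
  then obtain x where x: "x \<in> measure_support \<nu>"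
    using measure_support_nonempty[of \<nu>] by (auto simp: invariant_prob_on_def)
  have L: "measure_support \<nu> \<in> essential_classes (first_marginal \<mu>) I"
    unfolding essential_classes_def \<nu>_def using C parity_cosets_iff by blast
  \<comment> \<open>The first component is left free, so only the returns of \<open>Z\<close> to the
    unit ball are extracted.\<close>
  have "open ((UNIV :: (real ^ 'r) set) \<times> ball (0 :: real ^ 's) 1)" "(x, 0) \<in> UNIV \<times> ball (0 :: real ^ 's) 1"
    by (auto intro: open_Times)
  with rec L x have "AE \<omega> in S. infinite {n. (X x n \<omega>, 0 + Z n \<omega>) \<in> UNIV \<times> ball 0 1}" by blast
  then have "AE \<omega> in S. infinite {n. norm (Z n \<omega>) < 1}" by simp
  then show "centred (last_marginal \<mu>)"
    by (rule infinite_returns_imp_centred[OF last_marginal_integrable(1)[OF card mom]])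
next
  assume cen: "centred (last_marginal \<mu>)"
  show ?rec
  proof (intro ballI allI impI)
    fix L x v and U :: "((real ^ 'r) \<times> (real ^ 's)) set"
    assume L: "L \<in> essential_classes (first_marginal \<mu>) I" "x \<in> L" and U: "open U" "(x, v) \<in> U"
    from L obtain C where C: "coset C" "x \<in> measure_support (THE \<nu>. stationary C \<nu>)"
      unfolding essential_classes_def using parity_cosets_iff by blast
    obtain A B where AB: "open A" "open B" "x \<in> A" "v \<in> B" "A \<times> B \<subseteq> U"
      using open_prod_elim[OF U] by (metis mem_Sigma_iff)
    obtain e1 e2 where e: "e1 > 0" "ball x e1 \<subseteq> A" "e2 > 0" "ball v e2 \<subseteq> B"
      using AB(1-4) by (metis open_contains_ball)
    define \<epsilon> where "\<epsilon> = min e1 e2"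
    have "\<epsilon> > 0" using e by (simp add: \<epsilon>_def)
    have sub: "hits x \<epsilon> \<omega> \<subseteq> {n. (X x n \<omega>, v + Z n \<omega>) \<in> U}" for \<omega>
    proof
      fix n assume "n \<in> hits x \<epsilon> \<omega>"
      then have "X x n \<omega> \<in> ball x e1" "v + Z n \<omega> \<in> ball v e2"
        by (auto simp: hits_def \<epsilon>_def dist_norm norm_minus_commute)
      with e AB(5) show "n \<in> {n. (X x n \<omega>, v + Z n \<omega>) \<in> U}" by blast
    qed
    have "AE \<omega> in S. infinite (hits x \<epsilon> \<omega>)"
      by (rule centred_imp_hits_infinite[OF card mom cen C(1) the_stationary[OF C(1)] C(2) \<open>\<epsilon> > 0\<close>])
    then show "AE \<omega> in S. infinite {n. (X x n \<omega>, v + Z n \<omega>) \<in> U}"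
      by eventually_elim (rule infinite_super[OF sub])
  qed
qed

end

text \<open>A transfer: the increments of the given process have the law of the canonical model, and
  both the recurrence assumption and the conclusion depend on this law alone.\<close>

theorem theorem5p1:
  fixes \<mu> :: "((real ^ 'r) \<times> (real ^ 's)) measure"
    and I :: "'r set" and J :: "'s set"
    and M :: "'w measure"
    and Y :: "nat \<Rightarrow> 'w \<Rightarrow> real ^ 'r" and V :: "nat \<Rightarrow> 'w \<Rightarrow> real ^ 's"
  assumes "CARD('s) \<in> {1, 2}"
    and "prob_space \<mu>" and "sets \<mu> = sets borel"
    and "\<And>i. i \<in> I \<Longrightarrow> integer_aperiodic (coord_marginal (first_marginal \<mu>) i)"
    and "\<And>i. i \<notin> I \<Longrightarrow> non_lattice (coord_marginal (first_marginal \<mu>) i)"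
    and "\<And>j. j \<in> J \<Longrightarrow> integer_aperiodic (coord_marginal (last_marginal \<mu>) j)"
    and "\<And>j. j \<notin> J \<Longrightarrow> non_lattice (coord_marginal (last_marginal \<mu>) j)"
    and "prob_space M"
    and "prob_space.indep_vars M (\<lambda>n. borel) (\<lambda>n \<omega>. (Y n \<omega>, V n \<omega>)) {1..}"
    and "\<And>n. n \<ge> 1 \<Longrightarrow> distr M borel (\<lambda>\<omega>. (Y n \<omega>, V n \<omega>)) = \<mu>"
    and "\<And>i. emeasure (coord_marginal (first_marginal \<mu>) i) {0<..} > 0"
    and "\<And>i. positive_recurrent_on M (refl_walk (\<lambda>n \<omega>. Y n \<omega> $ i))
          (coord_class (coord_marginal (first_marginal \<mu>) i) (coord_space I i))"
    and "finite_moment (last_marginal \<mu>) CARD('s)"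
  shows "topologically_recurrent M (refl_walk Y) (partial_sum V)
           (essential_classes (first_marginal \<mu>) I) \<longleftrightarrow> centred (last_marginal \<mu>)"
proof -
  interpret M: prob_space M by (rule assms(8))
  interpret joint_walk \<mu> by (intro joint_walk.intro joint_walk_axioms.intro assms)
  \<comment> \<open>The map to the canonical space, which moves the numbering of the increments from
    1 to 0. The detour through \<eta> is due to independence being given on the index set
    \<open>{1..}\<close>.\<close>
  define \<xi> where "\<xi> \<omega> = (\<lambda>k. (Y (Suc k) \<omega>, V (Suc k) \<omega>))" for \<omega>
  have rv: "(\<lambda>\<omega>. (Y (Suc k) \<omega>, V (Suc k) \<omega>)) \<in> borel_measurable M" for k
    using assms(9) by (auto simp: M.indep_vars_def)
  define \<eta> where "\<eta> \<omega> = (\<lambda>n\<in>{1..}. (Y n \<omega>, V n \<omega>))" for \<omega>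
  have sets_eq: "sets (Pi\<^sub>M {1..} (\<lambda>_::nat. borel)) = sets (Pi\<^sub>M {1..} (\<lambda>_::nat. \<mu>))"
    by (rule sets_PiM_cong) (auto simp: sets_\<mu>)
  have rv': "(\<lambda>\<omega>. (Y n \<omega>, V n \<omega>)) \<in> borel_measurable M" if "n \<in> {1..}" for n
    using that rv[of "n - 1"] by simp
  have "\<eta> \<in> measurable M (Pi\<^sub>M {1..} (\<lambda>_. borel))"
    unfolding \<eta>_def by (rule measurable_restrict) (rule rv')
  then have \<eta> [measurable]: "\<eta> \<in> measurable M (Pi\<^sub>M {1..} (\<lambda>_. \<mu>))"
    using measurable_cong_sets[OF refl sets_eq, of M] by blast
  have shift [measurable]: "(\<lambda>\<omega>. \<lambda>n\<in>UNIV. \<omega> (Suc n)) \<in> measurable (Pi\<^sub>M {1..} (\<lambda>_. \<mu>)) S"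
    by (rule measurable_restrict) (rule measurable_component_singleton, simp)
  have \<xi>_eq: "\<xi> = (\<lambda>\<omega>. \<lambda>n\<in>UNIV. \<omega> (Suc n)) \<circ> \<eta>"
    by (auto simp: \<xi>_def \<eta>_def fun_eq_iff)
  have \<xi> [measurable]: "\<xi> \<in> measurable M S"
    unfolding \<xi>_eq by (rule measurable_comp[OF \<eta> shift])
  have distr_\<xi>: "distr M S \<xi> = S"
  proof -
    have "distr M (Pi\<^sub>M {1..} (\<lambda>_. borel)) (\<lambda>\<omega>. \<lambda>n\<in>{1..}. (Y n \<omega>, V n \<omega>))
        = Pi\<^sub>M {1..} (\<lambda>n. distr M borel (\<lambda>\<omega>. (Y n \<omega>, V n \<omega>)))"
      by (subst M.indep_vars_iff_distr_eq_PiM'[symmetric]) (use assms(9) rv' in auto)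
    also have "\<dots> = Pi\<^sub>M {1..} (\<lambda>_. \<mu>)" by (rule PiM_cong) (simp_all add: assms(10))
    finally have "distr M (Pi\<^sub>M {1..} (\<lambda>_. borel)) \<eta> = Pi\<^sub>M {1..} (\<lambda>_. \<mu>)" by (simp only: \<eta>_def[abs_def])
    moreover have "distr M (Pi\<^sub>M {1..} (\<lambda>_. \<mu>)) \<eta> = distr M (Pi\<^sub>M {1..} (\<lambda>_. borel)) \<eta>"
      by (rule distr_cong[OF refl sets_eq[symmetric] refl])
    ultimately have "distr M (Pi\<^sub>M {1..} (\<lambda>_. \<mu>)) \<eta> = Pi\<^sub>M {1..} (\<lambda>_. \<mu>)" by simp
    then have "distr M S \<xi> = distr (Pi\<^sub>M {1..} (\<lambda>_. \<mu>)) S (\<lambda>\<omega>. \<lambda>n\<in>UNIV. \<omega> (Suc n))"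
      unfolding \<xi>_eq using distr_distr[OF shift \<eta>] by simp
    also have "\<dots> = S"
      by (rule distr_PiM_reindex) (auto intro: mu.prob_space_axioms)
    finally show ?thesis .
  qed
  interpret refl_setting \<mu> I
  proof unfold_locales
    show "integer_aperiodic (cm i)" if "i \<in> I" for i by (rule assms(4)[OF that])
    show "non_lattice (cm i)" if "i \<notin> I" for i by (rule assms(5)[OF that])
    show "emeasure (cm i) {0<..} > 0" for i by (rule assms(11))
    fix a :: real and i assume "a > 0"
    have meas: "(\<lambda>\<omega>. return_time (\<lambda>n. X1 i 0 n \<omega>) {..<a}) \<in> borel_measurable S" by measurable
    \<comment> \<open>Needed for 0 to lie in the class of the coordinate, so that positive
      recurrence may be applied with start 0.\<close>
    have "0 \<le> coord_bound (cm i)"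
    proof (cases "measure_support (cm i) \<subseteq> {0..}")
      case True
      obtain y where "y \<in> measure_support (cm i)"
        using measure_support_nonempty[OF prob_space_cm sets_cm] by blast
      then have "0 \<le> ereal y" "ereal y \<le> Sup (ereal ` measure_support (cm i))"
        using True by (auto intro: Sup_upper)
      then have "0 \<le> Sup (ereal ` measure_support (cm i))" by (rule order_trans)
      with True show ?thesis by (simp add: coord_bound_def)
    qed (simp add: coord_bound_def)
    then have zero: "0 \<in> coord_class (cm i) (coord_space I i)"
      by (auto simp: coord_class_def coord_space_def zero_ereal_def)
    have "(\<integral>\<^sup>+ \<omega>. return_time (\<lambda>n. refl_walk (\<lambda>n \<omega>. Y n \<omega> $ i) 0 n \<omega>) {..<a} \<partial>M) < \<infinity>"
    proof -
      have "0 \<in> {..<a} \<inter> coord_class (cm i) (coord_space I i)" using zero \<open>a > 0\<close> by simp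
      then show ?thesis using assms(12)[of i] open_lessThan[of a] unfolding positive_recurrent_on_def by blast
    qed
    also have "(\<lambda>\<omega>. return_time (\<lambda>n. refl_walk (\<lambda>n \<omega>. Y n \<omega> $ i) 0 n \<omega>) {..<a})
        = (\<lambda>\<omega>. return_time (\<lambda>n. X1 i 0 n (\<xi> \<omega>)) {..<a})"
      by (simp add: refl_walk_eq_rwalk \<xi>_def)
    also have "(\<integral>\<^sup>+ \<omega>. return_time (\<lambda>n. X1 i 0 n (\<xi> \<omega>)) {..<a} \<partial>M)
        = (\<integral>\<^sup>+ \<omega>. return_time (\<lambda>n. X1 i 0 n \<omega>) {..<a} \<partial>distr M S \<xi>)"
      by (rule nn_integral_distr[OF \<xi>, symmetric]) (simp only: distr_\<xi> meas)
    finally show "(\<integral>\<^sup>+ \<omega>. return_time (\<lambda>n. X1 i 0 n \<omega>) {..<a} \<partial>S) < \<infinity>" by (simp only: distr_\<xi>)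
  qed
  have "(AE \<omega> in M. infinite {n. (refl_walk Y x n \<omega>, v + partial_sum V n \<omega>) \<in> U})
      \<longleftrightarrow> (AE \<omega> in S. infinite {n. (X x n \<omega>, v + Z n \<omega>) \<in> U})" if "open U" for x v U
  proof -
    have [measurable]: "U \<in> sets (borel \<Otimes>\<^sub>M borel)" unfolding borel_prod using that by (rule borel_open)
    \<comment> \<open>Written with countable quantifiers the event is measurable, so that almost
      sure statements pass through the image measure.\<close>
    have inf: "infinite {n. (X x n \<omega>, v + Z n \<omega>) \<in> U} \<longleftrightarrow> (\<forall>m. \<exists>n. m \<le> n \<and> (X x n \<omega>, v + Z n \<omega>) \<in> U)" for \<omega>
      by (auto simp: infinite_nat_iff_unbounded_le)
    have "{\<omega> \<in> space S. infinite {n. (X x n \<omega>, v + Z n \<omega>) \<in> U}} \<in> sets S"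
      unfolding inf by measurable
    from AE_distr_iff[OF \<xi> this]
    have "(AE \<omega> in S. infinite {n. (X x n \<omega>, v + Z n \<omega>) \<in> U})
        \<longleftrightarrow> (AE \<omega> in M. infinite {n. (X x n (\<xi> \<omega>), v + Z n (\<xi> \<omega>)) \<in> U})"
      by (simp only: distr_\<xi>)
    moreover have "X x n (\<xi> \<omega>) = refl_walk Y x n \<omega>" "Z n (\<xi> \<omega>) = partial_sum V n \<omega>" for n \<omega>
      by (simp_all add: \<xi>_def refl_walk_eq_rwalk Z_def partial_sum_def sum.atLeast1_atMost_eq)
    ultimately show ?thesis by simp
  qed
  then show ?thesis
    unfolding topologically_recurrent_def recurrent_iff_centred[OF assms(1,13), symmetric] by blast
qed

end
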